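(* Let $G$ be a connected compact Lie group of positive dimension, let $A>0$, $\varepsilon>0$, $\nu\ge 0$ and $s>2\nu+\dim(G)$. Consider the observations $$\mathrm{d}Y_m(g)=f^\star(\tau_m^{-1}g)\,\mathrm{d}g+\varepsilon\,\mathrm{d}W_m(g),\qquad g\in G,\ m=1,\dots,n,$$ where $\tau_1,\dots,\tau_n$ are i.i.d. $G$-valued random variables with known density $h\in L^2(G)$, and $W_1,\dots,W_n$ are independent white noises on $G$, independent of the $\tau_m$'s. Suppose that $h$ is smooth of order $\nu$. For $T>0$ let $$\hat f_T(g)=\frac1n\sum_{m=1}^n\ \sum_{\pi\in\widehat G:\ \lambda_\pi<T} d_\pi\,\mathrm{Tr}\left(\pi(g)\,c_\pi(Y_m)\,c_\pi(h)^{-1}\right),\qquad g\in G,$$ and let $T_n=\left\lfloor n^{\frac{2}{2s+2\nu+\dim(G)}}\right\rfloor$. Then there exists a constant $K_1>0$ such that $$\limsup_{n\to\infty}\ \sup_{f^\star\in H_s(G,A)} n^{\frac{2s}{2s+2\nu+\dim(G)}}\,R(\hat f_{T_n},f^\star)\le K_1 .$$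
   Context: **Group and Fourier analysis.** $\mathrm{d}g$ is the normalized Haar measure on $G$ and $L^2(G)$ is the space of complex valued square integrable functions, with norm $\|f\|^2=\int_G|f(g)|^2\,\mathrm{d}g$. $\widehat G$ is the set of equivalence classes of irreducible representations of $G$; each class is identified with a unitary matrix representative $\pi:G\to GL_{d_\pi}(\mathbb C)$, where $d_\pi$ is its dimension. For $f\in L^2(G)$, the $\pi$-th Fourier coefficient is the $d_\pi\times d_\pi$ matrix $c_\pi(f)=\int_G f(g)\pi(g^{-1})\,\mathrm{d}g$. A bi-invariant Riemannian metric on $G$ is fixed; $\lambda_\pi\ge0$ is the eigenvalue of $\pi$ for the associated (nonnegative) Laplace–Beltrami operator, i.e. the common eigenvalue of $-\Delta$ on the matrix coefficients of $\pi$. $\|M\|_F^2=\mathrm{Tr}(M\overline M^t)$ is the squared Frobenius norm and $\|M\|_{op}$ is the operator norm of a matrix for the Euclidean norm. **Sobolev balls.** For $s>\dim(G)/2$, $\|f\|_{H_s}^2=\int_G|f(g)|^2\,\mathrm{d}g+\sum_{\pi\in\widehat G}\lambda_\pi^s d_\pi\|c_\pi(f)\|_F^2$; $H_s(G)$ is the completion of $C^\infty(G)$ for $\|\cdot\|_{H_s}$; and $H_s(G,A)=\{f\in H_s(G):\|f\|_{H_s}^2\le A^2\}$. **Smoothness of order $\nu$.** $f\in L^2(G)$ is smooth of order $\nu\ge0$ if $c_\pi(f)$ is invertible for every $\pi\in\widehat G$ and there are constants $C_1,C_2>0$ such that $\|c_\pi(f)^{-1}\|_{op}^2\le C_1\lambda_\pi^\nu$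 and $\|c_\pi(f)\|_{op}^2\le C_2\lambda_\pi^{-\nu}$ for all $\pi\in\widehat G$ with $\lambda_\pi\neq0$. **Model.** The density $h$ is with respect to Haar measure. A white noise $W_m$ is a centered circularly symmetric complex Gaussian family $f\mapsto\int_G f\,\mathrm{d}W_m$, linear in $f\in L^2(G)$, with $\mathbb E\left[\int_G f_1\,\mathrm{d}W_m\ \overline{\int_G f_2\,\mathrm{d}W_m}\right]=\int_G f_1\overline{f_2}\,\mathrm{d}g$. The observation $Y_m$ means that $\int_G f\,\mathrm{d}Y_m=\int_G f(g)f^\star(\tau_m^{-1}g)\,\mathrm{d}g+\varepsilon\int_G f\,\mathrm{d}W_m$ for all $f\in L^2(G)$. Set $c_\pi(Y_m)=\int_G\pi(g^{-1})\,\mathrm{d}Y_m(g)$ (entrywise), which equals $c_\pi(f^\star)\pi(\tau_m^{-1})+\varepsilon c_\pi(W_m)$, where the entries of $c_\pi(W_m)=\int_G\pi(g^{-1})\,\mathrm{d}W_m(g)$ are independent centered complex Gaussian variables of variance $d_\pi^{-1}$. **Risk.** For an estimator $\hat f$ (a measurable function of $Y_1,\dots,Y_n$ with values in $L^2(G)$), $R(\hat f,f^\star)=\mathbb E\|\hat f-f^\star\|^2$, the expectation being taken when the true function is $f^\star$. The constant $K_1$ does not depend on $n$ or $f^\star$; $G,h,\varepsilon,s,\nu,A$ are fixed. *)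

theory Defs
  imports
    "HOL-Probability.Probability"
    "Jordan_Normal_Form.Gauss_Jordan_Elimination"
    "Jordan_Normal_Form.Schur_Decomposition"
    "Jordan_Normal_Form.VS_Connect"
begin

text \<open>
  Conventions. The Lie group is a type of class \<^class>\<open>topological_group_add\<close>, which is not
  assumed commutative: \<open>g + k\<close> is the group product, \<open>- g\<close> the group inverse, \<open>0\<close> the neutral
  element, so left translation by the inverse of \<open>a\<close> is \<open>\<lambda>g. - a + g\<close>.
  Matrices whose size is a type (\<open>real ^ 'n ^ 'n\<close>) are used for local coordinates on the group;
  the matrices of Jordan_Normal_Form, whose size is a number, are used for representations.
\<close>

no_notation vec_index (infixl \<open>$\<close> 100)

section \<open>Lie groups\<close>

text \<open>Intended for open \<open>S\<close>; the derivatives are two-sided.\<close>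

primrec Ck_on :: "nat \<Rightarrow> 'a::euclidean_space set \<Rightarrow> ('a \<Rightarrow> 'b::real_normed_vector) \<Rightarrow> bool" where
  "Ck_on 0 S f \<longleftrightarrow> continuous_on S f"
| "Ck_on (Suc k) S f \<longleftrightarrow> (\<forall>x\<in>S. f differentiable (at x)) \<and>
     (\<forall>b\<in>Basis. Ck_on k S (\<lambda>x. frechet_derivative f (at x) b))"

definition smooth_on :: "'a::euclidean_space set \<Rightarrow> ('a \<Rightarrow> 'b::real_normed_vector) \<Rightarrow> bool" where
  "smooth_on S f \<longleftrightarrow> (\<forall>k. Ck_on k S f)"

text \<open>A chart is a pair of an open domain and a coordinate map; only the values of the coordinate
  map on the domain matter.\<close>

type_synonym ('g, 'n) chart = "'g set \<times> ('g \<Rightarrow> real ^ 'n)"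

definition chart_image :: "('g, 'n) chart \<Rightarrow> (real ^ 'n) set" where
  "chart_image c = snd c ` fst c"

definition chart_inv :: "('g, 'n) chart \<Rightarrow> real ^ 'n \<Rightarrow> 'g" where
  "chart_inv c = inv_into (fst c) (snd c)"

definition is_chart :: "('g::topological_space, 'n::finite) chart \<Rightarrow> bool" where
  "is_chart c \<longleftrightarrow> open (fst c) \<and> open (chart_image c) \<and>
     homeomorphism (fst c) (chart_image c) (snd c) (chart_inv c)"

definition coord_dom ::
    "('g, 'n) chart \<Rightarrow> ('g, 'n) chart \<Rightarrow> ('g \<Rightarrow> 'g) \<Rightarrow> (real ^ 'n) set" where
  "coord_dom c c' F = {x \<in> chart_image c. F (chart_inv c x) \<in> fst c'}"

definition coord_map ::
    "('g, 'n) chart \<Rightarrow> ('g, 'n) chart \<Rightarrow> ('g \<Rightarrow> 'g) \<Rightarrow> real ^ 'n \<Rightarrow> real ^ 'n" where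
  "coord_map c c' F x = snd c' (F (chart_inv c x))"

definition smooth_atlas :: "('g::topological_space, 'n::finite) chart set \<Rightarrow> bool" where
  "smooth_atlas \<A> \<longleftrightarrow> (\<forall>c\<in>\<A>. is_chart c) \<and> (\<Union>c\<in>\<A>. fst c) = UNIV \<and>
     (\<forall>c\<in>\<A>. \<forall>c'\<in>\<A>. smooth_on (coord_dom c c' (\<lambda>g. g)) (coord_map c c' (\<lambda>g. g)))"

text \<open>Continuity of the group operations is part of the class \<^class>\<open>topological_group_add\<close>,
  so the sets on which smoothness is required below are open.\<close>

definition lie_group ::
    "('g::{topological_group_add, t2_space, second_countable_topology}, 'n::finite) chart set \<Rightarrow> bool"
where
  "lie_group \<A> \<longleftrightarrow> smooth_atlas \<A> \<and>
     (\<forall>c1\<in>\<A>. \<forall>c2\<in>\<A>. \<forall>c3\<in>\<A>.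
        smooth_on
          {(x, y). x \<in> chart_image c1 \<and> y \<in> chart_image c2 \<and>
                   chart_inv c1 x + chart_inv c2 y \<in> fst c3}
          (\<lambda>(x, y). snd c3 (chart_inv c1 x + chart_inv c2 y))) \<and>
     (\<forall>c\<in>\<A>. \<forall>c'\<in>\<A>. smooth_on (coord_dom c c' uminus) (coord_map c c' uminus))"

definition smooth_function ::
    "('g::topological_space, 'n::finite) chart set \<Rightarrow> ('g \<Rightarrow> complex) \<Rightarrow> bool" where
  "smooth_function \<A> f \<longleftrightarrow> (\<forall>c\<in>\<A>. smooth_on (chart_image c) (\<lambda>x. f (chart_inv c x)))"

section \<open>Riemannian metrics and the Laplace--Beltrami operator\<close>

text \<open>A metric is given by its Gram matrices: \<open>gm c p\<close> is the matrix of the inner product of the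
  tangent space at \<open>p\<close> in the coordinate basis of the chart \<open>c\<close>. The map \<open>F\<close> preserves the metric
  if its differentials are isometries in all coordinates; for the identity map this is the
  transformation law between charts.\<close>

type_synonym ('g, 'n) metric_field = "('g, 'n) chart \<Rightarrow> 'g \<Rightarrow> real ^ 'n ^ 'n"

definition preserves_metric ::
    "('g, 'n::finite) chart set \<Rightarrow> ('g, 'n) metric_field \<Rightarrow> ('g \<Rightarrow> 'g) \<Rightarrow> bool" where
  "preserves_metric \<A> gm F \<longleftrightarrow>
     (\<forall>c\<in>\<A>. \<forall>c'\<in>\<A>. \<forall>p\<in>fst c. F p \<in> fst c' \<longrightarrow>
        (let J = jacobian (coord_map c c' F) (at (snd c p))
         in gm c p = transpose J ** gm c' (F p) ** J))"

definition riemannian_metric ::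
    "('g, 'n::finite) chart set \<Rightarrow> ('g, 'n) metric_field \<Rightarrow> bool" where
  "riemannian_metric \<A> gm \<longleftrightarrow>
     (\<forall>c\<in>\<A>. smooth_on (chart_image c) (\<lambda>x. gm c (chart_inv c x)) \<and>
        (\<forall>p\<in>fst c. transpose (gm c p) = gm c p \<and>
           (\<forall>v. v \<noteq> 0 \<longrightarrow> inner v (gm c p *v v) > 0))) \<and>
     preserves_metric \<A> gm (\<lambda>g. g)"

definition bi_invariant_metric ::
    "('g::group_add, 'n::finite) chart set \<Rightarrow> ('g, 'n) metric_field \<Rightarrow> bool" where
  "bi_invariant_metric \<A> gm \<longleftrightarrow> riemannian_metric \<A> gm \<and>
     (\<forall>a. preserves_metric \<A> gm (\<lambda>g. a + g) \<and> preserves_metric \<A> gm (\<lambda>g. g + a))"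

definition partial_deriv ::
    "'n::finite \<Rightarrow> (real ^ 'n \<Rightarrow> 'b::real_normed_vector) \<Rightarrow> real ^ 'n \<Rightarrow> 'b" where
  "partial_deriv i u x = frechet_derivative u (at x) (axis i 1)"

text \<open>The coordinate formula
  \<open>\<Delta> u = det(G)^(-1/2) \<Sum>\<^sub>i \<partial>\<^sub>i (\<Sum>\<^sub>j det(G)^(1/2) G\<^sup>i\<^sup>j \<partial>\<^sub>j u)\<close>, with \<open>G\<close> the Gram matrix and \<open>G\<^sup>i\<^sup>j\<close> the
  entries of its inverse. On smooth functions its value does not depend on the chart around \<open>p\<close>.\<close>

definition laplace_beltrami ::
    "('g, 'n::finite) chart set \<Rightarrow> ('g, 'n) metric_field \<Rightarrow> ('g \<Rightarrow> complex) \<Rightarrow> 'g \<Rightarrow> complex" where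
  "laplace_beltrami \<A> gm f p =
     (let c = (SOME c. c \<in> \<A> \<and> p \<in> fst c);
          u = (\<lambda>x. f (chart_inv c x));
          G = (\<lambda>x. gm c (chart_inv c x));
          w = (\<lambda>x. sqrt (Determinants.det (G x)))
      in (1 / w (snd c p)) *\<^sub>R
           (\<Sum>i\<in>UNIV. partial_deriv i
              (\<lambda>x. \<Sum>j\<in>UNIV. (w x * matrix_inv (G x) $ i $ j) *\<^sub>R partial_deriv j u x)
              (snd c p)))"

section \<open>Matrices\<close>

definition mat_trace :: "complex mat \<Rightarrow> complex" where
  "mat_trace M = (\<Sum>i<dim_row M. M $$ (i, i))"

definition frobenius_sq :: "complex mat \<Rightarrow> real" where
  "frobenius_sq M = Re (mat_trace (M * mat_adjoint M))"

definition euclid_norm :: "complex Matrix.vec \<Rightarrow> real" where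
  "euclid_norm v = sqrt (Re (v \<bullet>c v))"

definition op_norm :: "complex mat \<Rightarrow> real" where
  "op_norm M = Sup {euclid_norm (M *\<^sub>v v) |v. v \<in> carrier_vec (dim_col M) \<and> euclid_norm v \<le> 1}"

text \<open>Only used for invertible matrices; \<^const>\<open>mat_inverse\<close> is option-valued.\<close>

definition mat_inv :: "complex mat \<Rightarrow> complex mat" where
  "mat_inv M = the (mat_inverse M)"

section \<open>Unitary dual\<close>

definition rep_dim :: "('g::zero \<Rightarrow> complex mat) \<Rightarrow> nat" where
  "rep_dim \<pi> = dim_row (\<pi> 0)"

definition is_rep :: "('g::topological_group_add \<Rightarrow> complex mat) \<Rightarrow> bool" where
  "is_rep \<pi> \<longleftrightarrow>
     (\<forall>g. \<pi> g \<in> carrier_mat (rep_dim \<pi>) (rep_dim \<pi>)) \<and>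
     \<pi> 0 = 1\<^sub>m (rep_dim \<pi>) \<and> (\<forall>g k. \<pi> (g + k) = \<pi> g * \<pi> k) \<and>
     (\<forall>i<rep_dim \<pi>. \<forall>j<rep_dim \<pi>. continuous_on UNIV (\<lambda>g. \<pi> g $$ (i, j)))"

definition irreducible_rep :: "('g::topological_group_add \<Rightarrow> complex mat) \<Rightarrow> bool" where
  "irreducible_rep \<pi> \<longleftrightarrow> is_rep \<pi> \<and> rep_dim \<pi> > 0 \<and>
     (\<forall>V. VectorSpace.subspace class_ring V (module_vec TYPE(complex) (rep_dim \<pi>)) \<and>
          (\<forall>g. \<forall>v\<in>V. \<pi> g *\<^sub>v v \<in> V)
        \<longrightarrow> V = {0\<^sub>v (rep_dim \<pi>)} \<or> V = carrier_vec (rep_dim \<pi>))"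

definition unitary_rep :: "('g::zero \<Rightarrow> complex mat) \<Rightarrow> bool" where
  "unitary_rep \<pi> \<longleftrightarrow> (\<forall>g. \<pi> g * mat_adjoint (\<pi> g) = 1\<^sub>m (rep_dim \<pi>))"

definition equivalent_reps ::
    "('g::zero \<Rightarrow> complex mat) \<Rightarrow> ('g \<Rightarrow> complex mat) \<Rightarrow> bool" where
  "equivalent_reps \<pi> \<rho> \<longleftrightarrow> rep_dim \<pi> = rep_dim \<rho> \<and>
     (\<exists>Q \<in> carrier_mat (rep_dim \<pi>) (rep_dim \<pi>).
        invertible_mat Q \<and> (\<forall>g. Q * \<pi> g = \<rho> g * Q))"

text \<open>A choice of one unitary matrix representative in each equivalence class.\<close>

definition unitary_dual :: "('g::topological_group_add \<Rightarrow> complex mat) set \<Rightarrow> bool" where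
  "unitary_dual Ghat \<longleftrightarrow>
     (\<forall>\<pi>\<in>Ghat. irreducible_rep \<pi> \<and> unitary_rep \<pi>) \<and>
     (\<forall>\<rho>. irreducible_rep \<rho> \<longrightarrow> (\<exists>!\<pi>. \<pi> \<in> Ghat \<and> equivalent_reps \<rho> \<pi>))"

text \<open>The common eigenvalue of \<open>- \<Delta>\<close> on the matrix coefficients of \<open>\<pi>\<close>.\<close>

definition laplace_eigenvalue ::
    "('g::zero, 'n::finite) chart set \<Rightarrow> ('g, 'n) metric_field \<Rightarrow> ('g \<Rightarrow> complex mat) \<Rightarrow> real" where
  "laplace_eigenvalue \<A> gm \<pi> =
     (THE l. \<forall>i<rep_dim \<pi>. \<forall>j<rep_dim \<pi>. \<forall>p.
        - laplace_beltrami \<A> gm (\<lambda>g. \<pi> g $$ (i, j)) p = complex_of_real l * \<pi> p $$ (i, j))"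

section \<open>Fourier analysis and Sobolev balls\<close>

text \<open>On a compact group left invariance implies right invariance.\<close>

definition normalized_haar :: "'g::topological_group_add measure \<Rightarrow> bool" where
  "normalized_haar \<mu> \<longleftrightarrow> prob_space \<mu> \<and> sets \<mu> = sets borel \<and>
     (\<forall>a. distr \<mu> \<mu> (\<lambda>g. a + g) = \<mu>)"

text \<open>Square integrable functions, not identified up to null sets.\<close>

definition L2 :: "'g measure \<Rightarrow> ('g \<Rightarrow> complex) set" where
  "L2 \<mu> = {f \<in> borel_measurable \<mu>. integrable \<mu> (\<lambda>g. (cmod (f g))\<^sup>2)}"

definition L2_norm_sq :: "'g measure \<Rightarrow> ('g \<Rightarrow> complex) \<Rightarrow> ennreal" where
  "L2_norm_sq \<mu> f = (\<integral>\<^sup>+g. ennreal ((cmod (f g))\<^sup>2) \<partial>\<mu>)"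

definition fourier_coeff ::
    "'g::group_add measure \<Rightarrow> ('g \<Rightarrow> complex) \<Rightarrow> ('g \<Rightarrow> complex mat) \<Rightarrow> complex mat" where
  "fourier_coeff \<mu> f \<pi> =
     Matrix.mat (rep_dim \<pi>) (rep_dim \<pi>) (\<lambda>(i, j). \<integral>g. f g * \<pi> (- g) $$ (i, j) \<partial>\<mu>)"

text \<open>Below, \<open>lam \<pi>\<close> stands for the Laplace eigenvalue of \<open>\<pi>\<close>. The Sobolev norm is
  \<^typ>\<open>ennreal\<close>-valued, so that a divergent series gives \<open>\<infinity>\<close>.\<close>

definition sobolev_norm_sq ::
    "'g::group_add measure \<Rightarrow> ('g \<Rightarrow> complex mat) set \<Rightarrow> (('g \<Rightarrow> complex mat) \<Rightarrow> real) \<Rightarrow>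
     real \<Rightarrow> ('g \<Rightarrow> complex) \<Rightarrow> ennreal" where
  "sobolev_norm_sq \<mu> Ghat lam s f = L2_norm_sq \<mu> f +
     (\<Sum>\<^sub>\<infinity>\<pi>\<in>Ghat. ennreal (lam \<pi> powr s * real (rep_dim \<pi>) * frobenius_sq (fourier_coeff \<mu> f \<pi>)))"

text \<open>The completion of the smooth functions is realised inside \<open>L2\<close>, as their closure for the
  Sobolev norm.\<close>

definition sobolev_space ::
    "('g::topological_group_add, 'n::finite) chart set \<Rightarrow> 'g measure \<Rightarrow> ('g \<Rightarrow> complex mat) set \<Rightarrow>
     (('g \<Rightarrow> complex mat) \<Rightarrow> real) \<Rightarrow> real \<Rightarrow> ('g \<Rightarrow> complex) set" where
  "sobolev_space \<A> \<mu> Ghat lam s = {f \<in> L2 \<mu>. \<exists>F. (\<forall>k. smooth_function \<A> (F k)) \<and>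
     (\<lambda>k. sobolev_norm_sq \<mu> Ghat lam s (\<lambda>g. F k g - f g)) \<longlonglongrightarrow> 0}"

definition sobolev_ball ::
    "('g::topological_group_add, 'n::finite) chart set \<Rightarrow> 'g measure \<Rightarrow> ('g \<Rightarrow> complex mat) set \<Rightarrow>
     (('g \<Rightarrow> complex mat) \<Rightarrow> real) \<Rightarrow> real \<Rightarrow> real \<Rightarrow> ('g \<Rightarrow> complex) set" where
  "sobolev_ball \<A> \<mu> Ghat lam s A =
     {f \<in> sobolev_space \<A> \<mu> Ghat lam s. sobolev_norm_sq \<mu> Ghat lam s f \<le> ennreal (A\<^sup>2)}"

definition smooth_of_order ::
    "'g::group_add measure \<Rightarrow> ('g \<Rightarrow> complex mat) set \<Rightarrow> (('g \<Rightarrow> complex mat) \<Rightarrow> real) \<Rightarrow>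
     real \<Rightarrow> ('g \<Rightarrow> complex) \<Rightarrow> bool" where
  "smooth_of_order \<mu> Ghat lam \<nu> f \<longleftrightarrow>
     (\<forall>\<pi>\<in>Ghat. invertible_mat (fourier_coeff \<mu> f \<pi>)) \<and>
     (\<exists>C1>0. \<exists>C2>0. \<forall>\<pi>\<in>Ghat. lam \<pi> \<noteq> 0 \<longrightarrow>
        (op_norm (mat_inv (fourier_coeff \<mu> f \<pi>)))\<^sup>2 \<le> C1 * lam \<pi> powr \<nu> \<and>
        (op_norm (fourier_coeff \<mu> f \<pi>))\<^sup>2 \<le> C2 * lam \<pi> powr (- \<nu>))"

section \<open>White noise and the observation model\<close>

text \<open>Point masses at \<open>0\<close> count as Gaussian.\<close>

definition centered_gaussian :: "'w measure \<Rightarrow> ('w \<Rightarrow> real) \<Rightarrow> bool" where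
  "centered_gaussian P X \<longleftrightarrow> X \<in> borel_measurable P \<and>
     ((AE \<omega> in P. X \<omega> = 0) \<or>
      (\<exists>\<sigma>>0. distributed P lborel X (\<lambda>x. ennreal (normal_density 0 \<sigma> x))))"

text \<open>The real parts of complex linear combinations are exactly the real linear combinations of
  the real and imaginary parts.\<close>

definition circular_complex_gaussian_family ::
    "'w measure \<Rightarrow> 'i set \<Rightarrow> ('i \<Rightarrow> 'w \<Rightarrow> complex) \<Rightarrow> bool" where
  "circular_complex_gaussian_family P I X \<longleftrightarrow>
     (\<forall>i\<in>I. X i \<in> borel_measurable P) \<and>
     (\<forall>J c. finite J \<and> J \<subseteq> I \<longrightarrow> centered_gaussian P (\<lambda>\<omega>. Re (\<Sum>i\<in>J. c i * X i \<omega>))) \<and>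
     (\<forall>J \<theta>. finite J \<and> J \<subseteq> I \<longrightarrow>
        distr P (Pi\<^sub>M J (\<lambda>_. borel)) (\<lambda>\<omega>. \<lambda>i\<in>J. cis \<theta> * X i \<omega>) =
        distr P (Pi\<^sub>M J (\<lambda>_. borel)) (\<lambda>\<omega>. \<lambda>i\<in>J. X i \<omega>))"

text \<open>\<open>W f \<omega>\<close> is the value at \<open>\<omega>\<close> of the stochastic integral of \<open>f\<close>; linearity holds almost
  surely.\<close>

definition white_noise ::
    "'g measure \<Rightarrow> 'w measure \<Rightarrow> (('g \<Rightarrow> complex) \<Rightarrow> 'w \<Rightarrow> complex) \<Rightarrow> bool" where
  "white_noise \<mu> P W \<longleftrightarrow>
     circular_complex_gaussian_family P (L2 \<mu>) W \<and>
     (\<forall>f1\<in>L2 \<mu>. \<forall>f2\<in>L2 \<mu>. \<forall>a b.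
        AE \<omega> in P. W (\<lambda>g. a * f1 g + b * f2 g) \<omega> = a * W f1 \<omega> + b * W f2 \<omega>) \<and>
     (\<forall>f1\<in>L2 \<mu>. \<forall>f2\<in>L2 \<mu>.
        (\<integral>\<omega>. W f1 \<omega> * cnj (W f2 \<omega>) \<partial>P) = (\<integral>g. f1 g * cnj (f2 g) \<partial>\<mu>))"

definition shift_events :: "'w measure \<Rightarrow> ('w \<Rightarrow> 'g::topological_space) \<Rightarrow> 'w set set" where
  "shift_events P X = {X -` B \<inter> space P |B. B \<in> sets borel}"

definition noise_events ::
    "'g measure \<Rightarrow> 'w measure \<Rightarrow> (('g \<Rightarrow> complex) \<Rightarrow> 'w \<Rightarrow> complex) \<Rightarrow> 'w set set" where
  "noise_events \<mu> P W =
     sigma_sets (space P) {W f -` B \<inter> space P |f B. f \<in> L2 \<mu> \<and> B \<in> sets borel}"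

text \<open>Joint independence of the \<open>2 n\<close> objects \<open>\<tau> 1, \<dots>, \<tau> n, W 1, \<dots>, W n\<close> (index \<open>Inl m\<close> for
  \<open>\<tau> m\<close>, \<open>Inr m\<close> for \<open>W m\<close>) is formulated with the sigma-algebras they generate.\<close>

definition shift_noise_model ::
    "'g::topological_space measure \<Rightarrow> ('g \<Rightarrow> real) \<Rightarrow> nat \<Rightarrow> 'w measure \<Rightarrow> (nat \<Rightarrow> 'w \<Rightarrow> 'g) \<Rightarrow>
     (nat \<Rightarrow> ('g \<Rightarrow> complex) \<Rightarrow> 'w \<Rightarrow> complex) \<Rightarrow> bool" where
  "shift_noise_model \<mu> h n P \<tau> W \<longleftrightarrow> prob_space P \<and>
     (\<forall>m\<in>{1..n}. distributed P \<mu> (\<tau> m) (\<lambda>g. ennreal (h g))) \<and>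
     (\<forall>m\<in>{1..n}. white_noise \<mu> P (W m)) \<and>
     prob_space.indep_sets P
       (case_sum (\<lambda>m. shift_events P (\<tau> m)) (\<lambda>m. noise_events \<mu> P (W m)))
       (Inl ` {1..n} \<union> Inr ` {1..n})"

text \<open>The integral of \<open>\<phi>\<close> against the observation with shift \<open>t\<close> and noise \<open>w\<close> (already
  evaluated at a point of the probability space), when the true function is \<open>f\<close>.\<close>

definition observation ::
    "'g::group_add measure \<Rightarrow> real \<Rightarrow> ('g \<Rightarrow> complex) \<Rightarrow> 'g \<Rightarrow> (('g \<Rightarrow> complex) \<Rightarrow> complex) \<Rightarrow>
     ('g \<Rightarrow> complex) \<Rightarrow> complex" where
  "observation \<mu> \<epsilon> f t w \<phi> = (\<integral>g. \<phi> g * f (- t + g) \<partial>\<mu>) + complex_of_real \<epsilon> * w \<phi>"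

definition obs_fourier_coeff ::
    "(('g::group_add \<Rightarrow> complex) \<Rightarrow> complex) \<Rightarrow> ('g \<Rightarrow> complex mat) \<Rightarrow> complex mat" where
  "obs_fourier_coeff Y \<pi> =
     Matrix.mat (rep_dim \<pi>) (rep_dim \<pi>) (\<lambda>(i, j). Y (\<lambda>g. \<pi> (- g) $$ (i, j)))"

definition estimator ::
    "'g::group_add measure \<Rightarrow> ('g \<Rightarrow> complex mat) set \<Rightarrow> (('g \<Rightarrow> complex mat) \<Rightarrow> real) \<Rightarrow>
     ('g \<Rightarrow> real) \<Rightarrow> real \<Rightarrow> nat \<Rightarrow> (nat \<Rightarrow> ('g \<Rightarrow> complex) \<Rightarrow> complex) \<Rightarrow> 'g \<Rightarrow> complex" where
  "estimator \<mu> Ghat lam h T n Y g =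
     (1 / of_nat n) * (\<Sum>m=1..n. \<Sum>\<pi>\<in>{\<pi> \<in> Ghat. lam \<pi> < T}.
        of_nat (rep_dim \<pi>) *
        mat_trace (\<pi> g * obs_fourier_coeff (Y m) \<pi> *
                   mat_inv (fourier_coeff \<mu> (\<lambda>k. complex_of_real (h k)) \<pi>)))"

text \<open>The risk at \<open>f\<close> of an estimator \<open>est\<close>, a function of the \<open>n\<close> observations.\<close>

definition risk ::
    "'g::group_add measure \<Rightarrow> real \<Rightarrow> 'w measure \<Rightarrow> (nat \<Rightarrow> 'w \<Rightarrow> 'g) \<Rightarrow>
     (nat \<Rightarrow> ('g \<Rightarrow> complex) \<Rightarrow> 'w \<Rightarrow> complex) \<Rightarrow>
     ((nat \<Rightarrow> ('g \<Rightarrow> complex) \<Rightarrow> complex) \<Rightarrow> 'g \<Rightarrow> complex) \<Rightarrow> ('g \<Rightarrow> complex) \<Rightarrow> ennreal" where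
  "risk \<mu> \<epsilon> P \<tau> W est f =
     (\<integral>\<^sup>+\<omega>. L2_norm_sq \<mu>
        (\<lambda>g. est (\<lambda>m. observation \<mu> \<epsilon> f (\<tau> m \<omega>) (\<lambda>\<phi>. W m \<phi> \<omega>)) g - f g) \<partial>P)"

end

theory Submission
  imports Defs "HOL-Real_Asymp.Real_Asymp"
begin

text \<open>
  The loss of the estimator is evaluated by orthogonal projection onto the matrix coefficients with
  \<open>\<lambda>\<^sub>\<pi> < T\<close>. Its bias is the tail of Parseval's identity, at most \<open>T\<^sup>-\<^sup>s A\<^sup>2\<close> on the Sobolev ball. Since
  \<open>E \<pi>(\<tau>\<^sup>-\<^sup>1) = c\<^sub>\<pi>(h)\<close>, the empirical coefficients are unbiased, and independence bounds their variance
  by a multiple of \<open>T\<^sup>\<nu> (A\<^sup>2 + \<epsilon>\<^sup>2 \<Sum> d\<^sub>\<pi>\<^sup>2) / n\<close>, the sum being over \<open>\<lambda>\<^sub>\<pi> < T\<close>. By Weyl's bound this sum is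
  \<open>O(T\<^bsup>dim/2\<^esup>)\<close>, and the choice of \<open>T\<close> balances both terms.

  Parseval's identity is obtained without a spectral theorem: power iteration gives an eigenfunction
  of the convolution with any nonzero Hermitian kernel, its finite-dimensional eigenspace contains
  an irreducible representation, and therefore no nonzero kernel is orthogonal to all matrix
  coefficients. Weyl's bound follows from \<open>\<Sum> a\<^sup>i\<^sup>j tr (D\<^sub>i D\<^sub>j\<^sup>*) = d\<^sub>\<pi> \<lambda>\<^sub>\<pi>\<close> for the derivatives \<open>D\<^sub>i\<close> of \<open>\<pi>\<close> at
  the identity (the product rule for \<open>\<Delta>\<close> applied to \<open>\<pi> \<pi>\<^sup>* = 1\<close>): it keeps \<open>tr \<pi>(g)\<close> above \<open>d\<^sub>\<pi> / 2\<close>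
  on a ball of radius of order \<open>T\<^bsup>-1/2\<^esup>\<close>, and Bessel's inequality for the indicator of this ball
  bounds \<open>\<Sum> d\<^sub>\<pi>\<^sup>2\<close>.
\<close>

section \<open>Haar measure\<close>

text \<open>The choice of \<open>T\<close> solves T^(-s) = T^(\<nu> + d/2) / n. Three obstacles
  shape the rest. The sum in \<open>estimator\<close> runs over a set that has to be shown finite (a
  sum over an infinite set is 0); the bound on the degrees gives this, every degree being at least
  1. \<open>laplace_eigenvalue\<close> is a definite description about a second-order operator in a
  chosen chart, applied to representations that are only assumed continuous: these must be shown
  smooth, the operator chart independent and invariant under isometries, and Schur's lemma then
  makes it a scalar on each class; invariance under inversion makes that scalar real. Finally, what
  remains of a function after its Fourier projections converges only in L2, while the injectivity
  argument is about continuous kernels. It is therefore applied to autocorrelations, which converge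
  uniformly, inherit vanishing Fourier coefficients, and have the squared norm as their value at 0.
  Parseval's identity is thus reached for continuous functions and their L2 limits, which include
  the elements of a Sobolev ball.\<close>

lemma borel_measurable_cnj [measurable (raw)]:
  "f \<in> borel_measurable M \<Longrightarrow> (\<lambda>x. cnj (f x)) \<in> borel_measurable M"
  by (rule borel_measurable_continuous_on[of cnj]) (auto intro: continuous_intros)

text \<open>Products are integrable because |f| |g| is at most |f|^2 + |g|^2; the inequality is the
  Cauchy-Schwarz inequality for extended nonnegative integrals, transferred by finiteness of both
  squares.\<close>

lemma L2_mult:
  assumes "f \<in> L2 M" "g \<in> L2 M"
  shows "integrable M (\<lambda>x. f x * cnj (g x))"
    and "(cmod (\<integral>x. f x * cnj (g x) \<partial>M))\<^sup>2 \<le> (\<integral>x. (cmod (f x))\<^sup>2 \<partial>M) * (\<integral>x. (cmod (g x))\<^sup>2 \<partial>M)"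
proof -
  have [measurable]: "f \<in> borel_measurable M" "g \<in> borel_measurable M"
    using assms by (auto simp: L2_def)
  have i: "integrable M (\<lambda>x. (cmod (f x))\<^sup>2)" "integrable M (\<lambda>x. (cmod (g x))\<^sup>2)"
    using assms by (auto simp: L2_def)
  show int: "integrable M (\<lambda>x. f x * cnj (g x))"
  proof (rule Bochner_Integration.integrable_bound)
    show "integrable M (\<lambda>x. (cmod (f x))\<^sup>2 + (cmod (g x))\<^sup>2)" using i by auto
    show "AE x in M. norm (f x * cnj (g x)) \<le> norm ((cmod (f x))\<^sup>2 + (cmod (g x))\<^sup>2)"
    proof (rule AE_I2)
      fix x
      have "0 \<le> (cmod (f x) - cmod (g x))\<^sup>2" "0 \<le> (cmod (f x))\<^sup>2" "0 \<le> cmod (f x) * cmod (g x)" by auto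
      hence "cmod (f x) * cmod (g x) \<le> (cmod (f x))\<^sup>2 + (cmod (g x))\<^sup>2"
        unfolding power2_diff by linarith
      thus "norm (f x * cnj (g x)) \<le> norm ((cmod (f x))\<^sup>2 + (cmod (g x))\<^sup>2)"
        by (simp add: norm_mult)
    qed
  qed measurable
  have "cmod (\<integral>x. f x * cnj (g x) \<partial>M) \<le> (\<integral>x. cmod (f x) * cmod (g x) \<partial>M)"
    using integral_norm_bound[of M "\<lambda>x. f x * cnj (g x)"] by (simp add: norm_mult)
  moreover have int': "integrable M (\<lambda>x. cmod (f x) * cmod (g x))"
    using integrable_norm[OF int] by (simp add: norm_mult)
  ultimately have 1: "(cmod (\<integral>x. f x * cnj (g x) \<partial>M))\<^sup>2 \<le> (\<integral>x. cmod (f x) * cmod (g x) \<partial>M)\<^sup>2"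
    by (intro power_mono) auto
  have "ennreal ((\<integral>x. cmod (f x) * cmod (g x) \<partial>M)\<^sup>2) = (ennreal (\<integral>x. cmod (f x) * cmod (g x) \<partial>M))\<^sup>2"
    by (simp add: ennreal_power)
  also have "\<dots> = (\<integral>\<^sup>+x. ennreal (cmod (f x)) * ennreal (cmod (g x)) \<partial>M)\<^sup>2"
    using int' by (subst nn_integral_eq_integral[symmetric]) (auto simp: ennreal_mult)
  also have "\<dots> \<le> (\<integral>\<^sup>+x. (ennreal (cmod (f x)))\<^sup>2 \<partial>M) * (\<integral>\<^sup>+x. (ennreal (cmod (g x)))\<^sup>2 \<partial>M)"
    by (rule Cauchy_Schwarz_nn_integral) auto
  also have "\<dots> = ennreal (\<integral>x. (cmod (f x))\<^sup>2 \<partial>M) * ennreal (\<integral>x. (cmod (g x))\<^sup>2 \<partial>M)"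
    using i by (simp add: ennreal_power nn_integral_eq_integral)
  finally have "(\<integral>x. cmod (f x) * cmod (g x) \<partial>M)\<^sup>2 \<le> (\<integral>x. (cmod (f x))\<^sup>2 \<partial>M) * (\<integral>x. (cmod (g x))\<^sup>2 \<partial>M)"
    by (simp add: ennreal_mult[symmetric])
  with 1 show "(cmod (\<integral>x. f x * cnj (g x) \<partial>M))\<^sup>2 \<le> (\<integral>x. (cmod (f x))\<^sup>2 \<partial>M) * (\<integral>x. (cmod (g x))\<^sup>2 \<partial>M)"
    by (rule order_trans)
qed

locale haar_group =
  fixes \<mu> :: "'g::{topological_group_add, t2_space, second_countable_topology} measure"
  assumes compact_G: "compact (UNIV :: 'g set)"
    and haar: "normalized_haar \<mu>"
begin

sublocale prob_space \<mu>
  using haar by (auto simp: normalized_haar_def)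

lemma sets_haar [simp, measurable_cong]: "sets \<mu> = sets borel"
  using haar by (auto simp: normalized_haar_def)

lemma space_haar [simp]: "space \<mu> = UNIV"
  using sets_eq_imp_space_eq[OF sets_haar] by simp

lemma continuous_measurable:
  fixes f :: "'g \<Rightarrow> 'b::topological_space"
  shows "continuous_on UNIV f \<Longrightarrow> f \<in> borel_measurable \<mu>"
  by (metis borel_measurable_continuous_onI measurable_cong_sets sets_haar)

lemma continuous_bounded:
  fixes f :: "'g \<Rightarrow> 'b::real_normed_vector"
  assumes "continuous_on UNIV f"
  obtains B where "\<And>x. norm (f x) \<le> B" "B > 0"
proof -
  have "bounded (range f)"
    using compact_continuous_image[OF assms compact_G] compact_imp_bounded by blast
  thus ?thesis using that unfolding bounded_pos by blast
qed

lemma continuous_integrable: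
  fixes f :: "'g \<Rightarrow> 'b::{banach, second_countable_topology}"
  assumes "continuous_on UNIV f"
  shows "integrable \<mu> f"
proof -
  obtain B where "\<And>x. norm (f x) \<le> B" using continuous_bounded[OF assms] by blast
  thus ?thesis
    by (intro integrable_const_bound[where B=B] continuous_measurable assms) auto
qed

lemma continuous_L2: "continuous_on UNIV f \<Longrightarrow> f \<in> L2 \<mu>"
  unfolding L2_def
  by (auto intro!: continuous_measurable continuous_integrable continuous_intros)

section \<open>Invariance under translations and inversion\<close>

lemma measurable_translate [measurable]:
  "(\<lambda>x. a + x) \<in> borel_measurable (borel :: 'g measure)"
  "(\<lambda>x. x + a) \<in> borel_measurable (borel :: 'g measure)"
  "(\<lambda>x. - x) \<in> borel_measurable (borel :: 'g measure)"
  by (auto intro!: borel_measurable_continuous_onI continuous_intros)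

lemma distr_left: "distr \<mu> \<mu> (\<lambda>x. a + x) = \<mu>"
  using haar by (auto simp: normalized_haar_def)

lemma integral_left:
  fixes f :: "'g \<Rightarrow> 'b::{banach, second_countable_topology}"
  assumes [measurable]: "f \<in> borel_measurable borel"
  shows "(\<integral>x. f (a + x) \<partial>\<mu>) = (\<integral>x. f x \<partial>\<mu>)"
proof -
  have "(\<integral>x. f x \<partial>\<mu>) = (\<integral>x. f x \<partial>(distr \<mu> \<mu> (\<lambda>x. a + x)))" by (simp add: distr_left)
  also have "\<dots> = (\<integral>x. f (a + x) \<partial>\<mu>)" by (rule integral_distr) auto
  finally show ?thesis by simp
qed

lemma nn_integral_left:
  assumes [measurable]: "f \<in> borel_measurable borel"
  shows "(\<integral>\<^sup>+x. f (a + x) \<partial>\<mu>) = (\<integral>\<^sup>+x. f x \<partial>\<mu>)"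
proof -
  have "(\<integral>\<^sup>+x. f x \<partial>\<mu>) = (\<integral>\<^sup>+x. f x \<partial>(distr \<mu> \<mu> (\<lambda>x. a + x)))" by (simp add: distr_left)
  also have "\<dots> = (\<integral>\<^sup>+x. f (a + x) \<partial>\<mu>)" by (rule nn_integral_distr) auto
  finally show ?thesis by simp
qed

text \<open>Second countability enters here: the product sigma-algebra is the Borel one, so
  continuous functions of two variables are jointly measurable and Fubini's theorem applies to
  them.\<close>

lemma sets_pair_haar [simp]: "sets (\<mu> \<Otimes>\<^sub>M \<mu>) = sets borel"
  by (metis borel_prod sets_haar sets_pair_measure_cong)

lemma measurable_add_pair [measurable]: "(\<lambda>(x, y). x + y :: 'g) \<in> borel_measurable (\<mu> \<Otimes>\<^sub>M \<mu>)"
  by (subst measurable_cong_sets[OF sets_pair_haar refl])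
     (auto intro!: borel_measurable_continuous_onI continuous_intros simp: case_prod_beta)

text \<open>Comparing both orders of integration in \<open>\<integral>\<integral>f(-x + y)\<close> shows that inversion preserves the measure.\<close>

lemma nn_integral_inv:
  assumes [measurable]: "f \<in> borel_measurable borel"
  shows "(\<integral>\<^sup>+x. f (- x) \<partial>\<mu>) = (\<integral>\<^sup>+x. f x \<partial>\<mu>)"
proof -
  interpret pair_sigma_finite \<mu> \<mu> ..
  have m: "(\<lambda>(x, y). f (- x + y)) \<in> borel_measurable (\<mu> \<Otimes>\<^sub>M \<mu>)" 
  proof -
    have "(\<lambda>p. f (- fst p + snd p)) \<in> borel_measurable (borel :: ('g \<times> 'g) measure)"
      by (rule measurable_compose[OF _ assms], rule borel_measurable_continuous_onI)
         (auto intro!: continuous_intros)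
    thus ?thesis by (subst measurable_cong_sets[OF sets_pair_haar refl]) (simp add: case_prod_beta)
  qed
  have "(\<integral>\<^sup>+x. f x \<partial>\<mu>) = (\<integral>\<^sup>+x. \<integral>\<^sup>+y. f (- x + y) \<partial>\<mu> \<partial>\<mu>)"
    by (simp add: nn_integral_left emeasure_space_1[simplified])
  also have "\<dots> = (\<integral>\<^sup>+y. \<integral>\<^sup>+x. f (- x + y) \<partial>\<mu> \<partial>\<mu>)"
    using Fubini'[OF m] by simp
  also have "\<dots> = (\<integral>\<^sup>+y. \<integral>\<^sup>+x. f (- (- y + x)) \<partial>\<mu> \<partial>\<mu>)"
    by (simp add: minus_add)
  also have "\<dots> = (\<integral>\<^sup>+x. f (- x) \<partial>\<mu>)"
    using nn_integral_left[of "\<lambda>x. f (- x)"] by (simp add: emeasure_space_1[simplified])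
  finally show ?thesis by simp
qed

lemma distr_inv: "distr \<mu> \<mu> uminus = \<mu>"
proof (rule measure_eqI)
  fix A assume "A \<in> sets (distr \<mu> \<mu> uminus)"
  hence [measurable]: "A \<in> sets borel" by simp
  have "emeasure (distr \<mu> \<mu> uminus) A = (\<integral>\<^sup>+x. indicator A x \<partial>distr \<mu> \<mu> uminus)"
    by simp
  also have "\<dots> = (\<integral>\<^sup>+x. indicator A (- x) \<partial>\<mu>)"
    by (rule nn_integral_distr) auto
  also have "\<dots> = emeasure \<mu> A"
    using nn_integral_inv[of "indicator A"] by simp
  finally show "emeasure (distr \<mu> \<mu> uminus) A = emeasure \<mu> A" .
qed simp

lemma integral_inv:
  fixes f :: "'g \<Rightarrow> 'b::{banach, second_countable_topology}"
  assumes [measurable]: "f \<in> borel_measurable borel"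
  shows "(\<integral>x. f (- x) \<partial>\<mu>) = (\<integral>x. f x \<partial>\<mu>)"
proof -
  have "(\<integral>x. f x \<partial>\<mu>) = (\<integral>x. f x \<partial>(distr \<mu> \<mu> uminus))" by (simp add: distr_inv)
  also have "\<dots> = (\<integral>x. f (- x) \<partial>\<mu>)" by (rule integral_distr) auto
  finally show ?thesis by simp
qed

text \<open>Right translation is left translation conjugated by inversion, and both preserve the
  measure.\<close>

lemma integral_right:
  fixes f :: "'g \<Rightarrow> 'b::{banach, second_countable_topology}"
  assumes [measurable]: "f \<in> borel_measurable borel"
  shows "(\<integral>x. f (x + a) \<partial>\<mu>) = (\<integral>x. f x \<partial>\<mu>)"
proof -
  have "(\<integral>x. f (x + a) \<partial>\<mu>) = (\<integral>x. f (- x + a) \<partial>\<mu>)"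
    using integral_inv[of "\<lambda>x. f (x + a)"] by simp
  also have "\<dots> = (\<integral>x. f (- (- a + x)) \<partial>\<mu>)" by (simp add: minus_add)
  also have "\<dots> = (\<integral>x. f (- x) \<partial>\<mu>)"
    using integral_left[of "\<lambda>x. f (- x)"] by simp
  finally show ?thesis by (simp add: integral_inv)
qed

section \<open>Continuous functions on the group and on its square\<close>

lemma continuous_pair_bounded:
  fixes F :: "'g \<times> 'g \<Rightarrow> 'b::real_normed_vector"
  assumes "continuous_on UNIV F"
  obtains B where "\<And>p. norm (F p) \<le> B" "B > 0"
proof -
  have "compact (UNIV :: ('g \<times> 'g) set)"
    using compact_Times[OF compact_G compact_G] by simp
  hence "bounded (range F)"
    using compact_continuous_image[OF assms] compact_imp_bounded by blast
  thus ?thesis using that unfolding bounded_pos by blast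
qed

lemma continuous_pair_sections:
  assumes "continuous_on UNIV (F :: 'g \<times> 'g \<Rightarrow> 'b::topological_space)"
  shows "continuous_on UNIV (\<lambda>y. F (x, y))" "continuous_on UNIV (\<lambda>x. F (x, y))"
  by (rule continuous_on_compose2[OF assms], auto intro!: continuous_intros)+

text \<open>The topology is first countable, so sequences suffice; compactness bounds
  \<open>F\<close>, so a constant dominates.\<close>

lemma continuous_integral:
  fixes F :: "'g \<times> 'g \<Rightarrow> complex"
  assumes F: "continuous_on UNIV F"
  shows "continuous_on UNIV (\<lambda>x. \<integral>y. F (x, y) \<partial>\<mu>)"
proof -
  obtain B where B: "\<And>p. norm (F p) \<le> B" using continuous_pair_bounded[OF F] by blast
  have m: "(\<lambda>y. F (x, y)) \<in> borel_measurable \<mu>" for x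
    by (intro continuous_measurable continuous_pair_sections F)
  have "isCont (\<lambda>x. \<integral>y. F (x, y) \<partial>\<mu>) a" for a
  proof (rule continuous_at_sequentiallyI)
    fix u :: "nat \<Rightarrow> 'g" assume u: "u \<longlonglongrightarrow> a"
    show "(\<lambda>n. \<integral>y. F (u n, y) \<partial>\<mu>) \<longlonglongrightarrow> (\<integral>y. F (a, y) \<partial>\<mu>)"
    proof (rule integral_dominated_convergence[where w="\<lambda>_. B"])
      show "AE y in \<mu>. (\<lambda>n. F (u n, y)) \<longlonglongrightarrow> F (a, y)"
      proof (rule AE_I2)
        fix y
        have "isCont (\<lambda>x. F (x, y)) a"
          using continuous_pair_sections(2)[OF F] by (simp add: continuous_on_eq_continuous_at)
        thus "(\<lambda>n. F (u n, y)) \<longlonglongrightarrow> F (a, y)"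
          using u by (rule isCont_tendsto_compose)
      qed
    qed (use m B in auto)
  qed
  thus ?thesis by (simp add: continuous_on_eq_continuous_at)
qed

lemma Fubini_continuous:
  fixes F :: "'g \<times> 'g \<Rightarrow> complex"
  assumes F: "continuous_on UNIV F"
  shows "(\<integral>x. \<integral>y. F (x, y) \<partial>\<mu> \<partial>\<mu>) = (\<integral>y. \<integral>x. F (x, y) \<partial>\<mu> \<partial>\<mu>)"
proof -
  interpret P: pair_prob_space \<mu> \<mu> ..
  obtain B where B: "\<And>p. norm (F p) \<le> B" using continuous_pair_bounded[OF F] by blast
  have "F \<in> borel_measurable (\<mu> \<Otimes>\<^sub>M \<mu>)"
    by (subst measurable_cong_sets[OF sets_pair_haar refl]) (intro borel_measurable_continuous_onI F)
  hence "integrable (\<mu> \<Otimes>\<^sub>M \<mu>) F"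
    by (intro P.integrable_const_bound[where B=B]) (use B in auto)
  thus ?thesis using P.Fubini_integral[of "\<lambda>x y. F (x, y)"] by simp
qed

text \<open>By compactness finitely many translates of \<open>U\<close> cover the group, and all of
  them have the measure of \<open>U\<close>.\<close>

lemma open_pos:
  assumes "open U" "U \<noteq> {}"
  shows "measure \<mu> U > 0"
proof (rule ccontr)
  assume "\<not> ?thesis"
  hence U0: "emeasure \<mu> U = 0" by (simp add: emeasure_eq_measure zero_less_measure_iff)
  obtain u where u: "u \<in> U" using assms by auto
  let ?T = "\<lambda>a. (\<lambda>x. a + x) -` U"
  have op: "open (?T a)" for a
    by (intro open_vimage assms continuous_intros)
  have "UNIV \<subseteq> (\<Union>a\<in>UNIV. ?T a)"
  proof
    fix x show "x \<in> (\<Union>a\<in>UNIV. ?T a)" using u by (intro UN_I[of "u - x"]) (auto simp: algebra_simps)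
  qed
  then obtain A where A: "finite A" "UNIV \<subseteq> (\<Union>a\<in>A. ?T a)"
    using compactE_image[OF compact_G, of UNIV ?T] op by metis
  have "emeasure \<mu> (?T a) = 0" for a
  proof -
    have "emeasure \<mu> U = emeasure (distr \<mu> \<mu> (\<lambda>x. a + x)) U" by (simp add: distr_left)
    also have "\<dots> = emeasure \<mu> (?T a)" using assms by (subst emeasure_distr) auto
    finally show ?thesis using U0 by simp
  qed
  hence "emeasure \<mu> (\<Union>a\<in>A. ?T a) = 0"
    using emeasure_subadditive_finite[OF A(1), of ?T \<mu>] op by (auto intro: borel_open)
  moreover have "(\<Union>a\<in>A. ?T a) = UNIV" using A by auto
  ultimately show False using emeasure_space_1 by simp
qed

section \<open>Inner product and squared norm\<close>

definition cip :: "('g \<Rightarrow> complex) \<Rightarrow> ('g \<Rightarrow> complex) \<Rightarrow> complex" where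
  "cip f g = (\<integral>x. f x * cnj (g x) \<partial>\<mu>)"

definition nsq :: "('g \<Rightarrow> complex) \<Rightarrow> real" where
  "nsq f = (\<integral>x. (cmod (f x))\<^sup>2 \<partial>\<mu>)"

lemma nsq_nonneg: "nsq f \<ge> 0"
  unfolding nsq_def by (intro Bochner_Integration.integral_nonneg) auto

lemma cip_self: "cip f f = complex_of_real (nsq f)"
  unfolding cip_def nsq_def by (simp flip: complex_norm_square integral_complex_of_real of_real_power)

lemma cip_bound: "f \<in> L2 \<mu> \<Longrightarrow> g \<in> L2 \<mu> \<Longrightarrow> (cmod (cip f g))\<^sup>2 \<le> nsq f * nsq g"
  unfolding cip_def nsq_def by (rule L2_mult(2))

lemma cip_cnj: "cnj (cip f g) = cip g f"
  unfolding cip_def by (subst Bochner_Integration.integral_cnj[symmetric]) (simp add: mult.commute)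

text \<open>A nonzero value of |f| stays above its half on a nonempty open set, which has positive
  measure.\<close>

lemma nsq_zero_continuous:
  assumes f: "continuous_on UNIV f" and "nsq f = 0"
  shows "f x = 0"
proof (rule ccontr)
  assume x: "f x \<noteq> 0"
  let ?U = "{y. cmod (f x) / 2 < cmod (f y)}"
  have U: "open ?U" using f by (intro open_Collect_less continuous_intros) 
  have "?U \<noteq> {}" using x by (auto intro!: exI[of _ x])
  with open_pos[OF U] have pos: "measure \<mu> ?U > 0" .
  have "(cmod (f x) / 2)\<^sup>2 * measure \<mu> ?U = (\<integral>y. (cmod (f x) / 2)\<^sup>2 * indicator ?U y \<partial>\<mu>)"
    using U by (simp del: indicator_simps) 
  also have "\<dots> \<le> nsq f"
    unfolding nsq_def
  proof (rule integral_mono)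
    show "integrable \<mu> (\<lambda>y. (cmod (f x) / 2)\<^sup>2 * indicat_real ?U y)"
      using U by (intro integrable_mult_right) (auto simp: integrable_indicator_iff less_top[symmetric])
    show "integrable \<mu> (\<lambda>y. (cmod (f y))\<^sup>2)" using continuous_L2[OF f] by (simp add: L2_def)
    show "(cmod (f x) / 2)\<^sup>2 * indicat_real ?U y \<le> (cmod (f y))\<^sup>2" for y
      by (auto simp: indicator_def intro!: power_mono)
  qed
  finally show False using pos x assms(2) by (simp add: mult_le_0_iff zero_less_mult_iff)
qed

end

section \<open>Eigenfunctions of convolution operators\<close>

context haar_group begin

text \<open>Convolution with \<open>a\<close> from the left, so that the operator commutes with
  right translations; this is what lets its eigenspaces carry representations.\<close>

definition conv :: "('g \<Rightarrow> complex) \<Rightarrow> ('g \<Rightarrow> complex) \<Rightarrow> 'g \<Rightarrow> complex" where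
  "conv a f x = (\<integral>z. a (x - z) * f z \<partial>\<mu>)"

lemma continuous_conv:
  assumes "continuous_on UNIV a" "continuous_on UNIV f"
  shows "continuous_on UNIV (conv a f)"
  unfolding conv_def
  by (rule continuous_integral[where F="\<lambda>(x, z). a (x - z) * f z", simplified])
     (auto simp: case_prod_beta intro!: continuous_intros continuous_on_compose2[OF assms(1)]
       continuous_on_compose2[OF assms(2)])

lemma nsq_reflect:
  assumes a: "continuous_on UNIV a"
  shows "nsq (\<lambda>z. cnj (a (x - z))) = nsq a"
proof -
  have m: "(\<lambda>z. (cmod (a z))\<^sup>2) \<in> borel_measurable borel"
    by (intro borel_measurable_continuous_onI continuous_intros a)
  have "nsq (\<lambda>z. cnj (a (x - z))) = (\<integral>z. (cmod (a (x + - z)))\<^sup>2 \<partial>\<mu>)" by (simp add: nsq_def)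
  also have "\<dots> = (\<integral>z. (cmod (a (x + z)))\<^sup>2 \<partial>\<mu>)"
    by (rule integral_inv) (intro borel_measurable_continuous_onI continuous_intros
       continuous_on_compose2[OF a], auto)
  also have "\<dots> = nsq a" unfolding nsq_def using integral_left[OF m] by simp
  finally show ?thesis .
qed

text \<open>Cauchy-Schwarz at each point separately, the reflected kernel having the same norm for
  every \<open>x\<close>. Convolution thus turns L2 estimates into uniform ones, the substitute for
  compactness of the operator.\<close>

lemma conv_bound:
  assumes a: "continuous_on UNIV a" and f: "continuous_on UNIV f"
  shows "(cmod (conv a f x))\<^sup>2 \<le> nsq a * nsq f"
proof -
  have c: "continuous_on UNIV (\<lambda>z. cnj (a (x - z)))"
    by (intro continuous_intros continuous_on_compose2[OF a]) auto
  have "conv a f x = cip f (\<lambda>z. cnj (a (x - z)))"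
    by (simp add: conv_def cip_def mult.commute)
  thus ?thesis using cip_bound[OF continuous_L2[OF f] continuous_L2[OF c]]
    by (simp add: nsq_reflect[OF a] mult.commute)
qed

lemma nsq_le:
  assumes "continuous_on UNIV f" "\<And>x. (cmod (f x))\<^sup>2 \<le> C"
  shows "nsq f \<le> C"
proof -
  have "nsq f \<le> (\<integral>x. C \<partial>\<mu>)" unfolding nsq_def
    using continuous_L2[OF assms(1)] assms(2) by (intro integral_mono) (auto simp: L2_def)
  thus ?thesis by (simp add: prob_space[simplified])
qed

lemma nsq_conv_bound:
  assumes "continuous_on UNIV a" "continuous_on UNIV f"
  shows "nsq (conv a f) \<le> nsq a * nsq f"
  by (intro nsq_le continuous_conv conv_bound assms)

lemma conv_assoc:
  assumes a: "continuous_on UNIV a" and b: "continuous_on UNIV b" and f: "continuous_on UNIV f"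
  shows "conv (conv a b) f = conv a (conv b f)"
proof
  fix x
  have c: "continuous_on UNIV (\<lambda>(z, u). a (x - u) * b (u - z) * f z)"
    unfolding case_prod_beta
    by (intro continuous_intros continuous_on_compose2[OF a] continuous_on_compose2[OF b]
       continuous_on_compose2[OF f]) auto
  have "conv a b (x - z) = (\<integral>u. a (x - u) * b (u - z) \<partial>\<mu>)" for z
  proof -
    have "(\<integral>u. a (x - u) * b (u - z) \<partial>\<mu>) = (\<integral>u. a (x - (u + z)) * b (u + z - z) \<partial>\<mu>)"
      by (rule integral_right[symmetric], intro borel_measurable_continuous_onI continuous_intros
        continuous_on_compose2[OF a] continuous_on_compose2[OF b]) auto
    thus ?thesis by (simp add: conv_def diff_conv_add_uminus minus_add add.assoc del: add_uminus_conv_diff)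
  qed
  hence "conv (conv a b) f x = (\<integral>z. \<integral>u. a (x - u) * b (u - z) * f z \<partial>\<mu> \<partial>\<mu>)"
    by (simp add: conv_def[of "conv a b"])
  also have "\<dots> = (\<integral>u. \<integral>z. a (x - u) * b (u - z) * f z \<partial>\<mu> \<partial>\<mu>)"
    using Fubini_continuous[OF c] by simp
  also have "\<dots> = conv a (conv b f) x"
    by (simp add: conv_def mult.assoc)
  finally show "conv (conv a b) f x = conv a (conv b f) x" .
qed

text \<open>Under \<open>sa\<close> the kernel a(x - z) is Hermitian, so exchanging the integrals
  moves the operator to the other side.\<close>

lemma cip_conv:
  assumes a: "continuous_on UNIV a" and f: "continuous_on UNIV f" and g: "continuous_on UNIV g"
    and sa: "\<And>x. a (- x) = cnj (a x)"
  shows "cip (conv a f) g = cip f (conv a g)"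
proof -
  have c: "continuous_on UNIV (\<lambda>(x, z). a (x - z) * f z * cnj (g x))"
    unfolding case_prod_beta
    by (intro continuous_intros continuous_on_compose2[OF a] continuous_on_compose2[OF g]
       continuous_on_compose2[OF f]) auto
  have s: "cnj (a (z - x)) = a (x - z)" for x z using sa[of "z - x"] by simp
  have "cip (conv a f) g = (\<integral>x. \<integral>z. a (x - z) * f z * cnj (g x) \<partial>\<mu> \<partial>\<mu>)"
    by (simp add: cip_def conv_def)
  also have "\<dots> = (\<integral>z. \<integral>x. a (x - z) * f z * cnj (g x) \<partial>\<mu> \<partial>\<mu>)"
    using Fubini_continuous[OF c] by simp
  also have "\<dots> = cip f (conv a g)"
    unfolding cip_def conv_def
    by (subst Bochner_Integration.integral_cnj[symmetric]) (simp add: s mult_ac flip: integral_mult_right_zero)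
  finally show ?thesis .
qed

lemma conv_scale: "conv a (\<lambda>x. c * f x) = (\<lambda>x. c * conv a f x)"
  by (rule ext) (simp add: conv_def mult.left_commute)

lemma conv_diff:
  assumes a: "continuous_on UNIV a" and f: "continuous_on UNIV f" and g: "continuous_on UNIV g"
  shows "conv a (\<lambda>x. f x - g x) x = conv a f x - conv a g x"
  unfolding conv_def right_diff_distrib
  by (rule Bochner_Integration.integral_diff; rule continuous_integrable)
     (intro continuous_intros continuous_on_compose2[OF a] continuous_on_compose2[OF f]
       continuous_on_compose2[OF g]; auto)+

lemma cip_diff:
  assumes "f \<in> L2 \<mu>" "g \<in> L2 \<mu>" "k \<in> L2 \<mu>"
  shows "cip (\<lambda>x. f x - g x) k = cip f k - cip g k"
  unfolding cip_def left_diff_distrib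
  by (rule Bochner_Integration.integral_diff) (intro L2_mult(1) assms)+

lemma nsq_uniform_limit:
  assumes p: "\<And>n. continuous_on UNIV (p n)" and u: "uniform_limit UNIV p q sequentially"
  shows "continuous_on UNIV q" "(\<lambda>n. nsq (p n)) \<longlonglongrightarrow> nsq q"
proof -
  show q: "continuous_on UNIV q"
    by (rule uniform_limit_theorem[OF _ u]) (auto simp: p)
  obtain B where B: "\<And>x. cmod (q x) \<le> B" "B > 0" using continuous_bounded[OF q] by blast
  have "\<forall>\<^sub>F n in sequentially. \<forall>x\<in>UNIV. dist (p n x) (q x) < 1"
    using u by (auto simp: uniform_limit_iff)
  then obtain N where N: "\<And>n x. n \<ge> N \<Longrightarrow> dist (p n x) (q x) < 1"
    by (auto simp: eventually_sequentially)
  have bd: "cmod (p (n + N) x) \<le> B + 1" for n x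
    using N[of "n+N" x] B(1)[of x] norm_triangle_sub[of "p (n+N) x" "q x"] by (simp add: dist_norm)
  have "(\<lambda>n. nsq (p (n + N))) \<longlonglongrightarrow> nsq q"
    unfolding nsq_def
  proof (rule integral_dominated_convergence[where w="\<lambda>_. (B + 1)\<^sup>2"])
    show "AE x in \<mu>. (\<lambda>n. (cmod (p (n + N) x))\<^sup>2) \<longlonglongrightarrow> (cmod (q x))\<^sup>2"
      by (intro AE_I2 tendsto_intros LIMSEQ_ignore_initial_segment tendsto_uniform_limitI[OF u]) auto
    show "AE x in \<mu>. norm ((cmod (p (n + N) x))\<^sup>2) \<le> (B + 1)\<^sup>2" for n
      using bd by (intro AE_I2) (auto intro!: power_mono)
  qed (auto intro!: continuous_measurable continuous_intros p q)
  thus "(\<lambda>n. nsq (p n)) \<longlonglongrightarrow> nsq q" by (rule LIMSEQ_offset)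
qed

lemma nsq_diff:
  assumes "f \<in> L2 \<mu>" "g \<in> L2 \<mu>"
  shows "nsq (\<lambda>x. f x - g x) = nsq f + nsq g - 2 * Re (cip f g)"
proof -
  have i: "integrable \<mu> (\<lambda>x. (cmod (f x))\<^sup>2)" "integrable \<mu> (\<lambda>x. (cmod (g x))\<^sup>2)"
    "integrable \<mu> (\<lambda>x. f x * cnj (g x))"
    using assms L2_mult(1) by (auto simp: L2_def)
  have "(cmod (f x - g x))\<^sup>2 = (cmod (f x))\<^sup>2 + (cmod (g x))\<^sup>2 - 2 * Re (f x * cnj (g x))" for x
    unfolding cmod_power2 by (simp add: power2_eq_square algebra_simps)
  hence "nsq (\<lambda>x. f x - g x) = (\<integral>x. (cmod (f x))\<^sup>2 + (cmod (g x))\<^sup>2 - 2 * Re (f x * cnj (g x)) \<partial>\<mu>)"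
    by (simp only: nsq_def)
  also have "\<dots> = nsq f + nsq g - 2 * Re (cip f g)"
    unfolding nsq_def cip_def integral_Re[OF i(3), symmetric]
    using i integrable_Re[OF i(3)] by (simp del: integral_Re times_complex.sel)
  finally show ?thesis .
qed

text \<open>A substitute for the spectral theorem. The squared norms \<open>B n\<close> of the convolution powers of
  \<open>\<eta>\<close> are log-convex, so \<open>B (n + 1) / B n\<close> increases to some \<open>\<rho>\<close>; submultiplicativity gives
  \<open>B n \<ge> \<rho> ^ (n + 1)\<close>, so that the powers divided by \<open>\<rho>\<close> to the right exponent converge to a
  nonzero function.\<close>

lemma exists_eigenfunction:
  assumes eta: "continuous_on UNIV \<eta>" and sa: "\<And>x. \<eta> (- x) = cnj (\<eta> x)" and nz: "nsq \<eta> > 0"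
  shows "\<exists>\<rho>>0. \<exists>p. continuous_on UNIV p \<and> nsq p > 0 \<and>
    conv \<eta> (conv \<eta> p) = (\<lambda>x. complex_of_real \<rho> * p x)"
proof -
  \<comment> \<open>\<open>e n\<close> is the (n + 1)-fold convolution power of \<eta>; hence the
    extra successor in \<open>e_add\<close> and \<open>submult\<close>.\<close>
  define e where "e = rec_nat \<eta> (\<lambda>_ f. conv \<eta> f)"
  have e0: "e 0 = \<eta>" and eS: "e (Suc n) = conv \<eta> (e n)" for n by (auto simp: e_def)
  have ce: "continuous_on UNIV (e n)" for n
    by (induction n) (auto simp: e0 eS intro: continuous_conv eta)
  note L2e = continuous_L2[OF ce]
  have e_add: "e (Suc (m + n)) = conv (e m) (e n)" for m n
    by (induction m) (auto simp: e0 eS conv_assoc[OF eta ce ce])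
  define B where "B n = nsq (e n)" for n
  have shift: "cip (e (Suc i)) (e j) = cip (e i) (e (Suc j))" for i j
    unfolding eS by (rule cip_conv[OF eta ce ce sa])
  have cip_e0: "cip (e i) (e j) = cip (e 0) (e (i + j))" for i j
    by (induction i arbitrary: j) (auto simp: shift)
  have cip_e: "cip (e i) (e j) = complex_of_real (B k)" if "i + j = 2 * k" for i j k
    using cip_e0[of i j] cip_e0[of k k] that by (simp add: cip_self B_def mult_2)
  have B_nonneg: "B n \<ge> 0" for n by (simp add: B_def nsq_nonneg)
  \<comment> \<open>Cauchy-Schwarz for \<open>e n\<close> and \<open>e (Suc (Suc n))\<close>: since
    the operator is symmetric, their inner product is \<open>B (Suc n)\<close>.\<close>
  have logconv: "(B (Suc n))\<^sup>2 \<le> B n * B (Suc (Suc n))" for n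
    using cip_bound[OF L2e L2e, of n "Suc (Suc n)"] cip_e[of n "Suc (Suc n)" "Suc n"] B_nonneg[of "Suc n"]
    by (simp add: B_def)
  have submult: "B (Suc (m + n)) \<le> B m * B n" for m n
    unfolding B_def e_add by (rule nsq_conv_bound[OF ce ce])
  have B0: "B 0 > 0" using nz by (simp add: B_def e0)
  \<comment> \<open>The value at the identity shows that the second power does not vanish;
    log-convexity then propagates positivity to all powers.\<close>
  have "e 1 0 = complex_of_real (B 0)"
  proof -
    have "e 1 0 = (\<integral>z. \<eta> (- z) * \<eta> z \<partial>\<mu>)" using eS[of 0] by (simp add: e0 conv_def)
    also have "\<dots> = cip \<eta> \<eta>" by (simp add: cip_def sa mult.commute)
    finally show ?thesis by (simp add: cip_self B_def e0)
  qed
  hence "B 1 \<noteq> 0" using nsq_zero_continuous[OF ce[of 1], of 0] B0 by (auto simp: B_def)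
  hence B1: "B 1 > 0" using B_nonneg[of 1] by simp
  have "B n > 0 \<and> B (Suc n) > 0" for n
  proof (induction n)
    case (Suc n)
    have "0 < (B (Suc n))\<^sup>2" using Suc by simp
    also note logconv[of n]
    finally show ?case using Suc by (simp add: zero_less_mult_iff)
  qed (use B0 B1 in auto)
  hence B_pos: "B n > 0" for n by blast
  define r where "r n = B (Suc n) / B n" for n
  have r_pos: "r n > 0" for n by (simp add: r_def B_pos)
  have "r n \<le> r (Suc n)" for n
    using logconv[of n] B_pos[of n] B_pos[of "Suc n"] by (simp add: r_def field_simps power2_eq_square)
  hence inc: "incseq r" by (rule incseq_SucI)
  have "r n \<le> B 0" for n using submult[of 0 n] B_pos[of n] by (simp add: r_def field_simps)
  then obtain \<rho> where rho: "r \<longlonglongrightarrow> \<rho>" "\<And>n. r n \<le> \<rho>"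
    using incseq_convergent[OF inc] by metis
  have rho_pos: "\<rho> > 0" using rho(2)[of 0] r_pos[of 0] by simp
  have step: "r n ^ m * B n \<le> B (n + m)" for n m
  proof (induction m)
    case (Suc m)
    have "r n ^ Suc m * B n = r n * (r n ^ m * B n)" by simp
    also have "\<dots> \<le> r (n + m) * B (n + m)"
      by (rule mult_mono) (use Suc r_pos[of n] r_pos[of "n+m"] B_pos[of n] incseqD[OF inc, of n "n+m"] in auto)
    also have "\<dots> = B (n + Suc m)" using B_pos[of "n+m"] by (simp add: r_def)
    finally show ?case .
  qed simp
  have B_ge: "\<rho> ^ Suc m \<le> B m" for m
  proof (rule LIMSEQ_le_const2)
    show "(\<lambda>n. r n ^ Suc m) \<longlonglongrightarrow> \<rho> ^ Suc m" by (intro tendsto_intros rho)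
    show "\<exists>N. \<forall>n\<ge>N. r n ^ Suc m \<le> B m"
    proof (intro exI[of _ 0] allI impI)
      fix n
      have "r n ^ Suc m * B n \<le> B (n + Suc m)" by (rule step)
      also have "\<dots> \<le> B m * B n" using submult[of m n] by (simp add: add.commute)
      finally show "r n ^ Suc m \<le> B m" using B_pos[of n] by simp
    qed
  qed
  define b where "b n = B n / \<rho> ^ Suc n" for n
  have b_ge: "b n \<ge> 1" for n using B_ge[of n] rho_pos by (simp add: b_def del: power_Suc)
  have "b (Suc n) \<le> b n" for n
  proof -
    have "B (Suc n) \<le> \<rho> * B n" using rho(2)[of n] B_pos[of n] by (simp add: r_def field_simps)
    thus ?thesis using rho_pos by (simp add: b_def field_simps)
  qed
  hence "decseq b" by (rule decseq_SucI)
  then obtain \<beta> where beta: "b \<longlonglongrightarrow> \<beta>" "\<And>n. \<beta> \<le> b n"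
    using decseq_convergent[of b 1] b_ge by metis
  \<comment> \<open>This lower bound keeps the limit function from vanishing.\<close>
  have beta1: "\<beta> \<ge> 1" by (rule LIMSEQ_le_const[OF beta(1)]) (use b_ge in auto)
  \<comment> \<open>Only even convolution powers are used: the operator may have eigenvalues of both
    signs, so its normalised powers may oscillate, whereas those of its square do not.\<close>
  define p where "p n = (\<lambda>x. complex_of_real (1 / \<rho> ^ Suc n) * e (Suc (2 * n)) x)" for n
  have cp: "continuous_on UNIV (p n)" for n unfolding p_def by (intro continuous_intros ce)
  note L2p = continuous_L2[OF cp]
  have cip_p: "cip (p i) (p j) = complex_of_real (b (Suc (i + j)))" for i j
  proof -
    have "cip (p i) (p j) = complex_of_real (1 / \<rho> ^ Suc i * (1 / \<rho> ^ Suc j)) * cip (e (Suc (2*i))) (e (Suc (2*j)))"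
      unfolding p_def cip_def by (simp add: mult_ac flip: integral_mult_right_zero)
    also have "cip (e (Suc (2*i))) (e (Suc (2*j))) = complex_of_real (B (Suc (i + j)))"
      by (rule cip_e) simp
    finally show ?thesis by (simp add: b_def power_add mult_ac)
  qed
  have nsq_p: "nsq (p i) = b (Suc (2 * i))" for i
    using cip_p[of i i] unfolding cip_self of_real_eq_iff by (simp add: mult_2)
  have p_diff: "nsq (\<lambda>x. p i x - p j x) = b (Suc (2*i)) + b (Suc (2*j)) - 2 * b (Suc (i + j))" for i j
    by (simp add: nsq_diff[OF L2p L2p] nsq_p cip_p)
  have p_Suc: "p (Suc n) = (\<lambda>x. complex_of_real (1 / \<rho>) * conv (e 1) (p n) x)" for n
  proof -
    have "e (Suc (2 * Suc n)) = conv (e 1) (e (Suc (2 * n)))" using e_add[of 1 "Suc (2*n)"] by simp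
    thus ?thesis unfolding p_def conv_scale by (auto simp: mult_ac)
  qed
  \<comment> \<open>The sequence itself is Cauchy in L2; the shifted one carries an additional
    convolution and is therefore uniformly Cauchy by \<open>conv_bound\<close>.\<close>
  have ucauchy: "uniformly_Cauchy_on UNIV (\<lambda>n. p (Suc n))"
  proof (rule uniformly_Cauchy_onI)
    fix \<epsilon> :: real assume eps: "\<epsilon> > 0"
    \<comment> \<open>With this value the final estimate of the squared distance is \<epsilon>^2 /
      2.\<close>
    define \<delta> where "\<delta> = (\<epsilon> * \<rho>)\<^sup>2 / (4 * B 1)"
    have "\<delta> > 0" using eps rho_pos B_pos[of 1] by (simp add: \<delta>_def)
    then obtain M where M: "\<And>n. n \<ge> M \<Longrightarrow> \<bar>b n - \<beta>\<bar> < \<delta> / 2"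
      using LIMSEQ_D[OF beta(1), of "\<delta> / 2"] by auto
    show "\<exists>M. \<forall>x\<in>UNIV. \<forall>m\<ge>M. \<forall>n\<ge>M. dist (p (Suc m) x) (p (Suc n) x) < \<epsilon>"
    proof (intro exI[of _ M] ballI allI impI)
      fix x m n assume mn: "m \<ge> M" "n \<ge> M"
      have "nsq (\<lambda>x. p m x - p n x) < 2 * \<delta>"
        proof -
        have "M \<le> Suc (2*m)" "M \<le> Suc (2*n)" using mn by auto
        from M[OF this(1)] M[OF this(2)] beta(2)[of "Suc (m+n)"] \<open>\<delta> > 0\<close>
        show ?thesis unfolding p_diff by linarith
      qed
      have cd: "continuous_on UNIV (\<lambda>x. p m x - p n x)" by (intro continuous_intros cp)
      have "p (Suc m) x - p (Suc n) x = complex_of_real (1 / \<rho>) * conv (e 1) (\<lambda>x. p m x - p n x) x"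
        unfolding p_Suc by (simp add: conv_diff[OF ce cp cp] algebra_simps)
      hence "(dist (p (Suc m) x) (p (Suc n) x))\<^sup>2 = (1 / \<rho>)\<^sup>2 * (cmod (conv (e 1) (\<lambda>x. p m x - p n x) x))\<^sup>2"
        by (simp add: dist_norm norm_mult norm_divide power_mult_distrib power_divide)
      also have "\<dots> \<le> (1 / \<rho>)\<^sup>2 * (nsq (e 1) * nsq (\<lambda>x. p m x - p n x))"
        by (intro mult_left_mono conv_bound ce cd) auto
      also have "\<dots> \<le> (1 / \<rho>)\<^sup>2 * (B 1 * (2 * \<delta>))"
        unfolding B_def using \<open>nsq _ < 2 * \<delta>\<close> by (intro mult_left_mono nsq_nonneg) auto
      also have "\<dots> < \<epsilon>\<^sup>2" using eps rho_pos B_pos[of 1] by (simp add: \<delta>_def power_mult_distrib field_simps)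
      finally show "dist (p (Suc m) x) (p (Suc n) x) < \<epsilon>"
        using eps by (simp add: power2_less_imp_less)
    qed
  qed
  then obtain q where q: "uniform_limit UNIV (\<lambda>n. p (Suc n)) q sequentially"
    using Cauchy_uniformly_convergent uniformly_convergent_on_def by blast
  note qc = nsq_uniform_limit[OF cp q]
  have "(\<lambda>n. nsq (p (Suc n))) \<longlonglongrightarrow> \<beta>"
    unfolding nsq_p by (rule filterlim_compose[OF beta(1)]) (auto intro!: filterlim_subseq simp: strict_mono_def)
  hence nsq_q: "nsq q = \<beta>" using qc(2) LIMSEQ_unique by blast
  have "conv (e 1) q x = complex_of_real \<rho> * q x" for x
  proof -
    have "(\<lambda>n. conv (e 1) (p (Suc n)) x) \<longlonglongrightarrow> conv (e 1) q x"
    proof -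
      have "uniform_limit UNIV (\<lambda>n z. q z - p (Suc n) z) (\<lambda>z. q z - q z) sequentially"
        by (intro uniform_limit_intros q)
      from nsq_uniform_limit(2)[OF _ this] qc(1) cp
      have "(\<lambda>n. nsq (\<lambda>z. q z - p (Suc n) z)) \<longlonglongrightarrow> nsq (\<lambda>z. q z - q z)"
        by (auto intro: continuous_intros)
      hence "(\<lambda>n. nsq (e 1) * nsq (\<lambda>z. q z - p (Suc n) z)) \<longlonglongrightarrow> 0"
        by (intro tendsto_mult_right_zero) (simp add: nsq_def)
      hence lim2: "(\<lambda>n. (cmod (conv (e 1) q x - conv (e 1) (p (Suc n)) x))\<^sup>2) \<longlonglongrightarrow> 0"
        proof (rule Lim_null_comparison[rotated])
        have "(cmod (conv (e 1) q x - conv (e 1) (p (Suc n)) x))\<^sup>2 \<le> nsq (e 1) * nsq (\<lambda>z. q z - p (Suc n) z)" for n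
          unfolding conv_diff[OF ce qc(1) cp, symmetric] by (intro conv_bound ce continuous_intros qc(1) cp)
        thus "\<forall>\<^sub>F n in sequentially. norm ((cmod (conv (e 1) q x - conv (e 1) (p (Suc n)) x))\<^sup>2)
            \<le> nsq (e 1) * nsq (\<lambda>z. q z - p (Suc n) z)" by simp
      qed
      from tendsto_real_sqrt[OF lim2]
      have "(\<lambda>n. cmod (conv (e 1) (p (Suc n)) x - conv (e 1) q x)) \<longlonglongrightarrow> 0"
        by (simp add: norm_minus_commute)
      thus ?thesis using Lim_null tendsto_norm_zero_iff by blast
    qed
    moreover have "(\<lambda>n. conv (e 1) (p (Suc n)) x) = (\<lambda>n. complex_of_real \<rho> * p (Suc (Suc n)) x)"
      unfolding p_Suc[of "Suc _"] using rho_pos by auto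
    moreover have "(\<lambda>n. complex_of_real \<rho> * p (Suc (Suc n)) x) \<longlonglongrightarrow> complex_of_real \<rho> * q x"
      using LIMSEQ_Suc[OF tendsto_uniform_limitI[OF q, of x]] by (intro tendsto_intros) auto
    ultimately show ?thesis using LIMSEQ_unique by metis
  qed
  moreover have "conv \<eta> (conv \<eta> q) = conv (e 1) q"
    using conv_assoc[OF eta eta qc(1)] eS[of 0] by (simp add: e0)
  ultimately show ?thesis
    using rho_pos qc(1) nsq_q beta1 by (intro exI[of _ \<rho>] conjI exI[of _ q]) auto
qed

end

section \<open>Unitary representations\<close>

lemma mat_adjoint_carrier [simp]:
  "(M :: 'a::conjugatable_field mat) \<in> carrier_mat n m \<Longrightarrow> mat_adjoint M \<in> carrier_mat m n"
  by (auto simp: mat_adjoint_def)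

lemma mat_adjoint_index [simp]:
  fixes M :: "complex mat"
  shows "i < dim_col M \<Longrightarrow> j < dim_row M \<Longrightarrow> mat_adjoint M $$ (i, j) = cnj (M $$ (j, i))"
  by (simp add: mat_adjoint_def mat_of_rows_def)

lemma mat_mult_index:
  assumes "A \<in> carrier_mat n m" "B \<in> carrier_mat m k" "i < n" "j < k"
  shows "(A * B) $$ (i, j) = (\<Sum>l<m. A $$ (i, l) * B $$ (l, j))"
  using assms by (auto simp: scalar_prod_def lessThan_atLeast0 intro!: sum.cong)

lemma adjoint_mult:
  fixes A B :: "complex mat"
  assumes "A \<in> carrier_mat n m" "B \<in> carrier_mat m k"
  shows "mat_adjoint (A * B) = mat_adjoint B * mat_adjoint A"
proof (rule eq_matI)
  have ab: "A * B \<in> carrier_mat n k" using assms by auto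
  fix i j assume "i < dim_row (mat_adjoint B * mat_adjoint A)" "j < dim_col (mat_adjoint B * mat_adjoint A)"
  hence ij: "i < k" "j < n"
    using carrier_matD[OF mat_adjoint_carrier[OF assms(1)]] carrier_matD[OF mat_adjoint_carrier[OF assms(2)]] by auto
  have "mat_adjoint (A * B) $$ (i, j) = cnj ((A * B) $$ (j, i))"
    using ij assms by (subst mat_adjoint_index) auto
  also have "\<dots> = (\<Sum>l<m. cnj (A $$ (j, l) * B $$ (l, i)))"
    using mat_mult_index[OF assms ij(2,1)] by simp
  also have "\<dots> = (\<Sum>l<m. mat_adjoint B $$ (i, l) * mat_adjoint A $$ (l, j))"
    using ij assms by (intro sum.cong) auto
  also have "\<dots> = (mat_adjoint B * mat_adjoint A) $$ (i, j)"
    using assms ij by (intro mat_mult_index[symmetric]) auto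
  finally show "mat_adjoint (A * B) $$ (i, j) = (mat_adjoint B * mat_adjoint A) $$ (i, j)" .
qed (use assms in \<open>auto simp: mat_adjoint_def\<close>)

lemma subspace_vec_iff:
  "VectorSpace.subspace class_ring V (module_vec TYPE(complex) d) \<longleftrightarrow>
    V \<subseteq> carrier_vec d \<and> 0\<^sub>v d \<in> V \<and> (\<forall>v\<in>V. \<forall>w\<in>V. v + w \<in> V) \<and> (\<forall>c. \<forall>v\<in>V. c \<cdot>\<^sub>v v \<in> V)"
proof -
  interpret vec_space "TYPE(complex)" d .
  have "vectorspace class_ring (module_vec TYPE(complex) d)" "Module.module class_ring (module_vec TYPE(complex) d)"
    by (rule vectorspace_axioms module_axioms)+
  thus ?thesis
    unfolding VectorSpace.subspace_def LinearCombinations.submodule_def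
    by (auto simp: module_vec_simps class_ring_simps)
qed

section \<open>Matrix entries of representations and Schur's lemma\<close>

lemma is_rep_entries:
  assumes "is_rep \<pi>"
  shows "\<pi> g \<in> carrier_mat (rep_dim \<pi>) (rep_dim \<pi>)" "\<pi> 0 = 1\<^sub>m (rep_dim \<pi>)" "\<pi> (g + k) = \<pi> g * \<pi> k"
    "\<pi> g * \<pi> (- g) = 1\<^sub>m (rep_dim \<pi>)" "\<pi> (- g) * \<pi> g = 1\<^sub>m (rep_dim \<pi>)"
    "i < rep_dim \<pi> \<Longrightarrow> j < rep_dim \<pi> \<Longrightarrow> continuous_on UNIV (\<lambda>g. \<pi> g $$ (i, j))"
proof -
  show "\<pi> g * \<pi> (- g) = 1\<^sub>m (rep_dim \<pi>)" "\<pi> (- g) * \<pi> g = 1\<^sub>m (rep_dim \<pi>)"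
    using assms unfolding is_rep_def by (metis add.right_inverse add.left_inverse)+
qed (use assms in \<open>auto simp: is_rep_def\<close>)

lemma rep_add_index:
  assumes "is_rep \<pi>" "i < rep_dim \<pi>" "j < rep_dim \<pi>"
  shows "\<pi> (g + k) $$ (i, j) = (\<Sum>l<rep_dim \<pi>. \<pi> g $$ (i, l) * \<pi> k $$ (l, j))"
  unfolding is_rep_entries(3)[OF assms(1)]
  by (rule mat_mult_index[OF is_rep_entries(1)[OF assms(1)] is_rep_entries(1)[OF assms(1)] assms(2,3)])

lemma unitary_rep_minus:
  assumes "is_rep \<pi>" "unitary_rep \<pi>"
  shows "\<pi> (- g) = mat_adjoint (\<pi> g)"
proof -
  note r = is_rep_entries[OF assms(1)]
  have a: "mat_adjoint (\<pi> g) \<in> carrier_mat (rep_dim \<pi>) (rep_dim \<pi>)" using r(1) by simp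
  have "\<pi> (- g) = \<pi> (- g) * (\<pi> g * mat_adjoint (\<pi> g))"
    using assms(2) r(1)[of "- g"] by (simp add: unitary_rep_def)
  also have "\<dots> = (\<pi> (- g) * \<pi> g) * mat_adjoint (\<pi> g)"
    by (rule assoc_mult_mat[OF r(1) r(1) a, symmetric])
  finally show ?thesis using r(5) a by simp
qed

lemma unitary_rep_minus_index:
  assumes "is_rep \<pi>" "unitary_rep \<pi>" "i < rep_dim \<pi>" "j < rep_dim \<pi>"
  shows "\<pi> (- g) $$ (i, j) = cnj (\<pi> g $$ (j, i))"
  using is_rep_entries(1)[OF assms(1), of g] assms(3,4)
  unfolding unitary_rep_minus[OF assms(1,2)] by (subst mat_adjoint_index) auto

text \<open>A complex matrix of positive size has an eigenvalue, and its eigenspace is stable under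
  everything that commutes with \<open>M\<close>; being nonzero, it is the whole space by
  irreducibility.\<close>

lemma schur_scalar:
  assumes irr: "irreducible_rep \<pi>" and M: "M \<in> carrier_mat (rep_dim \<pi>) (rep_dim \<pi>)"
    and comm: "\<And>g. M * \<pi> g = \<pi> g * M"
  shows "\<exists>c. M = c \<cdot>\<^sub>m 1\<^sub>m (rep_dim \<pi>)"
proof -
  define d where "d = rep_dim \<pi>"
  note M = M[folded d_def]
  have rep: "is_rep \<pi>" and d: "d > 0" using irr by (auto simp: irreducible_rep_def d_def)
  note r = is_rep_entries(1)[OF rep, folded d_def]
  have "degree (char_poly M) = d" using degree_monic_char_poly[OF M] by simp
  hence "\<not> constant (poly (char_poly M))" using d by (simp add: constant_degree)
  then obtain c where "poly (char_poly M) c = 0" using fundamental_theorem_of_algebra by blast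
  hence c: "eigenvalue M c" by (simp add: eigenvalue_root_char_poly[OF M])
  then obtain v where v: "v \<in> carrier_vec d" "v \<noteq> 0\<^sub>v d" "M *\<^sub>v v = c \<cdot>\<^sub>v v"
    using M by (auto simp: eigenvalue_def eigenvector_def)
  define V where "V = {v \<in> carrier_vec d. M *\<^sub>v v = c \<cdot>\<^sub>v v}"
  have "VectorSpace.subspace class_ring V (module_vec TYPE(complex) d)"
    unfolding subspace_vec_iff V_def using M
    by (auto simp: mult_add_distrib_mat_vec[OF M] mult_mat_vec[OF M] smult_add_distrib_vec
        smult_smult_assoc mult.commute intro!: eq_vecI)
  moreover have "\<pi> g *\<^sub>v w \<in> V" if "w \<in> V" for g w
  proof -
    have w: "w \<in> carrier_vec d" "M *\<^sub>v w = c \<cdot>\<^sub>v w" using that by (auto simp: V_def)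
    have "M *\<^sub>v (\<pi> g *\<^sub>v w) = (M * \<pi> g) *\<^sub>v w" using assoc_mult_mat_vec[OF M r w(1)] by simp
    also have "\<dots> = \<pi> g *\<^sub>v (M *\<^sub>v w)" unfolding comm using assoc_mult_mat_vec[OF r M w(1)] by simp
    also have "\<dots> = c \<cdot>\<^sub>v (\<pi> g *\<^sub>v w)" unfolding w(2) using mult_mat_vec[OF r w(1)] by simp
    finally show ?thesis using mult_mat_vec_carrier[OF r w(1)] by (auto simp: V_def)
  qed
  ultimately have "V = {0\<^sub>v d} \<or> V = carrier_vec d"
    using irr unfolding irreducible_rep_def d_def by blast
  moreover have "v \<in> V" using v by (auto simp: V_def)
  ultimately have V: "V = carrier_vec d" using v by auto
  have "M = c \<cdot>\<^sub>m 1\<^sub>m d"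
  proof (rule eq_matI)
    fix i j assume "i < dim_row (c \<cdot>\<^sub>m 1\<^sub>m d)" "j < dim_col (c \<cdot>\<^sub>m 1\<^sub>m d)"
    hence ij: "i < d" "j < d" by auto
    have "unit_vec d j \<in> V" by (simp add: V)
    hence "M *\<^sub>v unit_vec d j = c \<cdot>\<^sub>v unit_vec d j" by (simp add: V_def)
    hence "vec_index (M *\<^sub>v unit_vec d j) i = vec_index (c \<cdot>\<^sub>v unit_vec d j) i" by simp
    thus "M $$ (i, j) = (c \<cdot>\<^sub>m 1\<^sub>m d) $$ (i, j)" using ij M
      by (simp add: scalar_prod_right_unit)
  qed (use M in auto)
  thus ?thesis by (auto simp: d_def)
qed

lemma adjoint_adjoint: "mat_adjoint (mat_adjoint M) = (M :: complex mat)"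
  by (rule eq_matI) (auto simp: mat_adjoint_def mat_of_rows_def)

text \<open>For unitary representations the adjoint \<open>S\<close> of an intertwiner intertwines
  in the other direction, so T S and S T are both scalar. If T is nonzero, the scalars agree and are
  nonzero, so T is invertible up to comparing dimensions, and the two classes would have the same
  representative.\<close>

lemma schur_zero:
  assumes dual: "unitary_dual Ghat" and mem: "\<pi> \<in> Ghat" "\<rho> \<in> Ghat" "\<pi> \<noteq> \<rho>"
    and T: "T \<in> carrier_mat (rep_dim \<pi>) (rep_dim \<rho>)"
    and comm: "\<And>g. \<pi> g * T = T * \<rho> g"
  shows "T = 0\<^sub>m (rep_dim \<pi>) (rep_dim \<rho>)"
proof (rule ccontr)
  assume nz: "T \<noteq> 0\<^sub>m (rep_dim \<pi>) (rep_dim \<rho>)"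
  define n m where "n = rep_dim \<pi>" and "m = rep_dim \<rho>"
  have irr: "irreducible_rep \<pi>" "irreducible_rep \<rho>" "unitary_rep \<pi>" "unitary_rep \<rho>"
    using dual mem by (auto simp: unitary_dual_def)
  hence rep: "is_rep \<pi>" "is_rep \<rho>" by (auto simp: irreducible_rep_def)
  note r = is_rep_entries(1)[OF rep(1), folded n_def] is_rep_entries(1)[OF rep(2), folded m_def]
  define S where "S = mat_adjoint T"
  have T: "T \<in> carrier_mat n m" using T by (simp add: n_def m_def)
  have S: "S \<in> carrier_mat m n" unfolding S_def using T by simp
  have comm': "S * \<pi> g = \<rho> g * S" for g
  proof -
    have "mat_adjoint (\<pi> (- g) * T) = mat_adjoint (T * \<rho> (- g))" by (simp add: comm)
    hence "S * mat_adjoint (\<pi> (- g)) = mat_adjoint (\<rho> (- g)) * S"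
      using adjoint_mult[OF r(1) T] adjoint_mult[OF T r(2)] by (simp add: S_def)
    thus ?thesis using unitary_rep_minus[OF rep(1) irr(3), of g] unitary_rep_minus[OF rep(2) irr(4), of g]
      by (simp add: adjoint_adjoint)
  qed
  have "(T * S) * \<pi> g = \<pi> g * (T * S)" for g
  proof -
    have "(T * S) * \<pi> g = T * (S * \<pi> g)" by (rule assoc_mult_mat[OF T S r(1)])
    also have "\<dots> = (T * \<rho> g) * S" unfolding comm' by (rule assoc_mult_mat[OF T r(2) S, symmetric])
    also have "\<dots> = \<pi> g * (T * S)" unfolding comm[symmetric] by (rule assoc_mult_mat[OF r(1) T S])
    finally show ?thesis .
  qed
  then obtain c where c: "T * S = c \<cdot>\<^sub>m 1\<^sub>m n"
    using schur_scalar[OF irr(1), of "T * S"] T S by (auto simp: n_def m_def)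
  have "(S * T) * \<rho> g = \<rho> g * (S * T)" for g
  proof -
    have "(S * T) * \<rho> g = S * (T * \<rho> g)" by (rule assoc_mult_mat[OF S T r(2)])
    also have "\<dots> = (S * \<pi> g) * T" unfolding comm[symmetric] by (rule assoc_mult_mat[OF S r(1) T, symmetric])
    also have "\<dots> = \<rho> g * (S * T)" unfolding comm' by (rule assoc_mult_mat[OF r(2) S T])
    finally show ?thesis .
  qed
  then obtain c' where c': "S * T = c' \<cdot>\<^sub>m 1\<^sub>m m"
    using schur_scalar[OF irr(2), of "S * T"] T S by (auto simp: n_def m_def)
  have ts: "(T * S) $$ (i, i) = (\<Sum>l<m. (cmod (T $$ (i, l)))\<^sup>2)" if "i < n" for i
    unfolding mat_mult_index[OF T S that that] of_real_sum using T that unfolding S_def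
    by (intro sum.cong refl, subst mat_adjoint_index) (auto simp: complex_norm_square simp del: of_real_power)
  have st: "(S * T) $$ (i, i) = (\<Sum>l<n. (cmod (T $$ (l, i)))\<^sup>2)" if "i < m" for i
    unfolding mat_mult_index[OF S T that that] of_real_sum using T that unfolding S_def
    by (intro sum.cong refl, subst mat_adjoint_index) (auto simp: mult.commute complex_norm_square simp del: of_real_power)
  obtain i j where ij: "i < n" "j < m" "T $$ (i, j) \<noteq> 0"
    using nz T by (auto simp: n_def m_def mat_eq_iff)
  have "(\<Sum>l<m. (cmod (T $$ (i, l)))\<^sup>2) > 0"
    using ij by (intro sum_pos2[of _ j]) auto
  hence c0: "c \<noteq> 0" using ts[OF ij(1)] ij unfolding c by (auto simp del: of_real_sum of_real_power)
  have "c \<cdot>\<^sub>m T = c' \<cdot>\<^sub>m T"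
  proof -
    have "c \<cdot>\<^sub>m T = (T * S) * T" unfolding c
      using mult_smult_assoc_mat[OF one_carrier_mat T, of c] T by simp
    also have "\<dots> = T * (S * T)" by (rule assoc_mult_mat[OF T S T])
    also have "\<dots> = c' \<cdot>\<^sub>m T" unfolding c'
      using mult_smult_distrib[OF T one_carrier_mat, of c'] T by simp
    finally show ?thesis .
  qed
  hence "(c \<cdot>\<^sub>m T) $$ (i, j) = (c' \<cdot>\<^sub>m T) $$ (i, j)" by simp
  hence cc: "c = c'" using ij T by simp
  \<comment> \<open>Both traces equal the squared Frobenius norm of \<open>T\<close>, which forces
    equal dimensions.\<close>
  have "of_nat n * c = (\<Sum>i<n. (T * S) $$ (i, i))" by (simp add: c)
  also have "\<dots> = of_real (\<Sum>i<n. \<Sum>l<m. (cmod (T $$ (i, l)))\<^sup>2)" using ts by simp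
  also have "\<dots> = of_real (\<Sum>i<m. \<Sum>l<n. (cmod (T $$ (l, i)))\<^sup>2)" by (subst sum.swap) rule
  also have "\<dots> = (\<Sum>i<m. (S * T) $$ (i, i))" using st by simp
  also have "\<dots> = of_nat m * c" by (simp add: c' cc)
  finally have nm: "n = m" using c0 by simp
  have "invertible_mat T"
    unfolding invertible_mat_def inverts_mat_def
  proof (intro conjI exI[of _ "(1 / c) \<cdot>\<^sub>m S"])
    show "T * (1 / c \<cdot>\<^sub>m S) = 1\<^sub>m (dim_row T)"
      using T S c c0 nm by (auto simp: mult_smult_distrib[OF T S] intro!: eq_matI)
    show "1 / c \<cdot>\<^sub>m S * T = 1\<^sub>m (dim_row (1 / c \<cdot>\<^sub>m S))"
      using T S c' c0 nm cc by (auto simp: mult_smult_assoc_mat[OF S T] intro!: eq_matI)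
  qed (use T nm in auto)
  hence "equivalent_reps \<rho> \<pi>"
    unfolding equivalent_reps_def using T nm comm by (auto simp: n_def m_def intro!: bexI[of _ T])
  moreover have "equivalent_reps \<rho> \<rho>"
    unfolding equivalent_reps_def
    using left_mult_one_mat[OF r(2)[unfolded m_def]] right_mult_one_mat[OF r(2)[unfolded m_def]]
    by (auto simp: m_def invertible_mat_def inverts_mat_def intro!: bexI[of _ "1\<^sub>m (rep_dim \<rho>)"] exI[of _ "1\<^sub>m (rep_dim \<rho>)"])
  ultimately show False using dual mem irr(2) unfolding unitary_dual_def by blast
qed

section \<open>Schur orthogonality and Bessel's inequality\<close>

lemma cmod_add_sq_le: "(cmod (a + b))\<^sup>2 \<le> 2 * (cmod a)\<^sup>2 + 2 * (cmod b)\<^sup>2"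
proof -
  have "(cmod (a + b))\<^sup>2 \<le> (cmod a + cmod b)\<^sup>2"
    by (intro power_mono norm_triangle_ineq) auto
  also have "\<dots> \<le> 2 * (cmod a)\<^sup>2 + 2 * (cmod b)\<^sup>2"
    using zero_le_power2[of "cmod a - cmod b"] unfolding power2_diff power2_sum by linarith
  finally show ?thesis .
qed

lemma L2_add: "f \<in> L2 M \<Longrightarrow> g \<in> L2 M \<Longrightarrow> (\<lambda>x. f x + g x) \<in> L2 M"
proof -
  assume fg: "f \<in> L2 M" "g \<in> L2 M"
  hence [measurable]: "f \<in> borel_measurable M" "g \<in> borel_measurable M" by (auto simp: L2_def)
  have "integrable M (\<lambda>x. (cmod (f x + g x))\<^sup>2)"
  proof (rule Bochner_Integration.integrable_bound)
    show "integrable M (\<lambda>x. 2 * (cmod (f x))\<^sup>2 + 2 * (cmod (g x))\<^sup>2)"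
      using fg by (intro Bochner_Integration.integrable_add integrable_mult_right) (auto simp: L2_def)
    show "AE x in M. norm ((cmod (f x + g x))\<^sup>2) \<le> norm (2 * (cmod (f x))\<^sup>2 + 2 * (cmod (g x))\<^sup>2)"
      by (rule AE_I2) (simp add: cmod_add_sq_le)
  qed measurable
  thus ?thesis by (auto simp: L2_def)
qed

context haar_group begin

lemma cip_scale_left: "cip (\<lambda>x. c * f x) g = c * cip f g"
  and cip_scale_right: "cip f (\<lambda>x. c * g x) = cnj c * cip f g"
  unfolding cip_def by (simp_all add: mult.assoc mult.left_commute[of _ "cnj c"])

lemma cip_sum_right:
  assumes "f \<in> L2 \<mu>" "\<And>a. a \<in> I \<Longrightarrow> \<phi> a \<in> L2 \<mu>"
  shows "cip f (\<lambda>x. \<Sum>a\<in>I. c a * \<phi> a x) = (\<Sum>a\<in>I. cnj (c a) * cip f (\<phi> a))"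
proof -
  have "cip f (\<lambda>x. \<Sum>a\<in>I. c a * \<phi> a x) = (\<integral>x. (\<Sum>a\<in>I. cnj (c a) * (f x * cnj (\<phi> a x))) \<partial>\<mu>)"
    by (simp add: cip_def sum_distrib_left mult_ac)
  also have "\<dots> = (\<Sum>a\<in>I. (\<integral>x. cnj (c a) * (f x * cnj (\<phi> a x)) \<partial>\<mu>))"
    by (rule Bochner_Integration.integral_sum) (intro integrable_mult_right L2_mult(1) assms)
  finally show ?thesis by (simp add: cip_def)
qed

lemma cip_sum_left:
  assumes "f \<in> L2 \<mu>" "\<And>a. a \<in> I \<Longrightarrow> \<phi> a \<in> L2 \<mu>"
  shows "cip (\<lambda>x. \<Sum>a\<in>I. c a * \<phi> a x) f = (\<Sum>a\<in>I. c a * cip (\<phi> a) f)"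
proof -
  have "cip (\<lambda>x. \<Sum>a\<in>I. c a * \<phi> a x) f = cnj (cip f (\<lambda>x. \<Sum>a\<in>I. c a * \<phi> a x))" by (simp add: cip_cnj)
  also have "\<dots> = (\<Sum>a\<in>I. c a * cip (\<phi> a) f)" by (simp add: cip_sum_right[OF assms] cip_cnj)
  finally show ?thesis .
qed

text \<open>Pythagoras for arbitrary coefficients \<open>c\<close>: the squared error splits into
  the squared distance to the span and the squared coefficient errors. Being an identity, it later
  separates bias from variance without loss.\<close>

lemma orthonormal_projection:
  assumes I: "finite I" and f: "f \<in> L2 \<mu>" and phi: "\<And>a. a \<in> I \<Longrightarrow> continuous_on UNIV (\<phi> a)"
    and on: "\<And>a b. a \<in> I \<Longrightarrow> b \<in> I \<Longrightarrow> cip (\<phi> a) (\<phi> b) = (if a = b then 1 else 0)"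
  shows "nsq (\<lambda>x. f x - (\<Sum>a\<in>I. c a * \<phi> a x)) =
    nsq f - (\<Sum>a\<in>I. (cmod (cip f (\<phi> a)))\<^sup>2) + (\<Sum>a\<in>I. (cmod (c a - cip f (\<phi> a)))\<^sup>2)"
proof -
  define g where "g x = (\<Sum>a\<in>I. c a * \<phi> a x)" for x
  have L: "a \<in> I \<Longrightarrow> \<phi> a \<in> L2 \<mu>" for a by (intro continuous_L2 phi)
  have g: "g \<in> L2 \<mu>" unfolding g_def by (intro continuous_L2 continuous_intros phi)
  have "cip (\<phi> b) g = cnj (c b)" if "b \<in> I" for b
  proof -
    have "cip (\<phi> b) g = (\<Sum>a\<in>I. cnj (c a) * cip (\<phi> b) (\<phi> a))"
      unfolding g_def by (rule cip_sum_right[OF L[OF that] L])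
    also have "\<dots> = (\<Sum>a\<in>I. if b = a then cnj (c a) else 0)"
      using that by (intro sum.cong refl) (auto simp: on)
    finally show ?thesis using I that by simp
  qed
  hence "cip g g = (\<Sum>a\<in>I. complex_of_real ((cmod (c a))\<^sup>2))"
    using cip_sum_left[OF g L, where I=I and c=c] unfolding g_def[abs_def]
    by (simp add: complex_norm_square del: of_real_power)
  hence 1: "nsq g = (\<Sum>a\<in>I. (cmod (c a))\<^sup>2)"
    unfolding cip_self of_real_sum[symmetric] of_real_eq_iff .
  have 2: "cip f g = (\<Sum>a\<in>I. cnj (c a) * cip f (\<phi> a))"
    unfolding g_def by (rule cip_sum_right[OF f L])
  have 3: "(cmod (c a - b))\<^sup>2 = (cmod (c a))\<^sup>2 + (cmod b)\<^sup>2 - 2 * Re (cnj (c a) * b)" for a b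
    unfolding cmod_power2 by (simp add: power2_eq_square algebra_simps)
  have "nsq (\<lambda>x. f x - g x) = nsq f + (\<Sum>a\<in>I. (cmod (c a))\<^sup>2) - 2 * (\<Sum>a\<in>I. Re (cnj (c a) * cip f (\<phi> a)))"
    unfolding nsq_diff[OF f g] 1 2 by simp
  also have "\<dots> = nsq f - (\<Sum>a\<in>I. (cmod (cip f (\<phi> a)))\<^sup>2) + (\<Sum>a\<in>I. (cmod (c a - cip f (\<phi> a)))\<^sup>2)"
    unfolding 3 sum.distrib sum_subtractf by (simp add: sum_distrib_left)
  finally show ?thesis by (simp add: g_def)
qed

lemma bessel:
  assumes "finite I" "f \<in> L2 \<mu>" "\<And>a. a \<in> I \<Longrightarrow> continuous_on UNIV (\<phi> a)"
    "\<And>a b. a \<in> I \<Longrightarrow> b \<in> I \<Longrightarrow> cip (\<phi> a) (\<phi> b) = (if a = b then 1 else 0)"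
  shows "(\<Sum>a\<in>I. (cmod (cip f (\<phi> a)))\<^sup>2) \<le> nsq f"
  using orthonormal_projection[OF assms, of "\<lambda>a. cip f (\<phi> a)"]
    nsq_nonneg[of "\<lambda>x. f x - (\<Sum>a\<in>I. cip f (\<phi> a) * \<phi> a x)"] by simp

end

section \<open>Orthogonality relations and Fourier projections\<close>

locale dual_group = haar_group +
  fixes Ghat :: "('a \<Rightarrow> complex mat) set"
  assumes dual: "unitary_dual Ghat"
begin

lemma Ghat_irr: "\<pi> \<in> Ghat \<Longrightarrow> irreducible_rep \<pi>"
  and Ghat_unitary: "\<pi> \<in> Ghat \<Longrightarrow> unitary_rep \<pi>"
  using dual by (auto simp: unitary_dual_def)

lemma Ghat_rep: "\<pi> \<in> Ghat \<Longrightarrow> is_rep \<pi>" and Ghat_dim: "\<pi> \<in> Ghat \<Longrightarrow> rep_dim \<pi> > 0"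
  using Ghat_irr by (auto simp: irreducible_rep_def)

lemmas Ghat_cont = is_rep_entries(6)[OF Ghat_rep]

lemma Ghat_minus:
  "\<pi> \<in> Ghat \<Longrightarrow> i < rep_dim \<pi> \<Longrightarrow> j < rep_dim \<pi> \<Longrightarrow> \<pi> (- g) $$ (i, j) = cnj (\<pi> g $$ (j, i))"
  by (rule unitary_rep_minus_index[OF Ghat_rep Ghat_unitary])

lemma Ghat_add:
  "\<pi> \<in> Ghat \<Longrightarrow> i < rep_dim \<pi> \<Longrightarrow> j < rep_dim \<pi> \<Longrightarrow>
    \<pi> (g + k) $$ (i, j) = (\<Sum>l<rep_dim \<pi>. \<pi> g $$ (i, l) * \<pi> k $$ (l, j))"
  by (rule rep_add_index[OF Ghat_rep])

lemma Ghat_zero: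
  "\<pi> \<in> Ghat \<Longrightarrow> i < rep_dim \<pi> \<Longrightarrow> j < rep_dim \<pi> \<Longrightarrow> \<pi> 0 $$ (i, j) = (if i = j then 1 else 0)"
  by (subst is_rep_entries(2)[OF Ghat_rep]) auto

lemma Ghat_row_norm:
  assumes "\<pi> \<in> Ghat" "i < rep_dim \<pi>" "j < rep_dim \<pi>"
  shows "(\<Sum>l<rep_dim \<pi>. \<pi> g $$ (i, l) * cnj (\<pi> g $$ (j, l))) = (if i = j then 1 else 0)"
  using Ghat_add[OF assms, of g "- g"] Ghat_zero[OF assms] by (simp add: Ghat_minus assms)

text \<open>Averaging \<open>\<pi> g\<close> times a matrix unit times \<open>\<rho> (- g)\<close>
  over the group gives an intertwiner. Schur's lemma makes it zero or scalar, and the trace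
  determines the scalar.\<close>

lemma schur_orthogonality:
  assumes pr: "\<pi> \<in> Ghat" "\<rho> \<in> Ghat" and ij: "i < rep_dim \<pi>" "j < rep_dim \<pi>" and kl: "k < rep_dim \<rho>" "l < rep_dim \<rho>"
  shows "cip (\<lambda>g. \<pi> g $$ (i, j)) (\<lambda>g. \<rho> g $$ (k, l)) =
    (if \<pi> = \<rho> \<and> i = k \<and> j = l then 1 / of_nat (rep_dim \<pi>) else 0)"
proof -
  define n m where "n = rep_dim \<pi>" and "m = rep_dim \<rho>"
  note c\<pi> = Ghat_cont[OF pr(1), folded n_def] and c\<rho> = Ghat_cont[OF pr(2), folded m_def]
  \<comment> \<open>\<open>T l j\<close> is the average of the matrix unit whose single 1 is in
    position (j, l); its entry (i, k) is the inner product sought.\<close>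
  define t where "t l j i k = (\<integral>g. \<pi> g $$ (i, j) * \<rho> (- g) $$ (l, k) \<partial>\<mu>)" for l j i k
  define T where "T l j = Matrix.mat n m (\<lambda>(i, k). t l j i k)" for l j
  have T: "T l j \<in> carrier_mat n m" for l j by (simp add: T_def)
  note r = is_rep_entries(1)[OF Ghat_rep[OF pr(1)], folded n_def] is_rep_entries(1)[OF Ghat_rep[OF pr(2)], folded m_def]
  have c2: "continuous_on UNIV (\<lambda>g. \<rho> (- g) $$ (l, k))" if "l < m" "k < m" for l k
    by (rule continuous_on_compose2[OF c\<rho>]) (use that in \<open>auto intro!: continuous_intros\<close>)
  have comm: "\<pi> a * T l j = T l j * \<rho> a" if jl: "j < n" "l < m" for a l j
  proof (rule eq_matI)
    fix i k assume "i < dim_row (T l j * \<rho> a)" "k < dim_col (T l j * \<rho> a)"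
    hence ik: "i < n" "k < m" using T[of l j] r(2)[of a] by auto
    have "(\<pi> a * T l j) $$ (i, k) = (\<Sum>p<n. \<pi> a $$ (i, p) * (\<integral>g. \<pi> g $$ (p, j) * \<rho> (- g) $$ (l, k) \<partial>\<mu>))"
      unfolding mat_mult_index[OF r(1) T ik] using ik by (intro sum.cong) (auto simp: T_def t_def)
    also have "\<dots> = (\<Sum>p<n. (\<integral>g. \<pi> a $$ (i, p) * (\<pi> g $$ (p, j) * \<rho> (- g) $$ (l, k)) \<partial>\<mu>))" by simp
    also have "\<dots> = (\<integral>g. (\<Sum>p<n. \<pi> a $$ (i, p) * (\<pi> g $$ (p, j) * \<rho> (- g) $$ (l, k))) \<partial>\<mu>)"
      by (rule Bochner_Integration.integral_sum[symmetric])
         (use ik jl in \<open>auto intro!: continuous_integrable continuous_intros c\<pi> c2\<close>)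
    also have "\<dots> = (\<integral>g. \<pi> (a + g) $$ (i, j) * \<rho> (- g) $$ (l, k) \<partial>\<mu>)"
      using Ghat_add[OF pr(1), folded n_def, OF ik(1) jl(1)] by (simp add: sum_distrib_right mult.assoc)
    also have "\<dots> = (\<integral>g. (\<lambda>g. \<pi> g $$ (i, j) * \<rho> (- g + a) $$ (l, k)) (a + g) \<partial>\<mu>)"
      by (simp add: minus_add add.assoc)
    also have "\<dots> = (\<integral>g. \<pi> g $$ (i, j) * \<rho> (- g + a) $$ (l, k) \<partial>\<mu>)"
      by (rule integral_left, rule borel_measurable_continuous_onI)
         (intro continuous_intros c\<pi> ik jl continuous_on_compose2[OF c\<rho>[OF jl(2) ik(2)]], auto)
    also have "\<dots> = (\<integral>g. (\<Sum>p<m. \<pi> g $$ (i, j) * \<rho> (- g) $$ (l, p) * \<rho> a $$ (p, k)) \<partial>\<mu>)"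
      using Ghat_add[OF pr(2), folded m_def, OF jl(2) ik(2)] by (simp add: sum_distrib_left mult.assoc)
    also have "\<dots> = (\<Sum>p<m. (\<integral>g. \<pi> g $$ (i, j) * \<rho> (- g) $$ (l, p) * \<rho> a $$ (p, k) \<partial>\<mu>))"
      by (rule Bochner_Integration.integral_sum)
         (use ik jl in \<open>auto intro!: continuous_integrable continuous_intros c\<pi> c2\<close>)
    also have "\<dots> = (T l j * \<rho> a) $$ (i, k)"
      unfolding mat_mult_index[OF T r(2) ik] using ik by (intro sum.cong) (auto simp: T_def t_def)
    finally show "(\<pi> a * T l j) $$ (i, k) = (T l j * \<rho> a) $$ (i, k)" .
  qed (use r(1)[of a] r(2)[of a] T[of l j] in auto)
  have ijn: "i < n" "j < n" "k < m" "l < m" using ij kl by (auto simp: n_def m_def)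
  have eq: "cip (\<lambda>g. \<pi> g $$ (i, j)) (\<lambda>g. \<rho> g $$ (k, l)) = T l j $$ (i, k)"
    unfolding cip_def T_def t_def using ijn Ghat_minus[OF pr(2), folded m_def] by simp
  show ?thesis
  proof (cases "\<pi> = \<rho>")
    case False
    hence "T l j = 0\<^sub>m n m"
      unfolding n_def m_def
      by (intro schur_zero[OF dual pr False] comm[OF ijn(2,4)] T[unfolded n_def m_def])
    thus ?thesis using eq ijn False by simp
  next
    case True
    hence nm: "m = n" unfolding n_def m_def by (rule arg_cong[symmetric])
    have c2': "continuous_on UNIV (\<lambda>g. \<pi> (- g) $$ (l, k))" if "l < n" "k < n" for l k
      using c2[of l k] that True nm by simp
    have "T l j * \<pi> g = \<pi> g * T l j" for g
      unfolding comm[OF ijn(2,4)] unfolding True ..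
    then obtain c where c: "T l j = c \<cdot>\<^sub>m 1\<^sub>m n"
      using schur_scalar[OF Ghat_irr[OF pr(1)] T[unfolded nm n_def]] unfolding n_def by blast
    \<comment> \<open>Under the integral, the trace becomes entry (l, j) of
      \<open>\<pi> (- g)\<close> times \<open>\<pi> g\<close>, which is the identity matrix.\<close>
    have "of_nat n * c = (\<Sum>p<n. T l j $$ (p, p))" by (simp add: c)
    also have "\<dots> = (\<Sum>p<n. (\<integral>g. \<pi> (- g) $$ (l, p) * \<pi> g $$ (p, j) \<partial>\<mu>))"
      by (intro sum.cong) (auto simp: T_def t_def nm True mult.commute)
    also have "\<dots> = (\<integral>g. (\<Sum>p<n. \<pi> (- g) $$ (l, p) * \<pi> g $$ (p, j)) \<partial>\<mu>)"
      by (rule Bochner_Integration.integral_sum[symmetric])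
         (intro continuous_integrable continuous_intros c\<pi> c2', use ijn nm in auto)
    also have "\<dots> = (if j = l then 1 else 0)"
      proof -
      have "(\<Sum>p<n. \<pi> (- g) $$ (l, p) * \<pi> g $$ (p, j)) = (if j = l then 1 else 0)" for g
        proof -
        have a: "l < rep_dim \<pi>" "j < rep_dim \<pi>" using ijn nm by (auto simp: n_def)
        show ?thesis using Ghat_add[OF pr(1) a, of "- g" g] Ghat_zero[OF pr(1) a] by (auto simp: n_def)
      qed
      thus ?thesis using prob_space by simp
    qed
    finally have nc: "of_nat n * c = (if j = l then 1 else 0)" .
    have "n > 0" using ijn by simp
    with nc have "c = (if j = l then 1 / of_nat n else 0)"
      by (cases "j = l") (simp_all add: eq_divide_eq mult.commute)
    moreover have "T l j $$ (i, k) = (if i = k then c else 0)" using ijn nm by (simp add: c)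
    moreover have "(if \<pi> = \<rho> \<and> i = k \<and> j = l then 1 / of_nat (rep_dim \<pi>) else 0) =
        (if i = k \<and> j = l then 1 / of_nat n else (0 :: complex))"
      unfolding n_def by (simp only: True simp_thms)
    ultimately show ?thesis unfolding eq by (simp only:) simp
  qed
qed

text \<open>Entry of \<open>fourier_coeff\<close> as a plain function of the indices, free of
  carrier conditions.\<close>

definition fc :: "('a \<Rightarrow> complex) \<Rightarrow> ('a \<Rightarrow> complex mat) \<Rightarrow> nat \<Rightarrow> nat \<Rightarrow> complex" where
  "fc f \<pi> i j = (\<integral>g. f g * \<pi> (- g) $$ (i, j) \<partial>\<mu>)"

text \<open>Squared norm of the projection of \<open>f\<close> onto the coefficients of \<pi>: the
  term of \<pi> in Parseval's sum.\<close>

definition fsq :: "('a \<Rightarrow> complex) \<Rightarrow> ('a \<Rightarrow> complex mat) \<Rightarrow> real" where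
  "fsq f \<pi> = real (rep_dim \<pi>) * (\<Sum>i<rep_dim \<pi>. \<Sum>j<rep_dim \<pi>. (cmod (fc f \<pi> i j))\<^sup>2)"

text \<open>Fourier synthesis: the inner double sum is the trace of \<open>\<pi> g\<close> times the
  matrix \<open>C \<pi>\<close>, whence the order \<open>j i\<close>.\<close>

definition trig :: "('a \<Rightarrow> complex mat) set \<Rightarrow> (('a \<Rightarrow> complex mat) \<Rightarrow> nat \<Rightarrow> nat \<Rightarrow> complex) \<Rightarrow> 'a \<Rightarrow> complex" where
  "trig F C g = (\<Sum>\<pi>\<in>F. of_nat (rep_dim \<pi>) * (\<Sum>i<rep_dim \<pi>. \<Sum>j<rep_dim \<pi>. \<pi> g $$ (i, j) * C \<pi> j i))"

lemma fsq_nonneg: "fsq f \<pi> \<ge> 0"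
  by (auto simp: fsq_def intro!: mult_nonneg_nonneg sum_nonneg)

lemma fc_cip: "\<pi> \<in> Ghat \<Longrightarrow> i < rep_dim \<pi> \<Longrightarrow> j < rep_dim \<pi> \<Longrightarrow> fc f \<pi> i j = cip f (\<lambda>g. \<pi> g $$ (j, i))"
  by (simp add: fc_def cip_def Ghat_minus)

lemma continuous_trig: "F \<subseteq> Ghat \<Longrightarrow> continuous_on UNIV (trig F C)"
  unfolding trig_def by (intro continuous_intros Ghat_cont) auto

text \<open>The matrix coefficients scaled by the square root of the degree are orthonormal, so
  \<open>orthonormal_projection\<close> applies; the factor \<open>rep_dim \<pi>\<close> in both
  sums is the square of that scaling.\<close>

lemma trig_projection:
  assumes F: "finite F" "F \<subseteq> Ghat" and f: "f \<in> L2 \<mu>"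
  shows "nsq (\<lambda>g. f g - trig F C g) = nsq f - (\<Sum>\<pi>\<in>F. fsq f \<pi>) +
    (\<Sum>\<pi>\<in>F. real (rep_dim \<pi>) * (\<Sum>i<rep_dim \<pi>. \<Sum>j<rep_dim \<pi>. (cmod (C \<pi> i j - fc f \<pi> i j))\<^sup>2))"
proof -
  define I where "I = Sigma F (\<lambda>\<pi>. {..<rep_dim \<pi>} \<times> {..<rep_dim \<pi>})"
  define \<phi> where "\<phi> = (\<lambda>(\<pi> :: 'a \<Rightarrow> complex mat, i, j) g. complex_of_real (sqrt (real (rep_dim \<pi>))) * (\<pi> g $$ (i, j) :: complex))"
  define c where "c = (\<lambda>(\<pi> :: 'a \<Rightarrow> complex mat, i, j). complex_of_real (sqrt (real (rep_dim \<pi>))) * C \<pi> j i)"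
  have sq: "complex_of_real (sqrt (real n)) * complex_of_real (sqrt (real n)) = of_nat n" for n
    by (simp flip: of_real_mult)
  have fin: "finite I" using F by (simp add: I_def)
  have sumI: "(\<Sum>a\<in>I. h a) = (\<Sum>\<pi>\<in>F. \<Sum>i<rep_dim \<pi>. \<Sum>j<rep_dim \<pi>. h (\<pi>, i, j))"
    for h :: "_ \<Rightarrow> 'c::comm_monoid_add"
    using F by (simp add: I_def sum.Sigma sum.cartesian_product case_prod_beta)
  have "trig F C g = (\<Sum>a\<in>I. c a * \<phi> a g)" for g
    unfolding trig_def sumI c_def \<phi>_def split sum_distrib_left
    by (intro sum.cong refl) (simp add: sq[symmetric] mult_ac)
  moreover have cphi: "continuous_on UNIV (\<phi> a)" if "a \<in> I" for a
    using that F by (auto simp: I_def \<phi>_def intro!: continuous_intros Ghat_cont)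
  moreover have "cip (\<phi> a) (\<phi> b) = (if a = b then 1 else 0)" if ab: "a \<in> I" "b \<in> I" for a b
  proof -
    obtain \<pi> i j \<rho> k l where a: "a = (\<pi>, i, j)" and b: "b = (\<rho>, k, l)" by (metis surj_pair)
    have m: "\<pi> \<in> Ghat" "\<rho> \<in> Ghat" "i < rep_dim \<pi>" "j < rep_dim \<pi>" "k < rep_dim \<rho>" "l < rep_dim \<rho>"
      using ab F by (auto simp: I_def a b)
    have "cip (\<phi> a) (\<phi> b) = complex_of_real (sqrt (real (rep_dim \<pi>))) * complex_of_real (sqrt (real (rep_dim \<rho>))) *
      cip (\<lambda>g. \<pi> g $$ (i, j)) (\<lambda>g. \<rho> g $$ (k, l))"
      unfolding \<phi>_def a b split cip_scale_left cip_scale_right by simp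
    thus ?thesis unfolding schur_orthogonality[OF m(1-6)] using Ghat_dim[OF m(1)] by (auto simp: a b sq)
  qed
  ultimately have eq: "nsq (\<lambda>g. f g - trig F C g) =
     nsq f - (\<Sum>a\<in>I. (cmod (cip f (\<phi> a)))\<^sup>2) + (\<Sum>a\<in>I. (cmod (c a - cip f (\<phi> a)))\<^sup>2)"
    using orthonormal_projection[OF fin f, of \<phi> c] by (simp only:)
  have cipf: "cip f (\<phi> (\<pi>, i, j)) = complex_of_real (sqrt (real (rep_dim \<pi>))) * fc f \<pi> j i"
    if "\<pi> \<in> F" "i < rep_dim \<pi>" "j < rep_dim \<pi>" for \<pi> i j
    using that F fc_cip[of \<pi> j i f] unfolding \<phi>_def split cip_scale_right by (simp add: subset_eq)
  have swap: "(\<Sum>i<n. \<Sum>j<n. real n * h j i) = real n * (\<Sum>i<n. \<Sum>j<n. h i j)" for n and h :: "nat \<Rightarrow> nat \<Rightarrow> real"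
    by (subst sum.swap) (simp add: sum_distrib_left)
  have "(\<Sum>a\<in>I. (cmod (cip f (\<phi> a)))\<^sup>2) = (\<Sum>\<pi>\<in>F. fsq f \<pi>)"
    unfolding sumI fsq_def swap[symmetric]
    by (intro sum.cong refl) (simp add: cipf norm_mult power_mult_distrib)
  moreover have "(\<Sum>a\<in>I. (cmod (c a - cip f (\<phi> a)))\<^sup>2) =
    (\<Sum>\<pi>\<in>F. real (rep_dim \<pi>) * (\<Sum>i<rep_dim \<pi>. \<Sum>j<rep_dim \<pi>. (cmod (C \<pi> i j - fc f \<pi> i j))\<^sup>2))"
    unfolding sumI swap[symmetric]
    by (intro sum.cong refl) (simp add: cipf c_def norm_mult power_mult_distrib flip: right_diff_distrib)
  ultimately show ?thesis using eq by simp
qed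

lemma fourier_bessel:
  assumes "finite F" "F \<subseteq> Ghat" "f \<in> L2 \<mu>"
  shows "(\<Sum>\<pi>\<in>F. fsq f \<pi>) \<le> nsq f"
  using trig_projection[OF assms, of "fc f"] nsq_nonneg[of "\<lambda>g. f g - trig F (fc f) g"] by simp

end

section \<open>Completeness of the matrix coefficients\<close>

context haar_group begin

text \<open>Its members are continuous, so that zero norm forces the zero function.\<close>

definition fun_subspace :: "('g \<Rightarrow> complex) set \<Rightarrow> bool" where
  "fun_subspace E \<longleftrightarrow> (\<lambda>_. 0) \<in> E \<and> (\<forall>f\<in>E. \<forall>g\<in>E. (\<lambda>x. f x + g x) \<in> E) \<and>
    (\<forall>c. \<forall>f\<in>E. (\<lambda>x. c * f x) \<in> E) \<and> (\<forall>f\<in>E. continuous_on UNIV f)"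

definition orthonormal :: "nat \<Rightarrow> (nat \<Rightarrow> 'g \<Rightarrow> complex) \<Rightarrow> bool" where
  "orthonormal k f \<longleftrightarrow> (\<forall>i<k. \<forall>j<k. cip (f i) (f j) = (if i = j then 1 else 0))"

lemma orthonormal_nsq: "orthonormal k f \<Longrightarrow> i < k \<Longrightarrow> nsq (f i) = 1"
  using cip_self[of "f i"] by (auto simp: orthonormal_def)

lemma fun_subspace_sum:
  assumes "fun_subspace E" "finite I" "\<And>i. i \<in> I \<Longrightarrow> f i \<in> E"
  shows "(\<lambda>x. \<Sum>i\<in>I. c i * f i x) \<in> E"
  using assms(2,3) by (induction I rule: finite_induct) (use assms(1) in \<open>auto simp: fun_subspace_def\<close>)

text \<open>One Gram-Schmidt step: the part of \<open>h\<close> orthogonal to the family either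
  vanishes or, normalised, is a new member.\<close>

lemma orthonormal_extend:
  assumes E: "fun_subspace E" and f: "orthonormal k f" "\<And>i. i < k \<Longrightarrow> f i \<in> E" and h: "h \<in> E"
  shows "(\<forall>x. h x = (\<Sum>i<k. cip h (f i) * f i x)) \<or>
    (\<exists>f'. orthonormal (Suc k) f' \<and> (\<forall>i<Suc k. f' i \<in> E))"
proof -
  define s where "s x = (\<Sum>i<k. cip h (f i) * f i x)" for x
  define u where "u x = h x - s x" for x
  have c: "continuous_on UNIV g" if "g \<in> E" for g using E that by (auto simp: fun_subspace_def)
  have s: "s \<in> E" unfolding s_def[abs_def] using f by (intro fun_subspace_sum E) auto
  hence "(\<lambda>x. (-1) * s x) \<in> E" using E unfolding fun_subspace_def by blast
  hence u: "u \<in> E" using E h unfolding fun_subspace_def u_def[abs_def] by force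
  have orth: "cip u (f j) = 0" if j: "j < k" for j
  proof -
    have "cip s (f j) = (\<Sum>i<k. cip h (f i) * cip (f i) (f j))"
      unfolding s_def[abs_def] using f j by (intro cip_sum_left continuous_L2 c) auto
    also have "\<dots> = (\<Sum>i<k. if i = j then cip h (f i) else 0)"
      using f(1) j by (intro sum.cong) (auto simp: orthonormal_def)
    finally have "cip s (f j) = cip h (f j)" using j by simp
    moreover have "cip u (f j) = cip h (f j) - cip s (f j)"
      unfolding u_def[abs_def] using f j h s by (intro cip_diff continuous_L2 c) auto
    ultimately show ?thesis by simp
  qed
  show ?thesis
  proof (cases "nsq u = 0")
    case True
    hence "u x = 0" for x using nsq_zero_continuous[OF c[OF u]] by blast
    thus ?thesis by (auto simp: u_def s_def)
  next
    case False
    hence pos: "nsq u > 0" using nsq_nonneg[of u] by simp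
    define v where "v x = complex_of_real (1 / sqrt (nsq u)) * u x" for x
    have v: "v \<in> E" using E u unfolding v_def[abs_def] fun_subspace_def by blast
    have vv: "cip v v = 1"
      unfolding v_def[abs_def] cip_scale_left cip_scale_right cip_self using pos
      by (simp flip: of_real_mult)
    have vf: "cip v (f j) = 0" if "j < k" for j
      unfolding v_def[abs_def] cip_scale_left orth[OF that] by simp
    have fv: "cip (f j) v = 0" if "j < k" for j
      using vf[OF that] cip_cnj[of v "f j"] by simp
    have "orthonormal (Suc k) (f(k := v))"
      using f(1) by (auto simp: orthonormal_def less_Suc_eq vv vf fv)
    moreover have "\<forall>i<Suc k. (f(k := v)) i \<in> E" using f v by (auto simp: less_Suc_eq)
    ultimately show ?thesis by blast
  qed
qed

text \<open>Finite dimension is expressed by a bound \<open>N\<close> on the length of orthonormal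
  families; a longest one spans because it cannot be extended.\<close>

lemma exists_maximal_orthonormal:
  assumes E: "fun_subspace E" and bd: "\<And>k f. orthonormal k f \<Longrightarrow> (\<And>i. i < k \<Longrightarrow> f i \<in> E) \<Longrightarrow> k \<le> N"
  obtains k f where "orthonormal k f" "\<And>i. i < k \<Longrightarrow> f i \<in> E"
    "\<And>h. h \<in> E \<Longrightarrow> \<forall>x. h x = (\<Sum>i<k. cip h (f i) * f i x)"
proof -
  define P where "P k \<longleftrightarrow> (\<exists>f. orthonormal k f \<and> (\<forall>i<k. f i \<in> E))" for k
  have P0: "P 0" by (auto simp: P_def orthonormal_def)
  have PN: "k \<le> N" if "P k" for k using that bd by (auto simp: P_def)
  define k where "k = (GREATEST k. P k)"
  have Pk: "P k" unfolding k_def by (rule GreatestI_nat[of P 0 N]) (use P0 PN in auto)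
  then obtain f where f: "orthonormal k f" "\<And>i. i < k \<Longrightarrow> f i \<in> E" by (auto simp: P_def)
  have "\<not> P (Suc k)" using Greatest_le_nat[of P "Suc k" N] PN by (auto simp: k_def)
  hence "\<forall>x. h x = (\<Sum>i<k. cip h (f i) * f i x)" if "h \<in> E" for h
    using orthonormal_extend[OF E f that] by (auto simp: P_def)
  with f that show ?thesis by blast
qed

text \<open>Sum the squared moduli of all inner products in both orders: each \<open>e j\<close>
  contributes 1 since it lies in the span, and by Bessel's inequality each \<open>f i\<close>
  contributes at most 1.\<close>

lemma orthonormal_bound:
  assumes f: "orthonormal k f" and e: "orthonormal m e" and c: "\<And>i. i < k \<Longrightarrow> continuous_on UNIV (f i)"
    "\<And>i. i < m \<Longrightarrow> continuous_on UNIV (e i)"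
    and span: "\<And>j. j < m \<Longrightarrow> \<forall>x. e j x = (\<Sum>i<k. cip (e j) (f i) * f i x)"
  shows "m \<le> k"
proof -
  have "(\<Sum>i<k. (cmod (cip (e j) (f i)))\<^sup>2) = 1" if j: "j < m" for j
  proof -
    have "cip (e j) (e j) = cip (e j) (\<lambda>x. \<Sum>i<k. cip (e j) (f i) * f i x)"
      using span[OF j] by (metis ext)
    also have "\<dots> = (\<Sum>i<k. cnj (cip (e j) (f i)) * cip (e j) (f i))"
      using j c by (intro cip_sum_right continuous_L2) auto
    also have "\<dots> = complex_of_real (\<Sum>i<k. (cmod (cip (e j) (f i)))\<^sup>2)"
      by (simp add: complex_norm_square mult.commute del: of_real_power)
    finally have "complex_of_real (\<Sum>i<k. (cmod (cip (e j) (f i)))\<^sup>2) = cip (e j) (e j)" ..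
    also have "\<dots> = 1" using e j by (simp add: orthonormal_def)
    finally show ?thesis by (simp only: of_real_eq_1_iff)
  qed
  hence "real m = (\<Sum>j<m. \<Sum>i<k. (cmod (cip (e j) (f i)))\<^sup>2)" by simp
  also have "\<dots> = (\<Sum>i<k. \<Sum>j<m. (cmod (cip (f i) (e j)))\<^sup>2)"
    by (subst sum.swap) (simp flip: cip_cnj[of "e _" "f _"])
  also have "\<dots> \<le> (\<Sum>i<k. nsq (f i))"
    using c e by (intro sum_mono bessel continuous_L2) (auto simp: orthonormal_def)
  also have "\<dots> = (\<Sum>i<k. 1)"
    using orthonormal_nsq[OF f] by (intro sum.cong refl) auto
  finally show ?thesis by simp
qed

section \<open>Translation invariance and finite dimension of eigenspaces\<close>

lemma conv_sum:
  assumes "continuous_on UNIV a" "\<And>i. i \<in> I \<Longrightarrow> continuous_on UNIV (f i)"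
  shows "conv a (\<lambda>x. \<Sum>i\<in>I. c i * f i x) = (\<lambda>x. \<Sum>i\<in>I. c i * conv a (f i) x)"
proof
  fix x
  have "conv a (\<lambda>x. \<Sum>i\<in>I. c i * f i x) x = (\<integral>z. (\<Sum>i\<in>I. c i * (a (x - z) * f i z)) \<partial>\<mu>)"
    by (simp add: conv_def sum_distrib_left mult_ac)
  also have "\<dots> = (\<Sum>i\<in>I. (\<integral>z. c i * (a (x - z) * f i z) \<partial>\<mu>))"
    by (rule Bochner_Integration.integral_sum, rule continuous_integrable)
       (intro continuous_intros continuous_on_compose2[OF assms(1)] assms(2), auto)
  finally show "conv a (\<lambda>x. \<Sum>i\<in>I. c i * f i x) x = (\<Sum>i\<in>I. c i * conv a (f i) x)"
    by (simp add: conv_def)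
qed

lemma conv_translate:
  assumes a: "continuous_on UNIV a" and f: "continuous_on UNIV f"
  shows "conv a (\<lambda>x. f (x + g)) = (\<lambda>x. conv a f (x + g))"
proof
  fix x
  have "(\<integral>z. a (x + g - z) * f z \<partial>\<mu>) = (\<integral>z. a (x + g - (z + g)) * f (z + g) \<partial>\<mu>)"
    by (rule integral_right[symmetric], rule borel_measurable_continuous_onI)
       (intro continuous_intros continuous_on_compose2[OF a] continuous_on_compose2[OF f], auto)
  moreover have "x + g - (z + g) = x - z" for z
    by (simp add: diff_conv_add_uminus minus_add add.assoc del: add_uminus_conv_diff)
  ultimately show "conv a (\<lambda>x. f (x + g)) x = conv a f (x + g)" by (simp add: conv_def)
qed

text \<open>Eigenspace of the squared operator, matching what \<open>exists_eigenfunction\<close>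
  provides.\<close>

definition eigen :: "('g \<Rightarrow> complex) \<Rightarrow> real \<Rightarrow> ('g \<Rightarrow> complex) set" where
  "eigen \<eta> \<rho> = {f. continuous_on UNIV f \<and> conv \<eta> (conv \<eta> f) = (\<lambda>x. complex_of_real \<rho> * f x)}"

lemma fun_subspace_eigen:
  assumes eta: "continuous_on UNIV \<eta>"
  shows "fun_subspace (eigen \<eta> \<rho>)"
proof -
  have z: "conv \<eta> (\<lambda>_. 0) = (\<lambda>_. 0)" by (simp add: conv_def fun_eq_iff)
  have add: "conv \<eta> (\<lambda>x. f x + g x) = (\<lambda>x. conv \<eta> f x + conv \<eta> g x)"
    if "continuous_on UNIV f" "continuous_on UNIV g" for f g
    using conv_sum[OF eta, of "{True, False}" "\<lambda>b. if b then f else g" "\<lambda>_. 1"] that by auto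
  show ?thesis
    unfolding fun_subspace_def eigen_def
    by (auto simp: z add conv_scale continuous_conv[OF eta] distrib_left intro!: continuous_intros)
qed

lemma eigen_translate:
  assumes "continuous_on UNIV \<eta>" "f \<in> eigen \<eta> \<rho>"
  shows "(\<lambda>x. f (x + g)) \<in> eigen \<eta> \<rho>"
proof -
  have f: "continuous_on UNIV f" "conv \<eta> (conv \<eta> f) = (\<lambda>x. complex_of_real \<rho> * f x)"
    using assms by (auto simp: eigen_def)
  have "continuous_on UNIV (\<lambda>x. f (x + g))"
    by (rule continuous_on_compose2[OF f(1)]) (auto intro!: continuous_intros)
  thus ?thesis
    using f by (simp add: eigen_def conv_translate[OF assms(1)] continuous_conv[OF assms(1)])
qed

text \<open>The Hilbert-Schmidt argument: \<rho> times \<open>f i x\<close> is the inner product of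
  \<open>f i\<close> with the reflected kernel at \<open>x\<close>, so Bessel's inequality bounds
  the sum of the squared moduli at each point, and its integral is \<open>k\<close>.\<close>

lemma eigen_bound:
  assumes eta: "continuous_on UNIV \<eta>" and rho: "\<rho> > 0"
    and f: "orthonormal k f" "\<And>i. i < k \<Longrightarrow> f i \<in> eigen \<eta> \<rho>"
  shows "k \<le> nat \<lceil>nsq (conv \<eta> \<eta>) / \<rho>\<^sup>2\<rceil>"
proof -
  define e where "e = conv \<eta> \<eta>"
  have e: "continuous_on UNIV e" unfolding e_def by (intro continuous_conv eta)
  have c: "continuous_on UNIV (f i)" if "i < k" for i using f that by (auto simp: eigen_def)
  have "(\<Sum>i<k. (cmod (f i x))\<^sup>2) \<le> nsq e / \<rho>\<^sup>2" for x
  proof -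
    define w where "w z = cnj (e (x - z))" for z
    have w: "continuous_on UNIV w" unfolding w_def[abs_def]
      by (intro continuous_intros continuous_on_compose2[OF e]) auto
    have "complex_of_real \<rho> * f i x = cip (f i) w" if i: "i < k" for i
    proof -
      have "complex_of_real \<rho> * f i x = conv \<eta> (conv \<eta> (f i)) x"
        using f(2)[OF i] by (simp add: eigen_def)
      also have "\<dots> = conv e (f i) x" unfolding e_def conv_assoc[OF eta eta c[OF i]] ..
      also have "\<dots> = cip (f i) w" by (simp add: conv_def cip_def w_def mult.commute)
      finally show ?thesis .
    qed
    note fw = this
    have "\<rho>\<^sup>2 * (cmod (f i x))\<^sup>2 = (cmod (cip w (f i)))\<^sup>2" if i: "i < k" for i
      unfolding cip_cnj[of "f i" w, symmetric] fw[OF i, symmetric] using rho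
      by (simp add: norm_mult power_mult_distrib)
    hence "\<rho>\<^sup>2 * (\<Sum>i<k. (cmod (f i x))\<^sup>2) = (\<Sum>i<k. (cmod (cip w (f i)))\<^sup>2)"
      by (simp add: sum_distrib_left)
    also have "\<dots> \<le> nsq w"
      using f(1) by (intro bessel continuous_L2 w c) (auto simp: orthonormal_def)
    also have "nsq w = nsq e" unfolding w_def[abs_def] by (rule nsq_reflect[OF e])
    finally show ?thesis using rho by (simp add: field_simps)
  qed
  note pointwise = this
  have "real k = (\<Sum>i<k. nsq (f i))"
    using orthonormal_nsq[OF f(1)] by simp
  also have "\<dots> = (\<integral>x. (\<Sum>i<k. (cmod (f i x))\<^sup>2) \<partial>\<mu>)"
    unfolding nsq_def using continuous_L2[OF c] by (intro Bochner_Integration.integral_sum[symmetric]) (auto simp: L2_def)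
  also have "\<dots> \<le> (\<integral>x. nsq e / \<rho>\<^sup>2 \<partial>\<mu>)"
    by (intro integral_mono pointwise continuous_integrable continuous_intros c) auto
  also have "\<dots> = nsq e / \<rho>\<^sup>2" using prob_space by simp
  finally show ?thesis unfolding e_def by linarith
qed

end

section \<open>An irreducible representation inside an invariant space of functions\<close>

context haar_group begin

lemma orthonormal_coeff:
  assumes f: "orthonormal k f" "\<And>i. i < k \<Longrightarrow> continuous_on UNIV (f i)" and j: "j < k"
  shows "cip (\<lambda>x. \<Sum>i<k. c i * f i x) (f j) = c j"
proof -
  have "cip (\<lambda>x. \<Sum>i<k. c i * f i x) (f j) = (\<Sum>i<k. c i * cip (f i) (f j))"
    using f j by (intro cip_sum_left continuous_L2) auto
  also have "\<dots> = (\<Sum>i<k. if i = j then c i else 0)"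
    using f(1) j by (intro sum.cong) (auto simp: orthonormal_def)
  finally show ?thesis using j by simp
qed

text \<open>The matrix representation on a translation invariant space of functions of minimal
  positive dimension.\<close>

lemma exists_irreducible:
  assumes E: "fun_subspace E" and bd: "\<And>k f. orthonormal k f \<Longrightarrow> (\<And>i. i < k \<Longrightarrow> f i \<in> E) \<Longrightarrow> k \<le> N"
    and inv: "\<And>f g. f \<in> E \<Longrightarrow> (\<lambda>x. f (x + g)) \<in> E"
    and nz: "p \<in> E" "nsq p > 0"
  obtains \<pi> f where "irreducible_rep \<pi>" "\<And>j. j < rep_dim \<pi> \<Longrightarrow> f j \<in> E"
    "\<And>j. j < rep_dim \<pi> \<Longrightarrow> nsq (f j) = 1"
    "\<And>j g. j < rep_dim \<pi> \<Longrightarrow> f j g = (\<Sum>i<rep_dim \<pi>. f i 0 * \<pi> g $$ (i, j))"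
proof -
  \<comment> \<open>So \<open>k\<close> is the dimension of \<open>V\<close>; the last conjunct
    excludes the zero space, which would win the minimisation.\<close>
  define good where "good V k f \<longleftrightarrow> fun_subspace V \<and> V \<subseteq> E \<and> (\<forall>h\<in>V. \<forall>g. (\<lambda>x. h (x + g)) \<in> V) \<and> orthonormal k f \<and>
    (\<forall>i<k. f i \<in> V) \<and> (\<forall>h\<in>V. \<forall>x. h x = (\<Sum>i<k. cip h (f i) * f i x)) \<and> k > 0" for V k f
  have good_ex: "\<exists>k f. good V k f"
    if V: "fun_subspace V" "V \<subseteq> E" "\<forall>h\<in>V. \<forall>g. (\<lambda>x. h (x + g)) \<in> V" and h: "h \<in> V" "h x \<noteq> 0" for V h x
  proof -
    obtain k f where kf: "orthonormal k f" "\<And>i. i < k \<Longrightarrow> f i \<in> V"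
      "\<And>h. h \<in> V \<Longrightarrow> \<forall>x. h x = (\<Sum>i<k. cip h (f i) * f i x)"
      by (rule exists_maximal_orthonormal[OF V(1), of N]) (use bd V(2) in blast)+
    have "k > 0" using kf(3)[OF h(1)] h(2) by (intro gr0I) auto
    thus ?thesis unfolding good_def using kf V by (intro exI[of _ k] exI[of _ f] conjI) blast+
  qed
  obtain x0 where "p x0 \<noteq> 0"
  proof -
    have "\<not> (\<forall>x. p x = 0)"
    proof
      assume "\<forall>x. p x = 0"
      hence "nsq p = 0" by (simp add: nsq_def)
      with nz(2) show False by simp
    qed
    with that show ?thesis by blast
  qed
  hence "\<exists>k V f. good V k f" using good_ex[of E p x0] E inv nz by blast
  hence "\<exists>V f. good V (LEAST k. \<exists>V f. good V k f) f" by (rule LeastI_ex)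
  then obtain V k f where good: "good V k f" and min: "\<And>k' V' f'. good V' k' f' \<Longrightarrow> k \<le> k'"
    by (metis (mono_tags, lifting) Least_le)
  have V: "fun_subspace V" "V \<subseteq> E" "\<And>h g. h \<in> V \<Longrightarrow> (\<lambda>x. h (x + g)) \<in> V" and on: "orthonormal k f"
    and fV: "\<And>i. i < k \<Longrightarrow> f i \<in> V" and span: "\<And>h x. h \<in> V \<Longrightarrow> h x = (\<Sum>i<k. cip h (f i) * f i x)" and k: "k > 0"
    using good unfolding good_def by blast+
  have c: "continuous_on UNIV h" if "h \<in> V" for h using V(1) that by (auto simp: fun_subspace_def)
  note cf = c[OF fV]
  \<comment> \<open>Column \<open>j\<close> holds the coordinates of the right translate of
    \<open>f j\<close>. Right translation by \<open>g\<close> is multiplicative in \<open>g\<close>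
    without an inverse.\<close>
  define \<pi> where "\<pi> g = Matrix.mat k k (\<lambda>(i, j). cip (\<lambda>x. f j (x + g)) (f i))" for g
  have car: "\<pi> g \<in> carrier_mat k k" for g by (simp add: \<pi>_def)
  have dim: "rep_dim \<pi> = k" by (simp add: rep_dim_def \<pi>_def)
  have ent: "\<pi> g $$ (i, j) = cip (\<lambda>x. f j (x + g)) (f i)" if "i < k" "j < k" for g i j
    using that by (simp add: \<pi>_def)
  have trans: "f j (x + g) = (\<Sum>i<k. \<pi> g $$ (i, j) * f i x)" if j: "j < k" for j x g
    using span[OF V(3)[OF fV[OF j]], of x g] ent j by simp
  have cont: "continuous_on UNIV (\<lambda>g. \<pi> g $$ (i, j))" if ij: "i < k" "j < k" for i j
    unfolding ent[OF ij] cip_def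
    by (rule continuous_integral[where F="\<lambda>(g, x). f j (x + g) * cnj (f i x)", simplified])
       (auto simp: case_prod_beta intro!: continuous_intros continuous_on_compose2[OF cf[OF ij(1)]]
          continuous_on_compose2[OF cf[OF ij(2)]])
  have add: "\<pi> (g + h) = \<pi> g * \<pi> h" for g h
  proof (rule eq_matI)
    fix i j assume "i < dim_row (\<pi> g * \<pi> h)" "j < dim_col (\<pi> g * \<pi> h)"
    hence ij: "i < k" "j < k" using car[of g] car[of h] by auto
    have "\<pi> (g + h) $$ (i, j) = cip (\<lambda>x. f j ((x + g) + h)) (f i)" by (simp add: ent ij add.assoc)
    also have "(\<lambda>x. f j ((x + g) + h)) = (\<lambda>x. \<Sum>l<k. \<pi> h $$ (l, j) * f l (x + g))"
      using trans[OF ij(2)] by blast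
    also have "cip \<dots> (f i) = (\<Sum>l<k. \<pi> h $$ (l, j) * cip (\<lambda>x. f l (x + g)) (f i))"
      by (rule cip_sum_left) (auto intro!: continuous_L2 cf ij c V(3) fV)
    also have "\<dots> = (\<Sum>l<k. \<pi> g $$ (i, l) * \<pi> h $$ (l, j))"
      by (intro sum.cong) (auto simp: ent ij mult.commute)
    also have "\<dots> = (\<pi> g * \<pi> h) $$ (i, j)" by (rule mat_mult_index[OF car car ij, symmetric])
    finally show "\<pi> (g + h) $$ (i, j) = (\<pi> g * \<pi> h) $$ (i, j)" .
  qed (use car[of "g + h"] car[of g] car[of h] in auto)
  have one: "\<pi> 0 = 1\<^sub>m k"
    using on by (intro eq_matI) (auto simp: \<pi>_def orthonormal_def)
  have rep: "is_rep \<pi>"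
    unfolding is_rep_def dim using car one add cont by auto
  have irr: "W = {0\<^sub>v k} \<or> W = carrier_vec k"
    if W: "VectorSpace.subspace class_ring W (module_vec TYPE(complex) k)"
      and Winv: "\<forall>g. \<forall>v\<in>W. \<pi> g *\<^sub>v v \<in> W" for W
  proof (rule disjCI)
    assume "W \<noteq> carrier_vec k"
    have Wc: "W \<subseteq> carrier_vec k" and W0: "0\<^sub>v k \<in> W" and Wadd: "\<And>v w. v \<in> W \<Longrightarrow> w \<in> W \<Longrightarrow> v + w \<in> W"
      and Wsm: "\<And>c v. v \<in> W \<Longrightarrow> c \<cdot>\<^sub>v v \<in> W"
      using W unfolding subspace_vec_iff by blast+
    \<comment> \<open>Turns coordinate vectors into functions: an invariant space \<open>W\<close>
      of vectors becomes an invariant space of functions, to which the minimality of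
      \<open>k\<close> applies.\<close>
    define fn where "fn v x = (\<Sum>i<k. vec_index v i * f i x)" for v x
    define V' where "V' = fn ` W"
    have fn_inj: "v = w" if "v \<in> carrier_vec k" "w \<in> carrier_vec k" "fn v = fn w" for v w
    proof (rule eq_vecI)
      fix i assume "i < dim_vec w"
      hence i: "i < k" using that by auto
      show "vec_index v i = vec_index w i"
        using orthonormal_coeff[OF on cf i, of "vec_index v"] orthonormal_coeff[OF on cf i, of "vec_index w"] that(3)
        unfolding fn_def[abs_def] by simp
    qed (use that in auto)
    have fnV: "fn v \<in> V" for v unfolding fn_def[abs_def] by (intro fun_subspace_sum V) (auto intro: fV)
    have V'V: "V' \<subseteq> V" using fnV by (auto simp: V'_def)
    have "fun_subspace V'"
      unfolding fun_subspace_def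
    proof (intro conjI ballI allI)
      have "fn (0\<^sub>v k) = (\<lambda>_. 0)" by (auto simp: fn_def)
      thus "(\<lambda>_. 0) \<in> V'" using W0 unfolding V'_def by (metis image_eqI)
    next
      fix a b assume "a \<in> V'" "b \<in> V'"
      then obtain v w where vw: "v \<in> W" "w \<in> W" "a = fn v" "b = fn w" by (auto simp: V'_def)
      hence cv: "v \<in> carrier_vec k" "w \<in> carrier_vec k" using Wc by blast+
      have "fn (v + w) x = (\<Sum>i<k. vec_index v i * f i x + vec_index w i * f i x)" for x
        unfolding fn_def using cv by (intro sum.cong refl) (simp add: distrib_right)
      hence "fn (v + w) = (\<lambda>x. a x + b x)"
        by (simp add: fn_def[abs_def] vw sum.distrib fun_eq_iff)
      moreover have "v + w \<in> W" using Wadd vw by blast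
      ultimately show "(\<lambda>x. a x + b x) \<in> V'" unfolding V'_def by (metis image_eqI)
    next
      fix \<alpha> a assume "a \<in> V'"
      then obtain v where vw: "v \<in> W" "a = fn v" by (auto simp: V'_def)
      hence cv: "v \<in> carrier_vec k" using Wc by blast
      have "fn (\<alpha> \<cdot>\<^sub>v v) x = (\<Sum>i<k. \<alpha> * (vec_index v i * f i x))" for x
        unfolding fn_def using cv by (intro sum.cong refl) simp
      hence "fn (\<alpha> \<cdot>\<^sub>v v) = (\<lambda>x. \<alpha> * a x)"
        by (simp add: fn_def[abs_def] vw sum_distrib_left fun_eq_iff)
      moreover have "\<alpha> \<cdot>\<^sub>v v \<in> W" using Wsm vw by blast
      ultimately show "(\<lambda>x. \<alpha> * a x) \<in> V'" unfolding V'_def by (metis image_eqI)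
    qed (use V'V c in auto)
    moreover have "(\<lambda>x. h (x + g)) \<in> V'" if hV: "h \<in> V'" for h g
    proof -
      obtain v where v: "v \<in> W" "h = fn v" using hV by (auto simp: V'_def)
      have vc: "v \<in> carrier_vec k" using v Wc by blast
      have pv: "vec_index (\<pi> g *\<^sub>v v) i = (\<Sum>j<k. \<pi> g $$ (i, j) * vec_index v j)" if "i < k" for i
        using vc car[of g] that by (auto simp: scalar_prod_def lessThan_atLeast0 intro!: sum.cong)
      have "fn (\<pi> g *\<^sub>v v) x = h (x + g)" for x
      proof -
        have "fn (\<pi> g *\<^sub>v v) x = (\<Sum>i<k. (\<Sum>j<k. \<pi> g $$ (i, j) * vec_index v j) * f i x)"
          unfolding fn_def by (intro sum.cong refl) (simp add: pv)
        also have "\<dots> = (\<Sum>j<k. \<Sum>i<k. vec_index v j * (\<pi> g $$ (i, j) * f i x))"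
          unfolding sum_distrib_right by (subst sum.swap) (simp add: mult_ac)
        also have "\<dots> = h (x + g)" by (simp add: v fn_def trans sum_distrib_left)
        finally show ?thesis .
      qed
      hence "fn (\<pi> g *\<^sub>v v) = (\<lambda>x. h (x + g))" by (rule ext)
      moreover have "\<pi> g *\<^sub>v v \<in> W" using Winv v by blast
      ultimately show ?thesis unfolding V'_def by (metis image_eqI)
    qed
    ultimately have V': "fun_subspace V'" "V' \<subseteq> E" "\<forall>h\<in>V'. \<forall>g. (\<lambda>x. h (x + g)) \<in> V'"
      using V'V V(2) by auto
    show "W = {0\<^sub>v k}"
    proof (rule ccontr)
      assume "W \<noteq> {0\<^sub>v k}"
      then obtain w where w: "w \<in> W" "w \<noteq> 0\<^sub>v k" using W0 by blast
      have "fn w \<noteq> (\<lambda>_. 0)"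
      proof
        assume "fn w = (\<lambda>_. 0)"
        also have "\<dots> = fn (0\<^sub>v k)" by (auto simp: fn_def)
        finally show False using fn_inj[of w "0\<^sub>v k"] w Wc by auto
      qed
      then obtain x where "fn w x \<noteq> 0" by auto
      then obtain k' f' where g': "good V' k' f'" using good_ex[OF V', of "fn w" x] w by (auto simp: V'_def)
      hence kk: "k \<le> k'" by (rule min)
      have f': "orthonormal k' f'" "\<And>i. i < k' \<Longrightarrow> f' i \<in> V'"
        "\<And>h x. h \<in> V' \<Longrightarrow> h x = (\<Sum>i<k'. cip h (f' i) * f' i x)" "fun_subspace V'"
        using g' unfolding good_def by blast+
      \<comment> \<open>Otherwise the basis of \<open>V'\<close>, which has at least
        \<open>k\<close> members, would extend to more than \<open>k\<close> orthonormal functions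
        in \<open>V\<close>.\<close>
      have "h \<in> V'" if h: "h \<in> V" for h
      proof (rule ccontr)
        assume hV': "h \<notin> V'"
        have "\<not> (\<forall>x. h x = (\<Sum>i<k'. cip h (f' i) * f' i x))"
        proof
          assume "\<forall>x. h x = (\<Sum>i<k'. cip h (f' i) * f' i x)"
          hence "h = (\<lambda>x. \<Sum>i<k'. cip h (f' i) * f' i x)" by blast
          also have "\<dots> \<in> V'" by (rule fun_subspace_sum[OF f'(4)]) (use f'(2) in auto)
          finally show False using hV' by simp
        qed
        then obtain f'' where f'': "orthonormal (Suc k') f''" "\<forall>i<Suc k'. f'' i \<in> V"
          using orthonormal_extend[OF V(1) f'(1) _ h] f'(2) V'V by blast
        have "Suc k' \<le> k"
          by (rule orthonormal_bound[OF on f''(1)]) (use f''(2) cf c span in blast)+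
        thus False using kk by simp
      qed
      hence VV: "V = V'" using V'V by auto
      have "carrier_vec k \<subseteq> W"
      proof
        fix v :: "complex Matrix.vec" assume v: "v \<in> carrier_vec k"
        have "fn v \<in> V'" using fnV VV by simp
        then obtain w where "w \<in> W" "fn v = fn w" by (auto simp: V'_def)
        thus "v \<in> W" using fn_inj[OF v, of w] Wc by auto
      qed
      thus False using \<open>W \<noteq> carrier_vec k\<close> Wc by auto
    qed
  qed
  have "irreducible_rep \<pi>"
    unfolding irreducible_rep_def dim using rep k irr by blast
  \<comment> \<open>The translation formula at the point 0 exhibits \<open>f j\<close> as a
    combination of matrix coefficients.\<close>
  moreover have "f j g = (\<Sum>i<k. f i 0 * \<pi> g $$ (i, j))" if "j < k" for j g
    using trans[OF that, of 0 g] by (simp add: mult.commute)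
  ultimately show ?thesis using that[of \<pi> f] fV V(2) orthonormal_nsq[OF on] unfolding dim by blast
qed

end

section \<open>Injectivity of the Fourier transform on Hermitian kernels\<close>

context dual_group begin

text \<open>In matrix form: convolving \<pi> with \<eta> multiplies it on the left by the Fourier
  coefficient of \<eta>. A kernel with vanishing coefficients therefore annihilates all matrix
  coefficients.\<close>

lemma conv_entry:
  assumes eta: "continuous_on UNIV \<eta>" and \<pi>: "\<pi> \<in> Ghat" "i < rep_dim \<pi>" "j < rep_dim \<pi>"
  shows "conv \<eta> (\<lambda>g. \<pi> g $$ (i, j)) x = (\<Sum>l<rep_dim \<pi>. fc \<eta> \<pi> i l * \<pi> x $$ (l, j))"
proof -
  note c = Ghat_cont[OF \<pi>(1)]
  have cm: "continuous_on UNIV (\<lambda>g. \<pi> (- g) $$ (k, l))" if "k < rep_dim \<pi>" "l < rep_dim \<pi>" for k l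
    by (rule continuous_on_compose2[OF c]) (use that in \<open>auto intro!: continuous_intros\<close>)
  define F where "F y = \<eta> y * \<pi> (- y + x) $$ (i, j)" for y
  have F: "F \<in> borel_measurable borel"
    unfolding F_def by (rule borel_measurable_continuous_onI)
      (intro continuous_intros eta continuous_on_compose2[OF c[OF \<pi>(2,3)]], auto)
  have "conv \<eta> (\<lambda>g. \<pi> g $$ (i, j)) x = (\<integral>z. F (x + - z) \<partial>\<mu>)"
    by (simp add: conv_def F_def minus_add add.assoc flip: diff_conv_add_uminus)
  also have "\<dots> = (\<integral>z. F (x + z) \<partial>\<mu>)" by (rule integral_inv) (use F in measurable)
  also have "\<dots> = (\<integral>y. F y \<partial>\<mu>)" by (rule integral_left[OF F])
  also have "\<dots> = (\<integral>y. (\<Sum>l<rep_dim \<pi>. \<eta> y * \<pi> (- y) $$ (i, l) * \<pi> x $$ (l, j)) \<partial>\<mu>)"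
    unfolding F_def Ghat_add[OF \<pi>] by (simp add: sum_distrib_left mult.assoc)
  also have "\<dots> = (\<Sum>l<rep_dim \<pi>. (\<integral>y. \<eta> y * \<pi> (- y) $$ (i, l) * \<pi> x $$ (l, j) \<partial>\<mu>))"
    by (rule Bochner_Integration.integral_sum) (intro continuous_integrable continuous_intros eta cm, use \<pi> in auto)
  finally show ?thesis by (simp add: fc_def)
qed

text \<open>A nonzero \<eta> would have an eigenfunction \<open>f 0\<close> made of matrix
  coefficients. Convolution with \<eta> annihilates these by \<open>conv_entry\<close>, although its
  square multiplies \<open>f 0\<close> by \<rho> > 0.\<close>

theorem fourier_injective:
  assumes eta: "continuous_on UNIV \<eta>" and sa: "\<And>x. \<eta> (- x) = cnj (\<eta> x)"
    and zero: "\<And>\<pi> i j. \<pi> \<in> Ghat \<Longrightarrow> i < rep_dim \<pi> \<Longrightarrow> j < rep_dim \<pi> \<Longrightarrow> fc \<eta> \<pi> i j = 0"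
  shows "\<eta> x = 0"
proof (rule ccontr)
  assume "\<eta> x \<noteq> 0"
  hence "nsq \<eta> \<noteq> 0" using nsq_zero_continuous[OF eta] by auto
  hence "nsq \<eta> > 0" using nsq_nonneg[of \<eta>] by simp
  then obtain \<rho> p where rho: "\<rho> > 0" and p: "continuous_on UNIV p" "nsq p > 0"
    "conv \<eta> (conv \<eta> p) = (\<lambda>x. complex_of_real \<rho> * p x)"
    using exists_eigenfunction[OF eta sa] by blast
  have pE: "p \<in> eigen \<eta> \<rho>" using p by (simp add: eigen_def)
  obtain \<pi> f where \<pi>: "irreducible_rep \<pi>" and f: "\<And>j. j < rep_dim \<pi> \<Longrightarrow> f j \<in> eigen \<eta> \<rho>"
    "\<And>j. j < rep_dim \<pi> \<Longrightarrow> nsq (f j) = 1"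
    "\<And>j g. j < rep_dim \<pi> \<Longrightarrow> f j g = (\<Sum>i<rep_dim \<pi>. f i 0 * \<pi> g $$ (i, j))"
    proof (rule exists_irreducible[of "eigen \<eta> \<rho>"])
    show "fun_subspace (eigen \<eta> \<rho>)" by (rule fun_subspace_eigen[OF eta])
    show "k \<le> nat \<lceil>nsq (conv \<eta> \<eta>) / \<rho>\<^sup>2\<rceil>" if "orthonormal k f" "\<And>i. i < k \<Longrightarrow> f i \<in> eigen \<eta> \<rho>" for k f
      using that by (rule eigen_bound[OF eta rho])
    show "(\<lambda>x. f (x + g)) \<in> eigen \<eta> \<rho>" if "f \<in> eigen \<eta> \<rho>" for f g
      using that by (rule eigen_translate[OF eta])
    show "nsq p > 0" "p \<in> eigen \<eta> \<rho>" by (rule p pE)+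
  qed blast
  \<comment> \<open>The representation just built is only equivalent to a member of
    \<open>Ghat\<close>; its entries are linear combinations of the entries of that member, so
    \<eta> annihilates them too.\<close>
  obtain \<pi>' where \<pi>': "\<pi>' \<in> Ghat" "equivalent_reps \<pi> \<pi>'" using dual \<pi> unfolding unitary_dual_def by blast
  define n where "n = rep_dim \<pi>"
  have n': "rep_dim \<pi>' = n" using \<pi>' by (simp add: equivalent_reps_def n_def)
  obtain Q where Q: "Q \<in> carrier_mat n n" "invertible_mat Q" "\<And>g. Q * \<pi> g = \<pi>' g * Q"
    using \<pi>' unfolding equivalent_reps_def n_def by blast
  then obtain R where R: "R * Q = 1\<^sub>m (dim_row R)" "Q * R = 1\<^sub>m (dim_row Q)"
    unfolding invertible_mat_def inverts_mat_def by blast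
  have "dim_row R = n" using arg_cong[OF R(1), of dim_col] Q by simp
  moreover have "dim_col R = n" using arg_cong[OF R(2), of dim_col] Q by simp
  ultimately have Rc: "R \<in> carrier_mat n n" by auto
  have rep: "is_rep \<pi>" using \<pi> by (simp add: irreducible_rep_def)
  have n: "n > 0" using \<pi> by (simp add: irreducible_rep_def n_def)
  note r = is_rep_entries(1)[OF rep, folded n_def] is_rep_entries(1)[OF Ghat_rep[OF \<pi>'(1)], unfolded n']
  have eq: "\<pi> g = R * (\<pi>' g * Q)" for g
  proof -
    have "\<pi> g = R * Q * \<pi> g" using R(1) carrier_matD[OF Rc] left_mult_one_mat[OF r(1)[of g]] by simp
    also have "\<dots> = R * (Q * \<pi> g)" by (rule assoc_mult_mat[OF Rc Q(1) r(1)])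
    finally show ?thesis using Q(3) by simp
  qed
  note c' = Ghat_cont[OF \<pi>'(1), unfolded n']
  have ent: "\<pi> g $$ (i, j) = (\<Sum>(a, b)\<in>{..<n} \<times> {..<n}. (R $$ (i, a) * Q $$ (b, j)) * \<pi>' g $$ (a, b))"
    if ij: "i < n" "j < n" for g i j
    unfolding eq mat_mult_index[OF Rc mult_carrier_mat[OF r(2) Q(1)] ij]
    by (auto simp: sum.cartesian_product[symmetric] mat_mult_index[OF r(2) Q(1)] ij sum_distrib_left mult_ac intro!: sum.cong)
  have cz: "conv \<eta> (\<lambda>g. \<pi> g $$ (i, j)) = (\<lambda>_. 0)" if ij: "i < n" "j < n" for i j
  proof -
    have "conv \<eta> (\<lambda>g. \<pi> g $$ (i, j)) = conv \<eta> (\<lambda>g. \<Sum>p\<in>{..<n} \<times> {..<n}. (R $$ (i, fst p) * Q $$ (snd p, j)) * \<pi>' g $$ (fst p, snd p))"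
      unfolding ent[OF ij] by (simp add: case_prod_beta)
    also have "\<dots> = (\<lambda>x. \<Sum>p\<in>{..<n} \<times> {..<n}. (R $$ (i, fst p) * Q $$ (snd p, j)) * conv \<eta> (\<lambda>g. \<pi>' g $$ (fst p, snd p)) x)"
      by (rule conv_sum[OF eta]) (auto intro: c')
    also have "\<dots> = (\<lambda>_. 0)"
      using \<pi>'(1) zero by (auto simp: conv_entry[OF eta \<pi>'(1)] n' fun_eq_iff intro!: sum.neutral)
    finally show ?thesis .
  qed
  have c: "continuous_on UNIV (\<lambda>g. \<pi> g $$ (i, j))" if "i < n" "j < n" for i j
    using is_rep_entries(6)[OF rep] that by (simp add: n_def)
  have "f 0 = (\<lambda>g. \<Sum>i<n. f i 0 * \<pi> g $$ (i, 0))" using f(3)[of 0] n by (auto simp: n_def)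
  hence "conv \<eta> (f 0) = (\<lambda>x. \<Sum>i<n. f i 0 * conv \<eta> (\<lambda>g. \<pi> g $$ (i, 0)) x)"
    using conv_sum[OF eta, of "{..<n}" "\<lambda>i g. \<pi> g $$ (i, 0)" "\<lambda>i. f i 0"] c n by simp
  hence "conv \<eta> (f 0) = (\<lambda>_. 0)" by (simp add: cz n)
  moreover have "conv \<eta> (conv \<eta> (f 0)) = (\<lambda>x. complex_of_real \<rho> * f 0 x)"
    using f(1)[of 0] n by (simp add: eigen_def n_def)
  ultimately have "f 0 x = 0" for x
    using rho by (simp add: conv_def fun_eq_iff)
  hence "nsq (f 0) = 0" by (simp add: nsq_def)
  thus False using f(2)[of 0] n by (simp add: n_def)
qed

end

section \<open>Parseval's identity through autocorrelations\<close>

context dual_group begin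

text \<open>Cross-correlation: bounded uniformly in \<open>x\<close> by the L2 norms; for
  \<open>u = v\<close> it is Hermitian and its value at 0 is the squared norm.\<close>

definition corr :: "('a \<Rightarrow> complex) \<Rightarrow> ('a \<Rightarrow> complex) \<Rightarrow> 'a \<Rightarrow> complex" where
  "corr u v x = (\<integral>z. u (x + z) * cnj (v z) \<partial>\<mu>)"

lemma continuous_corr:
  assumes u: "continuous_on UNIV u" and v: "continuous_on UNIV v"
  shows "continuous_on UNIV (corr u v)"
  unfolding corr_def
  by (rule continuous_integral[where F="\<lambda>(x, z). u (x + z) * cnj (v z)", simplified])
     (auto simp: case_prod_beta intro!: continuous_intros continuous_on_compose2[OF u]
       continuous_on_compose2[OF v])

lemma corr_bound:
  assumes u: "continuous_on UNIV u" and v: "continuous_on UNIV v"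
  shows "(cmod (corr u v x))\<^sup>2 \<le> nsq u * nsq v"
proof -
  have c: "continuous_on UNIV (\<lambda>z. u (x + z))"
    by (rule continuous_on_compose2[OF u]) (auto intro!: continuous_intros)
  have "nsq (\<lambda>z. u (x + z)) = nsq u"
    unfolding nsq_def by (rule integral_left[of "\<lambda>z. (cmod (u z))\<^sup>2"], rule borel_measurable_continuous_onI)
      (intro continuous_intros u)
  thus ?thesis using cip_bound[OF continuous_L2[OF c] continuous_L2[OF v]] by (simp add: corr_def cip_def)
qed

lemma corr_diff:
  assumes u: "continuous_on UNIV u" and v: "continuous_on UNIV v"
  shows "corr u u x - corr v v x = corr (\<lambda>z. u z - v z) u x + corr v (\<lambda>z. u z - v z) x"
proof -
  have i: "integrable \<mu> (\<lambda>z. f (x + z) * cnj (g z))"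
    if f: "continuous_on UNIV f" and g: "continuous_on UNIV g" for f g
    by (rule continuous_integrable)
       (intro continuous_intros continuous_on_compose2[OF f] continuous_on_compose2[OF g], auto)
  have c: "continuous_on UNIV (\<lambda>z. u z - v z)" by (intro continuous_intros u v)
  have "corr u u x - corr v v x = (\<integral>z. u (x + z) * cnj (u z) - v (x + z) * cnj (v z) \<partial>\<mu>)"
    unfolding corr_def by (rule Bochner_Integration.integral_diff[symmetric]) (rule i u v)+
  also have "\<dots> = (\<integral>z. (u (x + z) - v (x + z)) * cnj (u z) + v (x + z) * cnj (u z - v z) \<partial>\<mu>)"
    by (simp add: algebra_simps)
  also have "\<dots> = corr (\<lambda>z. u z - v z) u x + corr v (\<lambda>z. u z - v z) x"
    unfolding corr_def by (rule Bochner_Integration.integral_add) (rule i[OF c u] i[OF v c])+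
  finally show ?thesis .
qed

lemma corr_minus:
  assumes u: "continuous_on UNIV u"
  shows "corr u u (- x) = cnj (corr u u x)"
proof -
  have "corr u u (- x) = (\<integral>z. u (- x + (x + z)) * cnj (u (x + z)) \<partial>\<mu>)"
    unfolding corr_def by (rule integral_left[symmetric], rule borel_measurable_continuous_onI)
      (intro continuous_intros continuous_on_compose2[OF u], auto)
  also have "\<dots> = (\<integral>z. cnj (u (x + z) * cnj (u z)) \<partial>\<mu>)" by (simp add: add.assoc[symmetric] mult.commute)
  finally show ?thesis by (simp add: corr_def del: complex_cnj_mult)
qed

lemma corr_zero: "corr u u 0 = complex_of_real (nsq u)"
  by (simp add: corr_def cip_self[symmetric] cip_def)

text \<open>Integrating over \<open>x\<close> before \<open>z\<close>, the inner integral is a row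
  of \<open>\<pi> z\<close> times the Fourier coefficient of \<open>u\<close>, hence zero.\<close>

lemma fc_corr_zero:
  assumes u: "continuous_on UNIV u" and \<pi>: "\<pi> \<in> Ghat" "i < rep_dim \<pi>" "j < rep_dim \<pi>"
    and zero: "\<And>i j. i < rep_dim \<pi> \<Longrightarrow> j < rep_dim \<pi> \<Longrightarrow> fc u \<pi> i j = 0"
  shows "fc (corr u u) \<pi> i j = 0"
proof -
  note c = Ghat_cont[OF \<pi>(1)]
  have cF: "continuous_on UNIV (\<lambda>(x, z). u (x + z) * cnj (u z) * \<pi> (- x) $$ (i, j))"
    unfolding case_prod_beta
    by (intro continuous_intros continuous_on_compose2[OF u] continuous_on_compose2[OF c[OF \<pi>(2,3)]]) auto
  have inner: "(\<integral>x. u (x + z) * \<pi> (- x) $$ (i, j) \<partial>\<mu>) = 0" for z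
  proof -
    define F where "F y = u y * \<pi> (z + - y) $$ (i, j)" for y
    have F: "F \<in> borel_measurable borel" unfolding F_def
      by (rule borel_measurable_continuous_onI)
         (intro continuous_intros u continuous_on_compose2[OF c[OF \<pi>(2,3)]], auto)
    have "(\<integral>x. u (x + z) * \<pi> (- x) $$ (i, j) \<partial>\<mu>) = (\<integral>x. F (x + z) \<partial>\<mu>)"
      by (simp add: F_def minus_add add.assoc[symmetric] del: add_uminus_conv_diff)
    also have "\<dots> = (\<integral>y. F y \<partial>\<mu>)" by (rule integral_right[OF F])
    also have "\<dots> = (\<integral>y. (\<Sum>l<rep_dim \<pi>. \<pi> z $$ (i, l) * (u y * \<pi> (- y) $$ (l, j))) \<partial>\<mu>)"
      unfolding F_def Ghat_add[OF \<pi>] by (simp add: sum_distrib_left mult_ac)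
    also have "\<dots> = (\<Sum>l<rep_dim \<pi>. (\<integral>y. \<pi> z $$ (i, l) * (u y * \<pi> (- y) $$ (l, j)) \<partial>\<mu>))"
      by (rule Bochner_Integration.integral_sum)
         (intro continuous_integrable continuous_intros u continuous_on_compose2[OF c], use \<pi> in auto)
    also have "\<dots> = 0" using zero \<pi> by (simp add: fc_def)
    finally show ?thesis .
  qed
  have "fc (corr u u) \<pi> i j = (\<integral>x. \<integral>z. u (x + z) * cnj (u z) * \<pi> (- x) $$ (i, j) \<partial>\<mu> \<partial>\<mu>)"
    by (simp add: fc_def corr_def)
  also have "\<dots> = (\<integral>z. \<integral>x. u (x + z) * cnj (u z) * \<pi> (- x) $$ (i, j) \<partial>\<mu> \<partial>\<mu>)"
    using Fubini_continuous[OF cF] by simp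
  also have "\<dots> = (\<integral>z. cnj (u z) * (\<integral>x. u (x + z) * \<pi> (- x) $$ (i, j) \<partial>\<mu>) \<partial>\<mu>)"
    by (simp add: mult_ac flip: integral_mult_right_zero)
  finally show ?thesis by (simp add: inner)
qed

lemma fc_trig:
  assumes F: "finite F" "F \<subseteq> Ghat" and \<pi>: "\<pi> \<in> Ghat" "i < rep_dim \<pi>" "j < rep_dim \<pi>"
  shows "fc (trig F C) \<pi> i j = (if \<pi> \<in> F then C \<pi> i j else 0)"
proof -
  define I where "I = Sigma F (\<lambda>\<pi>. {..<rep_dim \<pi>} \<times> {..<rep_dim \<pi>})"
  have "fc (trig F C) \<pi> i j = cip (\<lambda>g. \<Sum>(\<rho>, k, l)\<in>I. (of_nat (rep_dim \<rho>) * C \<rho> l k) * \<rho> g $$ (k, l)) (\<lambda>g. \<pi> g $$ (j, i))"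
    unfolding fc_cip[OF \<pi>] trig_def[abs_def] I_def using F
    by (simp add: sum.Sigma[symmetric] sum.cartesian_product[symmetric] sum_distrib_left mult_ac)
  also have "\<dots> = (\<Sum>(\<rho>, k, l)\<in>I. (of_nat (rep_dim \<rho>) * C \<rho> l k) * cip (\<lambda>g. \<rho> g $$ (k, l)) (\<lambda>g. \<pi> g $$ (j, i)))"
    unfolding case_prod_beta using F \<pi>
    by (intro cip_sum_left continuous_L2 Ghat_cont) (auto simp: I_def)
  also have "\<dots> = (\<Sum>p\<in>I. if p = (\<pi>, j, i) then C \<pi> i j else 0)"
  proof (rule sum.cong, goal_cases)
    case (2 p)
    obtain \<rho> k l where p: "p = (\<rho>, k, l)" by (metis surj_pair)
    have m: "\<rho> \<in> Ghat" "k < rep_dim \<rho>" "l < rep_dim \<rho>" using 2 F by (auto simp: p I_def)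
    show ?case unfolding p split schur_orthogonality[OF m(1) \<pi>(1) m(2,3) \<pi>(3,2)]
      using Ghat_dim[OF \<pi>(1)] by auto
  qed auto
  also have "\<dots> = (if \<pi> \<in> F then C \<pi> i j else 0)"
    using F \<pi> by (simp add: I_def)
  finally show ?thesis .
qed

lemma fc_diff:
  assumes "f \<in> L2 \<mu>" "g \<in> L2 \<mu>" and \<pi>: "\<pi> \<in> Ghat" "i < rep_dim \<pi>" "j < rep_dim \<pi>"
  shows "fc (\<lambda>x. f x - g x) \<pi> i j = fc f \<pi> i j - fc g \<pi> i j"
  unfolding fc_cip[OF \<pi>] using \<pi> by (intro cip_diff assms continuous_L2 Ghat_cont)

lemma fsq_zeroD: "fsq f \<pi> = 0 \<Longrightarrow> \<pi> \<in> Ghat \<Longrightarrow> i < rep_dim \<pi> \<Longrightarrow> j < rep_dim \<pi> \<Longrightarrow> fc f \<pi> i j = 0"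
  using Ghat_dim[of \<pi>]
  by (auto simp: fsq_def sum_nonneg_eq_0_iff sum_nonneg)

lemma trig_Un:
  assumes "finite F" "F' \<subseteq> F"
  shows "trig F C g = trig F' C g + trig (F - F') C g"
  unfolding trig_def using sum.subset_diff[OF assms(2,1)] by (simp add: add.commute)

text \<open>The residuals \<open>u n\<close> of projections onto increasing finite sets form an
  L2-Cauchy sequence. Their autocorrelations converge uniformly to a continuous Hermitian kernel
  \<theta> without Fourier coefficients; so \<theta> vanishes, and its value at 0 is the limit of
  the squared norms of the residuals.\<close>

theorem parseval_continuous:
  assumes f: "continuous_on UNIV f" and \<delta>: "\<delta> > 0"
  obtains F where "finite F" "F \<subseteq> Ghat" "nsq f - (\<Sum>\<pi>\<in>F. fsq f \<pi>) < \<delta>"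
proof -
  note L2f = continuous_L2[OF f]
  define \<S> where "\<S> = {F. finite F \<and> F \<subseteq> Ghat}"
  define \<Sigma> where "\<Sigma> F = (\<Sum>\<pi>\<in>F. fsq f \<pi>)" for F
  have mono: "\<Sigma> F \<le> \<Sigma> F'" if "F \<subseteq> F'" "finite F'" for F F'
    unfolding \<Sigma>_def using that fsq_nonneg by (intro sum_mono2) auto
  have bdd: "bdd_above (\<Sigma> ` \<S>)" unfolding \<Sigma>_def \<S>_def
    by (intro bdd_aboveI[of _ "nsq f"]) (auto intro!: fourier_bessel L2f)
  define S where "S = (SUP F\<in>\<S>. \<Sigma> F)"
  have S_ge: "\<Sigma> F \<le> S" if "F \<in> \<S>" for F unfolding S_def using bdd that by (rule cSUP_upper2) auto
  have "\<exists>F\<in>\<S>. S - 1 / real (Suc n) < \<Sigma> F" for n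
    unfolding S_def by (rule less_cSUP_iff[THEN iffD1, OF _ bdd]) (auto simp: \<S>_def)
  then obtain F0 where F0: "\<And>n. F0 n \<in> \<S>" "\<And>n. S - 1 / real (Suc n) < \<Sigma> (F0 n)" by metis
  \<comment> \<open>Unions make the sets increasing, and enlarging a set can only bring the partial
    sum closer to its supremum \<open>S\<close>.\<close>
  define F where "F n = (\<Union>k\<le>n. F0 k)" for n
  have F: "finite (F n)" "F n \<subseteq> Ghat" for n using F0(1) by (auto simp: F_def \<S>_def)
  hence FS: "F n \<in> \<S>" for n by (simp add: \<S>_def)
  have F_mono: "F m \<subseteq> F n" if "m \<le> n" for m n using that by (fastforce simp: F_def)
  have F_gt: "S - 1 / real (Suc n) < \<Sigma> (F n)" for n
    using F0(2)[of n] mono[of "F0 n" "F n"] F(1) by (force simp: F_def)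
  define u where "u n g = f g - trig (F n) (fc f) g" for n g
  have u: "continuous_on UNIV (u n)" for n
    unfolding u_def[abs_def] by (intro continuous_intros f continuous_trig F)
  have nsq_u: "nsq (u n) = nsq f - \<Sigma> (F n)" for n
    using trig_projection[OF F L2f, of n "fc f"] by (simp add: u_def[abs_def] \<Sigma>_def)
  \<comment> \<open>The difference of two residuals is the projection onto \<open>F n - F m\<close>,
    whose squared norm is the gap between the partial sums.\<close>
  have nsq_ud: "nsq (\<lambda>g. u m g - u n g) \<le> 1 / real (Suc m)" if mn: "m \<le> n" for m n
  proof -
    have "u m g - u n g = trig (F n - F m) (fc f) g" for g
      using trig_Un[OF F(1) F_mono[OF mn], of "fc f" g] by (simp add: u_def)
    hence "nsq (\<lambda>g. u m g - u n g) = nsq (\<lambda>g. 0 - trig (F n - F m) (fc f) g)"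
      by (simp add: nsq_def)
    also have "\<dots> = (\<Sum>\<pi>\<in>F n - F m. fsq f \<pi>)"
      using trig_projection[of "F n - F m" "\<lambda>_. 0" "fc f"] F[of n]
      by (auto simp: continuous_L2 nsq_def fsq_def fc_def Diff_subset subset_trans)
    also have "\<dots> = \<Sigma> (F n) - \<Sigma> (F m)"
      unfolding \<Sigma>_def using F F_mono[OF mn] by (intro sum_diff) auto
    also have "\<dots> \<le> 1 / real (Suc m)" using S_ge[OF FS[of n]] F_gt[of m] by simp
    finally show ?thesis .
  qed
  have fcu: "fc (u n) \<pi> i j = (if \<pi> \<in> F n then 0 else fc f \<pi> i j)"
    if \<pi>: "\<pi> \<in> Ghat" "i < rep_dim \<pi>" "j < rep_dim \<pi>" for n \<pi> i j
    unfolding u_def[abs_def]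
    using fc_diff[OF L2f continuous_L2[OF continuous_trig[OF F(2)]] \<pi>, of n "fc f"] fc_trig[OF F \<pi>, of n "fc f"]
    by simp
  define \<eta> where "\<eta> n = corr (u n) (u n)" for n
  have eta: "continuous_on UNIV (\<eta> n)" for n unfolding \<eta>_def by (intro continuous_corr u)
  have u_le: "nsq (u n) \<le> nsq f" for n
    unfolding nsq_u \<Sigma>_def using fsq_nonneg by (simp add: sum_nonneg)
  \<comment> \<open>\<open>corr_diff\<close> telescopes the difference into two correlations, each
    with the small factor \<open>u m - u n\<close>.\<close>
  have eta_diff: "cmod (\<eta> m x - \<eta> n x) \<le> 2 * sqrt (nsq f / real (Suc m))" if mn: "m \<le> n" for m n x
  proof -
    let ?w = "\<lambda>z. u m z - u n z"
    have w: "continuous_on UNIV ?w" by (intro continuous_intros u)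
    have b1: "(cmod (corr ?w (u m) x))\<^sup>2 \<le> nsq f / real (Suc m)"
    proof -
      have "(cmod (corr ?w (u m) x))\<^sup>2 \<le> nsq ?w * nsq (u m)" by (rule corr_bound[OF w u])
      also have "\<dots> \<le> (1 / real (Suc m)) * nsq f"
        by (intro mult_mono nsq_ud[OF mn] u_le nsq_nonneg) auto
      finally show ?thesis by simp
    qed
    have b2: "(cmod (corr (u n) ?w x))\<^sup>2 \<le> nsq f / real (Suc m)"
    proof -
      have "(cmod (corr (u n) ?w x))\<^sup>2 \<le> nsq (u n) * nsq ?w" by (rule corr_bound[OF u w])
      also have "\<dots> \<le> nsq f * (1 / real (Suc m))"
        by (intro mult_mono nsq_ud[OF mn] u_le nsq_nonneg)
      finally show ?thesis by simp
    qed
    have "cmod (\<eta> m x - \<eta> n x) \<le> cmod (corr ?w (u m) x) + cmod (corr (u n) ?w x)"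
      unfolding \<eta>_def corr_diff[OF u u] by (rule norm_triangle_ineq)
    also have "\<dots> \<le> sqrt (nsq f / real (Suc m)) + sqrt (nsq f / real (Suc m))"
      by (intro add_mono real_le_rsqrt b1 b2)
    finally show ?thesis by simp
  qed
  have lim0: "(\<lambda>m. 2 * sqrt (nsq f / real (Suc m))) \<longlonglongrightarrow> 0"
  proof -
    have "(\<lambda>m. nsq f / real (Suc m)) \<longlonglongrightarrow> 0"
      using LIMSEQ_Suc[OF lim_const_over_n[of "nsq f"]] by simp
    from tendsto_mult_right_zero[OF tendsto_real_sqrt[OF this, unfolded real_sqrt_zero], of 2] show ?thesis .
  qed
  have "uniformly_Cauchy_on UNIV \<eta>"
  proof (rule uniformly_Cauchy_onI')
    fix e :: real assume "e > 0"
    then obtain M where M: "\<And>m. m \<ge> M \<Longrightarrow> 2 * sqrt (nsq f / real (Suc m)) < e"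
      using LIMSEQ_D[OF lim0, of e] nsq_nonneg[of f] by auto
    show "\<exists>M. \<forall>x\<in>UNIV. \<forall>m\<ge>M. \<forall>n>m. dist (\<eta> m x) (\<eta> n x) < e"
      proof (intro exI[of _ M] ballI allI impI)
      fix x m n assume mn: "m \<ge> M" "n > m"
      show "dist (\<eta> m x) (\<eta> n x) < e"
        unfolding dist_norm
        by (rule le_less_trans[OF eta_diff[OF less_imp_le[OF mn(2)]] M[OF mn(1)]])
    qed
  qed
  then obtain \<theta> where \<theta>: "uniform_limit UNIV \<eta> \<theta> sequentially"
    using Cauchy_uniformly_convergent uniformly_convergent_on_def by blast
  have lim: "(\<lambda>n. \<eta> n x) \<longlonglongrightarrow> \<theta> x" for x by (rule tendsto_uniform_limitI[OF \<theta>]) simp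
  have ct: "continuous_on UNIV \<theta>" by (rule nsq_uniform_limit(1)[OF eta \<theta>])
  have sa: "\<theta> (- x) = cnj (\<theta> x)" for x
  proof -
    have "(\<lambda>n. \<eta> n (- x)) \<longlonglongrightarrow> cnj (\<theta> x)"
      unfolding \<eta>_def corr_minus[OF u] by (intro tendsto_cnj lim[unfolded \<eta>_def])
    thus ?thesis using lim[of "- x"] LIMSEQ_unique by blast
  qed
  have zero: "fc \<theta> \<pi> i j = 0" if \<pi>: "\<pi> \<in> Ghat" "i < rep_dim \<pi>" "j < rep_dim \<pi>" for \<pi> i j
  proof -
    have "\<exists>N. \<forall>n\<ge>N. fc (\<eta> n) \<pi> i j = 0"
    proof (cases "\<exists>N. \<pi> \<in> F N")
      case True
      then obtain N where N: "\<pi> \<in> F N" by blast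
      have "fc (\<eta> n) \<pi> i j = 0" if "n \<ge> N" for n
      proof -
        have "\<pi> \<in> F n" using F_mono[OF that] N by auto
        thus ?thesis unfolding \<eta>_def by (intro fc_corr_zero u \<pi>) (simp add: fcu \<pi>)
      qed
      thus ?thesis by blast
    next
      \<comment> \<open>A class that never enters the sets: inserting it may not push the sum above
        \<open>S\<close>, so its term is below 1 / (n + 1) for every \<open>n\<close> and
        vanishes.\<close>
      case False
      have "fsq f \<pi> \<le> 1 / real (Suc n)" for n
      proof -
        have "insert \<pi> (F n) \<in> \<S>" using F \<pi> by (simp add: \<S>_def)
        from S_ge[OF this] have "fsq f \<pi> + \<Sigma> (F n) \<le> S" using False F by (simp add: \<Sigma>_def)
        thus ?thesis using F_gt[of n] by simp
      qed
      hence "fsq f \<pi> \<le> 0"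
        by (intro LIMSEQ_le_const[OF LIMSEQ_Suc[OF lim_const_over_n[of 1]]]) auto
      hence "fsq f \<pi> = 0" using fsq_nonneg[of f \<pi>] by simp
      hence "fc (\<eta> n) \<pi> i j = 0" for n
        unfolding \<eta>_def using False fsq_zeroD \<pi> by (intro fc_corr_zero u \<pi>) (simp add: fcu \<pi>)
      thus ?thesis by blast
    qed
    then obtain N where N: "\<And>n. n \<ge> N \<Longrightarrow> fc (\<eta> n) \<pi> i j = 0" by blast
    have "(\<lambda>n. nsq (\<lambda>x. \<theta> x - \<eta> n x)) \<longlonglongrightarrow> nsq (\<lambda>x. \<theta> x - \<theta> x)"
    proof (rule nsq_uniform_limit(2))
      show "continuous_on UNIV (\<lambda>x. \<theta> x - \<eta> n x)" for n by (intro continuous_intros ct eta)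
      show "uniform_limit UNIV (\<lambda>n x. \<theta> x - \<eta> n x) (\<lambda>x. \<theta> x - \<theta> x) sequentially"
        by (intro uniform_limit_intros \<theta>)
    qed
    hence "(\<lambda>n. nsq (\<lambda>x. \<theta> x - \<eta> n x) * nsq (\<lambda>g. \<pi> g $$ (j, i))) \<longlonglongrightarrow> 0"
      by (intro tendsto_mult_left_zero) (simp add: nsq_def)
    moreover have "(cmod (fc \<theta> \<pi> i j))\<^sup>2 \<le> nsq (\<lambda>x. \<theta> x - \<eta> n x) * nsq (\<lambda>g. \<pi> g $$ (j, i))" if "n \<ge> N" for n
    proof -
      have cd: "continuous_on UNIV (\<lambda>x. \<theta> x - \<eta> n x)" by (intro continuous_intros ct eta)
      have "fc \<theta> \<pi> i j = fc (\<lambda>x. \<theta> x - \<eta> n x) \<pi> i j"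
        using fc_diff[OF continuous_L2[OF ct] continuous_L2[OF eta] \<pi>, of n] N[OF that] by simp
      also have "\<dots> = cip (\<lambda>x. \<theta> x - \<eta> n x) (\<lambda>g. \<pi> g $$ (j, i))" by (rule fc_cip[OF \<pi>])
      finally show ?thesis
        using cip_bound[OF continuous_L2[OF cd] continuous_L2[OF Ghat_cont[OF \<pi>(1,3,2)]]] by simp
    qed
    ultimately have "(cmod (fc \<theta> \<pi> i j))\<^sup>2 \<le> 0" by (intro LIMSEQ_le_const) blast+
    thus ?thesis by simp
  qed
  have "\<theta> 0 = 0" by (rule fourier_injective[OF ct sa zero])
  hence "(\<lambda>n. complex_of_real (nsq (u n))) \<longlonglongrightarrow> 0" using lim[of 0] by (simp add: \<eta>_def corr_zero)
  from tendsto_Re[OF this] have "(\<lambda>n. nsq (u n)) \<longlonglongrightarrow> 0" by simp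
  then obtain n where "nsq (u n) < \<delta>"
    using LIMSEQ_D[of "\<lambda>n. nsq (u n)" 0 \<delta>] \<delta> nsq_nonneg by auto
  thus ?thesis using that[OF F(1,2), of n] by (simp add: nsq_u \<Sigma>_def)
qed

lemma nsq_add_le:
  assumes "f \<in> L2 \<mu>" "g \<in> L2 \<mu>"
  shows "nsq (\<lambda>x. f x + g x) \<le> 2 * nsq f + 2 * nsq g"
proof -
  have i: "integrable \<mu> (\<lambda>x. (cmod (f x))\<^sup>2)" "integrable \<mu> (\<lambda>x. (cmod (g x))\<^sup>2)"
    "integrable \<mu> (\<lambda>x. (cmod (f x + g x))\<^sup>2)"
    using assms(1) assms(2) L2_add[OF assms] unfolding L2_def by blast+
  have "nsq (\<lambda>x. f x + g x) \<le> (\<integral>x. 2 * (cmod (f x))\<^sup>2 + 2 * (cmod (g x))\<^sup>2 \<partial>\<mu>)"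
    unfolding nsq_def by (intro integral_mono i cmod_add_sq_le Bochner_Integration.integrable_add integrable_mult_right)
  also have "\<dots> = 2 * nsq f + 2 * nsq g"
    unfolding nsq_def using i by simp
  finally show ?thesis .
qed

text \<open>The set \<open>F\<close> is taken from a continuous approximation \<phi>; the projection
  of \<open>f\<close> onto \<open>F\<close> is its best approximation there, hence at least as good
  as the projection of \<phi>.\<close>

lemma parseval:
  assumes f: "f \<in> L2 \<mu>" and approx: "\<And>e. e > 0 \<Longrightarrow> \<exists>\<phi>. continuous_on UNIV \<phi> \<and> nsq (\<lambda>x. f x - \<phi> x) < e"
    and \<delta>: "\<delta> > 0"
  obtains F where "finite F" "F \<subseteq> Ghat" "nsq f - (\<Sum>\<pi>\<in>F. fsq f \<pi>) < \<delta>"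
proof -
  obtain \<phi> where \<phi>: "continuous_on UNIV \<phi>" "nsq (\<lambda>x. f x - \<phi> x) < \<delta> / 4"
    using approx[of "\<delta> / 4"] \<delta> by auto
  obtain F where F: "finite F" "F \<subseteq> Ghat" "nsq \<phi> - (\<Sum>\<pi>\<in>F. fsq \<phi> \<pi>) < \<delta> / 4"
    using parseval_continuous[OF \<phi>(1), of "\<delta> / 4"] \<delta> by auto
  note L\<phi> = continuous_L2[OF \<phi>(1)]
  have ct: "continuous_on UNIV (\<lambda>x. \<phi> x - trig F (fc \<phi>) x)" by (intro continuous_intros \<phi> continuous_trig F)
  have "(\<lambda>x. f x + (- 1) * \<phi> x) \<in> L2 \<mu>" by (intro L2_add f continuous_L2 continuous_intros \<phi>)
  hence fd: "(\<lambda>x. f x - \<phi> x) \<in> L2 \<mu>" by simp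
  have "nsq f - (\<Sum>\<pi>\<in>F. fsq f \<pi>) \<le> nsq (\<lambda>x. f x - trig F (fc \<phi>) x)"
    unfolding trig_projection[OF F(1,2) f]
    by (simp add: sum_nonneg mult_nonneg_nonneg)
  also have "\<dots> = nsq (\<lambda>x. (f x - \<phi> x) + (\<phi> x - trig F (fc \<phi>) x))" by simp
  also have "\<dots> \<le> 2 * nsq (\<lambda>x. f x - \<phi> x) + 2 * nsq (\<lambda>x. \<phi> x - trig F (fc \<phi>) x)"
    by (rule nsq_add_le[OF fd continuous_L2[OF ct]])
  also have "nsq (\<lambda>x. \<phi> x - trig F (fc \<phi>) x) = nsq \<phi> - (\<Sum>\<pi>\<in>F. fsq \<phi> \<pi>)"
    unfolding trig_projection[OF F(1,2) L\<phi>] by simp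
  finally have "nsq f - (\<Sum>\<pi>\<in>F. fsq f \<pi>) < \<delta>" using \<phi>(2) F(3) by simp
  with F that show ?thesis by blast
qed

end

section \<open>Functions of class \<open>C\<^sup>k\<close>\<close>

lemma frechet_derivative_apply:
  "(f has_derivative D) (at x) \<Longrightarrow> frechet_derivative f (at x) v = D v"
  by (metis frechet_derivative_at)

lemma frechet_derivative_cong_open:
  assumes "open S" "x \<in> S" "\<And>y. y \<in> S \<Longrightarrow> f y = g y"
  shows "frechet_derivative f (at x) = frechet_derivative g (at x)"
proof -
  have "(f has_derivative D) (at x) \<longleftrightarrow> (g has_derivative D) (at x)" for D
    using has_derivative_transform_within_open[of f D x UNIV S g]
      has_derivative_transform_within_open[of g D x UNIV S f] assms by auto
  thus ?thesis by (simp add: frechet_derivative_def)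
qed

lemma differentiable_cong_open:
  assumes "open S" "x \<in> S" "\<And>y. y \<in> S \<Longrightarrow> f y = g y" "f differentiable (at x)"
  shows "g differentiable (at x)"
  using assms has_derivative_transform_within_open[of f _ x UNIV S g]
  unfolding differentiable_def by auto

lemma Ck_on_cong:
  assumes "open S" "\<And>x. x \<in> S \<Longrightarrow> f x = g x" "Ck_on k S f"
  shows "Ck_on k S g"
  using assms(2,3)
proof (induction k arbitrary: f g)
  case 0
  thus ?case using continuous_on_cong[of S S f g] by simp
next
  case (Suc k)
  have "g differentiable (at x)" if "x \<in> S" for x
    using differentiable_cong_open[OF assms(1) that Suc.prems(1)] Suc.prems(2) that by auto
  moreover have "Ck_on k S (\<lambda>x. frechet_derivative g (at x) b)" if "b \<in> Basis" for b
    proof (rule Suc.IH[of "\<lambda>x. frechet_derivative f (at x) b"])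
    show "frechet_derivative f (at x) b = frechet_derivative g (at x) b" if "x \<in> S" for x
      by (rule fun_cong[OF frechet_derivative_cong_open[OF assms(1) that Suc.prems(1)]])
  qed (use Suc.prems(2) that in auto)
  ultimately show ?case by simp
qed

lemma Ck_on_subset: "Ck_on k S f \<Longrightarrow> T \<subseteq> S \<Longrightarrow> Ck_on k T f"
  by (induction k arbitrary: f) (auto intro: continuous_on_subset)

lemma Ck_on_SucD: "Ck_on (Suc k) S f \<Longrightarrow> Ck_on k S f"
proof (induction k arbitrary: f)
  case 0
  hence "f differentiable_on S" unfolding differentiable_on_def
    using differentiable_at_withinI by (metis Ck_on.simps(2))
  thus ?case by (simp add: differentiable_imp_continuous_on)
next
  case (Suc k)
  have "Ck_on k S (\<lambda>x. frechet_derivative f (at x) b)" if "b \<in> Basis" for b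
    using Suc.prems that by (intro Suc.IH) auto
  thus ?case using Suc.prems by simp
qed

lemma Ck_on_le: "Ck_on m S f \<Longrightarrow> k \<le> m \<Longrightarrow> Ck_on k S f"
  by (induction m arbitrary: k) (auto simp: le_Suc_eq intro: Ck_on_SucD simp del: Ck_on.simps)

lemma Ck_on_continuous: "Ck_on k S f \<Longrightarrow> continuous_on S f"
  using Ck_on_le[of k S f 0] by simp

text \<open>\<open>Ck_on\<close> takes derivatives in the ambient space and not within
  \<open>S\<close>, so it is a local property.\<close>

lemma Ck_on_local:
  assumes "\<And>x. x \<in> S \<Longrightarrow> \<exists>T. open T \<and> x \<in> T \<and> Ck_on k T f"
  shows "Ck_on k S f"
  using assms
proof (induction k arbitrary: f)
  case 0
  have "continuous (at x) f" if "x \<in> S" for x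
    using 0[OF that] continuous_on_eq_continuous_at by (metis Ck_on.simps(1))
  thus ?case by (simp add: continuous_at_imp_continuous_on)
next
  case (Suc k)
  have "f differentiable (at x)" if "x \<in> S" for x using Suc.prems[OF that] by (metis Ck_on.simps(2))
  moreover have "Ck_on k S (\<lambda>x. frechet_derivative f (at x) b)" if "b \<in> Basis" for b
    proof (rule Suc.IH)
    fix x assume "x \<in> S"
    from Suc.prems[OF this] show "\<exists>T. open T \<and> x \<in> T \<and> Ck_on k T (\<lambda>x. frechet_derivative f (at x) b)"
      using that by (metis Ck_on.simps(2))
  qed
  ultimately show ?case by simp
qed

lemma Ck_on_const: "Ck_on k S (\<lambda>_. c)"
  by (induction k arbitrary: c) (auto simp: frechet_derivative_const)

lemma Ck_on_bounded_linear:
  assumes "bounded_linear L"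
  shows "Ck_on k S L"
proof (cases k)
  case 0
  thus ?thesis using assms by (simp add: linear_continuous_on)
next
  case (Suc m)
  have "frechet_derivative L (at x) = L" for x
    by (metis assms bounded_linear_imp_has_derivative frechet_derivative_at)
  thus ?thesis using assms Suc by (auto simp: Ck_on_const intro: bounded_linear_imp_differentiable)
qed

lemma Ck_on_linear_compose:
  assumes "open S" "bounded_linear L" "Ck_on k S f"
  shows "Ck_on k S (\<lambda>x. L (f x))"
  using assms(3)
proof (induction k arbitrary: f)
  case 0
  thus ?case using bounded_linear.continuous_on[OF assms(2)] by auto
next
  case (Suc k)
  have d: "((\<lambda>x. L (f x)) has_derivative (\<lambda>v. L (frechet_derivative f (at x) v))) (at x)" if "x \<in> S" for x
    using Suc.prems that bounded_linear.has_derivative[OF assms(2), of f "frechet_derivative f (at x)"]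
    by (auto simp: frechet_derivative_works)
  have "Ck_on k S (\<lambda>x. frechet_derivative (\<lambda>x. L (f x)) (at x) b)" if "b \<in> Basis" for b
    by (rule Ck_on_cong[OF assms(1) _ Suc.IH[of "\<lambda>x. frechet_derivative f (at x) b"]])
       (use Suc.prems that in \<open>auto simp: frechet_derivative_apply[OF d]\<close>)
  thus ?case using d by (auto simp: differentiable_def)
qed

lemma Ck_on_add:
  assumes "open S" "Ck_on k S f" "Ck_on k S g"
  shows "Ck_on k S (\<lambda>x. f x + g x)"
  using assms(2,3)
proof (induction k arbitrary: f g)
  case 0
  thus ?case by (auto intro: continuous_on_add)
next
  case (Suc k)
  have d: "((\<lambda>x. f x + g x) has_derivative (\<lambda>v. frechet_derivative f (at x) v + frechet_derivative g (at x) v)) (at x)"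
    if "x \<in> S" for x
    using Suc.prems that by (intro has_derivative_add) (auto simp: frechet_derivative_works)
  have "Ck_on k S (\<lambda>x. frechet_derivative (\<lambda>x. f x + g x) (at x) b)" if "b \<in> Basis" for b
    by (rule Ck_on_cong[OF assms(1) _ Suc.IH[of "\<lambda>x. frechet_derivative f (at x) b" "\<lambda>x. frechet_derivative g (at x) b"]])
       (use Suc.prems that in \<open>auto simp: frechet_derivative_apply[OF d]\<close>)
  thus ?case using d by (auto simp: differentiable_def)
qed

lemma Ck_on_sum:
  assumes "open S" "\<And>i. i \<in> I \<Longrightarrow> Ck_on k S (f i)"
  shows "Ck_on k S (\<lambda>x. \<Sum>i\<in>I. f i x)"
  using assms(2)
  by (induction I rule: infinite_finite_induct) (auto simp: Ck_on_const intro!: Ck_on_add assms(1))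

lemma Ck_on_bilinear:
  assumes "open S" "bounded_bilinear prd" "Ck_on k S f" "Ck_on k S g"
  shows "Ck_on k S (\<lambda>x. prd (f x) (g x))"
  using assms(3,4)
proof (induction k arbitrary: f g)
  case 0
  thus ?case using bounded_bilinear.continuous_on[OF assms(2)] by auto
next
  case (Suc k)
  have d: "((\<lambda>x. prd (f x) (g x)) has_derivative
      (\<lambda>v. prd (f x) (frechet_derivative g (at x) v) + prd (frechet_derivative f (at x) v) (g x))) (at x)"
    if "x \<in> S" for x
    using Suc.prems that by (intro bounded_bilinear.FDERIV[OF assms(2)]) (auto simp: frechet_derivative_works)
  have "Ck_on k S (\<lambda>x. frechet_derivative (\<lambda>x. prd (f x) (g x)) (at x) b)" if b: "b \<in> Basis" for b
  proof (rule Ck_on_cong[OF assms(1)])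
    show "Ck_on k S (\<lambda>x. prd (f x) (frechet_derivative g (at x) b) + prd (frechet_derivative f (at x) b) (g x))"
      using Suc.prems b Ck_on_SucD[OF Suc.prems(1)] Ck_on_SucD[OF Suc.prems(2)]
      by (intro Ck_on_add assms(1) Suc.IH) auto
  qed (simp add: frechet_derivative_apply[OF d])
  thus ?case using d by (auto simp: differentiable_def)
qed

lemmas Ck_on_mult = Ck_on_bilinear[OF _ bounded_bilinear_mult]
lemmas Ck_on_scaleR = Ck_on_bilinear[OF _ bounded_bilinear_scaleR]

lemma Ck_on_Pair:
  assumes "open S" "Ck_on k S f" "Ck_on k S g"
  shows "Ck_on k S (\<lambda>x. (f x, g x))"
proof -
  have "bounded_linear (\<lambda>a. (a, 0))" "bounded_linear (\<lambda>b. (0, b))"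
    by (auto intro!: bounded_linear_intros)
  from Ck_on_add[OF assms(1) Ck_on_linear_compose[OF assms(1) this(1) assms(2)]
      Ck_on_linear_compose[OF assms(1) this(2) assms(3)]]
  show ?thesis by simp
qed

text \<open>\<open>Ck_on\<close> controls derivatives along basis vectors only, so the outer
  derivative in the chain rule is expanded in the basis before the induction hypothesis
  applies.\<close>

lemma Ck_on_compose:
  fixes g :: "'a::euclidean_space \<Rightarrow> 'b::euclidean_space" and f :: "'b \<Rightarrow> 'c::real_normed_vector"
  assumes S: "open S" and T: "open T" and sub: "\<And>x. x \<in> S \<Longrightarrow> g x \<in> T" and "Ck_on k S g" "Ck_on k T f"
  shows "Ck_on k S (\<lambda>x. f (g x))"
  using assms(4,5)
proof (induction k arbitrary: f)
  case 0
  thus ?case using continuous_on_compose2[of T f S g] sub by auto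
next
  case (Suc k)
  have gk: "Ck_on k S g" using Ck_on_SucD[OF Suc.prems(1)] .
  have d: "((\<lambda>x. f (g x)) has_derivative (\<lambda>v. frechet_derivative f (at (g x)) (frechet_derivative g (at x) v))) (at x)"
    if "x \<in> S" for x
    using Suc.prems that sub has_derivative_compose[of g "frechet_derivative g (at x)" x UNIV f "frechet_derivative f (at (g x))"]
    by (auto simp: frechet_derivative_works)
  have "Ck_on k S (\<lambda>x. frechet_derivative (\<lambda>x. f (g x)) (at x) b)" if b: "b \<in> Basis" for b
  proof (rule Ck_on_cong[OF S])
    show "Ck_on k S (\<lambda>x. \<Sum>e\<in>Basis. (frechet_derivative g (at x) b \<bullet> e) *\<^sub>R frechet_derivative f (at (g x)) e)"
    proof (intro Ck_on_sum Ck_on_scaleR S)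
      fix e :: 'b assume e: "e \<in> Basis"
      show "Ck_on k S (\<lambda>x. frechet_derivative g (at x) b \<bullet> e)"
        using Ck_on_linear_compose[OF S bounded_linear_inner_left, of k "\<lambda>x. frechet_derivative g (at x) b" e]
          Suc.prems b by simp
      show "Ck_on k S (\<lambda>x. frechet_derivative f (at (g x)) e)"
        using Suc.IH[of "\<lambda>y. frechet_derivative f (at y) e"] gk Suc.prems(2) e by simp
    qed
    fix x assume x: "x \<in> S"
    have lin: "linear (frechet_derivative f (at (g x)))"
      using Suc.prems(2) sub[OF x] by (auto intro: linear_frechet_derivative)
    have "frechet_derivative (\<lambda>x. f (g x)) (at x) b = frechet_derivative f (at (g x)) (frechet_derivative g (at x) b)"
      by (rule frechet_derivative_apply[OF d[OF x]])
    also have "frechet_derivative g (at x) b = (\<Sum>e\<in>Basis. (frechet_derivative g (at x) b \<bullet> e) *\<^sub>R e)"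
      by (simp add: euclidean_representation)
    also have "frechet_derivative f (at (g x)) \<dots> = (\<Sum>e\<in>Basis. (frechet_derivative g (at x) b \<bullet> e) *\<^sub>R frechet_derivative f (at (g x)) e)"
      by (simp add: linear_sum[OF lin] linear_cmul[OF lin])
    finally show "(\<Sum>e\<in>Basis. (frechet_derivative g (at x) b \<bullet> e) *\<^sub>R frechet_derivative f (at (g x)) e) =
       frechet_derivative (\<lambda>x. f (g x)) (at x) b" by simp
  qed
  thus ?case using d by (auto simp: differentiable_def)
qed

lemma Ck_on_directional:
  fixes f :: "'a::euclidean_space \<Rightarrow> 'b::real_normed_vector"
  assumes "open S" "Ck_on (Suc k) S f"
  shows "Ck_on k S (\<lambda>x. frechet_derivative f (at x) v)"
proof (rule Ck_on_cong[OF assms(1)])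
  show "Ck_on k S (\<lambda>x. \<Sum>b\<in>Basis. (v \<bullet> b) *\<^sub>R frechet_derivative f (at x) b)"
    using assms by (intro Ck_on_sum Ck_on_scaleR Ck_on_const) auto
  fix x assume "x \<in> S"
  hence lin: "linear (frechet_derivative f (at x))"
    using assms(2) by (auto intro: linear_frechet_derivative)
  show "(\<Sum>b\<in>Basis. (v \<bullet> b) *\<^sub>R frechet_derivative f (at x) b) = frechet_derivative f (at x) v"
    using linear_sum[OF lin, of "\<lambda>b. (v \<bullet> b) *\<^sub>R b" Basis]
    by (simp add: linear_cmul[OF lin] euclidean_representation)
qed

section \<open>Symmetry of second derivatives\<close>

lemma has_real_derivative_along_line:
  fixes f :: "'a::real_normed_vector \<Rightarrow> real"
  assumes "f differentiable (at (p + t *\<^sub>R v))"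
  shows "((\<lambda>t. f (p + t *\<^sub>R v)) has_real_derivative frechet_derivative f (at (p + t *\<^sub>R v)) v) (at t)"
proof -
  let ?D = "frechet_derivative f (at (p + t *\<^sub>R v))"
  have "((\<lambda>t. p + t *\<^sub>R v) has_derivative (\<lambda>h. h *\<^sub>R v)) (at t)"
    by (auto intro!: derivative_eq_intros)
  from has_derivative_compose[OF this assms[unfolded frechet_derivative_works]]
  have "((\<lambda>t. f (p + t *\<^sub>R v)) has_derivative (\<lambda>h. ?D (h *\<^sub>R v))) (at t)" .
  moreover have "?D (h *\<^sub>R v) = ?D v * h" for h
    using linear_cmul[OF linear_frechet_derivative[OF assms]] by simp
  ultimately show ?thesis by (simp add: has_field_derivative_def)
qed

text \<open>Schwarz' theorem by the second difference quotient: two applications of the mean value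
  theorem, in either order.\<close>

lemma second_difference:
  fixes f :: "'a::euclidean_space \<Rightarrow> real"
  assumes f: "Ck_on 2 (ball x r) f" and t: "t > 0" "t * (norm u + norm v) < r"
  obtains y where "dist x y \<le> t * (norm u + norm v)"
    "f (x + t *\<^sub>R u + t *\<^sub>R v) - f (x + t *\<^sub>R u) - f (x + t *\<^sub>R v) + f x =
      t * t * frechet_derivative (\<lambda>y. frechet_derivative f (at y) u) (at y) v"
proof -
  have f': "Ck_on (Suc 1) (ball x r) f" using f by (simp add: numeral_2_eq_2)
  have d1: "f differentiable (at y)" if "y \<in> ball x r" for y using f' that by simp
  have "Ck_on 1 (ball x r) (\<lambda>y. frechet_derivative f (at y) u)" by (rule Ck_on_directional[OF open_ball f'])
  hence d2: "(\<lambda>y. frechet_derivative f (at y) u) differentiable (at y)" if "y \<in> ball x r" for y using that by simp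
  have inb: "x + a *\<^sub>R u + b *\<^sub>R v \<in> ball x r" and dle: "dist x (x + a *\<^sub>R u + b *\<^sub>R v) \<le> t * (norm u + norm v)"
    if "0 \<le> a" "a \<le> t" "0 \<le> b" "b \<le> t" for a b
  proof -
    have "dist x (x + a *\<^sub>R u + b *\<^sub>R v) = norm (a *\<^sub>R u + b *\<^sub>R v)"
      by (simp add: dist_norm norm_minus_commute add.assoc) (simp add: add.commute)
    also have "\<dots> \<le> a * norm u + b * norm v" using that norm_triangle_ineq[of "a *\<^sub>R u" "b *\<^sub>R v"] by simp
    also have "\<dots> \<le> t * (norm u + norm v)" unfolding distrib_left
      using that by (intro add_mono mult_right_mono) auto
    finally show "dist x (x + a *\<^sub>R u + b *\<^sub>R v) \<le> t * (norm u + norm v)" .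
    thus "x + a *\<^sub>R u + b *\<^sub>R v \<in> ball x r" using t(2) by simp
  qed
  define \<phi> where "\<phi> s = f ((x + t *\<^sub>R v) + s *\<^sub>R u) - f (x + s *\<^sub>R u)" for s
  have "\<exists>s. 0 < s \<and> s < t \<and> \<phi> t - \<phi> 0 = (t - 0) *
      (frechet_derivative f (at ((x + t *\<^sub>R v) + s *\<^sub>R u)) u - frechet_derivative f (at (x + s *\<^sub>R u)) u)"
  proof (rule MVT2[OF t(1)])
    fix s assume s: "0 \<le> s" "s \<le> t"
    have "f differentiable (at ((x + t *\<^sub>R v) + s *\<^sub>R u))" "f differentiable (at (x + s *\<^sub>R u))"
      using d1[OF inb[of s t]] d1[OF inb[of s 0]] s t by (simp_all add: ac_simps)
    thus "(\<phi> has_real_derivative frechet_derivative f (at ((x + t *\<^sub>R v) + s *\<^sub>R u)) u -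
        frechet_derivative f (at (x + s *\<^sub>R u)) u) (at s)"
      unfolding \<phi>_def by (intro DERIV_diff has_real_derivative_along_line)
  qed
  then obtain s where s: "0 < s" "s < t" and e1: "\<phi> t - \<phi> 0 = t *
      (frechet_derivative f (at ((x + s *\<^sub>R u) + t *\<^sub>R v)) u - frechet_derivative f (at (x + s *\<^sub>R u)) u)"
    by (auto simp: ac_simps)
  define \<psi> where "\<psi> b = frechet_derivative f (at ((x + s *\<^sub>R u) + b *\<^sub>R v)) u" for b
  have "\<exists>b. 0 < b \<and> b < t \<and> \<psi> t - \<psi> 0 = (t - 0) *
      frechet_derivative (\<lambda>y. frechet_derivative f (at y) u) (at ((x + s *\<^sub>R u) + b *\<^sub>R v)) v"
  proof (rule MVT2[OF t(1)])
    fix b assume b: "0 \<le> b" "b \<le> t"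
    show "(\<psi> has_real_derivative frechet_derivative (\<lambda>y. frechet_derivative f (at y) u) (at ((x + s *\<^sub>R u) + b *\<^sub>R v)) v) (at b)"
      unfolding \<psi>_def by (rule has_real_derivative_along_line[OF d2[OF inb]]) (use s b in auto)
  qed
  then obtain b where b: "0 < b" "b < t" and e2: "\<psi> t - \<psi> 0 = t *
      frechet_derivative (\<lambda>y. frechet_derivative f (at y) u) (at ((x + s *\<^sub>R u) + b *\<^sub>R v)) v" by auto
  have "f (x + t *\<^sub>R u + t *\<^sub>R v) - f (x + t *\<^sub>R u) - f (x + t *\<^sub>R v) + f x = \<phi> t - \<phi> 0"
    by (simp add: \<phi>_def ac_simps)
  also have "\<dots> = t * (\<psi> t - \<psi> 0)" unfolding e1 by (simp add: \<psi>_def)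
  also have "\<dots> = t * t * frechet_derivative (\<lambda>y. frechet_derivative f (at y) u) (at ((x + s *\<^sub>R u) + b *\<^sub>R v)) v"
    unfolding e2 by simp
  finally show ?thesis using that dle[of s b] s b by simp
qed

text \<open>The quotient \<open>q t\<close> is symmetric in \<open>u\<close> and \<open>v\<close>;
  by \<open>second_difference\<close> in both orders it is a value of either mixed derivative at a
  point tending to \<open>x\<close>.\<close>

lemma symmetric_second_derivative:
  fixes f :: "'a::euclidean_space \<Rightarrow> real"
  assumes S: "open S" "x \<in> S" and f: "Ck_on 2 S f"
  shows "frechet_derivative (\<lambda>y. frechet_derivative f (at y) u) (at x) v =
    frechet_derivative (\<lambda>y. frechet_derivative f (at y) v) (at x) u"
proof -
  obtain r where r: "r > 0" "ball x r \<subseteq> S" using S openE by blast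
  note fr = Ck_on_subset[OF f r(2)]
  define D where "D u v y = frechet_derivative (\<lambda>y. frechet_derivative f (at y) u) (at y) v" for u v y
  have cont: "isCont (D u v) x" for u v
  proof -
    have "Ck_on (Suc (Suc 0)) S f" using f by (simp add: numeral_2_eq_2)
    from Ck_on_directional[OF S(1) Ck_on_directional[OF S(1) this]]
    have "continuous_on S (D u v)" unfolding D_def by simp
    thus ?thesis using S continuous_on_eq_continuous_at by blast
  qed
  define q where "q t = (f (x + t *\<^sub>R u + t *\<^sub>R v) - f (x + t *\<^sub>R u) - f (x + t *\<^sub>R v) + f x) / (t * t)" for t
  have small: "\<exists>\<delta>>0. \<forall>t. 0 < t \<and> t < \<delta> \<longrightarrow> \<bar>q t - D u v x\<bar> < e \<and> \<bar>q t - D v u x\<bar> < e" if e: "e > 0" for e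
  proof -
    obtain d1 where d1: "d1 > 0" "\<And>y. dist y x < d1 \<Longrightarrow> dist (D u v y) (D u v x) < e"
      using cont[of u v] e unfolding continuous_at_eps_delta by blast
    obtain d2 where d2: "d2 > 0" "\<And>y. dist y x < d2 \<Longrightarrow> dist (D v u y) (D v u x) < e"
      using cont[of v u] e unfolding continuous_at_eps_delta by blast
    \<comment> \<open>The added 1 keeps \<open>M\<close> positive when both directions
      vanish.\<close>
    define M where "M = norm u + norm v + 1"
    have M: "M > 0" "norm u + norm v \<le> M" "norm v + norm u \<le> M" by (auto simp: M_def add_nonneg_pos)
    define m where "m = Min {r, d1, d2}"
    have m: "m > 0" "m \<le> r" "m \<le> d1" "m \<le> d2" using r d1 d2 by (auto simp: m_def)
    show ?thesis
    proof (intro exI[of _ "m / M"] conjI allI impI)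
      fix t assume t: "0 < t \<and> t < m / M"
      hence tm: "t * M < m" using M by (simp add: pos_less_divide_eq)
      have l1: "t * (norm u + norm v) < m" using tm mult_left_mono[OF M(2), of t] t by linarith
      have l2: "t * (norm v + norm u) < m" using tm mult_left_mono[OF M(3), of t] t by linarith
      obtain y where y: "dist x y \<le> t * (norm u + norm v)" "f (x + t *\<^sub>R u + t *\<^sub>R v) - f (x + t *\<^sub>R u) - f (x + t *\<^sub>R v) + f x = t * t * D u v y"
        unfolding D_def by (rule second_difference[OF fr, of t u v]) (use t l1 m in auto)
      obtain z where z: "dist x z \<le> t * (norm v + norm u)" "f (x + t *\<^sub>R v + t *\<^sub>R u) - f (x + t *\<^sub>R v) - f (x + t *\<^sub>R u) + f x = t * t * D v u z"
        unfolding D_def by (rule second_difference[OF fr, of t v u]) (use t l2 m in auto)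
      have "q t = D u v y" unfolding q_def y(2) using t by simp
      moreover have "dist y x < d1" using y(1) l1 m by (simp add: dist_commute)
      ultimately show "\<bar>q t - D u v x\<bar> < e" using d1(2)[of y] by (simp add: dist_real_def)
      have "f (x + t *\<^sub>R u + t *\<^sub>R v) - f (x + t *\<^sub>R u) - f (x + t *\<^sub>R v) + f x = t * t * D v u z"
        using z(2) by (simp add: ac_simps)
      hence "q t = D v u z" unfolding q_def using t by simp
      moreover have "dist z x < d2" using z(1) l2 m by (simp add: dist_commute)
      ultimately show "\<bar>q t - D v u x\<bar> < e" using d2(2)[of z] by (simp add: dist_real_def)
    qed (use m M in auto)
  qed
  have "\<bar>D u v x - D v u x\<bar> < 2 * e" if e: "e > 0" for e
  proof -
    obtain \<delta> where \<delta>: "\<delta> > 0" "\<forall>t. 0 < t \<and> t < \<delta> \<longrightarrow> \<bar>q t - D u v x\<bar> < e \<and> \<bar>q t - D v u x\<bar> < e"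
      using small[OF e] by blast
    have "\<bar>q (\<delta>/2) - D u v x\<bar> < e" "\<bar>q (\<delta>/2) - D v u x\<bar> < e" using \<delta> by (auto simp del: abs_less_iff)
    thus ?thesis by linarith
  qed
  from this[of "\<bar>D u v x - D v u x\<bar> / 2"] have "D u v x = D v u x" by fastforce
  thus ?thesis by (simp add: D_def)
qed

section \<open>The Laplace--Beltrami operator in coordinates\<close>

abbreviation det_v :: "real^'n^'n \<Rightarrow> real" where "det_v \<equiv> Determinants.det"

text \<open>The determinant is multilinear in the rows: differentiate one row at a time.\<close>

lemma has_derivative_det:
  fixes A :: "'a::real_normed_vector \<Rightarrow> real^'n^'n"
  assumes "\<And>i j. ((\<lambda>x. A x $ i $ j) has_derivative A' i j) (at y)"
  shows "((\<lambda>x. det_v (A x)) has_derivative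
    (\<lambda>h. \<Sum>r\<in>UNIV. det_v (\<chi> i j. if i = r then A' r j h else A y $ i $ j))) (at y)"
proof -
  let ?P = "{p. p permutes (UNIV :: 'n set)}"
  have *: "(\<Prod>i\<in>UNIV. if i = r then A' r (p i) h else A y $ i $ p i) =
      A' r (p r) h * (\<Prod>j\<in>UNIV - {r}. A y $ j $ p j)" for r h p
    by (subst prod.remove[of UNIV r]) auto
  have "((\<lambda>x. \<Sum>p\<in>?P. of_int (sign p) * (\<Prod>i\<in>UNIV. A x $ i $ p i)) has_derivative
    (\<lambda>h. \<Sum>p\<in>?P. of_int (sign p) * (\<Sum>r\<in>UNIV. A' r (p r) h * (\<Prod>j\<in>UNIV - {r}. A y $ j $ p j)))) (at y)"
    by (intro has_derivative_sum has_derivative_mult_right has_derivative_prod assms)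
  moreover have "(\<Sum>p\<in>?P. of_int (sign p) * (\<Sum>r\<in>UNIV. A' r (p r) h * (\<Prod>j\<in>UNIV - {r}. A y $ j $ p j))) =
     (\<Sum>r\<in>UNIV. det_v (\<chi> i j. if i = r then A' r j h else A y $ i $ j))" for h
    unfolding Determinants.det_def vec_lambda_beta sum_distrib_left
    by (subst sum.swap) (simp only: *)
  ultimately show ?thesis unfolding Determinants.det_def by simp
qed

lemma matrix_inv_works:
  fixes A :: "real^'n^'n"
  assumes "det_v A \<noteq> 0"
  shows "A ** matrix_inv A = Finite_Cartesian_Product.mat 1" "matrix_inv A ** A = Finite_Cartesian_Product.mat 1"
proof -
  have "invertible A" using assms invertible_det_nz by blast
  hence "A ** matrix_inv A = Finite_Cartesian_Product.mat 1 \<and> matrix_inv A ** A = Finite_Cartesian_Product.mat 1"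
    unfolding matrix_inv_def invertible_def by (rule someI_ex)
  thus "A ** matrix_inv A = Finite_Cartesian_Product.mat 1" "matrix_inv A ** A = Finite_Cartesian_Product.mat 1" by auto
qed

text \<open>Entries of the inverse become quotients of determinants, so their differentiability
  reduces to that of \<open>det_v\<close>.\<close>

lemma matrix_inv_cramer:
  fixes A :: "real^'n^'n"
  assumes "det_v A \<noteq> 0"
  shows "matrix_inv A $ i $ j = det_v (\<chi> k l. if l = i then axis j 1 $ k else A $ k $ l) / det_v A"
proof -
  have "A *v (matrix_inv A *v axis j 1) = axis j 1"
    by (simp add: matrix_vector_mul_assoc matrix_inv_works[OF assms])
  hence "matrix_inv A *v axis j 1 = (\<chi> k. det_v (\<chi> i l. if l = k then axis j 1 $ i else A $ i $ l) / det_v A)"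
    using cramer[OF assms] by blast
  hence "(matrix_inv A *v axis j 1) $ i = det_v (\<chi> k l. if l = i then axis j 1 $ k else A $ k $ l) / det_v A"
    by simp
  thus ?thesis by (simp add: matrix_vector_mul_component inner_axis row_def)
qed

lemma differentiable_det:
  fixes A :: "'a::real_normed_vector \<Rightarrow> real^'n^'n"
  assumes "\<And>i j. (\<lambda>x. A x $ i $ j) differentiable (at y)"
  shows "(\<lambda>x. det_v (A x)) differentiable (at y)"
  using has_derivative_det[of A "\<lambda>i j. frechet_derivative (\<lambda>x. A x $ i $ j) (at y)" y] assms
  unfolding differentiable_def frechet_derivative_works[symmetric] by blast

text \<open>Positivity of the product records both that the determinant stays nonzero and that its
  sign is constant; the sign is needed to differentiate absolute values of Jacobian
  determinants.\<close>

lemma eventually_det_nz: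
  fixes A :: "'a::real_normed_vector \<Rightarrow> real^'n^'n"
  assumes "\<And>i j. (\<lambda>x. A x $ i $ j) differentiable (at y)" "det_v (A y) \<noteq> 0"
  shows "\<exists>S. open S \<and> y \<in> S \<and> (\<forall>x\<in>S. det_v (A x) * det_v (A y) > 0)"
proof -
  have "isCont (\<lambda>x. det_v (A x)) y"
    using differentiable_det[OF assms(1)] differentiable_imp_continuous_within by blast
  hence "isCont (\<lambda>x. det_v (A x) * det_v (A y)) y" by (intro continuous_intros)
  hence lim: "((\<lambda>x. det_v (A x) * det_v (A y)) \<longlongrightarrow> det_v (A y) * det_v (A y)) (nhds y)"
    using tendsto_at_iff_tendsto_nhds[of "\<lambda>x. det_v (A x) * det_v (A y)" y] by (simp only: isCont_def)
  have pos: "det_v (A y) * det_v (A y) > 0" using assms(2) by (auto simp: zero_less_mult_iff linorder_neq_iff)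
  from order_tendstoD(1)[OF lim pos] show ?thesis unfolding eventually_nhds .
qed

lemma differentiable_matrix_inv:
  fixes A :: "'a::real_normed_vector \<Rightarrow> real^'n^'n"
  assumes A: "\<And>i j. (\<lambda>x. A x $ i $ j) differentiable (at y)" and nz: "det_v (A y) \<noteq> 0"
  shows "(\<lambda>x. matrix_inv (A x) $ i $ j) differentiable (at y)"
proof -
  obtain S where S: "open S" "y \<in> S" "\<And>x. x \<in> S \<Longrightarrow> det_v (A x) * det_v (A y) > 0"
    using eventually_det_nz[of A y, OF A nz] by metis
  have "(\<lambda>x. det_v (\<chi> k l. if l = i then axis j 1 $ k else A x $ k $ l) / det_v (A x)) differentiable (at y)"
  proof (intro differentiable_divide differentiable_det A nz)
    fix k l
    show "(\<lambda>x. (\<chi> k l. if l = i then axis j 1 $ k else A x $ k $ l) $ k $ l) differentiable at y"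
      using A by (cases "l = i") auto
  qed
  thus ?thesis
  proof (rule differentiable_cong_open[OF S(1,2), rotated])
    fix x assume "x \<in> S"
    hence "det_v (A x) \<noteq> 0" using S(3) by force
    thus "det_v (\<chi> k l. if l = i then axis j 1 $ k else A x $ k $ l) / det_v (A x) = matrix_inv (A x) $ i $ j"
      by (simp add: matrix_inv_cramer)
  qed
qed

lemma differentiable_sqrt:
  fixes f :: "'a::real_normed_vector \<Rightarrow> real"
  assumes "f differentiable (at y)" "f y \<noteq> 0"
  shows "(\<lambda>x. sqrt (f x)) differentiable (at y)"
proof -
  have "\<exists>D. DERIV sqrt (f y) :> D"
    \<comment> \<open>Negative values are covered too: \<open>sqrt\<close> is an odd function on the
      reals, whence the second branch.\<close>
    by (rule exI[of _ "if f y > 0 then inverse (sqrt (f y)) / 2 else - inverse (sqrt (f y)) / 2"],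
        rule DERIV_real_sqrt_generic) (use assms in auto)
  then obtain D where "(sqrt has_derivative (\<lambda>h. D * h)) (at (f y))" by (auto simp: has_field_derivative_def)
  from has_derivative_compose[OF assms(1)[unfolded frechet_derivative_works] this]
  show ?thesis by (auto simp: differentiable_def)
qed

text \<open>The operator \<^const>\<open>laplace_beltrami\<close> in a fixed chart in which the Gram matrices are \<open>G\<close>.\<close>

definition lb :: "(real^'n \<Rightarrow> real^'n^'n) \<Rightarrow> (real^'n \<Rightarrow> 'b::real_normed_vector) \<Rightarrow> real^'n \<Rightarrow> 'b" where
  "lb G u y = (1 / sqrt (det_v (G y))) *\<^sub>R (\<Sum>i\<in>UNIV. partial_deriv i
     (\<lambda>x. \<Sum>j\<in>UNIV. (sqrt (det_v (G x)) * matrix_inv (G x) $ i $ j) *\<^sub>R partial_deriv j u x) y)"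

section \<open>Algebraic rules for the operator in one chart\<close>

lemma partial_deriv_apply: "(f has_derivative D) (at x) \<Longrightarrow> partial_deriv i f x = D (axis i 1)"
  unfolding partial_deriv_def by (rule frechet_derivative_apply)

lemma partial_deriv_cong_open:
  "open S \<Longrightarrow> x \<in> S \<Longrightarrow> (\<And>y. y \<in> S \<Longrightarrow> f y = g y) \<Longrightarrow> partial_deriv i f x = partial_deriv i g x"
  unfolding partial_deriv_def using frechet_derivative_cong_open by metis

lemma axis_Basis: "axis i (1::real) \<in> Basis"
  by (auto simp: Basis_vec_def)

lemma frechet_derivative_partial:
  fixes f :: "real^'n \<Rightarrow> 'b::real_normed_vector"
  assumes "f differentiable (at x)"
  shows "frechet_derivative f (at x) v = (\<Sum>k\<in>UNIV. v $ k *\<^sub>R partial_deriv k f x)"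
proof -
  have lin: "linear (frechet_derivative f (at x))" by (rule linear_frechet_derivative[OF assms])
  have "v = (\<Sum>k\<in>UNIV. v $ k *\<^sub>R axis k 1)"
    using basis_expansion[of v] by (simp add: scalar_mult_eq_scaleR)
  hence "frechet_derivative f (at x) v = frechet_derivative f (at x) (\<Sum>k\<in>UNIV. v $ k *\<^sub>R axis k 1)" by simp
  also have "\<dots> = (\<Sum>k\<in>UNIV. v $ k *\<^sub>R partial_deriv k f x)"
    by (simp add: linear_sum[OF lin] linear_cmul[OF lin] partial_deriv_def)
  finally show ?thesis .
qed

lemma Ck2_differentiable:
  assumes "Ck_on 2 S f" "x \<in> S"
  shows "f differentiable (at x)" "partial_deriv i f differentiable (at x)"
  using assms axis_Basis[of i] by (auto simp: numeral_2_eq_2 partial_deriv_def[abs_def])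

definition metric_at :: "(real^'n \<Rightarrow> real^'n^'n) \<Rightarrow> real^'n \<Rightarrow> bool" where
  "metric_at G y \<longleftrightarrow> (\<forall>i j. (\<lambda>x. G x $ i $ j) differentiable (at y)) \<and> det_v (G y) \<noteq> 0"

text \<open>Coefficients of the first-order part that appears when the divergence is
  expanded.\<close>

definition lb_coeff :: "(real^'n \<Rightarrow> real^'n^'n) \<Rightarrow> real^'n \<Rightarrow> 'n \<Rightarrow> real" where
  "lb_coeff G y j = (1 / sqrt (det_v (G y))) *
    (\<Sum>i\<in>UNIV. partial_deriv i (\<lambda>x. sqrt (det_v (G x)) * matrix_inv (G x) $ i $ j) y)"

lemma metric_at_coeff_differentiable:
  assumes "metric_at G y"
  shows "(\<lambda>x. sqrt (det_v (G x)) * matrix_inv (G x) $ i $ j) differentiable (at y)"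
  using assms unfolding metric_at_def
  by (intro differentiable_mult differentiable_sqrt differentiable_det differentiable_matrix_inv) auto

text \<open>The non-divergence form. Linearity and the product rule for \<open>lb\<close> are read
  off from it.\<close>

lemma lb_expand:
  assumes G: "metric_at G y" and S: "open S" "y \<in> S" and u: "Ck_on 2 S u"
  shows "lb G u y = (\<Sum>i\<in>UNIV. \<Sum>j\<in>UNIV. matrix_inv (G y) $ i $ j *\<^sub>R partial_deriv i (partial_deriv j u) y) +
    (\<Sum>j\<in>UNIV. lb_coeff G y j *\<^sub>R partial_deriv j u y)"
proof -
  define c where "c i j x = sqrt (det_v (G x)) * matrix_inv (G x) $ i $ j" for i j x
  have nz: "sqrt (det_v (G y)) \<noteq> 0" using G by (simp add: metric_at_def)
  have "partial_deriv i (\<lambda>x. \<Sum>j\<in>UNIV. c i j x *\<^sub>R partial_deriv j u x) y =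
     (\<Sum>j\<in>UNIV. c i j y *\<^sub>R partial_deriv i (partial_deriv j u) y + partial_deriv i (c i j) y *\<^sub>R partial_deriv j u y)" for i
  proof -
    have "((\<lambda>x. \<Sum>j\<in>UNIV. c i j x *\<^sub>R partial_deriv j u x) has_derivative
      (\<lambda>h. \<Sum>j\<in>UNIV. c i j y *\<^sub>R frechet_derivative (partial_deriv j u) (at y) h +
        frechet_derivative (c i j) (at y) h *\<^sub>R partial_deriv j u y)) (at y)"
      using metric_at_coeff_differentiable[OF G] Ck2_differentiable(2)[OF u S(2)]
      by (intro has_derivative_sum has_derivative_scaleR) (auto simp: c_def[abs_def] frechet_derivative_works)
    thus ?thesis by (simp add: partial_deriv_apply) (simp add: partial_deriv_def)
  qed
  hence "lb G u y = (1 / sqrt (det_v (G y))) *\<^sub>R (\<Sum>i\<in>UNIV. \<Sum>j\<in>UNIV. c i j y *\<^sub>R partial_deriv i (partial_deriv j u) y +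
      partial_deriv i (c i j) y *\<^sub>R partial_deriv j u y)"
    unfolding lb_def c_def by simp
  also have "\<dots> = (\<Sum>i\<in>UNIV. \<Sum>j\<in>UNIV. ((1 / sqrt (det_v (G y))) * c i j y) *\<^sub>R partial_deriv i (partial_deriv j u) y) +
    (\<Sum>i\<in>UNIV. \<Sum>j\<in>UNIV. ((1 / sqrt (det_v (G y))) * partial_deriv i (c i j) y) *\<^sub>R partial_deriv j u y)"
    by (simp add: sum.distrib scaleR_sum_right scaleR_add_right)
  also have "(\<Sum>i\<in>UNIV. \<Sum>j\<in>UNIV. ((1 / sqrt (det_v (G y))) * partial_deriv i (c i j) y) *\<^sub>R partial_deriv j u y) =
     (\<Sum>j\<in>UNIV. lb_coeff G y j *\<^sub>R partial_deriv j u y)"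
    unfolding lb_coeff_def c_def[abs_def]
    by (subst sum.swap) (simp add: sum_distrib_left scaleR_sum_left)
  also have "(\<Sum>i\<in>UNIV. \<Sum>j\<in>UNIV. ((1 / sqrt (det_v (G y))) * c i j y) *\<^sub>R partial_deriv i (partial_deriv j u) y) =
     (\<Sum>i\<in>UNIV. \<Sum>j\<in>UNIV. matrix_inv (G y) $ i $ j *\<^sub>R partial_deriv i (partial_deriv j u) y)"
    using nz by (simp add: c_def)
  finally show ?thesis .
qed

lemma partial_deriv_bounded_linear:
  assumes "bounded_linear L" "f differentiable (at x)"
  shows "partial_deriv i (\<lambda>x. L (f x)) x = L (partial_deriv i f x)"
  using partial_deriv_apply[OF bounded_linear.has_derivative[OF assms(1) assms(2)[unfolded frechet_derivative_works]]]
  by (simp add: partial_deriv_def)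

lemma lb_bounded_linear:
  assumes G: "metric_at G y" and S: "open S" "y \<in> S" and u: "Ck_on 2 S u" and L: "bounded_linear L"
  shows "lb G (\<lambda>x. L (u x)) y = L (lb G u y)"
proof -
  interpret L: bounded_linear L by (rule L)
  have Lu: "Ck_on 2 S (\<lambda>x. L (u x))" by (rule Ck_on_linear_compose[OF S(1) L u])
  have "partial_deriv j (\<lambda>x. L (u x)) x = L (partial_deriv j u x)" if "x \<in> S" for j x
    by (rule partial_deriv_bounded_linear[OF L Ck2_differentiable(1)[OF u that]])
  hence 1: "partial_deriv i (partial_deriv j (\<lambda>x. L (u x))) y = L (partial_deriv i (partial_deriv j u) y)" for i j
    using partial_deriv_cong_open[OF S, of "partial_deriv j (\<lambda>x. L (u x))" "\<lambda>x. L (partial_deriv j u x)" i]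
      partial_deriv_bounded_linear[OF L Ck2_differentiable(2)[OF u S(2)]] by simp
  have 2: "partial_deriv j (\<lambda>x. L (u x)) y = L (partial_deriv j u y)" for j
    by (rule partial_deriv_bounded_linear[OF L Ck2_differentiable(1)[OF u S(2)]])
  show ?thesis unfolding lb_expand[OF G S u] lb_expand[OF G S Lu] 1 2
    by (simp add: L.add L.sum L.scaleR)
qed

lemma lb_const: 
  assumes G: "metric_at G y"
  shows "lb G (\<lambda>_. c) y = 0"
proof -
  have "partial_deriv j (\<lambda>_::real^'a. c) = (\<lambda>_. 0)" "partial_deriv j (\<lambda>_::real^'a. 0::'b) = (\<lambda>_. 0)" for j
    by (auto simp: partial_deriv_def[abs_def] frechet_derivative_const)
  thus ?thesis using lb_expand[OF G open_UNIV UNIV_I Ck_on_const[of 2 UNIV c]] by simp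
qed

lemma partial_deriv_sum:
  assumes "\<And>i. i \<in> I \<Longrightarrow> f i differentiable (at x)"
  shows "partial_deriv j (\<lambda>x. \<Sum>i\<in>I. f i x) x = (\<Sum>i\<in>I. partial_deriv j (f i) x)"
proof -
  have "((\<lambda>x. \<Sum>i\<in>I. f i x) has_derivative (\<lambda>h. \<Sum>i\<in>I. frechet_derivative (f i) (at x) h)) (at x)"
    using assms by (intro has_derivative_sum) (simp add: frechet_derivative_works)
  thus ?thesis by (simp add: partial_deriv_apply) (simp add: partial_deriv_def)
qed

lemma lb_sum:
  assumes G: "metric_at G y" and S: "open S" "y \<in> S" and u: "\<And>i. i \<in> I \<Longrightarrow> Ck_on 2 S (u i)" and I: "finite I"
  shows "lb G (\<lambda>x. \<Sum>i\<in>I. u i x) y = (\<Sum>i\<in>I. lb G (u i) y)"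
proof -
  have us: "Ck_on 2 S (\<lambda>x. \<Sum>i\<in>I. u i x)" by (intro Ck_on_sum S u)
  have 1: "partial_deriv j (\<lambda>x. \<Sum>i\<in>I. u i x) x = (\<Sum>i\<in>I. partial_deriv j (u i) x)" if "x \<in> S" for x j
    by (rule partial_deriv_sum) (use Ck2_differentiable(1)[OF u that] in auto)
  have 2: "partial_deriv k (partial_deriv j (\<lambda>x. \<Sum>i\<in>I. u i x)) y = (\<Sum>i\<in>I. partial_deriv k (partial_deriv j (u i)) y)" for j k
  proof -
    have "partial_deriv k (partial_deriv j (\<lambda>x. \<Sum>i\<in>I. u i x)) y = partial_deriv k (\<lambda>x. \<Sum>i\<in>I. partial_deriv j (u i) x) y"
      by (rule partial_deriv_cong_open[OF S 1])
    also have "\<dots> = (\<Sum>i\<in>I. partial_deriv k (partial_deriv j (u i)) y)"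
      by (rule partial_deriv_sum) (use Ck2_differentiable(2)[OF u S(2)] in auto)
    finally show ?thesis .
  qed
  have "(\<Sum>i\<in>I. lb G (u i) y) = (\<Sum>i\<in>I. (\<Sum>k\<in>UNIV. \<Sum>j\<in>UNIV. matrix_inv (G y) $ k $ j *\<^sub>R partial_deriv k (partial_deriv j (u i)) y) +
    (\<Sum>j\<in>UNIV. lb_coeff G y j *\<^sub>R partial_deriv j (u i) y))"
    by (intro sum.cong refl lb_expand[OF G S u])
  also have "\<dots> = (\<Sum>k\<in>UNIV. \<Sum>j\<in>UNIV. \<Sum>i\<in>I. matrix_inv (G y) $ k $ j *\<^sub>R partial_deriv k (partial_deriv j (u i)) y) +
    (\<Sum>j\<in>UNIV. \<Sum>i\<in>I. lb_coeff G y j *\<^sub>R partial_deriv j (u i) y)"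
    unfolding sum.distrib by (simp add: sum.swap[of _ _ I])
  also have "\<dots> = lb G (\<lambda>x. \<Sum>i\<in>I. u i x) y"
    unfolding lb_expand[OF G S us] 2 1[OF S(2)] by (simp add: scaleR_sum_right)
  finally show ?thesis by simp
qed

text \<open>The product rule of a second-order operator without zeroth-order term: of the second
  derivatives of the product, two gradient terms remain, and they coincide because the inverse Gram
  matrix is symmetric.\<close>

lemma lb_mult:
  fixes u v :: "real^'n \<Rightarrow> complex"
  assumes G: "metric_at G y" and sym: "transpose (G y) = G y"
    and S: "open S" "y \<in> S" and u: "Ck_on 2 S u" and v: "Ck_on 2 S v"
  shows "lb G (\<lambda>x. u x * v x) y = u y * lb G v y + lb G u y * v y +
    2 * (\<Sum>i\<in>UNIV. \<Sum>j\<in>UNIV. matrix_inv (G y) $ i $ j *\<^sub>R (partial_deriv i u y * partial_deriv j v y))"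
proof -
  have pd: "partial_deriv i (\<lambda>x. f x * g x) x = f x * partial_deriv i g x + partial_deriv i f x * g x"
    if "f differentiable (at x)" "g differentiable (at x)" for f g :: "real^'n \<Rightarrow> complex" and i x
  proof -
    have "((\<lambda>x. f x * g x) has_derivative (\<lambda>h. f x * frechet_derivative g (at x) h + frechet_derivative f (at x) h * g x)) (at x)"
      using that by (intro has_derivative_mult) (simp_all add: frechet_derivative_works)
    thus ?thesis by (simp add: partial_deriv_apply) (simp add: partial_deriv_def)
  qed
  note du = Ck2_differentiable[OF u] and dv = Ck2_differentiable[OF v]
  have uv: "Ck_on 2 S (\<lambda>x. u x * v x)" by (intro Ck_on_mult S u v)
  have 1: "partial_deriv j (\<lambda>x. u x * v x) x = u x * partial_deriv j v x + partial_deriv j u x * v x" if "x \<in> S" for j x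
    using du(1)[OF that] dv(1)[OF that] by (rule pd)
  have 2: "partial_deriv i (partial_deriv j (\<lambda>x. u x * v x)) y =
     u y * partial_deriv i (partial_deriv j v) y + partial_deriv i u y * partial_deriv j v y +
     (partial_deriv j u y * partial_deriv i v y + partial_deriv i (partial_deriv j u) y * v y)" for i j
  proof -
    have "partial_deriv i (partial_deriv j (\<lambda>x. u x * v x)) y =
       partial_deriv i (\<lambda>x. u x * partial_deriv j v x + partial_deriv j u x * v x) y"
      by (rule partial_deriv_cong_open[OF S 1])
    also have "\<dots> = partial_deriv i (\<lambda>x. u x * partial_deriv j v x) y + partial_deriv i (\<lambda>x. partial_deriv j u x * v x) y"
    proof -
      have "((\<lambda>x. u x * partial_deriv j v x + partial_deriv j u x * v x) has_derivative
        (\<lambda>h. frechet_derivative (\<lambda>x. u x * partial_deriv j v x) (at y) h + frechet_derivative (\<lambda>x. partial_deriv j u x * v x) (at y) h)) (at y)"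
        using du[OF S(2)] dv[OF S(2)]
        by (intro has_derivative_add) (auto simp flip: frechet_derivative_works intro!: differentiable_mult)
      thus ?thesis by (simp add: partial_deriv_apply) (simp add: partial_deriv_def)
    qed
    also have "\<dots> = u y * partial_deriv i (partial_deriv j v) y + partial_deriv i u y * partial_deriv j v y +
     (partial_deriv j u y * partial_deriv i v y + partial_deriv i (partial_deriv j u) y * v y)"
      using du[OF S(2)] dv[OF S(2)] by (simp add: pd)
    finally show ?thesis .
  qed
  define a where "a i j = matrix_inv (G y) $ i $ j" for i j
  have nz: "det_v (G y) \<noteq> 0" using G by (simp add: metric_at_def)
  have "transpose (matrix_inv (G y)) = matrix_inv (G y)"
  proof -
    let ?I = "matrix_inv (G y)"
    have "transpose ?I ** G y = Finite_Cartesian_Product.mat 1"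
      using matrix_inv_works(1)[OF nz] sym by (metis matrix_transpose_mul transpose_mat)
    hence "transpose ?I ** (G y ** ?I) = ?I" by (simp add: matrix_mul_assoc)
    thus ?thesis by (simp add: matrix_inv_works(1)[OF nz])
  qed
  hence asym: "a i j = a j i" for i j
    proof -
    have "transpose (matrix_inv (G y)) $ i $ j = matrix_inv (G y) $ j $ i" by (simp add: transpose_def)
    thus ?thesis using \<open>transpose (matrix_inv (G y)) = matrix_inv (G y)\<close> by (simp add: a_def)
  qed
  have sw: "(\<Sum>i\<in>UNIV. \<Sum>j\<in>UNIV. a i j *\<^sub>R (partial_deriv j u y * partial_deriv i v y)) =
     (\<Sum>i\<in>UNIV. \<Sum>j\<in>UNIV. a i j *\<^sub>R (partial_deriv i u y * partial_deriv j v y))"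
    by (subst sum.swap) (intro sum.cong refl arg_cong2[of _ _ _ _ "(*\<^sub>R)"] asym)
  have e1: "(\<Sum>i\<in>UNIV. \<Sum>j\<in>UNIV. a i j *\<^sub>R (p * X i j + P i j + (Q i j + Y i j * q))) =
      p * (\<Sum>i\<in>UNIV. \<Sum>j\<in>UNIV. a i j *\<^sub>R X i j) + (\<Sum>i\<in>UNIV. \<Sum>j\<in>UNIV. a i j *\<^sub>R P i j) +
      ((\<Sum>i\<in>UNIV. \<Sum>j\<in>UNIV. a i j *\<^sub>R Q i j) + (\<Sum>i\<in>UNIV. \<Sum>j\<in>UNIV. a i j *\<^sub>R Y i j) * q)"
    for p q :: complex and X P Q Y
    by (simp add: scaleR_add_right sum.distrib sum_distrib_left sum_distrib_right)
  have e2: "(\<Sum>j\<in>UNIV. lb_coeff G y j *\<^sub>R (p * X j + Y j * q)) =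
      p * (\<Sum>j\<in>UNIV. lb_coeff G y j *\<^sub>R X j) + (\<Sum>j\<in>UNIV. lb_coeff G y j *\<^sub>R Y j) * q"
    for p q :: complex and X Y
    by (simp add: scaleR_add_right sum.distrib sum_distrib_left sum_distrib_right)
  show ?thesis
    unfolding lb_expand[OF G S uv] lb_expand[OF G S u] lb_expand[OF G S v] 2 1[OF S(2)] a_def[symmetric] e1 e2 sw
    by (simp only: distrib_left distrib_right mult_2) (simp only: ac_simps)
qed

section \<open>Invariance under changes of coordinates\<close>

lemma det_row_swap:
  fixes A :: "real^'n^'n"
  assumes "i \<noteq> r"
  shows "det_v (\<chi> k. if k = r then v else if k = i then w else A $ k) =
    - det_v (\<chi> k. if k = r then w else if k = i then v else A $ k)"
proof -
  let ?A = "\<chi> k. if k = r then w else if k = i then v else A $ k"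
  let ?p = "Transposition.transpose i r"
  have "det_v (\<chi> k. ?A $ ?p k) = of_int (sign ?p) * det_v ?A"
    by (rule Determinants.det_permute_rows) (simp add: permutes_swap_id)
  moreover have "(\<chi> k. ?A $ ?p k) = (\<chi> k. if k = r then v else if k = i then w else A $ k)"
    using assms by (auto simp: Finite_Cartesian_Product.vec_eq_iff Transposition.transpose_def)
  ultimately show ?thesis using assms by (simp add: sign_swap_id)
qed

text \<open>Cramer's rule for rows: \<open>v\<close> is the combination of the rows of
  \<open>K\<close> with coefficients \<open>z\<close>, and only the multiple of row \<open>i\<close>
  contributes.\<close>

lemma det_replace_row:
  fixes K :: "real^'n^'n"
  assumes "v = transpose K *v z"
  shows "det_v (\<chi> k. if k = i then v else K $ k) = z $ i * det_v K"
proof -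
  have v: "v = (\<Sum>k\<in>UNIV. z $ k *s Finite_Cartesian_Product.row k K)"
    unfolding assms matrix_mult_sum by (simp add: column_transpose)
  have r: "(\<chi> k. if k = i then v else K $ k) = (\<chi> k. if k = i then v else Finite_Cartesian_Product.row k K)"
    by (intro arg_cong[where f=vec_lambda] ext) (simp add: Finite_Cartesian_Product.vec_eq_iff Finite_Cartesian_Product.row_def)
  show ?thesis using cramer_lemma_transpose[of i z K] by (simp only: r v[symmetric])
qed

lemma sqrt_square_mult: "sqrt (a\<^sup>2 * b) = \<bar>a\<bar> * sqrt b"
  by (simp add: real_sqrt_mult)

text \<open>With \<open>Y\<close> the field \<open>sqrt (det G') G'\<^sup>-\<^sup>1 grad u\<close> in the target coordinates, the corresponding
  field in the source coordinates has, by Cramer's rule, the components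
  \<open>\<plusminus> det (K with row i replaced by Y)\<close>, where \<open>K\<close> is the transposed Jacobian. In its divergence the
  terms with second derivatives of \<open>\<Phi>\<close> cancel, since the determinant is antisymmetric in the rows
  and the second derivatives are symmetric; the remaining terms form a trace.\<close>

lemma lb_invariant_real:
  fixes \<Phi> :: "real^'n \<Rightarrow> real^'n" and u :: "real^'n \<Rightarrow> real"
  assumes S: "open S" "y \<in> S" and S': "open S'" "\<And>x. x \<in> S \<Longrightarrow> \<Phi> x \<in> S'"
    and \<Phi>: "Ck_on 2 S \<Phi>" and u: "Ck_on 2 S' u"
    and G': "\<And>x. x \<in> S' \<Longrightarrow> metric_at G' x" and G: "\<And>x. x \<in> S \<Longrightarrow> det_v (G x) \<noteq> 0"
    and iso: "\<And>x. x \<in> S \<Longrightarrow> G x = transpose (jacobian \<Phi> (at x)) ** G' (\<Phi> x) ** jacobian \<Phi> (at x)"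
  shows "lb G (\<lambda>x. u (\<Phi> x)) y = lb G' u (\<Phi> y)"
proof -
  define J where "J x = jacobian \<Phi> (at x)" for x
  define K where "K x = transpose (J x)" for x
  define w' where "w' x = sqrt (det_v (G' x))" for x
  define Y' where "Y' k x = (\<Sum>j\<in>UNIV. (w' x * matrix_inv (G' x) $ k $ j) * partial_deriv j u x)" for k x
  define Y where "Y x = (\<chi> k. Y' k (\<Phi> x))" for x
  have d\<Phi>: "\<Phi> differentiable (at x)" if "x \<in> S" for x using Ck2_differentiable(1)[OF \<Phi> that] .
  define \<Phi>c where "\<Phi>c k x = \<Phi> x $ k" for k x
  have c\<Phi>: "Ck_on 2 S (\<Phi>c k)" for k
    unfolding \<Phi>c_def[abs_def] by (rule Ck_on_linear_compose[OF S(1) bounded_linear_vec_nth \<Phi>])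
  have J_ent: "J x $ k $ j = partial_deriv j (\<Phi>c k) x" if "x \<in> S" for x k j
  proof -
    have "J x $ k $ j = frechet_derivative \<Phi> (at x) (axis j 1) $ k"
      by (simp add: J_def jacobian_def matrix_def)
    also have "\<dots> = partial_deriv j (\<Phi>c k) x"
      unfolding \<Phi>c_def[abs_def] using partial_deriv_bounded_linear[OF bounded_linear_vec_nth d\<Phi>[OF that]]
      by (simp add: partial_deriv_def)
    finally show ?thesis .
  qed
  have K_ent: "K x $ l $ k = partial_deriv l (\<Phi>c k) x" if "x \<in> S" for x k l
    using J_ent[OF that] by (simp add: K_def transpose_def)
  have detG: "det_v (G x) = (det_v (J x))\<^sup>2 * det_v (G' (\<Phi> x))" if "x \<in> S" for x
    unfolding iso[OF that] J_def by (simp add: Determinants.det_mul power2_eq_square)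
  have detJ: "det_v (J x) \<noteq> 0" if "x \<in> S" for x using G[OF that] detG[OF that] by auto
  have detK: "det_v (K x) = det_v (J x)" for x by (simp add: K_def)
  have grad: "partial_deriv j (\<lambda>x. u (\<Phi> x)) x = (\<Sum>k\<in>UNIV. J x $ k $ j * partial_deriv k u (\<Phi> x))"
    if x: "x \<in> S" for x j
  proof -
    have du: "u differentiable (at (\<Phi> x))" using Ck2_differentiable(1)[OF u S'(2)[OF x]] .
    have "((\<lambda>x. u (\<Phi> x)) has_derivative (\<lambda>h. frechet_derivative u (at (\<Phi> x)) (frechet_derivative \<Phi> (at x) h))) (at x)"
      using has_derivative_compose[OF d\<Phi>[OF x, unfolded frechet_derivative_works] du[unfolded frechet_derivative_works]] .
    hence "partial_deriv j (\<lambda>x. u (\<Phi> x)) x = frechet_derivative u (at (\<Phi> x)) (frechet_derivative \<Phi> (at x) (axis j 1))"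
      by (rule partial_deriv_apply)
    also have "\<dots> = (\<Sum>k\<in>UNIV. frechet_derivative \<Phi> (at x) (axis j 1) $ k * partial_deriv k u (\<Phi> x))"
      using frechet_derivative_partial[OF du] by simp
    finally show ?thesis by (simp add: J_def jacobian_def matrix_def)
  qed
  define X where "X i x = (\<Sum>j\<in>UNIV. (sqrt (det_v (G x)) * matrix_inv (G x) $ i $ j) * partial_deriv j (\<lambda>x. u (\<Phi> x)) x)" for i x
  obtain S1 where S1: "open S1" "y \<in> S1" "S1 \<subseteq> S" "\<And>x. x \<in> S1 \<Longrightarrow> det_v (J x) * det_v (J y) > 0"
  proof -
    have dJ: "(\<lambda>x. J x $ i $ j) differentiable (at y)" for i j
    proof (rule differentiable_cong_open[OF S, rotated])
      show "partial_deriv j (\<Phi>c i) differentiable (at y)" by (rule Ck2_differentiable(2)[OF c\<Phi> S(2)])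
    qed (simp add: J_ent)
    obtain S0 where "open S0" "y \<in> S0" "\<forall>x\<in>S0. det_v (J x) * det_v (J y) > 0"
      using eventually_det_nz[of J y, OF dJ detJ[OF S(2)]] by metis
    thus ?thesis using that[of "S0 \<inter> S"] S by auto
  qed
  \<comment> \<open>The sign of the Jacobian determinant is constant on \<open>S1\<close>, so its
    absolute value may be replaced by \<sigma> times the determinant, which can be differentiated as
    a multilinear form.\<close>
  define \<sigma> where "\<sigma> = sgn (det_v (J y))"
  have abs_det: "\<bar>det_v (J x)\<bar> = \<sigma> * det_v (J x)" if "x \<in> S1" for x
    using S1(4)[OF that] by (auto simp: \<sigma>_def zero_less_mult_iff)
  have X_eq: "X i x = \<sigma> * det_v (\<chi> k. if k = i then Y x else K x $ k)" if x1: "x \<in> S1" for i x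
  proof -
    have x: "x \<in> S" using S1(3) x1 by auto
    define g where "g = (\<chi> j. partial_deriv j (\<lambda>x. u (\<Phi> x)) x)"
    define g' where "g' = (\<chi> j. partial_deriv j u (\<Phi> x))"
    have "g = transpose (J x) *v g'"
      by (simp add: Finite_Cartesian_Product.vec_eq_iff g_def g'_def grad[OF x] matrix_vector_mult_def transpose_def)
    note gg = this
    \<comment> \<open>The gradient in source coordinates; the isometry relation makes its image
      under \<open>J x\<close> the gradient in target coordinates.\<close>
    define z where "z = matrix_inv (G x) *v g"
    have G'nz: "det_v (G' (\<Phi> x)) \<noteq> 0" using G' S'(2)[OF x] by (auto simp: metric_at_def)
    have Gz: "G x *v z = g" unfolding z_def by (simp add: matrix_vector_mul_assoc matrix_inv_works[OF G[OF x]])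
    have "transpose (J x) *v (G' (\<Phi> x) *v (J x *v z)) = transpose (J x) *v g'"
      using Gz unfolding iso[OF x] J_def[symmetric] gg[symmetric] by (simp add: matrix_vector_mul_assoc matrix_mul_assoc)
    moreover have "inj ((*v) (transpose (J x)))"
      using detJ[OF x] by (metis Determinants.det_transpose invertible_det_nz invertible_eq_bij bij_is_inj)
    ultimately have G'Jz: "G' (\<Phi> x) *v (J x *v z) = g'" by (simp add: inj_def)
    have Jz: "J x *v z = matrix_inv (G' (\<Phi> x)) *v g'"
      unfolding G'Jz[symmetric] matrix_vector_mul_assoc[of "matrix_inv (G' (\<Phi> x))" "G' (\<Phi> x)"]
      by (simp add: matrix_inv_works[OF G'nz])
    have sG: "sqrt (det_v (G x)) = \<bar>det_v (J x)\<bar> * w' (\<Phi> x)"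
      unfolding detG[OF x] w'_def by (rule sqrt_square_mult)
    have Yz: "Y x = transpose (K x) *v (w' (\<Phi> x) *s z)"
    proof -
      have "Y x = w' (\<Phi> x) *s (matrix_inv (G' (\<Phi> x)) *v g')"
        unfolding Finite_Cartesian_Product.vec_eq_iff Y_def Y'_def g'_def matrix_vector_mult_def
        by (simp add: sum_distrib_left mult.assoc)
      thus ?thesis unfolding Jz[symmetric] K_def by (simp add: vector_scalar_commute)
    qed
    have "X i x = sqrt (det_v (G x)) * z $ i"
      unfolding X_def z_def g_def by (simp add: matrix_vector_mult_def sum_distrib_left mult.assoc)
    also have "\<dots> = \<sigma> * ((w' (\<Phi> x) *s z) $ i * det_v (K x))"
      unfolding sG abs_det[OF x1] detK by simp
    also have "\<dots> = \<sigma> * det_v (\<chi> k. if k = i then Y x else K x $ k)"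
      unfolding det_replace_row[OF Yz] ..
    finally show ?thesis .
  qed
  have dY': "Y' k differentiable (at (\<Phi> y))" for k
    unfolding Y'_def[abs_def] w'_def
    using metric_at_coeff_differentiable[OF G'[OF S'(2)[OF S(2)]]] Ck2_differentiable(2)[OF u S'(2)[OF S(2)]]
    by (intro differentiable_sum differentiable_mult) auto
  define B where "B = (\<chi> k m. partial_deriv m (Y' k) (\<Phi> y))"
  define dY where "dY i = (\<chi> k. \<Sum>m\<in>UNIV. B $ k $ m * J y $ m $ i)" for i
  define Q where "Q i r = (\<chi> k. partial_deriv i (partial_deriv r (\<Phi>c k)) y)" for i r
  have Qsym: "Q i r = Q r i" for i r
  proof -
    have "partial_deriv i (partial_deriv r (\<Phi>c k)) y = partial_deriv r (partial_deriv i (\<Phi>c k)) y" for k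
      unfolding partial_deriv_def[abs_def] by (rule symmetric_second_derivative[OF S c\<Phi>])
    thus ?thesis by (simp add: Q_def)
  qed
  have dYc: "((\<lambda>x. Y x $ k) has_derivative (\<lambda>h. frechet_derivative (Y' k) (at (\<Phi> y)) (frechet_derivative \<Phi> (at y) h))) (at y)" for k
    unfolding Y_def vec_lambda_beta
    by (rule has_derivative_compose[OF d\<Phi>[OF S(2), unfolded frechet_derivative_works] dY'[unfolded frechet_derivative_works]])
  have dY_eq: "frechet_derivative (Y' k) (at (\<Phi> y)) (frechet_derivative \<Phi> (at y) (axis i 1)) = dY i $ k" for i k
    unfolding frechet_derivative_partial[OF dY'] by (simp add: dY_def B_def J_def jacobian_def matrix_def mult.commute)
  have dK: "((\<lambda>x. K x $ r $ k) has_derivative frechet_derivative (partial_deriv r (\<Phi>c k)) (at y)) (at y)" for r k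
    by (rule has_derivative_transform_within_open[OF _ S, of "partial_deriv r (\<Phi>c k)"])
       (use Ck2_differentiable(2)[OF c\<Phi> S(2)] in \<open>auto simp: K_ent frechet_derivative_works[symmetric]\<close>)
  \<comment> \<open>Contribution to the i-th partial derivative from differentiating row
    \<open>r\<close>: row \<open>i\<close> carries the field, all other rows those of the transposed
    Jacobian.\<close>
  define D where "D i r = (if r = i then det_v (\<chi> k. if k = i then dY i else K y $ k)
     else det_v (\<chi> k. if k = r then Q i r else if k = i then Y y else K y $ k))" for i r
  have pdX: "partial_deriv i (X i) y = \<sigma> * (\<Sum>r\<in>UNIV. D i r)" for i
  proof -
    define A where "A x = (\<chi> k. if k = i then Y x else K x $ k)" for x
    define A' where "A' r k h = (if r = i then frechet_derivative (Y' k) (at (\<Phi> y)) (frechet_derivative \<Phi> (at y) h)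
      else frechet_derivative (partial_deriv r (\<Phi>c k)) (at y) h)" for r k h
    have "((\<lambda>x. A x $ r $ k) has_derivative A' r k) (at y)" for r k
      using dYc[of k] dK[of r k] unfolding A_def A'_def[abs_def] by (cases "r = i") auto
    from has_derivative_det[of A A', OF this]
    have "((\<lambda>x. det_v (A x)) has_derivative (\<lambda>h. \<Sum>r\<in>UNIV. det_v (\<chi> k j. if k = r then A' r j h else A y $ k $ j))) (at y)" .
    from has_derivative_mult_right[OF this, of \<sigma>]
    have "((\<lambda>x. \<sigma> * det_v (A x)) has_derivative (\<lambda>h. \<sigma> * (\<Sum>r\<in>UNIV. det_v (\<chi> k j. if k = r then A' r j h else A y $ k $ j)))) (at y)" .
    hence pdA: "partial_deriv i (\<lambda>x. \<sigma> * det_v (A x)) y = \<sigma> * (\<Sum>r\<in>UNIV. det_v (\<chi> k j. if k = r then A' r j (axis i 1) else A y $ k $ j))"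
      by (rule partial_deriv_apply)
    have Dr: "det_v (\<chi> k j. if k = r then A' r j (axis i 1) else A y $ k $ j) = D i r" for r
    proof (cases "r = i")
      case True
      thus ?thesis unfolding D_def
        by (auto simp: A'_def A_def dY_eq Finite_Cartesian_Product.vec_eq_iff intro!: arg_cong[of _ _ det_v])
    next
      case False
      have q: "frechet_derivative (partial_deriv r (\<Phi>c j)) (at y) (axis i 1) = Q i r $ j" for j
        by (simp add: Q_def partial_deriv_def)
      show ?thesis unfolding D_def using False
        by (auto simp: A'_def A_def q Finite_Cartesian_Product.vec_eq_iff intro!: arg_cong[of _ _ det_v])
    qed
    have "partial_deriv i (X i) y = partial_deriv i (\<lambda>x. \<sigma> * det_v (A x)) y"
      by (rule partial_deriv_cong_open[OF S1(1,2)]) (simp add: X_eq A_def)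
    thus ?thesis unfolding pdA Dr .
  qed
  \<comment> \<open>The derivative \<open>B\<close> of the target field, conjugated into source
    coordinates; conjugation keeps the trace.\<close>
  define R where "R = matrix_inv (J y) ** (B ** J y)"
  have diag: "D i i = R $ i $ i * det_v (J y)" for i
  proof -
    have "dY i = J y *v Finite_Cartesian_Product.column i R"
    proof -
      have "dY i = Finite_Cartesian_Product.column i (B ** J y)" by (simp add: Finite_Cartesian_Product.vec_eq_iff dY_def Finite_Cartesian_Product.column_def matrix_matrix_mult_def)
      also have "B ** J y = J y ** R"
        unfolding R_def by (simp add: matrix_mul_assoc matrix_inv_works[OF detJ[OF S(2)]])
      also have "Finite_Cartesian_Product.column i (J y ** R) = J y *v Finite_Cartesian_Product.column i R"
        by (simp add: Finite_Cartesian_Product.vec_eq_iff Finite_Cartesian_Product.column_def matrix_matrix_mult_def matrix_vector_mult_def)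
      finally show ?thesis .
    qed
    hence "dY i = transpose (K y) *v Finite_Cartesian_Product.column i R" by (simp add: K_def)
    from det_replace_row[OF this, of i] show ?thesis by (simp add: D_def detK Finite_Cartesian_Product.column_def)
  qed
  have anti: "D i r = - D r i" if ir: "r \<noteq> i" for i r
  proof -
    have "(\<chi> k. if k = r then Y y else if k = i then Q i r else K y $ k) =
        (\<chi> k. if k = i then Q r i else if k = r then Y y else K y $ k)"
      using ir by (intro arg_cong[where f=vec_lambda] ext) (simp add: Qsym)
    thus ?thesis using det_row_swap[OF ir[symmetric], of "Q i r" "Y y" "K y"] ir by (simp add: D_def)
  qed
  have "(\<Sum>i\<in>UNIV. \<Sum>r\<in>UNIV. D i r) = (\<Sum>i\<in>UNIV. D i i)"
  proof -
    define E where "E i r = (if r = i then 0 else D i r)" for i r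
    have "(\<Sum>i\<in>UNIV. \<Sum>r\<in>UNIV. E i r) = (\<Sum>i\<in>UNIV. \<Sum>r\<in>UNIV. E r i)" by (rule sum.swap)
    also have "\<dots> = - (\<Sum>i\<in>UNIV. \<Sum>r\<in>UNIV. E i r)"
      proof -
      have "E r i = - E i r" for i r
      proof (cases "r = i")
        case False
        from anti[OF False] False show ?thesis by (simp add: E_def)
      qed (simp add: E_def)
      thus ?thesis unfolding sum_negf[symmetric] by (intro sum.cong refl)
    qed
    finally have E0: "(\<Sum>i\<in>UNIV. \<Sum>r\<in>UNIV. E i r) = 0" by simp
    have "D i r = E i r + (if r = i then D i i else 0)" for i r by (simp add: E_def)
    hence "(\<Sum>i\<in>UNIV. \<Sum>r\<in>UNIV. D i r) = (\<Sum>i\<in>UNIV. \<Sum>r\<in>UNIV. E i r + (if r = i then D i i else 0))"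
      by (intro sum.cong refl)
    also have "\<dots> = (\<Sum>i\<in>UNIV. D i i)" using E0 by (simp add: sum.distrib)
    finally show ?thesis .
  qed
  also have "\<dots> = Determinants.trace R * det_v (J y)" by (simp add: diag trace_def sum_distrib_right)
  also have "Determinants.trace R = Determinants.trace B"
    unfolding R_def trace_mul_sym[of "matrix_inv (J y)"]
    by (simp add: matrix_mul_assoc[symmetric] matrix_inv_works[OF detJ[OF S(2)]])
  finally have tot: "(\<Sum>i\<in>UNIV. \<Sum>r\<in>UNIV. D i r) = Determinants.trace B * det_v (J y)" .
  have sGy: "sqrt (det_v (G y)) = \<bar>det_v (J y)\<bar> * w' (\<Phi> y)"
    unfolding detG[OF S(2)] w'_def by (rule sqrt_square_mult)
  have "lb G (\<lambda>x. u (\<Phi> x)) y = (1 / sqrt (det_v (G y))) * (\<Sum>i\<in>UNIV. partial_deriv i (X i) y)"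
    by (simp add: lb_def X_def[abs_def])
  also have "\<dots> = (1 / (\<bar>det_v (J y)\<bar> * w' (\<Phi> y))) * (\<bar>det_v (J y)\<bar> * Determinants.trace B)"
    unfolding pdX sGy sum_distrib_left[symmetric] tot abs_det[OF S1(2)] by simp
  also have "\<dots> = (1 / w' (\<Phi> y)) * Determinants.trace B"
    using detJ[OF S(2)] by simp
  also have "\<dots> = lb G' u (\<Phi> y)"
    by (simp add: lb_def trace_def B_def Y'_def[abs_def] w'_def)
  finally show ?thesis .
qed

text \<open>The real case applied to real and imaginary parts, which commute with
  \<open>lb\<close>.\<close>

lemma lb_invariant:
  fixes \<Phi> :: "real^'n \<Rightarrow> real^'n" and u :: "real^'n \<Rightarrow> complex"
  assumes S: "open S" "y \<in> S" and S': "open S'" "\<And>x. x \<in> S \<Longrightarrow> \<Phi> x \<in> S'"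
    and \<Phi>: "Ck_on 2 S \<Phi>" and u: "Ck_on 2 S' u"
    and G': "\<And>x. x \<in> S' \<Longrightarrow> metric_at G' x" and G: "\<And>x. x \<in> S \<Longrightarrow> metric_at G x"
    and iso: "\<And>x. x \<in> S \<Longrightarrow> G x = transpose (jacobian \<Phi> (at x)) ** G' (\<Phi> x) ** jacobian \<Phi> (at x)"
  shows "lb G (\<lambda>x. u (\<Phi> x)) y = lb G' u (\<Phi> y)"
proof -
  have u\<Phi>: "Ck_on 2 S (\<lambda>x. u (\<Phi> x))" by (rule Ck_on_compose[OF S(1) S' \<Phi> u])
  have Gnz: "det_v (G x) \<noteq> 0" if "x \<in> S" for x using G[OF that] by (simp add: metric_at_def)
  have "L (lb G (\<lambda>x. u (\<Phi> x)) y) = L (lb G' u (\<Phi> y))" if L: "bounded_linear L" for L :: "complex \<Rightarrow> real"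
  proof -
    have "L (lb G (\<lambda>x. u (\<Phi> x)) y) = lb G (\<lambda>x. L (u (\<Phi> x))) y"
      by (rule lb_bounded_linear[OF G[OF S(2)] S u\<Phi> L, symmetric])
    also have "\<dots> = lb G' (\<lambda>x. L (u x)) (\<Phi> y)"
      by (rule lb_invariant_real[OF S S' \<Phi> Ck_on_linear_compose[OF S'(1) L u] G' Gnz iso])
    also have "\<dots> = L (lb G' u (\<Phi> y))"
      by (rule lb_bounded_linear[OF G'[OF S'(2)[OF S(2)]] S'(1) S'(2)[OF S(2)] u L])
    finally show ?thesis .
  qed
  from this[OF bounded_linear_Re] this[OF bounded_linear_Im] show ?thesis by (simp add: complex_eq_iff)
qed

section \<open>Smooth maps into a Lie group\<close>

text \<open>Smooth maps from Euclidean space into the group. Continuity is required separately so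
  that, for open \<open>S\<close>, the sets on which the coordinates are tested are open.\<close>

definition csmooth ::
    "('g::topological_space, 'n::finite) chart set \<Rightarrow> 'e::euclidean_space set \<Rightarrow> ('e \<Rightarrow> 'g) \<Rightarrow> bool" where
  "csmooth \<A> S Z \<longleftrightarrow> continuous_on S Z \<and>
     (\<forall>c\<in>\<A>. smooth_on {x \<in> S. Z x \<in> fst c} (\<lambda>x. snd c (Z x)))"

lemma smooth_on_local:
  assumes "\<And>x. x \<in> S \<Longrightarrow> \<exists>T. open T \<and> x \<in> T \<and> smooth_on T f"
  shows "smooth_on S f"
  unfolding smooth_on_def
proof (intro allI Ck_on_local)
  fix k x assume "x \<in> S"
  from assms[OF this] show "\<exists>T. open T \<and> x \<in> T \<and> Ck_on k T f" unfolding smooth_on_def by blast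
qed

lemma smooth_on_cong:
  "open S \<Longrightarrow> (\<And>x. x \<in> S \<Longrightarrow> f x = g x) \<Longrightarrow> smooth_on S f \<Longrightarrow> smooth_on S g"
  unfolding smooth_on_def using Ck_on_cong by blast

lemma smooth_on_subset: "smooth_on S f \<Longrightarrow> T \<subseteq> S \<Longrightarrow> smooth_on T f"
  unfolding smooth_on_def using Ck_on_subset by blast

lemma smooth_on_compose:
  fixes g :: "'a::euclidean_space \<Rightarrow> 'b::euclidean_space" and f :: "'b \<Rightarrow> 'c::real_normed_vector"
  shows "open S \<Longrightarrow> open T \<Longrightarrow> (\<And>x. x \<in> S \<Longrightarrow> g x \<in> T) \<Longrightarrow> smooth_on S g \<Longrightarrow> smooth_on T f \<Longrightarrow>
    smooth_on S (\<lambda>x. f (g x))"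
  unfolding smooth_on_def using Ck_on_compose by blast

lemma smooth_on_Pair:
  "open S \<Longrightarrow> smooth_on S f \<Longrightarrow> smooth_on S g \<Longrightarrow> smooth_on S (\<lambda>x. (f x, g x))"
  unfolding smooth_on_def using Ck_on_Pair by blast

lemma smooth_on_const: "smooth_on S (\<lambda>_. c)"
  unfolding smooth_on_def using Ck_on_const by blast

lemma smooth_on_bounded_linear: "bounded_linear L \<Longrightarrow> smooth_on S L"
  unfolding smooth_on_def using Ck_on_bounded_linear by blast

lemma chart_facts:
  assumes "smooth_atlas \<A>" "c \<in> \<A>"
  shows "open (fst c)" "open (chart_image c)" "continuous_on (chart_image c) (chart_inv c)"
    "continuous_on (fst c) (snd c)" "\<And>p. p \<in> fst c \<Longrightarrow> chart_inv c (snd c p) = p"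
    "\<And>p. p \<in> fst c \<Longrightarrow> snd c p \<in> chart_image c"
    "\<And>x. x \<in> chart_image c \<Longrightarrow> chart_inv c x \<in> fst c"
    "\<And>x. x \<in> chart_image c \<Longrightarrow> snd c (chart_inv c x) = x"
  proof -
  have h: "open (fst c)" "open (chart_image c)" "homeomorphism (fst c) (chart_image c) (snd c) (chart_inv c)"
    using assms unfolding smooth_atlas_def is_chart_def by blast+
  show "open (fst c)" "open (chart_image c)" by (rule h)+
  show "continuous_on (chart_image c) (chart_inv c)" "continuous_on (fst c) (snd c)"
    "\<And>p. p \<in> fst c \<Longrightarrow> chart_inv c (snd c p) = p" "\<And>x. x \<in> chart_image c \<Longrightarrow> snd c (chart_inv c x) = x"
    using h(3) unfolding homeomorphism_def by blast+
  show "\<And>p. p \<in> fst c \<Longrightarrow> snd c p \<in> chart_image c" "\<And>x. x \<in> chart_image c \<Longrightarrow> chart_inv c x \<in> fst c"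
    using h(3) unfolding homeomorphism_def by blast+
qed

lemma chart_cover:
  assumes "smooth_atlas \<A>"
  shows "\<exists>c\<in>\<A>. p \<in> fst c"
  using assms unfolding smooth_atlas_def by blast

lemma open_restrict:
  assumes "open S" "continuous_on S Z" "open U"
  shows "open {x \<in> S. Z x \<in> U}"
proof -
  have "{x \<in> S. Z x \<in> U} = Z -` U \<inter> S" by auto
  thus ?thesis using continuous_open_preimage[OF assms(2,1,3)] by (simp add: Int_commute)
qed

lemma csmooth_continuous: "csmooth \<A> S Z \<Longrightarrow> continuous_on S Z"
  by (simp add: csmooth_def)

lemma csmooth_coord:
  "csmooth \<A> S Z \<Longrightarrow> c \<in> \<A> \<Longrightarrow> smooth_on {x \<in> S. Z x \<in> fst c} (\<lambda>x. snd c (Z x))"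
  by (simp add: csmooth_def)

lemma csmooth_compose:
  assumes "open S" "open T" "\<And>x. x \<in> S \<Longrightarrow> g x \<in> T" "smooth_on S g" "csmooth \<A> T Z" "smooth_atlas \<A>"
  shows "csmooth \<A> S (\<lambda>x. Z (g x))"
  unfolding csmooth_def
proof (intro conjI ballI)
  have gc: "continuous_on S g" using assms(4) Ck_on.simps(1) unfolding smooth_on_def by blast
  thus c: "continuous_on S (\<lambda>x. Z (g x))"
    by (rule continuous_on_compose2[OF csmooth_continuous[OF assms(5)]]) (use assms(3) in auto)
  fix c assume "c \<in> \<A>"
  note cf = chart_facts[OF assms(6) this]
  show "smooth_on {x \<in> S. Z (g x) \<in> fst c} (\<lambda>x. snd c (Z (g x)))"
  proof (rule smooth_on_compose[OF _ _ _ _ csmooth_coord[OF assms(5) \<open>c \<in> \<A>\<close>]])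
    show "open {x \<in> S. Z (g x) \<in> fst c}" by (rule open_restrict[OF assms(1) c cf(1)])
    show "open {x \<in> T. Z x \<in> fst c}" by (rule open_restrict[OF assms(2) csmooth_continuous[OF assms(5)] cf(1)])
  qed (use assms(3) smooth_on_subset[OF assms(4)] in auto)
qed

lemma csmooth_const: "csmooth \<A> S (\<lambda>_. a)"
  unfolding csmooth_def by (auto simp: smooth_on_const)

lemma csmooth_chart_inv:
  assumes "smooth_atlas \<A>" "c \<in> \<A>"
  shows "csmooth \<A> (chart_image c) (chart_inv c)"
  unfolding csmooth_def
proof (intro conjI ballI)
  fix c' assume "c' \<in> \<A>"
  hence "smooth_on (coord_dom c c' (\<lambda>g. g)) (coord_map c c' (\<lambda>g. g))"
    using assms unfolding smooth_atlas_def by blast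
  thus "smooth_on {x \<in> chart_image c. chart_inv c x \<in> fst c'} (\<lambda>x. snd c' (chart_inv c x))"
    by (simp add: coord_dom_def coord_map_def[abs_def])
qed (rule chart_facts(3)[OF assms])

context
  fixes \<A> :: "('g::{topological_group_add, t2_space, second_countable_topology}, 'n::finite) chart set"
  assumes lie: "lie_group \<A>"
begin

lemma lie_atlas: "smooth_atlas \<A>"
  using lie by (simp add: lie_group_def)

text \<open>Near each point both factors lie in fixed chart domains, where the product is the
  coordinate form of the group law composed with a smooth pair.\<close>

lemma csmooth_add:
  fixes S :: "'e::euclidean_space set"
  assumes S: "open S" and Z: "csmooth \<A> S Z1" "csmooth \<A> S Z2"
  shows "csmooth \<A> S (\<lambda>x. Z1 x + Z2 x)"
  unfolding csmooth_def
proof (intro conjI ballI)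
  note Zc = csmooth_continuous[OF Z(1)] csmooth_continuous[OF Z(2)]
  show c: "continuous_on S (\<lambda>x. Z1 x + Z2 x)" by (intro continuous_intros Zc)
  fix c3 assume c3: "c3 \<in> \<A>"
  note cf3 = chart_facts[OF lie_atlas c3]
  show "smooth_on {x \<in> S. Z1 x + Z2 x \<in> fst c3} (\<lambda>x. snd c3 (Z1 x + Z2 x))"
  proof (rule smooth_on_local)
    fix x0 assume x0: "x0 \<in> {x \<in> S. Z1 x + Z2 x \<in> fst c3}"
    obtain c1 c2 where c: "c1 \<in> \<A>" "Z1 x0 \<in> fst c1" "c2 \<in> \<A>" "Z2 x0 \<in> fst c2"
      using chart_cover[OF lie_atlas] by metis
    note cf1 = chart_facts[OF lie_atlas c(1)] and cf2 = chart_facts[OF lie_atlas c(3)]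
    define T where "T = {x \<in> S. Z1 x + Z2 x \<in> fst c3} \<inter> {x \<in> S. Z1 x \<in> fst c1} \<inter> {x \<in> S. Z2 x \<in> fst c2}"
    have T: "open T" unfolding T_def
      by (intro open_Int open_restrict S Zc \<open>continuous_on S (\<lambda>x. Z1 x + Z2 x)\<close> cf1 cf2 cf3)
    define D where "D = {(x, y). x \<in> chart_image c1 \<and> y \<in> chart_image c2 \<and> chart_inv c1 x + chart_inv c2 y \<in> fst c3}"
    have D: "open D"
    proof -
      have o: "open (chart_image c1 \<times> chart_image c2)" by (intro open_Times cf1 cf2)
      have "continuous_on (chart_image c1 \<times> chart_image c2) (\<lambda>p. chart_inv c1 (fst p) + chart_inv c2 (snd p))"
        by (intro continuous_intros continuous_on_compose2[OF cf1(3)] continuous_on_compose2[OF cf2(3)]) auto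
      from open_restrict[OF o this cf3(1)]
      have "open {x \<in> chart_image c1 \<times> chart_image c2. chart_inv c1 (fst x) + chart_inv c2 (snd x) \<in> fst c3}" .
      also have "{x \<in> chart_image c1 \<times> chart_image c2. chart_inv c1 (fst x) + chart_inv c2 (snd x) \<in> fst c3} = D"
        by (auto simp: D_def)
      finally show ?thesis .
    qed
    have sm: "smooth_on D (\<lambda>(x, y). snd c3 (chart_inv c1 x + chart_inv c2 y))"
      using lie c c3 unfolding lie_group_def D_def by blast
    have "smooth_on T (\<lambda>x. (\<lambda>(x, y). snd c3 (chart_inv c1 x + chart_inv c2 y)) (snd c1 (Z1 x), snd c2 (Z2 x)))"
    proof (rule smooth_on_compose[OF T D _ _ sm])
      show "smooth_on T (\<lambda>x. (snd c1 (Z1 x), snd c2 (Z2 x)))"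
        by (intro smooth_on_Pair T smooth_on_subset[OF csmooth_coord[OF Z(1) c(1)]]
            smooth_on_subset[OF csmooth_coord[OF Z(2) c(3)]]) (auto simp: T_def)
    qed (auto simp: T_def D_def cf1 cf2)
    hence "smooth_on T (\<lambda>x. snd c3 (Z1 x + Z2 x))"
      by (rule smooth_on_cong[OF T, rotated]) (auto simp: T_def cf1 cf2)
    moreover have "x0 \<in> T" using x0 c by (simp add: T_def)
    ultimately show "\<exists>T. open T \<and> x0 \<in> T \<and> smooth_on T (\<lambda>x. snd c3 (Z1 x + Z2 x))" using T by blast
  qed
qed

lemma csmooth_minus:
  fixes S :: "'e::euclidean_space set"
  assumes S: "open S" and Z: "csmooth \<A> S Z"
  shows "csmooth \<A> S (\<lambda>x. - Z x)"
  unfolding csmooth_def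
proof (intro conjI ballI)
  note Zc = csmooth_continuous[OF Z]
  show c: "continuous_on S (\<lambda>x. - Z x)" by (intro continuous_intros Zc)
  fix c3 assume c3: "c3 \<in> \<A>"
  note cf3 = chart_facts[OF lie_atlas c3]
  show "smooth_on {x \<in> S. - Z x \<in> fst c3} (\<lambda>x. snd c3 (- Z x))"
  proof (rule smooth_on_local)
    fix x0 assume x0: "x0 \<in> {x \<in> S. - Z x \<in> fst c3}"
    obtain c1 where c: "c1 \<in> \<A>" "Z x0 \<in> fst c1"
      using chart_cover[OF lie_atlas] by metis
    note cf1 = chart_facts[OF lie_atlas c(1)]
    define T where "T = {x \<in> S. - Z x \<in> fst c3} \<inter> {x \<in> S. Z x \<in> fst c1}"
    have T: "open T" unfolding T_def
      by (intro open_Int open_restrict S Zc \<open>continuous_on S (\<lambda>x. - Z x)\<close> cf1 cf3)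
    have D: "open (coord_dom c1 c3 uminus)"
      unfolding coord_dom_def by (rule open_restrict[OF cf1(2) _ cf3(1)]) (intro continuous_intros cf1)
    have sm: "smooth_on (coord_dom c1 c3 uminus) (coord_map c1 c3 uminus)"
      using lie c c3 unfolding lie_group_def by blast
    have "smooth_on T (\<lambda>x. coord_map c1 c3 uminus (snd c1 (Z x)))"
    proof (rule smooth_on_compose[OF T D _ _ sm])
      show "smooth_on T (\<lambda>x. snd c1 (Z x))"
        by (rule smooth_on_subset[OF csmooth_coord[OF Z c(1)]]) (auto simp: T_def)
    qed (auto simp: T_def coord_dom_def cf1)
    hence "smooth_on T (\<lambda>x. snd c3 (- Z x))"
      by (rule smooth_on_cong[OF T, rotated]) (auto simp: T_def cf1 coord_map_def)
    moreover have "x0 \<in> T" using x0 c by (simp add: T_def)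
    ultimately show "\<exists>T. open T \<and> x0 \<in> T \<and> smooth_on T (\<lambda>x. snd c3 (- Z x))" using T by blast
  qed
qed

end

text \<open>\<open>L\<close> bounds the sum of the norms of the derivatives along the basis on the
  compact set; convexity turns the bound on the derivative into a Lipschitz bound.\<close>

lemma C1_lipschitz:
  fixes f :: "'a::euclidean_space \<Rightarrow> 'b::real_normed_vector"
  assumes f: "Ck_on 1 S f" and K: "compact K" "convex K" "K \<subseteq> S"
  obtains L where "L \<ge> 0" "\<And>x y. x \<in> K \<Longrightarrow> y \<in> K \<Longrightarrow> norm (f x - f y) \<le> L * norm (x - y)"
    "\<And>x h. x \<in> K \<Longrightarrow> norm (frechet_derivative f (at x) h) \<le> L * norm h"
proof -
  have d: "f differentiable (at x)" if "x \<in> K" for x using f K that by auto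
  have c: "continuous_on K (\<lambda>x. \<Sum>b\<in>Basis. norm (frechet_derivative f (at x) b))"
    using f K by (intro continuous_intros) (auto intro: continuous_on_subset)
  obtain L0 where L0: "\<And>x. x \<in> K \<Longrightarrow> (\<Sum>b\<in>Basis. norm (frechet_derivative f (at x) b)) \<le> L0"
    using compact_imp_bounded[OF compact_continuous_image[OF c K(1)]]
    unfolding bounded_iff by (metis abs_le_D1 imageI real_norm_def)
  define L where "L = max L0 0"
  have L: "(\<Sum>b\<in>Basis. norm (frechet_derivative f (at x) b)) \<le> L" if "x \<in> K" for x
    using L0[OF that] by (simp add: L_def)
  have Lh: "norm (frechet_derivative f (at x) h) \<le> L * norm h" if x: "x \<in> K" for x h
  proof -
    have lin: "linear (frechet_derivative f (at x))" using d[OF x] by (rule linear_frechet_derivative)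
    have "frechet_derivative f (at x) h = frechet_derivative f (at x) (\<Sum>b\<in>Basis. (h \<bullet> b) *\<^sub>R b)"
      by (simp add: euclidean_representation)
    also have "\<dots> = (\<Sum>b\<in>Basis. (h \<bullet> b) *\<^sub>R frechet_derivative f (at x) b)"
      by (simp add: linear_sum[OF lin] linear_cmul[OF lin])
    finally have "norm (frechet_derivative f (at x) h) \<le> (\<Sum>b\<in>Basis. \<bar>h \<bullet> b\<bar> * norm (frechet_derivative f (at x) b))"
      using norm_sum[of "\<lambda>b. (h \<bullet> b) *\<^sub>R frechet_derivative f (at x) b" Basis] by simp
    also have "\<dots> \<le> (\<Sum>b\<in>Basis. norm h * norm (frechet_derivative f (at x) b))"
      by (intro sum_mono mult_right_mono Basis_le_norm) auto
    also have "\<dots> \<le> L * norm h"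
      unfolding sum_distrib_left[symmetric] using mult_left_mono[OF L[OF x], of "norm h"] by (simp add: mult.commute)
    finally show ?thesis .
  qed
  have on: "onorm (frechet_derivative f (at x)) \<le> L" if x: "x \<in> K" for x
    by (rule onorm_le) (rule Lh[OF x])
  have "norm (f x - f y) \<le> L * norm (x - y)" if "x \<in> K" "y \<in> K" for x y
  proof (rule differentiable_bound[OF K(2) _ on that])
    show "(f has_derivative frechet_derivative f (at z)) (at z within K)" if "z \<in> K" for z
      using d[OF that] has_derivative_at_withinI frechet_derivative_works by blast
  qed
  thus ?thesis using that[of L] Lh by (simp add: L_def)
qed

text \<open>Dominated convergence for difference quotients. The Lipschitz condition bounds the
  quotients and, in the limit, the derivative \<open>D g\<close>, whose measurability in
  \<open>g\<close> comes from being a limit of quotients along basis vectors.\<close>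

lemma differentiable_integral:
  fixes F :: "'e::euclidean_space \<Rightarrow> 'a \<Rightarrow> complex"
  assumes M: "finite_measure M" and r: "r > 0"
    and int: "\<And>y. y \<in> ball x0 r \<Longrightarrow> integrable M (F y)"
    and d: "\<And>g. g \<in> space M \<Longrightarrow> (\<lambda>y. F y g) differentiable (at x0)"
    and lip: "\<And>y g. y \<in> ball x0 r \<Longrightarrow> g \<in> space M \<Longrightarrow> norm (F y g - F x0 g) \<le> L * norm (y - x0)"
  shows "(\<lambda>y. \<integral>g. F y g \<partial>M) differentiable (at x0)"
proof -
  interpret finite_measure M by (rule M)
  define D where "D g = frechet_derivative (\<lambda>y. F y g) (at x0)" for g
  have x0: "x0 \<in> ball x0 r" using r by simp
  have D: "((\<lambda>y. F y g) has_derivative D g) (at x0)" if "g \<in> space M" for g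
    unfolding D_def using d[OF that] frechet_derivative_works by blast
  have Dlim: "(\<lambda>h. norm (F (x0 + h) g - F x0 g - D g h) / norm h) \<midarrow>0\<rightarrow> 0" if "g \<in> space M" for g
    using D[OF that] unfolding has_derivative_at by blast
  have lin: "linear (D g)" if "g \<in> space M" for g using D[OF that] by (rule has_derivative_linear)
  define t where "t n = r / (2 * real (Suc n))" for n
  have t: "t n > 0" "t n < r" for n using r by (auto simp: t_def divide_less_eq)
  have t0: "t \<longlonglongrightarrow> 0"
    unfolding t_def by real_asymp
  have quot: "(\<lambda>n. (1 / t n) *\<^sub>R (F (x0 + t n *\<^sub>R b) g - F x0 g)) \<longlonglongrightarrow> D g b"
    if g: "g \<in> space M" and b: "b \<in> Basis" for g b
  proof -
    have "filterlim (\<lambda>n. t n *\<^sub>R b) (at 0) sequentially"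
    proof (rule filterlim_atI)
      show "(\<lambda>n. t n *\<^sub>R b) \<longlonglongrightarrow> 0" using tendsto_scaleR[OF t0 tendsto_const[of b]] by simp
      show "\<forall>\<^sub>F n in sequentially. t n *\<^sub>R b \<noteq> 0"
        using t(1) nonzero_Basis[OF b] by (intro always_eventually allI) (simp add: less_imp_neq[symmetric])
    qed
    from filterlim_compose[OF Dlim[OF g] this]
    have "(\<lambda>n. norm (F (x0 + t n *\<^sub>R b) g - F x0 g - D g (t n *\<^sub>R b)) / norm (t n *\<^sub>R b)) \<longlonglongrightarrow> 0" .
    moreover have "norm (F (x0 + t n *\<^sub>R b) g - F x0 g - D g (t n *\<^sub>R b)) / norm (t n *\<^sub>R b) =
       norm ((1 / t n) *\<^sub>R (F (x0 + t n *\<^sub>R b) g - F x0 g) - D g b)" for n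
    proof -
      have "(1 / t n) *\<^sub>R (F (x0 + t n *\<^sub>R b) g - F x0 g) - D g b =
        (1 / t n) *\<^sub>R (F (x0 + t n *\<^sub>R b) g - F x0 g - D g (t n *\<^sub>R b))"
        using t(1)[of n] linear_cmul[OF lin[OF g], of "t n" b] by (simp add: scaleR_diff_right)
      thus ?thesis using t(1)[of n] b by simp
    qed
    ultimately show ?thesis using Lim_null tendsto_norm_zero_iff by fastforce
  qed
  have Fm: "F y \<in> borel_measurable M" if "y \<in> ball x0 r" for y using int[OF that] by auto
  have tb: "x0 + t n *\<^sub>R b \<in> ball x0 r" if "b \<in> Basis" for n b using t[of n] that by (simp add: dist_norm)
  have Dm: "(\<lambda>g. D g b) \<in> borel_measurable M" if b: "b \<in> Basis" for b
  proof (rule borel_measurable_LIMSEQ_metric)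
    show "(\<lambda>g. (1 / t n) *\<^sub>R (F (x0 + t n *\<^sub>R b) g - F x0 g)) \<in> borel_measurable M" for n
      using Fm[OF tb[OF b]] Fm[OF x0] by measurable
  qed (rule quot[OF _ b])
  have Db: "norm (D g b) \<le> L" if g: "g \<in> space M" and b: "b \<in> Basis" for g b
  proof (rule LIMSEQ_le_const2[OF tendsto_norm[OF quot[OF g b]]])
    show "\<exists>N. \<forall>n\<ge>N. norm ((1 / t n) *\<^sub>R (F (x0 + t n *\<^sub>R b) g - F x0 g)) \<le> L"
      proof (intro exI[of _ 0] allI impI)
      fix n
      have "norm (F (x0 + t n *\<^sub>R b) g - F x0 g) \<le> L * t n" using lip[OF tb[OF b] g, of n] t(1)[of n] b by simp
      thus "norm ((1 / t n) *\<^sub>R (F (x0 + t n *\<^sub>R b) g - F x0 g)) \<le> L"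
        using t(1)[of n] by (simp add: divide_le_eq)
    qed
  qed
  have Dexp: "D g h = (\<Sum>b\<in>Basis. (h \<bullet> b) *\<^sub>R D g b)" if g: "g \<in> space M" for g h
  proof -
    have "D g h = D g (\<Sum>b\<in>Basis. (h \<bullet> b) *\<^sub>R b)" by (simp add: euclidean_representation)
    thus ?thesis by (simp add: linear_sum[OF lin[OF g]] linear_cmul[OF lin[OF g]])
  qed
  have Di: "integrable M (\<lambda>g. D g b)" if b: "b \<in> Basis" for b
    by (rule integrable_const_bound[where B=L]) (use Db[OF _ b] Dm[OF b] in auto)
  define D' where "D' h = (\<Sum>b\<in>Basis. (h \<bullet> b) *\<^sub>R (\<integral>g. D g b \<partial>M))" for h
  have iD: "integrable M (\<lambda>g. D g h)" and D'eq: "D' h = (\<integral>g. D g h \<partial>M)" for h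
  proof -
    have "integrable M (\<lambda>g. \<Sum>b\<in>Basis. (h \<bullet> b) *\<^sub>R D g b)"
      by (intro Bochner_Integration.integrable_sum integrable_scaleR_right Di)
    thus "integrable M (\<lambda>g. D g h)"
      by (subst Bochner_Integration.integrable_cong[OF refl Dexp])
    have "(\<integral>g. D g h \<partial>M) = (\<integral>g. (\<Sum>b\<in>Basis. (h \<bullet> b) *\<^sub>R D g b) \<partial>M)"
      by (rule Bochner_Integration.integral_cong[OF refl Dexp])
    also have "\<dots> = D' h" unfolding D'_def
      by (subst Bochner_Integration.integral_sum) (auto intro: integrable_scaleR_right Di)
    finally show "D' h = (\<integral>g. D g h \<partial>M)" by simp
  qed
  have "((\<lambda>y. \<integral>g. F y g \<partial>M) has_derivative D') (at x0)"
    unfolding has_derivative_at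
  proof
    show "bounded_linear D'" unfolding D'_def[abs_def]
      by (intro bounded_linear_sum bounded_linear_scaleR_left[THEN bounded_linear_compose] bounded_linear_inner_left)
    show "(\<lambda>h. norm ((\<integral>g. F (x0 + h) g \<partial>M) - (\<integral>g. F x0 g \<partial>M) - D' h) / norm h) \<midarrow>0\<rightarrow> 0"
      unfolding tendsto_at_iff_sequentially comp_def
    proof (intro allI impI)
      fix X :: "nat \<Rightarrow> 'e" assume X: "\<forall>i. X i \<in> UNIV - {0}" "X \<longlonglongrightarrow> 0"
      obtain N where N: "\<And>n. n \<ge> N \<Longrightarrow> norm (X n) < r" using LIMSEQ_D[OF X(2) r] by auto
      define R where "R n g = norm (F (x0 + X (n + N)) g - F x0 g - D g (X (n + N))) / norm (X (n + N))" for n g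
      have inb: "x0 + X (n + N) \<in> ball x0 r" for n using N[of "n + N"] by (simp add: dist_norm)
      have iR: "integrable M (\<lambda>g. F (x0 + X (n + N)) g - F x0 g - D g (X (n + N)))" for n
        by (intro Bochner_Integration.integrable_diff int inb x0 iD)
      have "(\<lambda>n. \<integral>g. R n g \<partial>M) \<longlonglongrightarrow> (\<integral>g. 0 \<partial>M)"
      \<comment> \<open>The first \<open>L\<close> is for the difference quotient, the second term
        for the derivative expanded in the basis.\<close>
      proof (rule integral_dominated_convergence[where w="\<lambda>_. L + L * DIM('e)"])
        show "AE g in M. (\<lambda>n. R n g) \<longlonglongrightarrow> 0"
        proof (rule AE_I2)
          fix g assume g: "g \<in> space M"
          have "filterlim (\<lambda>n. X (n + N)) (at 0) sequentially"
            by (rule filterlim_atI) (use X LIMSEQ_ignore_initial_segment[OF X(2)] in auto)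
          from filterlim_compose[OF Dlim[OF g] this] show "(\<lambda>n. R n g) \<longlonglongrightarrow> 0" by (simp add: R_def)
        qed
        show "AE g in M. norm (R n g) \<le> L + L * DIM('e)" for n
        proof (rule AE_I2)
          fix g assume g: "g \<in> space M"
          have nz: "norm (X (n + N)) > 0" using X(1) by simp
          have "norm (D g (X (n + N))) \<le> (\<Sum>b\<in>Basis. \<bar>X (n + N) \<bullet> b\<bar> * norm (D g b))"
            unfolding Dexp[OF g, of "X (n + N)"] using norm_sum[of "\<lambda>b. (X (n + N) \<bullet> b) *\<^sub>R D g b" Basis] by simp
          also have "\<dots> \<le> (\<Sum>b\<in>(Basis::'e set). norm (X (n + N)) * L)"
            by (intro sum_mono mult_mono Basis_le_norm Db g) auto
          finally have "norm (D g (X (n + N))) \<le> L * DIM('e) * norm (X (n + N))" by (simp add: mult_ac)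
          moreover have "norm (F (x0 + X (n + N)) g - F x0 g) \<le> L * norm (X (n + N))"
            using lip[OF inb g] by simp
          ultimately have "norm (F (x0 + X (n + N)) g - F x0 g - D g (X (n + N))) \<le> (L + L * DIM('e)) * norm (X (n + N))"
            using norm_triangle_ineq4[of "F (x0 + X (n + N)) g - F x0 g" "D g (X (n + N))"] by (simp add: distrib_right)
          thus "norm (R n g) \<le> L + L * DIM('e)" unfolding R_def using nz by (simp add: divide_le_eq)
        qed
        show "R n \<in> borel_measurable M" for n unfolding R_def
          using borel_measurable_integrable[OF iR[of n]] by measurable
      qed auto
      hence "(\<lambda>n. \<integral>g. R n g \<partial>M) \<longlonglongrightarrow> 0" by simp
      hence "(\<lambda>n. norm ((\<integral>g. F (x0 + X (n + N)) g \<partial>M) - (\<integral>g. F x0 g \<partial>M) - D' (X (n + N))) / norm (X (n + N))) \<longlonglongrightarrow> 0"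
      proof (rule Lim_null_comparison[rotated])
        have "norm (norm ((\<integral>g. F (x0 + X (n + N)) g \<partial>M) - (\<integral>g. F x0 g \<partial>M) - D' (X (n + N))) / norm (X (n + N))) \<le> (\<integral>g. R n g \<partial>M)" for n
        proof -
          have "(\<integral>g. F (x0 + X (n + N)) g \<partial>M) - (\<integral>g. F x0 g \<partial>M) - D' (X (n + N)) =
             (\<integral>g. F (x0 + X (n + N)) g - F x0 g - D g (X (n + N)) \<partial>M)"
            unfolding D'eq
            by (simp only: Bochner_Integration.integral_diff[OF Bochner_Integration.integrable_diff[OF int[OF inb] int[OF x0]] iD]
                Bochner_Integration.integral_diff[OF int[OF inb] int[OF x0]])
          hence "norm ((\<integral>g. F (x0 + X (n + N)) g \<partial>M) - (\<integral>g. F x0 g \<partial>M) - D' (X (n + N))) \<le>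
             (\<integral>g. norm (F (x0 + X (n + N)) g - F x0 g - D g (X (n + N))) \<partial>M)"
            using integral_norm_bound[of M "\<lambda>g. F (x0 + X (n + N)) g - F x0 g - D g (X (n + N))"] by simp
          thus ?thesis unfolding R_def by (simp add: divide_right_mono)
        qed
        thus "\<forall>\<^sub>F n in sequentially. norm (norm ((\<integral>g. F (x0 + X (n + N)) g \<partial>M) - (\<integral>g. F x0 g \<partial>M) - D' (X (n + N))) / norm (X (n + N))) \<le> (\<integral>g. R n g \<partial>M)"
          by simp
      qed
      thus "(\<lambda>n. norm ((\<integral>g. F (x0 + X n) g \<partial>M) - (\<integral>g. F x0 g \<partial>M) - D' (X n)) / norm (X n)) \<longlonglongrightarrow> 0"
        by (rule LIMSEQ_offset)
    qed
  qed
  thus ?thesis by (auto simp: differentiable_def)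
qed

section \<open>Smoothness of representations\<close>

text \<open>A function of class C^1 is enough for the bump: only differentiability of
  representations is drawn from it, and higher regularity is bootstrapped.\<close>

lemma square_pos_Ck: "Ck_on 1 UNIV (\<lambda>t::real. (max 0 t)\<^sup>2)"
proof -
  have d: "((\<lambda>t::real. (max 0 t)\<^sup>2) has_real_derivative 2 * max 0 t) (at t)" for t
  proof (cases "t = 0")
    case False
    show ?thesis
    proof (cases "t > 0")
      case True
      have "((\<lambda>t::real. t\<^sup>2) has_real_derivative 2 * max 0 t) (at t)"
        using True by (auto intro!: derivative_eq_intros)
      thus ?thesis by (rule has_field_derivative_transform_within_open[of _ _ _ "{0<..}"]) (use True in auto)
    next
      case False
      with \<open>t \<noteq> 0\<close> have t: "t < 0" by simp
      have "((\<lambda>t::real. 0) has_real_derivative 2 * max 0 t) (at t)" using t by (auto intro!: derivative_eq_intros)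
      thus ?thesis by (rule has_field_derivative_transform_within_open[of _ _ _ "{..<0}"]) (use t in auto)
    qed
  next
    case True
    have "(\<lambda>h. ((max 0 (0 + h))\<^sup>2 - (max 0 0)\<^sup>2) / h) \<midarrow>0\<rightarrow> (0::real)"
    proof (rule Lim_null_comparison)
      show "\<forall>\<^sub>F h in at (0::real). norm (((max 0 (0 + h))\<^sup>2 - (max 0 0)\<^sup>2) / h) \<le> \<bar>h\<bar>"
        by (intro always_eventually allI) (auto simp: max_def power2_eq_square)
      show "((\<lambda>h::real. \<bar>h\<bar>) \<longlongrightarrow> 0) (at 0)" by (rule tendsto_rabs_zero) (rule tendsto_ident_at)
    qed
    thus ?thesis using True by (simp add: DERIV_def)
  qed
  hence "frechet_derivative (\<lambda>t::real. (max 0 t)\<^sup>2) (at t) 1 = 2 * max 0 t" for t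
    using frechet_derivative_apply[of _ "\<lambda>h. 2 * max 0 t * h" t 1] by (simp add: has_field_derivative_def)
  moreover have "continuous_on UNIV (\<lambda>t::real. 2 * max 0 t)" by (intro continuous_intros)
  ultimately show ?thesis using d
    by (auto simp: differentiable_def has_field_derivative_def)
qed

definition bump :: "'b::euclidean_space \<Rightarrow> real \<Rightarrow> 'b \<Rightarrow> real" where
  "bump x0 e w = (max 0 (e\<^sup>2 - (w - x0) \<bullet> (w - x0)))\<^sup>2"

lemma bump_Ck: "Ck_on 1 UNIV (bump x0 e :: 'b::euclidean_space \<Rightarrow> real)"
proof -
  have sub: "Ck_on 1 UNIV (\<lambda>w :: 'b. w - x0)"
    using Ck_on_add[OF open_UNIV Ck_on_bounded_linear[OF bounded_linear_ident] Ck_on_const, of 1 "- x0"] by simp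
  have "Ck_on 1 UNIV (\<lambda>w. (w - x0) \<bullet> (w - x0))"
    by (rule Ck_on_bilinear[OF open_UNIV bounded_bilinear_inner sub sub])
  from Ck_on_linear_compose[OF open_UNIV bounded_linear_minus[OF bounded_linear_ident] this]
  have "Ck_on 1 UNIV (\<lambda>w. e\<^sup>2 - (w - x0) \<bullet> (w - x0))"
    using Ck_on_add[OF open_UNIV Ck_on_const[of 1 UNIV "e\<^sup>2"]] by fastforce
  from Ck_on_compose[OF open_UNIV open_UNIV _ this square_pos_Ck]
  show ?thesis by (simp add: bump_def[abs_def])
qed

lemma bump_pos: "e > 0 \<Longrightarrow> bump x0 e w > 0 \<longleftrightarrow> dist x0 w < e"
  and bump_nonneg: "bump x0 e w \<ge> 0"
proof -
  assume e: "e > 0"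
  have "bump x0 e w > 0 \<longleftrightarrow> (w - x0) \<bullet> (w - x0) < e\<^sup>2" by (auto simp: bump_def max_def)
  also have "\<dots> \<longleftrightarrow> (norm (w - x0))\<^sup>2 < e\<^sup>2" by (simp add: dot_square_norm)
  also have "\<dots> \<longleftrightarrow> dist x0 w < e" using e
    by (metis dist_commute dist_norm less_imp_le norm_ge_zero power2_less_imp_less power_strict_mono zero_less_numeral)
  finally show "bump x0 e w > 0 \<longleftrightarrow> dist x0 w < e" .
qed (simp add: bump_def)

lemma mat_vec_index:
  assumes "A \<in> carrier_mat n m" "v \<in> carrier_vec m" "i < n"
  shows "vec_index (A *\<^sub>v v) i = (\<Sum>l<m. A $$ (i, l) * vec_index v l)"
  using assms by (auto simp: scalar_prod_def lessThan_atLeast0 intro!: sum.cong)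

locale compact_lie_group = dual_group \<mu> Ghat
  for \<mu> :: "'g::{topological_group_add, t2_space, second_countable_topology} measure"
    and Ghat :: "('g \<Rightarrow> complex mat) set" +
  fixes \<A> :: "('g, 'n::finite) chart set"
  assumes lie: "lie_group \<A>"
begin

lemma atlas: "smooth_atlas \<A>" by (rule lie_atlas[OF lie])

lemmas chart_facts' = chart_facts[OF atlas]

text \<open>The left quotient of two values. It sends the diagonal to the identity and serves to
  transport derivatives at arbitrary points there.\<close>

lemma csmooth_diff_pair:
  assumes "open S" "csmooth \<A> S Z"
  shows "csmooth \<A> (S \<times> S) (\<lambda>p. - Z (fst p) + Z (snd p))"
proof -
  have o: "open (S \<times> S)" by (intro open_Times assms)
  have "csmooth \<A> (S \<times> S) (\<lambda>p. Z (fst p))" "csmooth \<A> (S \<times> S) (\<lambda>p. Z (snd p))"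
    by (rule csmooth_compose[OF o assms(1) _ _ assms(2) atlas]; auto intro!: smooth_on_bounded_linear bounded_linear_fst bounded_linear_snd)+
  thus ?thesis by (intro csmooth_add[OF lie o] csmooth_minus[OF lie o])
qed

lemma diff_coord:
  assumes "open S" "csmooth \<A> S Z" "c \<in> \<A>"
  shows "open {p \<in> S \<times> S. - Z (fst p) + Z (snd p) \<in> fst c}"
    "smooth_on {p \<in> S \<times> S. - Z (fst p) + Z (snd p) \<in> fst c} (\<lambda>p. snd c (- Z (fst p) + Z (snd p)))"
  using csmooth_coord[OF csmooth_diff_pair[OF assms(1,2)] assms(3)]
    open_restrict[OF open_Times[OF assms(1,1)] csmooth_continuous[OF csmooth_diff_pair[OF assms(1,2)]] chart_facts'(1)[OF assms(3)]]
  by auto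

text \<open>A continuous representation is differentiable: up to an invertible matrix it equals its
  average against a bump function, and the translated bump function is differentiable in the
  translation parameter.\<close>

lemma rep_differentiable_zero:
  assumes rep: "is_rep \<pi>" and c: "c \<in> \<A>" "0 \<in> fst c" and ij: "i < rep_dim \<pi>" "j < rep_dim \<pi>"
  shows "(\<lambda>y. \<pi> (chart_inv c y) $$ (i, j)) differentiable (at (snd c 0))"
proof -
  define d where "d = rep_dim \<pi>"
  define ch where "ch = chart_inv c"
  define x0 where "x0 = snd c 0"
  define I where "I = chart_image c"
  note cf = chart_facts'[OF c(1), folded ch_def I_def]
  have x0I: "x0 \<in> I" and ch0: "ch x0 = 0" using cf(5,6)[OF c(2)] by (auto simp: x0_def)
  have d: "d > 0" using ij by (simp add: d_def)
  note r = is_rep_entries[OF rep, folded d_def]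
  have cs: "csmooth \<A> I ch" unfolding I_def ch_def by (rule csmooth_chart_inv[OF atlas c(1)])
  define \<Omega> where "\<Omega> = {p \<in> I \<times> I. - ch (fst p) + ch (snd p) \<in> fst c}"
  define m where "m p = snd c (- ch (fst p) + ch (snd p))" for p
  have \<Omega>: "open \<Omega>" and m: "smooth_on \<Omega> m"
    unfolding \<Omega>_def m_def[abs_def] using diff_coord[OF cf(2) cs c(1)] by auto
  have "(x0, x0) \<in> \<Omega>" using x0I c by (simp add: \<Omega>_def ch0)
  then obtain U V where UV: "open U" "open V" "x0 \<in> U" "x0 \<in> V" "U \<times> V \<subseteq> \<Omega>"
    using \<Omega> open_prod_elim by (metis SigmaE2 mem_Sigma_iff)
  then obtain r1 where r1: "r1 > 0" "cball x0 r1 \<subseteq> U \<inter> V"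
    by (metis IntI open_Int open_contains_cball)
  have K: "cball x0 r1 \<times> cball x0 r1 \<subseteq> \<Omega>" using r1(2) UV(5) by auto
  have subI: "cball x0 r1 \<subseteq> I" using K by (auto simp: \<Omega>_def)
  define Vr where "Vr = {g \<in> fst c. snd c g \<in> ball x0 r1}"
  have Vr: "open Vr" unfolding Vr_def by (rule open_restrict[OF cf(1,4) open_ball])
  have mm: "(0, 0) \<in> {p :: 'g \<times> 'g. fst p + snd p \<in> Vr}" using c r1 by (simp add: Vr_def x0_def)
  have op: "open {p :: 'g \<times> 'g. fst p + snd p \<in> Vr}"
    proof -
    have "continuous_on UNIV (\<lambda>p :: 'g \<times> 'g. fst p + snd p)" by (intro continuous_intros)
    from open_vimage[OF Vr this] show ?thesis by (simp add: vimage_def)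
  qed
  have "\<exists>A B. open A \<and> open B \<and> (0, 0) \<in> A \<times> B \<and> A \<times> B \<subseteq> {p :: 'g \<times> 'g. fst p + snd p \<in> Vr}"
    by (rule open_prod_elim[OF op mm]) (intro exI conjI; assumption)
  then obtain A B where AB: "open A" "open B" "0 \<in> A" "0 \<in> B" "A \<times> B \<subseteq> {p :: 'g \<times> 'g. fst p + snd p \<in> Vr}"
    unfolding mem_Sigma_iff by blast
  \<comment> \<open>On this neighbourhood every entry of \<pi> is within 1 / (2 d) of the identity
    matrix; summed over a row of length \<open>d\<close> the deviation is at most 1/2, which makes
    the average \<open>M\<close> invertible.\<close>
  define N0 where "N0 = (\<Inter>k\<in>{..<d}. \<Inter>l\<in>{..<d}. {g. cmod (\<pi> g $$ (k, l) - \<pi> 0 $$ (k, l)) < 1 / (2 * real d)}) \<inter> B"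
  have N0: "open N0" unfolding N0_def
    by (intro open_Int open_INT finite_lessThan ballI open_Collect_less continuous_intros r AB) auto
  have "open {y \<in> I. ch y \<in> N0}" by (rule open_restrict[OF cf(2,3) N0])
  moreover have "x0 \<in> {y \<in> I. ch y \<in> N0}" using x0I d AB by (simp add: ch0 N0_def)
  ultimately obtain e where e: "e > 0" "ball x0 e \<subseteq> {y \<in> I. ch y \<in> N0}" by (metis openE)
  have "open {y \<in> I. ch y \<in> A}" by (rule open_restrict[OF cf(2,3) AB(1)])
  moreover have "x0 \<in> {y \<in> I. ch y \<in> A}" using x0I AB by (simp add: ch0)
  ultimately obtain e2 where e2: "e2 > 0" "ball x0 e2 \<subseteq> {y \<in> I. ch y \<in> A}" by (metis openE)
  define r2 where "r2 = min r1 e2"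
  have r2: "r2 > 0" using r1 e2 by (simp add: r2_def)
  define \<phi> where "\<phi> g = (if g \<in> fst c then bump x0 e (snd c g) else 0)" for g
  have \<phi>0: "g \<in> fst c \<and> g \<in> N0" if "\<phi> g \<noteq> 0" for g
  proof -
    have g: "g \<in> fst c" "bump x0 e (snd c g) > 0" using that bump_nonneg[of x0 e "snd c g"] by (auto simp: \<phi>_def split: if_splits)
    hence "snd c g \<in> ball x0 e" using bump_pos[OF e(1), of x0 "snd c g"] by simp
    hence "ch (snd c g) \<in> N0" using e(2) by auto
    thus ?thesis using g cf(5) by simp
  qed
  have \<phi>nn: "\<phi> g \<ge> 0" for g by (simp add: \<phi>_def bump_nonneg)
  have bc: "continuous_on UNIV (bump x0 e)" using Ck_on_continuous[OF bump_Ck] .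
  have \<phi>m: "\<phi> \<in> borel_measurable borel"
  proof -
    have "(\<lambda>g. indicator (fst c) g *\<^sub>R bump x0 e (snd c g)) \<in> borel_measurable borel"
      by (intro borel_measurable_continuous_on_indicator)
         (use cf(1) in \<open>auto intro!: continuous_on_compose2[OF bc cf(4)]\<close>)
    moreover have "\<phi> g = indicator (fst c) g *\<^sub>R bump x0 e (snd c g)" for g by (simp add: \<phi>_def)
    hence "\<phi> = (\<lambda>g. indicator (fst c) g *\<^sub>R bump x0 e (snd c g))" by (rule ext)
    ultimately show ?thesis by (simp only:)
  qed
  have \<phi>b: "\<phi> g \<le> (e\<^sup>2)\<^sup>2" for g
    proof -
    have "bump x0 e w \<le> (e\<^sup>2)\<^sup>2" for w :: "real^'n"
      unfolding bump_def by (rule power_mono) auto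
    thus ?thesis by (simp add: \<phi>_def del: power_mult_numeral power_mult)
  qed
  \<comment> \<open>By left invariance the integral of the translated bump against \<pi> is
    \<open>\<pi> (ch y)\<close> times \<open>M\<close>; a right inverse of \<open>M\<close> then
    recovers the representation from integrals that are differentiable in \<open>y\<close>.\<close>
  define M where "M = Matrix.mat d d (\<lambda>(k, l). \<integral>g. complex_of_real (\<phi> g) * \<pi> g $$ (k, l) \<partial>\<mu>)"
  define F where "F k l y g = complex_of_real (\<phi> (- ch y + g)) * \<pi> g $$ (k, l)" for k l y g
  have \<pi>m: "(\<lambda>g. \<pi> g $$ (k, l)) \<in> borel_measurable borel" if "k < d" "l < d" for k l
    by (intro borel_measurable_continuous_onI r that)
  obtain Bd where Bd: "\<And>k l g. k < d \<Longrightarrow> l < d \<Longrightarrow> cmod (\<pi> g $$ (k, l)) \<le> Bd" "Bd > 0"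
  proof -
    have "\<exists>b. \<forall>g. cmod (\<pi> g $$ (k, l)) \<le> b" if "k < d" "l < d" for k l
      using continuous_bounded[OF r(6)[OF that]] by blast
    then obtain b where b: "\<And>k l g. k < d \<Longrightarrow> l < d \<Longrightarrow> cmod (\<pi> g $$ (k, l)) \<le> b k l" by metis
    have bp: "0 \<le> b k l" if "k < d" "l < d" for k l using b[OF that, of 0] norm_ge_zero order_trans by blast
    have "cmod (\<pi> g $$ (k, l)) \<le> (\<Sum>k<d. \<Sum>l<d. b k l) + 1" if kl: "k < d" "l < d" for k l g
    proof -
      have "b k l \<le> (\<Sum>l<d. b k l)" by (rule member_le_sum) (use kl bp in auto)
      also have "\<dots> \<le> (\<Sum>k<d. \<Sum>l<d. b k l)" 
        by (rule member_le_sum[of k "{..<d}" "\<lambda>k. \<Sum>l<d. b k l"]) (use kl bp in \<open>auto intro!: sum_nonneg\<close>)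
      finally show ?thesis using b[OF kl, of g] by simp
    qed
    moreover have "(\<Sum>k<d. \<Sum>l<d. b k l) + 1 > 0" using bp by (intro add_nonneg_pos sum_nonneg) auto
    ultimately show ?thesis using that by blast
  qed
  have Fm: "F k l y \<in> borel_measurable \<mu>" if "k < d" "l < d" for k l y
    unfolding F_def using \<phi>m \<pi>m[OF that] by (auto intro!: measurable_compose[OF measurable_translate(1)])
  have Fi: "integrable \<mu> (F k l y)" if "k < d" "l < d" for k l y
  proof (rule integrable_const_bound[where B="(e\<^sup>2)\<^sup>2 * Bd", OF AE_I2 Fm[OF that]])
    fix g
    have "norm (F k l y g) = \<phi> (- ch y + g) * cmod (\<pi> g $$ (k, l))" by (simp add: F_def norm_mult \<phi>nn)
    also have "\<dots> \<le> (e\<^sup>2)\<^sup>2 * Bd" by (intro mult_mono \<phi>b Bd that) (auto simp: \<phi>nn)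
    finally show "norm (F k l y g) \<le> (e\<^sup>2)\<^sup>2 * Bd" .
  qed
  have bm: "Ck_on 1 \<Omega> (\<lambda>p. bump x0 e (m p))"
    by (rule Ck_on_compose[OF \<Omega> open_UNIV _ _ bump_Ck]) (use m in \<open>auto simp: smooth_on_def\<close>)
  obtain L where L: "L \<ge> 0" "\<And>p q. p \<in> cball x0 r1 \<times> cball x0 r1 \<Longrightarrow> q \<in> cball x0 r1 \<times> cball x0 r1 \<Longrightarrow>
      norm (bump x0 e (m p) - bump x0 e (m q)) \<le> L * norm (p - q)"
    proof (rule C1_lipschitz[OF bm _ _ K])
    show "compact (cball x0 r1 \<times> cball x0 r1)" "convex (cball x0 r1 \<times> cball x0 r1)"
      by (intro compact_Times compact_cball convex_Times convex_cball)+
  qed blast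
  have in1: "\<phi> (- ch y + g) = bump x0 e (m (y, snd c g))" if "g \<in> Vr" "y \<in> cball x0 r1" for y g
  proof -
    have "snd c g \<in> cball x0 r1" using that by (auto simp: Vr_def)
    hence "(y, snd c g) \<in> \<Omega>" using that(2) by (intro subsetD[OF K] SigmaI)
    thus ?thesis using that by (simp add: \<Omega>_def m_def \<phi>_def Vr_def cf(5))
  qed
  \<comment> \<open>For \<open>y\<close> near \<open>x0\<close> the translated bump is supported in
    \<open>Vr\<close>, so wherever it is nonzero the coordinates of \<open>g\<close> are
    available.\<close>
  have out: "\<phi> (- ch y + g) = 0" if "g \<notin> Vr" "y \<in> ball x0 r2" for y g
  proof (rule ccontr)
    assume "\<phi> (- ch y + g) \<noteq> 0"
    hence "- ch y + g \<in> B" using \<phi>0 by (auto simp: N0_def)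
    moreover have "ch y \<in> A" using that(2) e2(2) by (auto simp: r2_def)
    ultimately have "ch y + (- ch y + g) \<in> Vr" using AB(5) by fastforce
    thus False using that(1) by (simp add: add.assoc[symmetric])
  qed
  have x0r: "x0 \<in> ball x0 r2" "x0 \<in> cball x0 r1" using r1 r2 by auto
  have diff: "(\<lambda>y. \<integral>g. F k l y g \<partial>\<mu>) differentiable (at x0)" if kl: "k < d" "l < d" for k l
  proof (rule differentiable_integral[OF _ r2, where L="L * Bd"])
    show "finite_measure \<mu>" by unfold_locales
    show "integrable \<mu> (F k l y)" for y by (rule Fi[OF kl])
    show "(\<lambda>y. F k l y g) differentiable at x0" for g
    proof (cases "g \<in> Vr")
      case True
      hence z: "snd c g \<in> cball x0 r1" by (auto simp: Vr_def)
      have "(\<lambda>p. bump x0 e (m p)) differentiable (at (x0, snd c g))"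
        using bm K z x0r by (auto simp: subset_eq)
      moreover have "(\<lambda>y. (y, snd c g)) differentiable (at x0)"
        by (intro differentiableI[of _ "\<lambda>h. (h, 0)"] derivative_eq_intros) auto
      ultimately have "(\<lambda>y. bump x0 e (m (y, snd c g))) differentiable (at x0)"
        using differentiable_chain_at[of "\<lambda>y. (y, snd c g)" x0 "\<lambda>p. bump x0 e (m p)"] by (simp add: comp_def)
      hence "(\<lambda>y. complex_of_real (bump x0 e (m (y, snd c g)))) differentiable (at x0)"
        using bounded_linear.has_derivative[OF bounded_linear_of_real] unfolding differentiable_def by blast
      hence "(\<lambda>y. complex_of_real (bump x0 e (m (y, snd c g))) * \<pi> g $$ (k, l)) differentiable (at x0)"
        by (rule differentiable_mult) (rule differentiable_const)
      thus ?thesis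
        by (rule differentiable_cong_open[OF open_ball, of x0 x0 r1, rotated 2])
           (use r1 True in \<open>auto simp: F_def in1\<close>)
    next
      case False
      have "(\<lambda>_. 0 :: complex) differentiable (at x0)" by simp
      thus ?thesis
        by (rule differentiable_cong_open[OF open_ball x0r(1), rotated])
           (simp add: F_def out[OF False])
    qed
    fix y g assume y: "y \<in> ball x0 r2"
    have y1: "y \<in> cball x0 r1" using y by (auto simp: r2_def)
    have "\<bar>\<phi> (- ch y + g) - \<phi> (- ch x0 + g)\<bar> \<le> L * norm (y - x0)"
    proof (cases "g \<in> Vr")
      case True
      hence z: "snd c g \<in> cball x0 r1" by (auto simp: Vr_def)
      show ?thesis unfolding in1[OF True y1] in1[OF True x0r(2)]
        using L(2)[of "(y, snd c g)" "(x0, snd c g)"] y1 x0r z by (simp add: norm_Pair)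
    next
      case False
      show ?thesis unfolding out[OF False y] out[OF False x0r(1)] using L(1) by simp
    qed
    note lip = this
    have "norm (F k l y g - F k l x0 g) = \<bar>\<phi> (- ch y + g) - \<phi> (- ch x0 + g)\<bar> * cmod (\<pi> g $$ (k, l))"
      unfolding F_def left_diff_distrib[symmetric] norm_mult of_real_diff[symmetric] norm_of_real ..
    also have "\<dots> \<le> L * norm (y - x0) * Bd"
      by (intro mult_mono lip Bd kl) (use L in auto)
    finally show "norm (F k l y g - F k l x0 g) \<le> L * Bd * norm (y - x0)" by (simp add: mult_ac)
  qed
  have Mc: "M \<in> carrier_mat d d" by (simp add: M_def)
  have Mi: "integrable \<mu> (\<lambda>g. complex_of_real (\<phi> g) * \<pi> g $$ (k, l))" if "k < d" "l < d" for k l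
    using Fi[OF that, of x0] by (simp add: F_def[abs_def] ch0)
  have UM: "(\<integral>g. F k l y g \<partial>\<mu>) = (\<pi> (ch y) * M) $$ (k, l)" if kl: "k < d" "l < d" for k l y
  proof -
    have "(\<integral>g. F k l y g \<partial>\<mu>) = (\<integral>g. F k l y (ch y + g) \<partial>\<mu>)"
      by (rule integral_left[symmetric]) (use Fm[OF kl] in simp)
    also have "\<dots> = (\<integral>g. (\<Sum>p<d. \<pi> (ch y) $$ (k, p) * (complex_of_real (\<phi> g) * \<pi> g $$ (p, l))) \<partial>\<mu>)"
      using rep_add_index[OF rep, folded d_def, OF kl] by (simp add: F_def sum_distrib_left mult_ac add.assoc[symmetric])
    also have "\<dots> = (\<Sum>p<d. \<pi> (ch y) $$ (k, p) * M $$ (p, l))"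
      using kl Mi by (subst Bochner_Integration.integral_sum) (auto simp: M_def)
    also have "\<dots> = (\<pi> (ch y) * M) $$ (k, l)" by (rule mat_mult_index[OF r(1) Mc kl, symmetric])
    finally show ?thesis .
  qed
  have "\<exists>R\<in>carrier_mat d d. M * R = 1\<^sub>m d"
  proof -
    \<comment> \<open>Take the largest entry \<open>k\<close> of a kernel vector: on the support of
      \<phi>, \<open>s g\<close> stays within half of that entry's modulus, so its average against
      \<phi> cannot vanish.\<close>
    have inj: "v = 0\<^sub>v d" if v: "v \<in> carrier_vec d" "M *\<^sub>v v = 0\<^sub>v d" for v
    proof (rule ccontr)
      assume nz: "v \<noteq> 0\<^sub>v d"
      define vv where "vv k = cmod (vec_index v k)" for k
      have ne: "vv ` {..<d} \<noteq> {}" "finite (vv ` {..<d})" using d by auto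
      obtain k where k: "k < d" "vv k = Max (vv ` {..<d})" using Max_in[OF ne(2,1)] by auto
      have max: "vv l \<le> vv k" if "l < d" for l unfolding k(2) using that by (intro Max_ge) auto
      have vk: "vv k > 0"
      proof (rule ccontr)
        assume "\<not> vv k > 0"
        hence "vec_index v l = 0" if "l < d" for l using max[OF that] norm_ge_zero[of "vec_index v l"] by (simp add: vv_def)
        hence "v = 0\<^sub>v d" using v by (intro eq_vecI) auto
        thus False using nz by simp
      qed
      define s where "s g = (\<Sum>l<d. \<pi> g $$ (k, l) * vec_index v l)" for g
      have "0 = vec_index (M *\<^sub>v v) k" using v k by simp
      also have "\<dots> = (\<Sum>l<d. M $$ (k, l) * vec_index v l)" by (rule mat_vec_index[OF Mc v(1) k(1)])
      also have "\<dots> = (\<Sum>l<d. (\<integral>g. complex_of_real (\<phi> g) * \<pi> g $$ (k, l) * vec_index v l \<partial>\<mu>))"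
        by (intro sum.cong refl) (simp add: M_def k(1))
      also have "\<dots> = (\<integral>g. (\<Sum>l<d. complex_of_real (\<phi> g) * \<pi> g $$ (k, l) * vec_index v l) \<partial>\<mu>)"
        using Mi k by (intro Bochner_Integration.integral_sum[symmetric]) auto
      also have "\<dots> = (\<integral>g. complex_of_real (\<phi> g) * s g \<partial>\<mu>)"
        by (simp add: s_def sum_distrib_left mult_ac)
      finally have z: "(\<integral>g. complex_of_real (\<phi> g) * s g \<partial>\<mu>) = 0" by simp
      have \<phi>i: "integrable \<mu> \<phi>"
        by (rule integrable_const_bound[where B="(e\<^sup>2)\<^sup>2"]) (use \<phi>m \<phi>b \<phi>nn in auto)
      have sm: "s \<in> borel_measurable \<mu>" unfolding s_def[abs_def] using \<pi>m k by (auto intro!: borel_measurable_sum)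
      have sdev: "cmod (s g - vec_index v k) \<le> vv k / 2" if "\<phi> g \<noteq> 0" for g
      proof -
        have g: "g \<in> N0" using \<phi>0[OF that] by simp
        have one: "\<pi> 0 $$ (k, l) = (if k = l then 1 else 0)" if "l < d" for l using that k by (simp add: r(2))
        have "s g - vec_index v k = (\<Sum>l<d. (\<pi> g $$ (k, l) - \<pi> 0 $$ (k, l)) * vec_index v l)"
        proof -
          have "(\<Sum>l<d. \<pi> 0 $$ (k, l) * vec_index v l) = (\<Sum>l<d. if k = l then vec_index v l else 0)"
            by (intro sum.cong refl) (simp add: one)
          also have "\<dots> = vec_index v k" using k by simp
          finally show ?thesis by (simp add: s_def left_diff_distrib sum_subtractf)
        qed
        also have "cmod \<dots> \<le> (\<Sum>l<d. cmod (\<pi> g $$ (k, l) - \<pi> 0 $$ (k, l)) * vv l)"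
          using norm_sum[of "\<lambda>l. (\<pi> g $$ (k, l) - \<pi> 0 $$ (k, l)) * vec_index v l" "{..<d}"] by (simp add: norm_mult vv_def)
        also have "\<dots> \<le> (\<Sum>l<d. 1 / (2 * real d) * vv k)"
          using g k max by (intro sum_mono mult_mono) (auto simp: N0_def vv_def less_imp_le)
        also have "\<dots> = vv k / 2" using d by simp
        finally show ?thesis .
      qed
      have si: "integrable \<mu> (\<lambda>g. complex_of_real (\<phi> g) * (s g - vec_index v k))"
      proof (rule Bochner_Integration.integrable_bound[of _ "\<lambda>g. \<phi> g * (vv k / 2)"])
        show "AE g in \<mu>. norm (complex_of_real (\<phi> g) * (s g - vec_index v k)) \<le> norm (\<phi> g * (vv k / 2))"
        proof (rule AE_I2)
          fix g show "norm (complex_of_real (\<phi> g) * (s g - vec_index v k)) \<le> norm (\<phi> g * (vv k / 2))"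
            using sdev[of g] vk by (cases "\<phi> g = 0") (auto simp: norm_mult abs_mult)
        qed
      qed (use \<phi>i sm \<phi>m in auto)
      have "(\<integral>g. complex_of_real (\<phi> g) * (s g - vec_index v k) \<partial>\<mu>) =
          (\<integral>g. complex_of_real (\<phi> g) * s g \<partial>\<mu>) - (\<integral>g. complex_of_real (\<phi> g) * vec_index v k \<partial>\<mu>)"
      proof -
        have i2: "integrable \<mu> (\<lambda>g. complex_of_real (\<phi> g) * vec_index v k)" using \<phi>i by simp
        have i1: "integrable \<mu> (\<lambda>g. complex_of_real (\<phi> g) * s g)"
          using Bochner_Integration.integrable_add[OF si i2] by (simp add: algebra_simps)
        show ?thesis unfolding right_diff_distrib by (rule Bochner_Integration.integral_diff[OF i1 i2])
      qed
      also have "(\<integral>g. complex_of_real (\<phi> g) * vec_index v k \<partial>\<mu>) = complex_of_real (\<integral>g. \<phi> g \<partial>\<mu>) * vec_index v k"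
        by simp
      finally have "complex_of_real (\<integral>g. \<phi> g \<partial>\<mu>) * vec_index v k = - (\<integral>g. complex_of_real (\<phi> g) * (s g - vec_index v k) \<partial>\<mu>)"
        using z by simp
      from arg_cong[OF this, of cmod]
      have "cmod (complex_of_real (\<integral>g. \<phi> g \<partial>\<mu>)) * vv k = cmod (\<integral>g. complex_of_real (\<phi> g) * (s g - vec_index v k) \<partial>\<mu>)"
        by (simp only: norm_mult vv_def norm_minus_cancel)
      moreover have "cmod (complex_of_real (\<integral>g. \<phi> g \<partial>\<mu>)) = (\<integral>g. \<phi> g \<partial>\<mu>)"
        using \<phi>nn by (simp add: Bochner_Integration.integral_nonneg del: integral_complex_of_real)
      ultimately have "(\<integral>g. \<phi> g \<partial>\<mu>) * vv k = cmod (\<integral>g. complex_of_real (\<phi> g) * (s g - vec_index v k) \<partial>\<mu>)"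
        by simp
      also have "\<dots> \<le> (\<integral>g. norm (complex_of_real (\<phi> g) * (s g - vec_index v k)) \<partial>\<mu>)" by (rule integral_norm_bound)
      also have "\<dots> \<le> (\<integral>g. \<phi> g * (vv k / 2) \<partial>\<mu>)"
      proof (rule integral_mono)
        show "norm (complex_of_real (\<phi> g) * (s g - vec_index v k)) \<le> \<phi> g * (vv k / 2)" for g
          using sdev[of g] \<phi>nn[of g] by (cases "\<phi> g = 0") (auto simp: norm_mult)
      qed (use si \<phi>i in auto)
      also have "\<dots> = (\<integral>g. \<phi> g \<partial>\<mu>) * vv k / 2" by simp
      finally have le: "(\<integral>g. \<phi> g \<partial>\<mu>) \<le> 0" using vk by (simp add: mult_le_0_iff)
      have "(\<integral>g. \<phi> g \<partial>\<mu>) = 0" using le \<phi>nn by (intro antisym Bochner_Integration.integral_nonneg) auto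
      hence ae: "AE g in \<mu>. \<phi> g = 0" using integral_nonneg_eq_0_iff_AE[OF \<phi>i] \<phi>nn by auto
      define W where "W = {g \<in> fst c. snd c g \<in> ball x0 e}"
      have W: "open W" unfolding W_def by (rule open_restrict[OF cf(1,4) open_ball])
      have "0 \<in> W" using c e by (simp add: W_def x0_def)
      hence "measure \<mu> W > 0" using open_pos[OF W] by auto
      moreover have "AE g in \<mu>. g \<notin> W"
        using ae by eventually_elim (use bump_pos[OF e(1), of x0] in \<open>force simp: W_def \<phi>_def\<close>)
      hence "measure \<mu> W = 0" using W by (subst (asm) AE_iff_measurable[of W]) (auto simp: measure_def)
      ultimately show False by simp
    qed
    have "Determinant.det M \<noteq> 0"
      using inj det_0_iff_vec_prod_zero[OF Mc] by metis
    from det_non_zero_imp_unit[OF Mc this, of "()"] show ?thesis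
      by (auto simp: Units_def ring_mat_simps)
  qed
  then obtain R where R: "R \<in> carrier_mat d d" "M * R = 1\<^sub>m d" by blast
  have eq: "\<pi> (ch y) $$ (i, j) = (\<Sum>l<d. (\<integral>g. F i l y g \<partial>\<mu>) * R $$ (l, j))" for y
  proof -
    have ij': "i < d" "j < d" using ij by (auto simp: d_def)
    have "\<pi> (ch y) = \<pi> (ch y) * (M * R)" using R r(1)[of "ch y"] by simp
    also have "\<dots> = (\<pi> (ch y) * M) * R" by (rule assoc_mult_mat[OF r(1) Mc R(1), symmetric])
    finally have "\<pi> (ch y) $$ (i, j) = ((\<pi> (ch y) * M) * R) $$ (i, j)" by simp
    also have "\<dots> = (\<Sum>l<d. (\<pi> (ch y) * M) $$ (i, l) * R $$ (l, j))"
      by (rule mat_mult_index[OF mult_carrier_mat[OF r(1) Mc] R(1) ij'])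
    also have "\<dots> = (\<Sum>l<d. (\<integral>g. F i l y g \<partial>\<mu>) * R $$ (l, j))"
      using ij' by (intro sum.cong refl) (simp add: UM)
    finally show ?thesis .
  qed
  have "(\<lambda>y. \<Sum>l<d. (\<integral>g. F i l y g \<partial>\<mu>) * R $$ (l, j)) differentiable (at x0)"
    using ij by (intro differentiable_sum ballI differentiable_mult differentiable_const diff) (auto simp: d_def)
  thus ?thesis unfolding eq[symmetric] by (simp add: ch_def x0_def)
qed

end

section \<open>Derivatives of representations at arbitrary points\<close>

context compact_lie_group
begin

text \<open>The derivative of \<pi> at the identity, that is the associated representation of the
  Lie algebra, in the coordinates of \<open>c\<close>.\<close>

definition rep_deriv :: "('g, 'n) chart \<Rightarrow> ('g \<Rightarrow> complex mat) \<Rightarrow> nat \<Rightarrow> nat \<Rightarrow> real^'n \<Rightarrow> complex" where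
  "rep_deriv c \<pi> i j w = frechet_derivative (\<lambda>y. \<pi> (chart_inv c y) $$ (i, j)) (at (snd c 0)) w"

lemma rep_deriv_has_derivative:
  assumes "is_rep \<pi>" "c \<in> \<A>" "0 \<in> fst c" "i < rep_dim \<pi>" "j < rep_dim \<pi>"
  shows "((\<lambda>y. \<pi> (chart_inv c y) $$ (i, j)) has_derivative rep_deriv c \<pi> i j) (at (snd c 0))"
  unfolding rep_deriv_def[abs_def] using rep_differentiable_zero[OF assms] by (simp add: frechet_derivative_works)

text \<open>This is the left logarithmic derivative of \<open>Z\<close>. Written as a directional
  derivative of the pair map on the diagonal, it is seen to depend smoothly on
  \<open>x\<close>.\<close>

lemma csmooth_section:
  fixes Z :: "'e::euclidean_space \<Rightarrow> 'g"
  assumes S: "open S" and Z: "csmooth \<A> S Z" and c: "c \<in> \<A>" "0 \<in> fst c" and x: "x \<in> S"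
  shows "(\<lambda>x'. snd c (- Z x + Z x')) differentiable (at x)"
    "frechet_derivative (\<lambda>x'. snd c (- Z x + Z x')) (at x) v =
      frechet_derivative (\<lambda>p. snd c (- Z (fst p) + Z (snd p))) (at (x, x)) (0, v)"
proof -
  define n where "n p = snd c (- Z (fst p) + Z (snd p))" for p
  define \<Omega> where "\<Omega> = {p \<in> S \<times> S. - Z (fst p) + Z (snd p) \<in> fst c}"
  have "Ck_on (Suc 0) \<Omega> n"
    using diff_coord(2)[OF S Z c(1)] unfolding smooth_on_def \<Omega>_def n_def[abs_def] by blast
  moreover have "(x, x) \<in> \<Omega>" using x c by (simp add: \<Omega>_def)
  ultimately have dn: "n differentiable (at (x, x))" by simp
  have "((\<lambda>x'. (x, x')) has_derivative (\<lambda>h. (0, h))) (at x)" by (auto intro!: derivative_eq_intros)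
  from has_derivative_compose[OF this dn[unfolded frechet_derivative_works]]
  have d: "((\<lambda>x'. snd c (- Z x + Z x')) has_derivative (\<lambda>h. frechet_derivative n (at (x, x)) (0, h))) (at x)"
    by (simp add: n_def)
  thus "(\<lambda>x'. snd c (- Z x + Z x')) differentiable (at x)" by (auto simp: differentiable_def)
  show "frechet_derivative (\<lambda>x'. snd c (- Z x + Z x')) (at x) v =
      frechet_derivative (\<lambda>p. snd c (- Z (fst p) + Z (snd p))) (at (x, x)) (0, v)"
    using frechet_derivative_apply[OF d] by (simp add: n_def[abs_def])
qed

text \<open>Since \<pi> is multiplicative, \<open>\<pi> (Z x')\<close> is \<open>\<pi> (Z x)\<close>
  times \<pi> of the left quotient, so differentiability at the identity suffices.\<close>

lemma rep_has_derivative: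
  fixes Z :: "'e::euclidean_space \<Rightarrow> 'g"
  assumes rep: "is_rep \<pi>" and c: "c \<in> \<A>" "0 \<in> fst c" and S: "open S" and Z: "csmooth \<A> S Z" and x: "x \<in> S"
    and ij: "i < rep_dim \<pi>" "j < rep_dim \<pi>"
  shows "((\<lambda>x'. \<pi> (Z x') $$ (i, j)) has_derivative
    (\<lambda>v. \<Sum>l<rep_dim \<pi>. \<pi> (Z x) $$ (i, l) *
      rep_deriv c \<pi> l j (frechet_derivative (\<lambda>x'. snd c (- Z x + Z x')) (at x) v))) (at x)"
proof -
  define n where "n x' = snd c (- Z x + Z x')" for x'
  note cf = chart_facts'[OF c(1)]
  define T where "T = {x' \<in> S. - Z x + Z x' \<in> fst c}"
  have T: "open T" unfolding T_def
    by (rule open_restrict[OF S _ cf(1)]) (intro continuous_intros csmooth_continuous[OF Z])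
  have xT: "x \<in> T" using x c by (simp add: T_def)
  have n: "(n has_derivative frechet_derivative n (at x)) (at x)"
    using csmooth_section(1)[OF S Z c x] by (simp add: n_def[abs_def] frechet_derivative_works)
  have nx: "n x = snd c 0" by (simp add: n_def)
  have "((\<lambda>x'. \<Sum>l<rep_dim \<pi>. \<pi> (Z x) $$ (i, l) * \<pi> (chart_inv c (n x')) $$ (l, j)) has_derivative
     (\<lambda>v. \<Sum>l<rep_dim \<pi>. \<pi> (Z x) $$ (i, l) * rep_deriv c \<pi> l j (frechet_derivative n (at x) v))) (at x)"
    using ij by (intro has_derivative_sum has_derivative_mult_right has_derivative_compose[OF n])
      (auto simp: nx intro!: rep_deriv_has_derivative rep c)
  thus ?thesis unfolding n_def[abs_def, symmetric]
  proof (rule has_derivative_transform_within_open[OF _ T xT])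
    fix x' assume "x' \<in> T"
    hence "chart_inv c (n x') = - Z x + Z x'" using cf(5) by (simp add: T_def n_def)
    moreover have "\<pi> (Z x') $$ (i, j) = \<pi> (Z x + (- Z x + Z x')) $$ (i, j)"
      by (simp add: add.assoc[symmetric])
    ultimately show "(\<Sum>l<rep_dim \<pi>. \<pi> (Z x) $$ (i, l) * \<pi> (chart_inv c (n x')) $$ (l, j)) = \<pi> (Z x') $$ (i, j)"
      using rep_add_index[OF rep ij, of "Z x" "- Z x + Z x'"] by (simp only:)
  qed
qed

text \<open>The derivative formula expresses the derivatives of a representation through the
  representation itself, so that regularity bootstraps.\<close>

lemma rep_smooth:
  fixes Z :: "'e::euclidean_space \<Rightarrow> 'g"
  assumes rep: "is_rep \<pi>" and S: "open S" and Z: "csmooth \<A> S Z"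
    and ij: "i < rep_dim \<pi>" "j < rep_dim \<pi>"
  shows "Ck_on k S (\<lambda>x. \<pi> (Z x) $$ (i, j))"
proof -
  obtain c where c: "c \<in> \<A>" "0 \<in> fst c" using chart_cover[OF atlas] by metis
  define n where "n p = snd c (- Z (fst p) + Z (snd p))" for p
  define \<Omega> where "\<Omega> = {p \<in> S \<times> S. - Z (fst p) + Z (snd p) \<in> fst c}"
  have \<Omega>: "open \<Omega>" and n: "Ck_on k \<Omega> n" for k
    using diff_coord[OF S Z c(1)] unfolding smooth_on_def \<Omega>_def n_def[abs_def] by blast+
  note der = rep_has_derivative[OF rep c S Z]
  show ?thesis using ij
  proof (induction k arbitrary: i j)
    case 0
    have "continuous_on S (\<lambda>x. \<pi> (Z x) $$ (i, j))"
      by (rule continuous_on_compose2[OF is_rep_entries(6)[OF rep 0] csmooth_continuous[OF Z]]) auto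
    thus ?case by simp
  next
    case (Suc k)
    have "Ck_on k S (\<lambda>x. frechet_derivative (\<lambda>x. \<pi> (Z x) $$ (i, j)) (at x) b)" if b: "b \<in> Basis" for b
    proof (rule Ck_on_cong[OF S])
      have db: "Ck_on k S (\<lambda>x. frechet_derivative n (at (x, x)) (0, b))"
      proof (rule Ck_on_compose[OF S \<Omega>])
        show "Ck_on k S (\<lambda>x. (x, x))" by (intro Ck_on_Pair S Ck_on_bounded_linear bounded_linear_ident)
        show "Ck_on k \<Omega> (\<lambda>p. frechet_derivative n (at p) (0, b))" by (rule Ck_on_directional[OF \<Omega> n])
      qed (use c in \<open>simp add: \<Omega>_def\<close>)
      have "bounded_linear (rep_deriv c \<pi> l j)" if "l < rep_dim \<pi>" for l
        using rep_deriv_has_derivative[OF rep c that Suc.prems(2)] has_derivative_bounded_linear by blast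
      thus "Ck_on k S (\<lambda>x. \<Sum>l<rep_dim \<pi>. \<pi> (Z x) $$ (i, l) * rep_deriv c \<pi> l j (frechet_derivative n (at (x, x)) (0, b)))"
        using Suc by (intro Ck_on_sum Ck_on_mult S Ck_on_linear_compose[OF S _ db]) auto
      fix x assume x: "x \<in> S"
      show "(\<Sum>l<rep_dim \<pi>. \<pi> (Z x) $$ (i, l) * rep_deriv c \<pi> l j (frechet_derivative n (at (x, x)) (0, b))) =
        frechet_derivative (\<lambda>x. \<pi> (Z x) $$ (i, j)) (at x) b"
        unfolding frechet_derivative_apply[OF der[OF x Suc.prems]] csmooth_section(2)[OF S Z c x] n_def[abs_def] ..
    qed
    moreover have "(\<lambda>x. \<pi> (Z x) $$ (i, j)) differentiable (at x)" if "x \<in> S" for x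
      using der[OF that Suc.prems] by (auto simp: differentiable_def)
    ultimately show ?case by simp
  qed
qed

end

section \<open>Eigenvalues of the Laplacian\<close>

text \<open>Isometries read as identities of bilinear forms, which compose more easily than matrix
  products.\<close>

lemma matrix_congruence_iff:
  fixes A G J :: "real^'n^'n"
  shows "A = transpose J ** G ** J \<longleftrightarrow> (\<forall>v w. v \<bullet> (A *v w) = (J *v v) \<bullet> (G *v (J *v w)))"
proof -
  have e: "v \<bullet> ((transpose J ** G ** J) *v w) = (J *v v) \<bullet> (G *v (J *v w))" for v w
    by (metis dot_lmul_matrix matrix_vector_mul_assoc transpose_matrix_vector inner_commute)
  show ?thesis
  proof
    assume h: "\<forall>v w. v \<bullet> (A *v w) = (J *v v) \<bullet> (G *v (J *v w))"
    hence "v \<bullet> (A *v w - (transpose J ** G ** J) *v w) = 0" for v w by (simp add: inner_diff_right e)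
    hence "A *v w = (transpose J ** G ** J) *v w" for w
      by (metis inner_eq_zero_iff eq_iff_diff_eq_0)
    thus "A = transpose J ** G ** J" by (simp add: matrix_eq)
  qed (simp add: e)
qed

lemma posdef_det:
  fixes G :: "real^'n^'n"
  assumes "\<And>v. v \<noteq> 0 \<Longrightarrow> v \<bullet> (G *v v) > 0"
  shows "det_v G \<noteq> 0"
proof -
  have "\<forall>x. G *v x = 0 \<longrightarrow> x = 0" using assms by (metis inner_zero_right less_irrefl)
  hence "\<exists>B. B ** G = Finite_Cartesian_Product.mat 1" using matrix_left_invertible_ker by blast
  thus ?thesis by (metis invertible_det_nz invertible_left_inverse)
qed

text \<open>\<kappa> is the least value of the inverse form on the unit sphere; a Hermitian
  expression in \<open>z\<close> is the sum of the real form at the real and at the imaginary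
  parts.\<close>

lemma posdef_inverse_lower_bound:
  fixes G :: "real^'n^'n"
  assumes sym: "transpose G = G" and pos: "\<And>v. v \<noteq> 0 \<Longrightarrow> v \<bullet> (G *v v) > 0"
  obtains \<kappa> where "\<kappa> > 0" "\<And>z :: 'n \<Rightarrow> complex. \<kappa> * (\<Sum>i\<in>UNIV. (cmod (z i))\<^sup>2) \<le>
    Re (\<Sum>i\<in>UNIV. \<Sum>j\<in>UNIV. matrix_inv G $ i $ j *\<^sub>R (z i * cnj (z j)))"
proof -
  note nz = posdef_det[OF pos]
  let ?a = "matrix_inv G"
  have inv_pos: "v \<bullet> (?a *v v) > 0" if v: "v \<noteq> 0" for v
  proof -
    let ?w = "?a *v v"
    have Gw: "G *v ?w = v" by (simp add: matrix_vector_mul_assoc matrix_inv_works[OF nz])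
    hence "?w \<noteq> 0" using v by auto
    from pos[OF this] show ?thesis unfolding Gw by (simp add: inner_commute)
  qed
  define S where "S = sphere (0 :: real^'n) 1"
  have S: "compact S" "S \<noteq> {}"
    unfolding S_def using vector_choose_size[of 1] by (auto simp: compact_sphere)
  have "continuous_on S (\<lambda>v. v \<bullet> (?a *v v))" by (intro continuous_intros)
  from continuous_attains_inf[OF S this] obtain v0 where v0: "v0 \<in> S" "\<And>v. v \<in> S \<Longrightarrow> v0 \<bullet> (?a *v v0) \<le> v \<bullet> (?a *v v)"
    by blast
  define \<kappa> where "\<kappa> = v0 \<bullet> (?a *v v0)"
  have kp: "\<kappa> > 0" unfolding \<kappa>_def by (rule inv_pos) (use v0(1) in \<open>auto simp: S_def\<close>)
  have lower: "\<kappa> * (v \<bullet> v) \<le> v \<bullet> (?a *v v)" for v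
  proof (cases "v = 0")
    case False
    hence "(1 / norm v) *\<^sub>R v \<in> S" by (simp add: S_def)
    from v0(2)[OF this] have "\<kappa> \<le> (1 / norm v)\<^sup>2 * (v \<bullet> (?a *v v))"
      by (simp add: \<kappa>_def matrix_vector_mult_scaleR power2_eq_square)
    moreover have "(norm v)\<^sup>2 = v \<bullet> v" by (rule dot_square_norm[symmetric])
    ultimately show ?thesis using False by (simp add: power_divide field_simps)
  qed simp
  have quad: "v \<bullet> (?a *v v) = (\<Sum>i\<in>UNIV. \<Sum>j\<in>UNIV. ?a $ i $ j * (v $ i * v $ j))" for v
    by (simp add: inner_vec_def matrix_vector_mult_def sum_distrib_left mult_ac)
  have "\<kappa> * (\<Sum>i\<in>UNIV. (cmod (z i))\<^sup>2) \<le> Re (\<Sum>i\<in>UNIV. \<Sum>j\<in>UNIV. ?a $ i $ j *\<^sub>R (z i * cnj (z j)))" for z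
  proof -
    define x y where "x = (\<chi> i. Re (z i))" and "y = (\<chi> i. Im (z i))"
    have "(\<Sum>i\<in>UNIV. (cmod (z i))\<^sup>2) = x \<bullet> x + y \<bullet> y"
      unfolding cmod_power2 sum.distrib by (simp add: x_def y_def inner_vec_def power2_eq_square)
    moreover have "Re (\<Sum>i\<in>UNIV. \<Sum>j\<in>UNIV. ?a $ i $ j *\<^sub>R (z i * cnj (z j))) = x \<bullet> (?a *v x) + y \<bullet> (?a *v y)"
      unfolding quad by (simp add: x_def y_def sum.distrib distrib_left)
    ultimately show ?thesis using lower[of x] lower[of y] by (simp add: distrib_left)
  qed
  with kp that show ?thesis by blast
qed

lemma lb_cong:
  assumes "open S" "y \<in> S" "\<And>x. x \<in> S \<Longrightarrow> u x = v x"
  shows "lb G u y = lb G v y"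
proof -
  have "partial_deriv j u x = partial_deriv j v x" if "x \<in> S" for j x
    by (rule partial_deriv_cong_open[OF assms(1) that assms(3)])
  hence "partial_deriv i (\<lambda>x. \<Sum>j\<in>UNIV. (sqrt (det_v (G x)) * matrix_inv (G x) $ i $ j) *\<^sub>R partial_deriv j u x) y =
    partial_deriv i (\<lambda>x. \<Sum>j\<in>UNIV. (sqrt (det_v (G x)) * matrix_inv (G x) $ i $ j) *\<^sub>R partial_deriv j v x) y" for i
    by (intro partial_deriv_cong_open[OF assms(1,2)]) simp
  thus ?thesis by (simp add: lb_def)
qed

section \<open>Isometries of a bi-invariant metric\<close>

locale riemannian_lie_group = compact_lie_group \<mu> Ghat \<A>
  for \<mu> :: "'g::{topological_group_add, t2_space, second_countable_topology} measure"
    and Ghat :: "('g \<Rightarrow> complex mat) set" and \<A> :: "('g, 'n::finite) chart set" +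
  fixes gm :: "('g, 'n) metric_field"
  assumes bi: "bi_invariant_metric \<A> gm"
begin

definition gram :: "('g, 'n) chart \<Rightarrow> real^'n \<Rightarrow> real^'n^'n" where
  "gram c x = gm c (chart_inv c x)"

lemma metric: "riemannian_metric \<A> gm"
  and metric_left: "preserves_metric \<A> gm (\<lambda>g. a + g)"
  and metric_right: "preserves_metric \<A> gm (\<lambda>g. g + a)"
  using bi by (auto simp: bi_invariant_metric_def)

lemma metricD:
  "preserves_metric \<A> gm F \<Longrightarrow> c \<in> \<A> \<Longrightarrow> c' \<in> \<A> \<Longrightarrow> p \<in> fst c \<Longrightarrow> F p \<in> fst c' \<Longrightarrow>
    gm c p = transpose (jacobian (coord_map c c' F) (at (snd c p))) ** gm c' (F p) **
      jacobian (coord_map c c' F) (at (snd c p))"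
  unfolding preserves_metric_def Let_def by blast

lemma gm_posdef:
  assumes "c \<in> \<A>" "p \<in> fst c"
  shows "transpose (gm c p) = gm c p" "\<And>v. v \<noteq> 0 \<Longrightarrow> v \<bullet> (gm c p *v v) > 0"
  using metric assms unfolding riemannian_metric_def by blast+

lemma metric_at_gram:
  assumes c: "c \<in> \<A>" and x: "x \<in> chart_image c"
  shows "metric_at (gram c) x"
proof -
  note cf = chart_facts'[OF c]
  have "Ck_on (Suc 0) (chart_image c) (gram c)"
    using metric c unfolding riemannian_metric_def smooth_on_def gram_def[abs_def] by blast
  hence d: "gram c differentiable (at x)" using x by simp
  have "(\<lambda>x. gram c x $ i $ j) differentiable (at x)" for i j
  proof -
    have "bounded_linear (\<lambda>A :: real^'n^'n. A $ i $ j)"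
      by (intro bounded_linear_compose[OF bounded_linear_vec_nth] bounded_linear_vec_nth)
    from bounded_linear.has_derivative[OF this d[unfolded frechet_derivative_works]]
    show ?thesis by (auto simp: differentiable_def)
  qed
  moreover have "det_v (gram c x) \<noteq> 0"
    unfolding gram_def by (rule posdef_det) (rule gm_posdef(2)[OF c cf(7)[OF x]])
  ultimately show ?thesis by (simp add: metric_at_def)
qed

text \<open>The coordinate form of \<open>F\<close> satisfies the transformation law of Gram
  matrices, so \<open>lb_invariant\<close> applies. Since the two charts may differ, chart
  independence is the case of the identity map.\<close>

lemma lb_isometry:
  assumes F: "preserves_metric \<A> gm F" and cs: "csmooth \<A> (chart_image c) (\<lambda>x. F (chart_inv c x))"
    and c: "c \<in> \<A>" "c' \<in> \<A>" and p: "p \<in> fst c" "F p \<in> fst c'"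
    and u: "Ck_on 2 (chart_image c') (\<lambda>x. u (chart_inv c' x))"
  shows "lb (gram c) (\<lambda>x. u (F (chart_inv c x))) (snd c p) =
    (lb (gram c') (\<lambda>x. u (chart_inv c' x)) (snd c' (F p)) :: complex)"
proof -
  note cf = chart_facts'[OF c(1)] and cf' = chart_facts'[OF c(2)]
  define S where "S = coord_dom c c' F"
  define \<Phi> where "\<Phi> = coord_map c c' F"
  have S: "open S" unfolding S_def coord_dom_def
    by (rule open_restrict[OF cf(2) csmooth_continuous[OF cs] cf'(1)])
  have pS: "snd c p \<in> S" using p cf by (simp add: S_def coord_dom_def)
  have \<Phi>: "Ck_on 2 S \<Phi>"
    using csmooth_coord[OF cs c(2)] unfolding S_def \<Phi>_def coord_dom_def coord_map_def[abs_def] smooth_on_def by blast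
  have "lb (gram c) (\<lambda>x. u (F (chart_inv c x))) (snd c p) = lb (gram c) (\<lambda>x. u (chart_inv c' (\<Phi> x))) (snd c p)"
    by (rule lb_cong[OF S pS]) (simp add: S_def \<Phi>_def coord_dom_def coord_map_def cf')
  also have "\<dots> = lb (gram c') (\<lambda>x. u (chart_inv c' x)) (\<Phi> (snd c p))"
  proof (rule lb_invariant[OF S pS cf'(2) _ \<Phi> u])
    show "\<Phi> x \<in> chart_image c'" if "x \<in> S" for x
      using that by (simp add: S_def \<Phi>_def coord_dom_def coord_map_def cf')
    show "metric_at (gram c') x" if "x \<in> chart_image c'" for x by (rule metric_at_gram[OF c(2) that])
    show "metric_at (gram c) x" if "x \<in> S" for x
      using that by (intro metric_at_gram c) (simp add: S_def coord_dom_def)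
    fix x assume x: "x \<in> S"
    hence x': "chart_inv c x \<in> fst c" "F (chart_inv c x) \<in> fst c'" "snd c (chart_inv c x) = x"
      using cf by (auto simp: S_def coord_dom_def)
    have "gm c (chart_inv c x) = transpose (jacobian \<Phi> (at x)) ** gm c' (F (chart_inv c x)) ** jacobian \<Phi> (at x)"
      using F c x' unfolding preserves_metric_def Let_def \<Phi>_def by metis
    thus "gram c x = transpose (jacobian \<Phi> (at x)) ** gram c' (\<Phi> x) ** jacobian \<Phi> (at x)"
      using x' by (simp add: gram_def \<Phi>_def coord_map_def cf')
  qed
  also have "\<Phi> (snd c p) = snd c' (F p)" using p cf by (simp add: \<Phi>_def coord_map_def)
  finally show ?thesis .
qed

lemma csmooth_left: "c \<in> \<A> \<Longrightarrow> csmooth \<A> (chart_image c) (\<lambda>x. a + chart_inv c x)"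
  and csmooth_right: "c \<in> \<A> \<Longrightarrow> csmooth \<A> (chart_image c) (\<lambda>x. chart_inv c x + a)"
  and csmooth_inv: "c \<in> \<A> \<Longrightarrow> csmooth \<A> (chart_image c) (\<lambda>x. - chart_inv c x)"
  by (intro csmooth_add[OF lie] csmooth_minus[OF lie] csmooth_const csmooth_chart_inv[OF atlas] chart_facts'(2); assumption)+

lemma coord_map_differentiable:
  assumes cs: "csmooth \<A> (chart_image c) (\<lambda>x. F (chart_inv c x))"
    and c: "c \<in> \<A>" "c' \<in> \<A>" and p: "p \<in> fst c" "F p \<in> fst c'"
  shows "coord_map c c' F differentiable (at (snd c p))"
proof -
  note cf = chart_facts'[OF c(1)]
  have "Ck_on (Suc 0) {x \<in> chart_image c. F (chart_inv c x) \<in> fst c'} (\<lambda>x. snd c' (F (chart_inv c x)))"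
    using csmooth_coord[OF cs c(2)] unfolding smooth_on_def by blast
  thus ?thesis using p cf by (simp add: coord_map_def[abs_def])
qed

text \<open>Both partial derivatives of the product at the identity are the identity;
  differentiating the product of \<open>x\<close> and its inverse, which is constant, leaves minus
  the identity.\<close>

lemma inversion_derivative:
  assumes c: "c \<in> \<A>" "0 \<in> fst c"
  shows "(coord_map c c uminus has_derivative uminus) (at (snd c 0))"
proof -
  note cf = chart_facts'[OF c(1)]
  define ch where "ch = chart_inv c"
  define x0 where "x0 = snd c 0"
  define I where "I = chart_image c"
  note cf = cf[folded ch_def I_def]
  have x0: "x0 \<in> I" "ch x0 = 0" using cf c by (auto simp: x0_def)
  define \<Phi> where "\<Phi> = coord_map c c uminus"
  have d\<Phi>: "\<Phi> differentiable (at x0)"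
    unfolding \<Phi>_def x0_def using coord_map_differentiable[OF csmooth_inv[OF c(1)] c(1,1) c(2)] c(2) by simp
  define \<Omega> where "\<Omega> = {p \<in> I \<times> I. ch (fst p) + ch (snd p) \<in> fst c}"
  define P where "P p = snd c (ch (fst p) + ch (snd p))" for p
  have o: "open (I \<times> I)" using cf(2) by (intro open_Times)
  have cs: "csmooth \<A> I ch" unfolding I_def ch_def by (rule csmooth_chart_inv[OF atlas c(1)])
  have "csmooth \<A> (I \<times> I) (\<lambda>p. ch (fst p))" "csmooth \<A> (I \<times> I) (\<lambda>p. ch (snd p))"
    by (rule csmooth_compose[OF o cf(2) _ _ cs atlas]; auto intro!: smooth_on_bounded_linear bounded_linear_fst bounded_linear_snd)+
  hence csP: "csmooth \<A> (I \<times> I) (\<lambda>p. ch (fst p) + ch (snd p))" by (rule csmooth_add[OF lie o])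
  have "Ck_on (Suc 0) \<Omega> P"
    using csmooth_coord[OF csP c(1)] unfolding smooth_on_def \<Omega>_def P_def[abs_def] by blast
  moreover have "(x0, x0) \<in> \<Omega>" using x0 c by (simp add: \<Omega>_def)
  ultimately have "P differentiable (at (x0, x0))" by simp
  then obtain P' where P': "(P has_derivative P') (at (x0, x0))" by (auto simp: differentiable_def)
  obtain \<Phi>' where \<Phi>': "(\<Phi> has_derivative \<Phi>') (at x0)" using d\<Phi> by (auto simp: differentiable_def)
  have linP: "linear P'" using has_derivative_linear[OF P'] .
  have \<Phi>x0: "\<Phi> x0 = x0" using x0 c by (simp add: \<Phi>_def coord_map_def ch_def[symmetric] x0_def[symmetric])
  have 1: "P' (h, 0) = h" for h
  proof -
    have "((\<lambda>x. (x, x0)) has_derivative (\<lambda>h. (h, 0))) (at x0)" by (auto intro!: derivative_eq_intros)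
    from has_derivative_compose[OF this P'] have "((\<lambda>x. P (x, x0)) has_derivative (\<lambda>h. P' (h, 0))) (at x0)" .
    hence "((\<lambda>x. x) has_derivative (\<lambda>h. P' (h, 0))) (at x0)"
      by (rule has_derivative_transform_within_open[OF _ cf(2) x0(1)]) (simp add: P_def x0 cf)
    thus ?thesis using has_derivative_unique[OF _ has_derivative_ident] by metis
  qed
  have 2: "P' (0, h) = h" for h
  proof -
    have "((\<lambda>x. (x0, x)) has_derivative (\<lambda>h. (0, h))) (at x0)" by (auto intro!: derivative_eq_intros)
    from has_derivative_compose[OF this P'] have "((\<lambda>x. P (x0, x)) has_derivative (\<lambda>h. P' (0, h))) (at x0)" .
    hence "((\<lambda>x. x) has_derivative (\<lambda>h. P' (0, h))) (at x0)"
      by (rule has_derivative_transform_within_open[OF _ cf(2) x0(1)]) (simp add: P_def x0 cf)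
    thus ?thesis using has_derivative_unique[OF _ has_derivative_ident] by metis
  qed
  have "((\<lambda>x. (x, \<Phi> x)) has_derivative (\<lambda>h. (h, \<Phi>' h))) (at x0)"
    by (intro has_derivative_Pair has_derivative_ident \<Phi>')
  from has_derivative_compose[OF this, of P P'] P'
  have "((\<lambda>x. P (x, \<Phi> x)) has_derivative (\<lambda>h. P' (h, \<Phi>' h))) (at x0)" by (simp add: \<Phi>x0)
  moreover define T where "T = {x \<in> I. - ch x \<in> fst c}"
  have T: "open T" unfolding T_def by (rule open_restrict[OF cf(2) _ cf(1)]) (intro continuous_intros cf)
  have "x0 \<in> T" using x0 c by (simp add: T_def)
  ultimately have "((\<lambda>x. x0) has_derivative (\<lambda>h. P' (h, \<Phi>' h))) (at x0)"
    by (rule has_derivative_transform_within_open[OF _ T])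
       (simp add: P_def \<Phi>_def coord_map_def T_def cf ch_def[symmetric] x0_def)
  hence z: "P' (h, \<Phi>' h) = 0" for h using has_derivative_unique[OF _ has_derivative_const] by metis
  have "\<Phi>' h = - h" for h
  proof -
    have "P' (h, \<Phi>' h) = P' ((h, 0) + (0, \<Phi>' h))" by simp
    also have "\<dots> = h + \<Phi>' h" unfolding linear_add[OF linP] 1 2 ..
    finally show ?thesis using z[of h] by (simp add: add_eq_0_iff)
  qed
  hence "\<Phi>' = uminus" by (rule ext)
  thus ?thesis using \<Phi>' by (simp add: \<Phi>_def x0_def)
qed

text \<open>Inversion near \<open>p\<close> is the left translation taking \<open>p\<close> to 0,
  followed by inversion at 0 and a right translation. The translations are isometries, and the
  differential of the middle map at 0 is minus the identity, which preserves every bilinear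
  form.\<close>

lemma metric_inversion: "preserves_metric \<A> gm uminus"
  unfolding preserves_metric_def Let_def
proof (intro ballI impI)
  fix c c' p assume c: "c \<in> \<A>" "c' \<in> \<A>" and p: "p \<in> fst c" "- p \<in> fst c'"
  obtain c0 where c0: "c0 \<in> \<A>" "0 \<in> fst c0" using chart_cover[OF atlas] by metis
  note cf = chart_facts'[OF c(1)] and cf' = chart_facts'[OF c(2)] and cf0 = chart_facts'[OF c0(1)]
  define L where "L = coord_map c c0 (\<lambda>g. - p + g)"
  define R where "R = coord_map c0 c' (\<lambda>g. g + - p)"
  define V where "V = coord_map c0 c0 uminus"
  define I where "I = coord_map c c' uminus"
  define JL JR J where "JL = jacobian L (at (snd c p))" and "JR = jacobian R (at (snd c0 0))"
    and "J = jacobian I (at (snd c p))"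
  have dL: "(L has_derivative (*v) JL) (at (snd c p))"
    unfolding JL_def jacobian_works[symmetric] L_def
    by (rule coord_map_differentiable[OF csmooth_left[OF c(1)] c(1) c0(1) p(1)]) (simp add: c0)
  have dR: "(R has_derivative (*v) JR) (at (snd c0 0))"
    unfolding JR_def jacobian_works[symmetric] R_def
    by (rule coord_map_differentiable[OF csmooth_right[OF c0(1)] c0(1) c(2) c0(2)]) (simp add: p)
  have dI: "(I has_derivative (*v) J) (at (snd c p))"
    unfolding J_def jacobian_works[symmetric] I_def
    by (rule coord_map_differentiable[OF csmooth_inv[OF c(1)] c p])
  have Lp: "L (snd c p) = snd c0 0" using p cf by (simp add: L_def coord_map_def)
  have V0: "V (snd c0 0) = snd c0 0" using c0 cf0 by (simp add: V_def coord_map_def)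
  have dVL: "((\<lambda>x. V (L x)) has_derivative (\<lambda>h. - (JL *v h))) (at (snd c p))"
    using has_derivative_compose[OF dL, of V uminus] inversion_derivative[OF c0] by (simp add: Lp V_def)
  have "((\<lambda>x. R (V (L x))) has_derivative (\<lambda>h. JR *v (- (JL *v h)))) (at (snd c p))"
    using has_derivative_compose[OF dVL, of R "(*v) JR"] dR by (simp add: Lp V0)
  moreover define T where "T = {x \<in> chart_image c. - p + chart_inv c x \<in> fst c0} \<inter> {x \<in> chart_image c. - (- p + chart_inv c x) \<in> fst c0}"
  have T: "open T" unfolding T_def
    by (intro open_Int open_restrict cf cf0 continuous_intros)
  have pT: "snd c p \<in> T" using p c0 cf by (simp add: T_def)
  ultimately have "(I has_derivative (\<lambda>h. JR *v (- (JL *v h)))) (at (snd c p))"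
  proof (rule has_derivative_transform_within_open[OF _ T])
    fix x assume "x \<in> T"
    thus "R (V (L x)) = I x"
      by (simp add: T_def R_def V_def L_def I_def coord_map_def cf0 minus_add add.assoc)
  qed
  from has_derivative_unique[OF dI this] have "(*v) J = (\<lambda>h. JR *v (- (JL *v h)))" .
  from fun_cong[OF this] have Jh0: "J *v h = JR *v (- (JL *v h))" for h .
  have mneg: "A *v (- y) = - (A *v y)" for A :: "real^'n^'n" and y
    using linear_neg[OF matrix_vector_mul_linear] .
  have Jh: "J *v h = - (JR *v (JL *v h))" for h
    unfolding Jh0 by (rule mneg)
  have "gm c p = transpose JL ** gm c0 (- p + p) ** JL"
    unfolding JL_def L_def by (rule metricD[OF metric_left c(1) c0(1) p(1)]) (simp add: c0)
  moreover have "gm c0 0 = transpose JR ** gm c' (0 + - p) ** JR"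
    unfolding JR_def R_def by (rule metricD[OF metric_right c0(1) c(2) c0(2)]) (simp add: p)
  ultimately have e1: "\<forall>v w. v \<bullet> (gm c p *v w) = (JL *v v) \<bullet> (gm c0 0 *v (JL *v w))"
    and e2: "\<forall>v w. v \<bullet> (gm c0 0 *v w) = (JR *v v) \<bullet> (gm c' (- p) *v (JR *v w))"
    unfolding matrix_congruence_iff[symmetric] by simp_all
  have neg: "gm c' (- p) *v (- y) = - (gm c' (- p) *v y)" for y by (rule mneg)
  show "gm c p = transpose (jacobian (coord_map c c' uminus) (at (snd c p))) ** gm c' (- p) **
      jacobian (coord_map c c' uminus) (at (snd c p))"
    unfolding I_def[symmetric] J_def[symmetric] matrix_congruence_iff using e1 e2 by (simp add: Jh neg)
qed

end

section \<open>The Laplacian on matrix coefficients\<close>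

context riemannian_lie_group
begin

text \<open>The choice made inside \<open>laplace_beltrami\<close>, so that the operator unfolds to
  \<open>lb\<close> in this chart.\<close>

definition chart_at :: "'g \<Rightarrow> ('g, 'n) chart" where
  "chart_at p = (SOME c. c \<in> \<A> \<and> p \<in> fst c)"

lemma chart_at: "chart_at p \<in> \<A>" "p \<in> fst (chart_at p)"
proof -
  have "\<exists>c. c \<in> \<A> \<and> p \<in> fst c" using chart_cover[OF atlas] by metis
  from someI_ex[OF this] show "chart_at p \<in> \<A>" "p \<in> fst (chart_at p)" unfolding chart_at_def by blast+
qed

abbreviation lap :: "('g \<Rightarrow> complex) \<Rightarrow> 'g \<Rightarrow> complex" where
  "lap \<equiv> laplace_beltrami \<A> gm"

lemma lap_lb: "lap f p = lb (gram (chart_at p)) (\<lambda>x. f (chart_inv (chart_at p) x)) (snd (chart_at p) p)"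
  unfolding laplace_beltrami_def Let_def lb_def gram_def chart_at_def ..

definition C2_function :: "('g \<Rightarrow> complex) \<Rightarrow> bool" where
  "C2_function f \<longleftrightarrow> (\<forall>c\<in>\<A>. Ck_on 2 (chart_image c) (\<lambda>x. f (chart_inv c x)))"

lemma lap_isometry:
  assumes "preserves_metric \<A> gm F" "\<And>c. c \<in> \<A> \<Longrightarrow> csmooth \<A> (chart_image c) (\<lambda>x. F (chart_inv c x))"
    and u: "C2_function u"
  shows "lap (\<lambda>g. u (F g)) p = lap u (F p)"
  unfolding lap_lb by (rule lb_isometry) (use assms chart_at in \<open>auto simp: C2_function_def\<close>)

lemma chart_at_facts: "metric_at (gram (chart_at p)) (snd (chart_at p) p)"
  "open (chart_image (chart_at p))" "snd (chart_at p) p \<in> chart_image (chart_at p)"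
proof -
  note cf = chart_facts'[OF chart_at(1)[of p]]
  show 1: "open (chart_image (chart_at p))" "snd (chart_at p) p \<in> chart_image (chart_at p)"
    using cf chart_at[of p] by auto
  show "metric_at (gram (chart_at p)) (snd (chart_at p) p)" by (rule metric_at_gram[OF chart_at(1) 1(2)])
qed

lemma lap_linear:
  assumes I: "finite I" and u: "\<And>i. i \<in> I \<Longrightarrow> C2_function (u i)"
  shows "lap (\<lambda>g. \<Sum>i\<in>I. a i * u i g) p = (\<Sum>i\<in>I. a i * lap (u i) p)"
proof -
  let ?c = "chart_at p"
  note c = chart_at_facts[of p]
  have u': "Ck_on 2 (chart_image ?c) (\<lambda>x. u i (chart_inv ?c x))" if "i \<in> I" for i
    using u[OF that] chart_at(1) by (auto simp: C2_function_def)
  have "lap (\<lambda>g. \<Sum>i\<in>I. a i * u i g) p =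
      (\<Sum>i\<in>I. lb (gram ?c) (\<lambda>x. a i * u i (chart_inv ?c x)) (snd ?c p))"
    unfolding lap_lb by (rule lb_sum[OF c _ I]) (intro Ck_on_linear_compose[OF c(2) _ u'] bounded_linear_mult_right)
  also have "\<dots> = (\<Sum>i\<in>I. a i * lap (u i) p)"
    unfolding lap_lb by (intro sum.cong refl lb_bounded_linear[OF c u'] bounded_linear_mult_right)
  finally show ?thesis .
qed

lemma lap_cnj:
  assumes "C2_function u"
  shows "lap (\<lambda>g. cnj (u g)) p = cnj (lap u p)"
  unfolding lap_lb
  by (rule lb_bounded_linear[OF chart_at_facts _ bounded_linear_cnj])
    (use assms chart_at(1) in \<open>auto simp: C2_function_def\<close>)

lemma C2_rep: "is_rep \<pi> \<Longrightarrow> i < rep_dim \<pi> \<Longrightarrow> j < rep_dim \<pi> \<Longrightarrow> C2_function (\<lambda>g. \<pi> g $$ (i, j))"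
  unfolding C2_function_def by (intro ballI rep_smooth csmooth_chart_inv[OF atlas] chart_facts'(2)) auto

text \<open>Left and right translations are isometries, so the Laplacian of \<pi> is
  \<open>\<pi> p\<close> multiplied on either side by the matrix of its values at the
  identity.\<close>

lemma lap_rep:
  assumes rep: "is_rep \<pi>" and ij: "i < rep_dim \<pi>" "j < rep_dim \<pi>"
  shows "lap (\<lambda>g. \<pi> g $$ (i, j)) p = (\<Sum>l<rep_dim \<pi>. \<pi> p $$ (i, l) * lap (\<lambda>g. \<pi> g $$ (l, j)) 0)"
    and "lap (\<lambda>g. \<pi> g $$ (i, j)) p = (\<Sum>l<rep_dim \<pi>. lap (\<lambda>g. \<pi> g $$ (i, l)) 0 * \<pi> p $$ (l, j))"
proof -
  have "lap (\<lambda>g. \<pi> g $$ (i, j)) (p + 0) = lap (\<lambda>g. \<pi> (p + g) $$ (i, j)) 0"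
    by (rule lap_isometry[OF metric_left csmooth_left C2_rep[OF assms], symmetric])
  also have "\<dots> = lap (\<lambda>g. \<Sum>l<rep_dim \<pi>. \<pi> p $$ (i, l) * \<pi> g $$ (l, j)) 0"
    by (simp only: rep_add_index[OF assms])
  also have "\<dots> = (\<Sum>l<rep_dim \<pi>. \<pi> p $$ (i, l) * lap (\<lambda>g. \<pi> g $$ (l, j)) 0)"
    by (rule lap_linear) (auto intro!: C2_rep rep ij)
  finally show "lap (\<lambda>g. \<pi> g $$ (i, j)) p = (\<Sum>l<rep_dim \<pi>. \<pi> p $$ (i, l) * lap (\<lambda>g. \<pi> g $$ (l, j)) 0)" by simp
  have "lap (\<lambda>g. \<pi> g $$ (i, j)) (0 + p) = lap (\<lambda>g. \<pi> (g + p) $$ (i, j)) 0"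
    by (rule lap_isometry[OF metric_right csmooth_right C2_rep[OF assms], symmetric])
  also have "\<dots> = lap (\<lambda>g. \<Sum>l<rep_dim \<pi>. \<pi> p $$ (l, j) * \<pi> g $$ (i, l)) 0"
    by (simp only: rep_add_index[OF assms] mult.commute)
  also have "\<dots> = (\<Sum>l<rep_dim \<pi>. \<pi> p $$ (l, j) * lap (\<lambda>g. \<pi> g $$ (i, l)) 0)"
    by (rule lap_linear) (auto intro!: C2_rep rep ij)
  finally show "lap (\<lambda>g. \<pi> g $$ (i, j)) p = (\<Sum>l<rep_dim \<pi>. lap (\<lambda>g. \<pi> g $$ (i, l)) 0 * \<pi> p $$ (l, j))"
    by (simp add: mult.commute)
qed

text \<open>By the two formulas of \<open>lap_rep\<close> the matrix of Laplacians at 0 commutes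
  with \<pi>, hence is scalar. Inversion is an isometry and conjugates the diagonal entries of a
  unitary representation, so the scalar is real.\<close>

lemma lap_scalar:
  assumes \<pi>: "\<pi> \<in> Ghat"
  obtains l :: real where "\<And>i j. i < rep_dim \<pi> \<Longrightarrow> j < rep_dim \<pi> \<Longrightarrow>
    lap (\<lambda>g. \<pi> g $$ (i, j)) 0 = (if i = j then - complex_of_real l else 0)"
proof -
  note rep = Ghat_rep[OF \<pi>]
  let ?d = "rep_dim \<pi>"
  define M where "M = Matrix.mat ?d ?d (\<lambda>(i, j). lap (\<lambda>g. \<pi> g $$ (i, j)) 0)"
  have M: "M \<in> carrier_mat ?d ?d" by (simp add: M_def)
  have "M * \<pi> g = \<pi> g * M" for g
  proof (rule eq_matI)
    note ca = is_rep_entries(1)[OF rep, of g]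
    fix i j assume "i < dim_row (\<pi> g * M)" "j < dim_col (\<pi> g * M)"
    hence ij: "i < ?d" "j < ?d" using ca M by auto
    have "(M * \<pi> g) $$ (i, j) = lap (\<lambda>g. \<pi> g $$ (i, j)) g"
      unfolding mat_mult_index[OF M ca ij] lap_rep(2)[OF rep ij] using ij by (intro sum.cong) (auto simp: M_def)
    moreover have "(\<pi> g * M) $$ (i, j) = lap (\<lambda>g. \<pi> g $$ (i, j)) g"
      unfolding mat_mult_index[OF ca M ij] lap_rep(1)[OF rep ij] using ij by (intro sum.cong) (auto simp: M_def)
    ultimately show "(M * \<pi> g) $$ (i, j) = (\<pi> g * M) $$ (i, j)" by simp
  qed (use M is_rep_entries(1)[OF rep, of g] in auto)
  from schur_scalar[OF Ghat_irr[OF \<pi>] M this] obtain z where z: "M = z \<cdot>\<^sub>m 1\<^sub>m ?d" by blast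
  have lz: "lap (\<lambda>g. \<pi> g $$ (i, j)) 0 = (if i = j then z else 0)" if "i < ?d" "j < ?d" for i j
  proof -
    have "M $$ (i, j) = (z \<cdot>\<^sub>m 1\<^sub>m ?d) $$ (i, j)" by (simp only: z)
    thus ?thesis using that by (simp add: M_def)
  qed
  note d0 = Ghat_dim[OF \<pi>]
  have "lap (\<lambda>g. \<pi> g $$ (0, 0)) (- 0) = lap (\<lambda>g. \<pi> (- g) $$ (0, 0)) 0"
    by (rule lap_isometry[OF metric_inversion csmooth_inv C2_rep[OF rep d0 d0], symmetric])
  also have "\<dots> = lap (\<lambda>g. cnj (\<pi> g $$ (0, 0))) 0" by (simp only: Ghat_minus[OF \<pi> d0 d0])
  also have "\<dots> = cnj (lap (\<lambda>g. \<pi> g $$ (0, 0)) 0)" by (rule lap_cnj[OF C2_rep[OF rep d0 d0]])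
  finally have "z = cnj z" using lz[OF d0 d0] by simp
  hence "z = complex_of_real (Re z)" by (simp add: complex_eq_iff)
  hence "z = - complex_of_real (- Re z)" by simp
  with that[of "- Re z"] lz show ?thesis by simp
qed

definition eig :: "('g \<Rightarrow> complex mat) \<Rightarrow> real" where
  "eig \<pi> = laplace_eigenvalue \<A> gm \<pi>"

lemma lap_eig:
  assumes \<pi>: "\<pi> \<in> Ghat" and ij: "i < rep_dim \<pi>" "j < rep_dim \<pi>"
  shows "lap (\<lambda>g. \<pi> g $$ (i, j)) 0 = (if i = j then - complex_of_real (eig \<pi>) else 0)"
proof -
  note rep = Ghat_rep[OF \<pi>] and d0 = Ghat_dim[OF \<pi>]
  obtain l where l: "lap (\<lambda>g. \<pi> g $$ (i, j)) 0 = (if i = j then - complex_of_real l else 0)"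
    if "i < rep_dim \<pi>" "j < rep_dim \<pi>" for i j
    using lap_scalar[OF \<pi>] by metis
  have "eig \<pi> = l" unfolding eig_def laplace_eigenvalue_def
  proof (rule the_equality)
    show "\<forall>i<rep_dim \<pi>. \<forall>j<rep_dim \<pi>. \<forall>p. - lap (\<lambda>g. \<pi> g $$ (i, j)) p = complex_of_real l * \<pi> p $$ (i, j)"
    proof (intro allI impI)
      fix i j p assume ij: "i < rep_dim \<pi>" "j < rep_dim \<pi>"
      have "lap (\<lambda>g. \<pi> g $$ (i, j)) p = (\<Sum>k<rep_dim \<pi>. if k = j then \<pi> p $$ (i, j) * - complex_of_real l else 0)"
        unfolding lap_rep(1)[OF rep ij] by (intro sum.cong refl) (use ij in \<open>simp add: l\<close>)
      also have "\<dots> = - complex_of_real l * \<pi> p $$ (i, j)" using ij by simp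
      finally show "- lap (\<lambda>g. \<pi> g $$ (i, j)) p = complex_of_real l * \<pi> p $$ (i, j)" by simp
    qed
  next
    fix l' assume "\<forall>i<rep_dim \<pi>. \<forall>j<rep_dim \<pi>. \<forall>p. - lap (\<lambda>g. \<pi> g $$ (i, j)) p = complex_of_real l' * \<pi> p $$ (i, j)"
    hence "- lap (\<lambda>g. \<pi> g $$ (0, 0)) 0 = complex_of_real l' * \<pi> 0 $$ (0, 0)" using d0 by blast
    thus "l' = l" using l[OF d0 d0] Ghat_zero[OF \<pi> d0 d0] by (simp del: of_real_minus)
  qed
  thus ?thesis using l[OF ij] by simp
qed

abbreviation (input) "c0 \<equiv> chart_at 0"

text \<open>The statement for a single row \<open>i\<close>: the squared moduli of a row of a
  unitary matrix sum to 1, and the product rule yields minus twice the eigenvalue plus twice the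
  gradient term. Summation over \<open>i\<close> gives the trace identity.\<close>

lemma eig_gradient:
  assumes \<pi>: "\<pi> \<in> Ghat" and i: "i < rep_dim \<pi>"
  shows "eig \<pi> = Re (\<Sum>k<rep_dim \<pi>. \<Sum>a\<in>UNIV. \<Sum>b\<in>UNIV.
    matrix_inv (gm c0 0) $ a $ b *\<^sub>R (rep_deriv c0 \<pi> i k (axis a 1) * cnj (rep_deriv c0 \<pi> i k (axis b 1))))"
proof -
  note rep = Ghat_rep[OF \<pi>]
  let ?x = "snd c0 0" and ?ch = "chart_inv c0" and ?S = "chart_image c0"
  note c = chart_at_facts[of 0]
  have ch0: "?ch ?x = 0" using chart_facts'[OF chart_at(1)[of 0]] chart_at(2)[of 0] by simp
  have GG0: "gram c0 ?x = gm c0 0" by (simp add: gram_def ch0)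
  define u where "u k x = \<pi> (?ch x) $$ (i, k)" for k x
  have u: "Ck_on 2 ?S (u k)" if "k < rep_dim \<pi>" for k
    using C2_rep[OF rep i that] chart_at(1) unfolding C2_function_def u_def[abs_def] by blast
  have u': "Ck_on 2 ?S (\<lambda>x. cnj (u k x))" if "k < rep_dim \<pi>" for k
    by (rule Ck_on_linear_compose[OF c(2) bounded_linear_cnj u[OF that]])
  have pu: "partial_deriv a (u k) ?x = rep_deriv c0 \<pi> i k (axis a 1)" if "k < rep_dim \<pi>" for a k
    unfolding partial_deriv_def rep_deriv_def u_def[abs_def] ..
  have pu': "partial_deriv a (\<lambda>x. cnj (u k x)) ?x = cnj (rep_deriv c0 \<pi> i k (axis a 1))" if "k < rep_dim \<pi>" for a k
    using partial_deriv_bounded_linear[OF bounded_linear_cnj Ck2_differentiable(1)[OF u[OF that] c(3)]] pu[OF that] by simp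
  have lu: "lb (gram c0) (u k) ?x = (if i = k then - complex_of_real (eig \<pi>) else 0)" if "k < rep_dim \<pi>" for k
    using lap_eig[OF \<pi> i that] unfolding lap_lb u_def[abs_def] .
  have lu': "lb (gram c0) (\<lambda>x. cnj (u k x)) ?x = (if i = k then - complex_of_real (eig \<pi>) else 0)" if "k < rep_dim \<pi>" for k
    using lb_bounded_linear[OF c u[OF that] bounded_linear_cnj] lu[OF that] by simp
  have u0: "u k ?x = (if i = k then 1 else 0)" if "k < rep_dim \<pi>" for k
    unfolding u_def ch0 by (rule Ghat_zero[OF \<pi> i that])
  define Q where "Q k = (\<Sum>a\<in>UNIV. \<Sum>b\<in>UNIV.
    matrix_inv (gm c0 0) $ a $ b *\<^sub>R (rep_deriv c0 \<pi> i k (axis a 1) * cnj (rep_deriv c0 \<pi> i k (axis b 1))))" for k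
  have sym: "transpose (gram c0 ?x) = gram c0 ?x" unfolding GG0 by (rule gm_posdef(1)[OF chart_at])
  have trm: "lb (gram c0) (\<lambda>x. u k x * cnj (u k x)) ?x = (if i = k then - 2 * complex_of_real (eig \<pi>) else 0) + 2 * Q k"
    if k: "k < rep_dim \<pi>" for k
    unfolding lb_mult[OF c(1) sym c(2,3) u[OF k] u'[OF k]] lu[OF k] lu'[OF k] u0[OF k] pu[OF k] pu'[OF k] GG0 Q_def
    by simp
  have "0 = lb (gram c0) (\<lambda>x. 1 :: complex) ?x" by (rule lb_const[OF c(1), symmetric])
  also have "(\<lambda>x. 1) = (\<lambda>x. \<Sum>k<rep_dim \<pi>. u k x * cnj (u k x))"
    unfolding u_def Ghat_row_norm[OF \<pi> i i] by simp
  also have "lb (gram c0) \<dots> ?x = (\<Sum>k<rep_dim \<pi>. lb (gram c0) (\<lambda>x. u k x * cnj (u k x)) ?x)"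
    by (rule lb_sum[OF c]) (auto intro!: Ck_on_mult c u u')
  also have "\<dots> = (\<Sum>k<rep_dim \<pi>. (if i = k then - 2 * complex_of_real (eig \<pi>) else 0) + 2 * Q k)"
    by (intro sum.cong refl trm) simp
  also have "\<dots> = - 2 * complex_of_real (eig \<pi>) + 2 * (\<Sum>k<rep_dim \<pi>. Q k)"
    using i by (simp add: sum.distrib sum_distrib_left)
  finally have "complex_of_real (eig \<pi>) = (\<Sum>k<rep_dim \<pi>. Q k)" by simp
  hence "eig \<pi> = Re (\<Sum>k<rep_dim \<pi>. Q k)" by (metis Re_complex_of_real)
  thus ?thesis by (simp only: Q_def)
qed

text \<open>\<kappa> depends only on the metric at the identity, so the bound is uniform over all
  classes.\<close>

lemma gradient_bound:
  obtains \<kappa> where "\<kappa> > 0" "\<And>\<pi> i. \<pi> \<in> Ghat \<Longrightarrow> i < rep_dim \<pi> \<Longrightarrow>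
    \<kappa> * (\<Sum>k<rep_dim \<pi>. \<Sum>a\<in>UNIV. (cmod (rep_deriv c0 \<pi> i k (axis a 1)))\<^sup>2) \<le> eig \<pi>"
proof -
  note g = gm_posdef[OF chart_at(1)[of 0] chart_at(2)]
  obtain \<kappa> where \<kappa>: "\<kappa> > 0" "\<And>z :: 'n \<Rightarrow> complex. \<kappa> * (\<Sum>i\<in>UNIV. (cmod (z i))\<^sup>2) \<le>
    Re (\<Sum>i\<in>UNIV. \<Sum>j\<in>UNIV. matrix_inv (gm c0 0) $ i $ j *\<^sub>R (z i * cnj (z j)))"
    using posdef_inverse_lower_bound[OF g] by blast
  have "\<kappa> * (\<Sum>k<rep_dim \<pi>. \<Sum>a\<in>UNIV. (cmod (rep_deriv c0 \<pi> i k (axis a 1)))\<^sup>2) \<le> eig \<pi>"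
    if "\<pi> \<in> Ghat" "i < rep_dim \<pi>" for \<pi> i
    unfolding eig_gradient[OF that] sum_distrib_left[of \<kappa> _ "{..<rep_dim \<pi>}"] Re_sum[of _ "{..<rep_dim \<pi>}"]
    by (rule sum_mono) (rule \<kappa>(2))
  with \<kappa>(1) that show ?thesis by blast
qed

lemma eig_nonneg: "\<pi> \<in> Ghat \<Longrightarrow> eig \<pi> \<ge> 0"
proof -
  assume \<pi>: "\<pi> \<in> Ghat"
  obtain \<kappa> where \<kappa>: "\<kappa> > 0" "\<And>\<pi> i. \<pi> \<in> Ghat \<Longrightarrow> i < rep_dim \<pi> \<Longrightarrow>
    \<kappa> * (\<Sum>k<rep_dim \<pi>. \<Sum>a\<in>UNIV. (cmod (rep_deriv c0 \<pi> i k (axis a 1)))\<^sup>2) \<le> eig \<pi>"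
    using gradient_bound by blast
  have "0 \<le> \<kappa> * (\<Sum>k<rep_dim \<pi>. \<Sum>a\<in>UNIV. (cmod (rep_deriv c0 \<pi> 0 k (axis a 1)))\<^sup>2)"
    using \<kappa>(1) by (intro mult_nonneg_nonneg sum_nonneg) auto
  with \<kappa>(2)[OF \<pi> Ghat_dim[OF \<pi>]] show ?thesis by simp
qed

end

section \<open>Weyl's bound\<close>

lemma sum_cauchy_schwarz_cmod:
  fixes a b :: "'i \<Rightarrow> complex"
  shows "cmod (\<Sum>i\<in>I. a i * b i) \<le> sqrt (\<Sum>i\<in>I. (cmod (a i))\<^sup>2) * sqrt (\<Sum>i\<in>I. (cmod (b i))\<^sup>2)"
proof -
  have "cmod (\<Sum>i\<in>I. a i * b i) \<le> (\<Sum>i\<in>I. \<bar>cmod (a i)\<bar> * \<bar>cmod (b i)\<bar>)"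
    using norm_sum[of "\<lambda>i. a i * b i" I] by (simp add: norm_mult)
  also have "\<dots> \<le> L2_set (\<lambda>i. cmod (a i)) I * L2_set (\<lambda>i. cmod (b i)) I" by (rule L2_set_mult_ineq)
  finally show ?thesis by (simp add: L2_set_def)
qed

section \<open>Characters near the identity\<close>

context riemannian_lie_group
begin

text \<open>A compact product of balls on which the left quotient is C^1 in coordinates gives one
  constant \<open>L\<close> for two purposes: derivatives along the quotient control characters, and
  the Lipschitz bound in the first argument controls volumes.\<close>

lemma local_chart:
  obtains r L where "r > 0" "L > 0" "cball (snd c0 0) r \<subseteq> chart_image c0"
    "\<And>x y. x \<in> cball (snd c0 0) r \<Longrightarrow> y \<in> cball (snd c0 0) r \<Longrightarrow> - chart_inv c0 x + chart_inv c0 y \<in> fst c0"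
    "\<And>x y z. x \<in> cball (snd c0 0) r \<Longrightarrow> y \<in> cball (snd c0 0) r \<Longrightarrow> z \<in> cball (snd c0 0) r \<Longrightarrow>
      norm (snd c0 (- chart_inv c0 x + chart_inv c0 z) - snd c0 (- chart_inv c0 y + chart_inv c0 z)) \<le> L * norm (x - y)"
    "\<And>x v. x \<in> cball (snd c0 0) r \<Longrightarrow>
      norm (frechet_derivative (\<lambda>y. snd c0 (- chart_inv c0 x + chart_inv c0 y)) (at x) v) \<le> L * norm v"
proof -
  define x0 where "x0 = snd c0 0"
  define I where "I = chart_image c0"
  define ch where "ch = chart_inv c0"
  note cf = chart_facts'[OF chart_at(1)[of 0], folded I_def ch_def]
  have x0: "x0 \<in> I" "ch x0 = 0" using cf chart_at(2)[of 0] by (auto simp: x0_def)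
  have cs: "csmooth \<A> I ch" unfolding I_def ch_def by (rule csmooth_chart_inv[OF atlas chart_at(1)])
  define n where "n p = snd c0 (- ch (fst p) + ch (snd p))" for p
  define \<Omega> where "\<Omega> = {p \<in> I \<times> I. - ch (fst p) + ch (snd p) \<in> fst c0}"
  have \<Omega>: "open \<Omega>" and n: "Ck_on 1 \<Omega> n"
    using diff_coord[OF cf(2) cs chart_at(1)] unfolding smooth_on_def \<Omega>_def n_def[abs_def] by blast+
  have "(x0, x0) \<in> \<Omega>" using x0 chart_at(2)[of 0] by (simp add: \<Omega>_def)
  with \<Omega> obtain A B where AB: "open A" "open B" "(x0, x0) \<in> A \<times> B" "A \<times> B \<subseteq> \<Omega>"
    using open_prod_elim by metis
  hence "open (A \<inter> B)" "x0 \<in> A \<inter> B" by auto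
  then obtain r where r: "r > 0" "cball x0 r \<subseteq> A \<inter> B" by (metis open_contains_cball)
  define K where "K = cball x0 r \<times> cball x0 r"
  have K: "compact K" "convex K" "K \<subseteq> \<Omega>"
    using r AB by (auto simp: K_def intro!: compact_Times convex_Times)
  obtain L0 where L0: "L0 \<ge> 0" "\<And>x y. x \<in> K \<Longrightarrow> y \<in> K \<Longrightarrow> norm (n x - n y) \<le> L0 * norm (x - y)"
    "\<And>x h. x \<in> K \<Longrightarrow> norm (frechet_derivative n (at x) h) \<le> L0 * norm h"
    using C1_lipschitz[OF n K] by blast
  show ?thesis
  proof (rule that[of r "L0 + 1"])
    show "cball (snd c0 0) r \<subseteq> chart_image c0" using K(3) by (auto simp: K_def \<Omega>_def I_def x0_def)
    fix x y assume xy: "x \<in> cball (snd c0 0) r" "y \<in> cball (snd c0 0) r"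
    hence "(x, y) \<in> \<Omega>" using K(3) unfolding K_def x0_def by blast
    thus "- chart_inv c0 x + chart_inv c0 y \<in> fst c0" by (simp add: \<Omega>_def ch_def)
    fix z assume z: "z \<in> cball (snd c0 0) r"
    have "norm (n (x, z) - n (y, z)) \<le> L0 * norm ((x, z) - (y, z))"
      by (rule L0(2)) (use xy z in \<open>auto simp: K_def x0_def\<close>)
    also have "\<dots> \<le> (L0 + 1) * norm (x - y)" by (simp add: norm_Pair mult_right_mono)
    finally show "norm (snd c0 (- chart_inv c0 x + chart_inv c0 z) - snd c0 (- chart_inv c0 y + chart_inv c0 z))
        \<le> (L0 + 1) * norm (x - y)" by (simp add: n_def ch_def)
  next
    fix x v assume x: "x \<in> cball (snd c0 0) r"
    hence "(x, x) \<in> \<Omega>" using K(3) unfolding K_def x0_def by blast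
    hence xI: "x \<in> I" by (simp add: \<Omega>_def)
    have "frechet_derivative (\<lambda>y. snd c0 (- ch x + ch y)) (at x) v = frechet_derivative n (at (x, x)) (0, v)"
      unfolding n_def[abs_def] by (rule csmooth_section(2)[OF cf(2) cs chart_at xI])
    also have "norm \<dots> \<le> L0 * norm (0 :: real^'n, v)" by (rule L0(3)) (use x in \<open>auto simp: K_def x0_def\<close>)
    also have "\<dots> \<le> (L0 + 1) * norm v" by (simp add: norm_Pair mult_right_mono)
    finally show "norm (frechet_derivative (\<lambda>y. snd c0 (- chart_inv c0 x + chart_inv c0 y)) (at x) v) \<le> (L0 + 1) * norm v"
      by (simp add: ch_def)
  qed (use r L0 in auto)
qed

lemma rep_deriv_bound:
  assumes rep: "is_rep \<pi>" and ij: "i < rep_dim \<pi>" "j < rep_dim \<pi>"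
  shows "(cmod (rep_deriv c0 \<pi> i j w))\<^sup>2 \<le> (norm w)\<^sup>2 * (\<Sum>a\<in>UNIV. (cmod (rep_deriv c0 \<pi> i j (axis a 1)))\<^sup>2)"
proof -
  let ?f = "\<lambda>y. \<pi> (chart_inv c0 y) $$ (i, j)"
  have "?f differentiable (at (snd c0 0))" using rep_deriv_has_derivative[OF rep chart_at ij] by (auto simp: differentiable_def)
  hence "rep_deriv c0 \<pi> i j w = (\<Sum>a\<in>UNIV. w $ a *\<^sub>R rep_deriv c0 \<pi> i j (axis a 1))"
    using frechet_derivative_partial[of ?f "snd c0 0" w] by (simp add: rep_deriv_def partial_deriv_def)
  hence "cmod (rep_deriv c0 \<pi> i j w) = cmod (\<Sum>a\<in>UNIV. complex_of_real (w $ a) * rep_deriv c0 \<pi> i j (axis a 1))"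
    by (simp add: scaleR_conv_of_real)
  also have "\<dots> \<le> norm w * sqrt (\<Sum>a\<in>UNIV. (cmod (rep_deriv c0 \<pi> i j (axis a 1)))\<^sup>2)"
    using sum_cauchy_schwarz_cmod[of "\<lambda>a. complex_of_real (w $ a)" "\<lambda>a. rep_deriv c0 \<pi> i j (axis a 1)" UNIV]
    by (simp add: norm_vec_def L2_set_def)
  finally have "(cmod (rep_deriv c0 \<pi> i j w))\<^sup>2 \<le> (norm w * sqrt (\<Sum>a\<in>UNIV. (cmod (rep_deriv c0 \<pi> i j (axis a 1)))\<^sup>2))\<^sup>2"
    by (rule power_mono) simp
  thus ?thesis by (simp add: power_mult_distrib sum_nonneg)
qed

text \<open>Cauchy-Schwarz for the Frobenius inner product: the unitary matrix has norm sqrt d, and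
  the derivative at most sqrt d times the remaining factor. The product is linear in the degree, as
  needed to compare with the trace d at the identity.\<close>

lemma trace_derivative_bound:
  assumes \<pi>: "\<pi> \<in> Ghat" and \<kappa>: "\<kappa> > 0" "\<And>\<pi> i. \<pi> \<in> Ghat \<Longrightarrow> i < rep_dim \<pi> \<Longrightarrow>
    \<kappa> * (\<Sum>k<rep_dim \<pi>. \<Sum>a\<in>UNIV. (cmod (rep_deriv c0 \<pi> i k (axis a 1)))\<^sup>2) \<le> eig \<pi>"
  shows "cmod (\<Sum>i<rep_dim \<pi>. \<Sum>l<rep_dim \<pi>. \<pi> g $$ (i, l) * rep_deriv c0 \<pi> l i w) \<le>
    real (rep_dim \<pi>) * (norm w * sqrt (eig \<pi> / \<kappa>))"
proof -
  let ?d = "rep_dim \<pi>"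
  note rep = Ghat_rep[OF \<pi>]
  have "(\<Sum>i<?d. (cmod (rep_deriv c0 \<pi> l i w))\<^sup>2) \<le> (norm w)\<^sup>2 * (eig \<pi> / \<kappa>)" if l: "l < ?d" for l
  proof -
    have "(\<Sum>i<?d. (cmod (rep_deriv c0 \<pi> l i w))\<^sup>2) \<le> (\<Sum>i<?d. (norm w)\<^sup>2 * (\<Sum>a\<in>UNIV. (cmod (rep_deriv c0 \<pi> l i (axis a 1)))\<^sup>2))"
      by (intro sum_mono rep_deriv_bound[OF rep l]) simp
    also have "\<dots> = (norm w)\<^sup>2 * (\<Sum>i<?d. \<Sum>a\<in>UNIV. (cmod (rep_deriv c0 \<pi> l i (axis a 1)))\<^sup>2)"
      by (simp only: sum_distrib_left)
    also have "\<dots> \<le> (norm w)\<^sup>2 * (eig \<pi> / \<kappa>)"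
      using \<kappa>(2)[OF \<pi> l] \<kappa>(1) by (intro mult_left_mono) (auto simp: field_simps)
    finally show ?thesis .
  qed
  hence row: "(\<Sum>l<?d. \<Sum>i<?d. (cmod (rep_deriv c0 \<pi> l i w))\<^sup>2) \<le> real ?d * ((norm w)\<^sup>2 * (eig \<pi> / \<kappa>))"
    using sum_mono[of "{..<?d}" "\<lambda>l. \<Sum>i<?d. (cmod (rep_deriv c0 \<pi> l i w))\<^sup>2" "\<lambda>l. (norm w)\<^sup>2 * (eig \<pi> / \<kappa>)"] by simp
  have "(\<Sum>i<?d. \<Sum>l<?d. (cmod (\<pi> g $$ (i, l)))\<^sup>2) = (\<Sum>i<?d. Re (\<Sum>l<?d. \<pi> g $$ (i, l) * cnj (\<pi> g $$ (i, l))))"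
    by (simp add: complex_norm_square[symmetric] del: of_real_power)
  also have "\<dots> = (\<Sum>i<?d. 1)" by (intro sum.cong refl) (simp only: Ghat_row_norm[OF \<pi>] lessThan_iff, simp)
  finally have unit: "(\<Sum>i<?d. \<Sum>l<?d. (cmod (\<pi> g $$ (i, l)))\<^sup>2) = real ?d" by simp
  have "cmod (\<Sum>i<?d. \<Sum>l<?d. \<pi> g $$ (i, l) * rep_deriv c0 \<pi> l i w) =
      cmod (\<Sum>p\<in>{..<?d} \<times> {..<?d}. \<pi> g $$ (fst p, snd p) * rep_deriv c0 \<pi> (snd p) (fst p) w)"
    by (simp add: sum.cartesian_product split_def)
  also have "\<dots> \<le> sqrt (\<Sum>p\<in>{..<?d} \<times> {..<?d}. (cmod (\<pi> g $$ (fst p, snd p)))\<^sup>2) *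
      sqrt (\<Sum>p\<in>{..<?d} \<times> {..<?d}. (cmod (rep_deriv c0 \<pi> (snd p) (fst p) w))\<^sup>2)"
    by (rule sum_cauchy_schwarz_cmod)
  also have "(\<Sum>p\<in>{..<?d} \<times> {..<?d}. (cmod (\<pi> g $$ (fst p, snd p)))\<^sup>2) = real ?d"
    unfolding unit[symmetric] by (simp add: sum.cartesian_product split_def)
  also have "(\<Sum>p\<in>{..<?d} \<times> {..<?d}. (cmod (rep_deriv c0 \<pi> (snd p) (fst p) w))\<^sup>2) =
      (\<Sum>i<?d. \<Sum>l<?d. (cmod (rep_deriv c0 \<pi> l i w))\<^sup>2)" by (simp add: sum.cartesian_product split_def)
  also have "sqrt (real ?d) * sqrt (\<Sum>i<?d. \<Sum>l<?d. (cmod (rep_deriv c0 \<pi> l i w))\<^sup>2) =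
      sqrt (real ?d) * sqrt (\<Sum>l<?d. \<Sum>i<?d. (cmod (rep_deriv c0 \<pi> l i w))\<^sup>2)"
    by (subst sum.swap) (rule refl)
  also have "\<dots> \<le> sqrt (real ?d) * sqrt (real ?d * ((norm w)\<^sup>2 * (eig \<pi> / \<kappa>)))"
    using row by (intro mult_left_mono real_sqrt_le_mono) auto
  also have "\<dots> = real ?d * (norm w * sqrt (eig \<pi> / \<kappa>))"
    unfolding real_sqrt_mult by simp
  finally show ?thesis .
qed

text \<open>The trace equals the degree at the identity, and the mean value inequality controls its
  decrease. The constant L / sqrt \<kappa> does not depend on \<pi>.\<close>

lemma character_lower_bound:
  obtains r C where "r > 0" "C > 0" "cball (snd c0 0) r \<subseteq> chart_image c0"
    "\<And>\<pi> x. \<pi> \<in> Ghat \<Longrightarrow> x \<in> ball (snd c0 0) r \<Longrightarrow>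
      Re (\<Sum>i<rep_dim \<pi>. \<pi> (chart_inv c0 x) $$ (i, i)) \<ge> real (rep_dim \<pi>) * (1 - C * norm (x - snd c0 0) * sqrt (eig \<pi>))"
proof -
  define x0 where "x0 = snd c0 0"
  define I where "I = chart_image c0"
  define ch where "ch = chart_inv c0"
  note cf = chart_facts'[OF chart_at(1)[of 0], folded I_def ch_def]
  have x0: "x0 \<in> I" "ch x0 = 0" using cf chart_at(2)[of 0] by (auto simp: x0_def)
  have cs: "csmooth \<A> I ch" unfolding I_def ch_def by (rule csmooth_chart_inv[OF atlas chart_at(1)])
  obtain r L where rL: "r > 0" "L > 0" "cball x0 r \<subseteq> I"
    "\<And>x v. x \<in> cball x0 r \<Longrightarrow> norm (frechet_derivative (\<lambda>y. snd c0 (- ch x + ch y)) (at x) v) \<le> L * norm v"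
    by (rule local_chart[folded x0_def I_def ch_def]) (rule that; assumption)
  obtain \<kappa> where \<kappa>: "\<kappa> > 0" "\<And>\<pi> i. \<pi> \<in> Ghat \<Longrightarrow> i < rep_dim \<pi> \<Longrightarrow>
    \<kappa> * (\<Sum>k<rep_dim \<pi>. \<Sum>a\<in>UNIV. (cmod (rep_deriv c0 \<pi> i k (axis a 1)))\<^sup>2) \<le> eig \<pi>"
    using gradient_bound by blast
  have "Re (\<Sum>i<rep_dim \<pi>. \<pi> (ch x) $$ (i, i)) \<ge> real (rep_dim \<pi>) * (1 - (L / sqrt \<kappa>) * norm (x - x0) * sqrt (eig \<pi>))"
    if \<pi>: "\<pi> \<in> Ghat" and x: "x \<in> ball x0 r" for \<pi> x
  proof -
    note rep = Ghat_rep[OF \<pi>]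
    let ?d = "rep_dim \<pi>"
    define D where "D y v = frechet_derivative (\<lambda>z. snd c0 (- ch y + ch z)) (at y) v" for y v
    define T where "T y = (\<Sum>i<?d. \<pi> (ch y) $$ (i, i))" for y
    define T' where "T' y v = (\<Sum>i<?d. \<Sum>l<?d. \<pi> (ch y) $$ (i, l) * rep_deriv c0 \<pi> l i (D y v))" for y v
    have dT: "(T has_derivative T' y) (at y)" if "y \<in> I" for y
      unfolding T_def[abs_def] T'_def[abs_def] D_def[abs_def]
      by (intro has_derivative_sum rep_has_derivative[OF rep chart_at cf(2) cs that]) auto
    have "norm (T x - T x0) \<le> (real ?d * (L * sqrt (eig \<pi> / \<kappa>))) * norm (x - x0)"
    proof (rule differentiable_bound[of "cball x0 r"])
      show "(T has_derivative T' y) (at y within cball x0 r)" if "y \<in> cball x0 r" for y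
        using dT that rL(3) has_derivative_at_withinI by blast
      show "onorm (T' y) \<le> real ?d * (L * sqrt (eig \<pi> / \<kappa>))" if y: "y \<in> cball x0 r" for y
      proof (rule onorm_le)
        fix v
        have "norm (T' y v) \<le> real ?d * (norm (D y v) * sqrt (eig \<pi> / \<kappa>))"
          unfolding T'_def by (rule trace_derivative_bound[OF \<pi> \<kappa>])
        also have "\<dots> \<le> real ?d * ((L * norm v) * sqrt (eig \<pi> / \<kappa>))"
          using rL(4)[OF y] eig_nonneg[OF \<pi>] \<kappa>(1) unfolding D_def
          by (intro mult_left_mono mult_right_mono) auto
        finally show "norm (T' y v) \<le> real ?d * (L * sqrt (eig \<pi> / \<kappa>)) * norm v" by (simp add: mult_ac)
      qed
    qed (use x rL in auto)
    moreover have "T x0 = of_nat ?d" unfolding T_def x0 by (simp add: Ghat_zero[OF \<pi>])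
    ultimately have "real ?d - Re (T x) \<le> (real ?d * (L * sqrt (eig \<pi> / \<kappa>))) * norm (x - x0)"
      using abs_Re_le_cmod[of "T x - T x0"] by simp
    also have "\<dots> = real ?d * ((L / sqrt \<kappa>) * norm (x - x0) * sqrt (eig \<pi>))" by (simp add: real_sqrt_divide)
    finally show ?thesis unfolding T_def by (simp add: algebra_simps)
  qed
  moreover have "L / sqrt \<kappa> > 0" using rL \<kappa> by simp
  ultimately show ?thesis using that[of r "L / sqrt \<kappa>"] rL unfolding x0_def I_def ch_def by blast
qed

end

section \<open>Volumes of small balls and the sum of squared degrees\<close>

context riemannian_lie_group
begin

lemma small_ball_open:
  assumes "cball (snd c0 0) r \<subseteq> chart_image c0" "\<rho> \<le> r"
  shows "open (chart_inv c0 ` ball (snd c0 0) \<rho>)"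
    "chart_inv c0 ` ball (snd c0 0) \<rho> = {p \<in> fst c0. snd c0 p \<in> ball (snd c0 0) \<rho>}"
proof -
  note cf = chart_facts'[OF chart_at(1)[of 0]]
  have sub: "ball (snd c0 0) \<rho> \<subseteq> chart_image c0" using assms by (auto simp: subset_iff)
  show "chart_inv c0 ` ball (snd c0 0) \<rho> = {p \<in> fst c0. snd c0 p \<in> ball (snd c0 0) \<rho>}" (is "?A = ?B")
  proof
    show "?A \<subseteq> ?B" using sub cf(7,8) by auto
    show "?B \<subseteq> ?A"
    proof
      fix p assume "p \<in> ?B"
      thus "p \<in> ?A" using cf(5)[of p] by (intro image_eqI[of _ _ "snd c0 p"]) auto
    qed
  qed
  thus "open ?A" using open_restrict[OF cf(1,4), of "ball (snd c0 0) \<rho>"] by simp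
qed

text \<open>Measure in two ways the pairs of coordinates \<open>y\<close> and group elements
  \<open>g\<close> whose left quotient lies in the small ball \<open>B\<close>. Integrating over
  \<open>g\<close> gives the measure of \<open>B\<close> times a fixed volume, by invariance; for
  \<open>g\<close> in the fixed set \<open>U\<close>, all \<open>y\<close> within \<rho> / L of its
  coordinates qualify. No density of the Haar measure in coordinates is involved.\<close>

lemma small_ball_measure:
  obtains r c where "r > 0" "c > 0" "cball (snd c0 0) r \<subseteq> chart_image c0"
    "\<And>\<rho>. 0 < \<rho> \<Longrightarrow> \<rho> \<le> r \<Longrightarrow> measure \<mu> (chart_inv c0 ` ball (snd c0 0) \<rho>) \<ge> c * \<rho> ^ CARD('n)"
proof -
  define x0 where "x0 = snd c0 0"
  define I where "I = chart_image c0"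
  define ch where "ch = chart_inv c0"
  note cf = chart_facts'[OF chart_at(1)[of 0], folded I_def ch_def]
  have x0: "x0 \<in> I" "ch x0 = 0" using cf chart_at(2)[of 0] by (auto simp: x0_def)
  obtain r1 L where rL: "r1 > 0" "L > 0" "cball x0 r1 \<subseteq> I"
    "\<And>x y. x \<in> cball x0 r1 \<Longrightarrow> y \<in> cball x0 r1 \<Longrightarrow> - ch x + ch y \<in> fst c0"
    "\<And>x y z. x \<in> cball x0 r1 \<Longrightarrow> y \<in> cball x0 r1 \<Longrightarrow> z \<in> cball x0 r1 \<Longrightarrow>
      norm (snd c0 (- ch x + ch z) - snd c0 (- ch y + ch z)) \<le> L * norm (x - y)"
    by (rule local_chart[folded x0_def I_def ch_def]) (rule that; assumption)
  define K where "K = ball x0 r1"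
  define U where "U = ch ` ball x0 (r1 / 2)"
  \<comment> \<open>The second bound gives \<rho> / L <= r1 / 2, so that the ball of that radius
    around a point of coordinates below r1 / 2 stays inside \<open>K\<close>.\<close>
  define r where "r = min r1 (L * r1 / 2)"
  define V where "V = unit_ball_vol (real CARD('n))"
  have V: "V > 0" unfolding V_def by (rule unit_ball_vol_pos) simp
  have r: "r > 0" "r \<le> r1" "r \<le> L * r1 / 2" using rL by (auto simp: r_def)
  note ops = small_ball_open[folded x0_def I_def ch_def]
  have oU: "open U" unfolding U_def by (rule ops(1)[OF rL(3)]) (use rL in simp)
  have U0: "U \<noteq> {}" using rL by (simp add: U_def)
  have mU: "measure \<mu> U > 0" by (rule open_pos[OF oU U0])
  interpret pair: pair_sigma_finite lborel \<mu> by unfold_locales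
  have main: "measure \<mu> U / (L * r1) ^ CARD('n) * \<rho> ^ CARD('n) \<le> measure \<mu> (ch ` ball x0 \<rho>)"
    if \<rho>: "0 < \<rho>" "\<rho> \<le> r" for \<rho>
  proof -
    define B where "B = ch ` ball x0 \<rho>"
    have B: "open B" "B = {p \<in> fst c0. snd c0 p \<in> ball x0 \<rho>}"
      unfolding B_def by (rule ops[OF rL(3)]; use \<rho> r in simp)+
    hence [measurable]: "B \<in> sets borel" by simp
    define E where "E = {p \<in> K \<times> UNIV. - ch (fst p) + snd p \<in> B}"
    have "K \<subseteq> I" using rL(3) by (auto simp: K_def subset_iff)
    have "continuous_on (K \<times> UNIV) (\<lambda>p :: (real^'n) \<times> 'g. ch (fst p))"
      by (rule continuous_on_compose2[OF cf(3)]) (use \<open>K \<subseteq> I\<close> in \<open>auto intro!: continuous_intros\<close>)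
    hence "open E" unfolding E_def
      by (intro open_restrict B open_Times continuous_intros) (auto simp: K_def)
    hence "E \<in> sets borel" by simp
    also have "sets borel = sets (lborel \<Otimes>\<^sub>M \<mu>)"
      unfolding borel_prod[symmetric] by (intro sets_pair_measure_cong) simp_all
    finally have E: "E \<in> sets (lborel \<Otimes>\<^sub>M \<mu>)" .
    hence mE: "(\<lambda>(y, g). indicator E (y, g) :: ennreal) \<in> borel_measurable (lborel \<Otimes>\<^sub>M \<mu>)" by simp
    have "(\<integral>\<^sup>+y. \<integral>\<^sup>+g. indicator E (y, g) \<partial>\<mu> \<partial>lborel) = (\<integral>\<^sup>+y. emeasure \<mu> B * indicator K y \<partial>lborel)"
    proof (rule nn_integral_cong)
      fix y
      show "(\<integral>\<^sup>+g. indicator E (y, g) \<partial>\<mu>) = emeasure \<mu> B * indicator K y"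
      proof (cases "y \<in> K")
        case True
        have "(\<integral>\<^sup>+g. indicator E (y, g) \<partial>\<mu>) = (\<integral>\<^sup>+g. indicator B (- ch y + g) \<partial>\<mu>)"
          by (intro nn_integral_cong) (use True in \<open>simp add: E_def indicator_def\<close>)
        also have "\<dots> = (\<integral>\<^sup>+g. indicator B g \<partial>\<mu>)" by (rule nn_integral_left) simp
        finally show ?thesis using True by simp
      qed (simp add: E_def)
    qed
    also have "\<dots> = emeasure \<mu> B * emeasure lborel K" by (rule nn_integral_cmult_indicator) (simp add: K_def)
    also have "emeasure lborel K = ennreal (V * r1 ^ CARD('n))"
      unfolding K_def V_def using rL(1) by (subst emeasure_ball) auto
    finally have up: "(\<integral>\<^sup>+y. \<integral>\<^sup>+g. indicator E (y, g) \<partial>\<mu> \<partial>lborel) = ennreal (measure \<mu> B * (V * r1 ^ CARD('n)))"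
      using V rL by (simp add: emeasure_eq_measure ennreal_mult)
    have "ennreal (V * (\<rho> / L) ^ CARD('n)) * indicator U g \<le> (\<integral>\<^sup>+y. indicator E (y, g) \<partial>lborel)" for g
    proof (cases "g \<in> U")
      case True
      then obtain z where z: "z \<in> ball x0 (r1 / 2)" "g = ch z" by (auto simp: U_def)
      have zK: "z \<in> cball x0 r1" using z(1) rL(1) by simp
      have "(y, g) \<in> E" if y: "y \<in> ball z (\<rho> / L)" for y
      proof -
        have "\<rho> / L \<le> r1 / 2" using \<rho> r rL(2) by (simp add: field_simps)
        moreover have "dist z y < \<rho> / L" "dist x0 z < r1 / 2" using y z(1) by (simp_all only: mem_ball)
        ultimately have "dist x0 y < r1" using dist_triangle[of x0 y z] by linarith
        hence yK: "y \<in> K" by (simp add: K_def)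
        hence yK': "y \<in> cball x0 r1" by (simp add: K_def)
        have "norm (snd c0 (- ch z + ch z) - snd c0 (- ch y + ch z)) \<le> L * norm (z - y)"
          by (rule rL(5)[OF zK yK' zK])
        also have "\<dots> < \<rho>" using y rL(2) by (simp add: dist_norm field_simps)
        finally have "snd c0 (- ch y + ch z) \<in> ball x0 \<rho>" by (simp add: x0_def dist_norm)
        moreover have "- ch y + ch z \<in> fst c0" by (rule rL(4)[OF yK' zK])
        ultimately show ?thesis using yK z(2) by (simp add: E_def B(2))
      qed
      hence "indicator (ball z (\<rho> / L)) y \<le> (indicator E (y, g) :: ennreal)" for y
        by (cases "y \<in> ball z (\<rho> / L)") (simp_all del: mem_ball)
      hence "(\<integral>\<^sup>+y. indicator (ball z (\<rho> / L)) y \<partial>lborel) \<le> (\<integral>\<^sup>+y. indicator E (y, g) \<partial>lborel)"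
        by (rule nn_integral_mono)
      hence "emeasure lborel (ball z (\<rho> / L)) \<le> (\<integral>\<^sup>+y. indicator E (y, g) \<partial>lborel)"
        by (subst (asm) nn_integral_indicator) simp_all
      moreover have "emeasure lborel (ball z (\<rho> / L)) = ennreal (V * (\<rho> / L) ^ CARD('n))"
        unfolding V_def using \<rho> rL(2) by (subst emeasure_ball) auto
      ultimately show ?thesis using True by simp
    qed simp
    hence "(\<integral>\<^sup>+g. ennreal (V * (\<rho> / L) ^ CARD('n)) * indicator U g \<partial>\<mu>) \<le> (\<integral>\<^sup>+g. \<integral>\<^sup>+y. indicator E (y, g) \<partial>lborel \<partial>\<mu>)"
      by (rule nn_integral_mono)
    also have "\<dots> = (\<integral>\<^sup>+y. \<integral>\<^sup>+g. indicator E (y, g) \<partial>\<mu> \<partial>lborel)" by (rule pair.Fubini'[OF mE])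
    also note up
    also have "(\<integral>\<^sup>+g. ennreal (V * (\<rho> / L) ^ CARD('n)) * indicator U g \<partial>\<mu>) = ennreal (V * (\<rho> / L) ^ CARD('n) * measure \<mu> U)"
      using oU V \<rho> rL(2) by (subst nn_integral_cmult_indicator) (auto simp: emeasure_eq_measure ennreal_mult)
    finally have "V * (\<rho> / L) ^ CARD('n) * measure \<mu> U \<le> measure \<mu> B * (V * r1 ^ CARD('n))"
      using V rL(1) by (subst (asm) ennreal_le_iff) auto
    hence "V * ((\<rho> / L) ^ CARD('n) * measure \<mu> U) \<le> V * (measure \<mu> B * r1 ^ CARD('n))" by (simp add: mult_ac)
    hence "(\<rho> / L) ^ CARD('n) * measure \<mu> U \<le> measure \<mu> B * r1 ^ CARD('n)" using V by (simp only: mult_le_cancel_left_pos)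
    thus ?thesis using rL(1,2) unfolding B_def[symmetric]
      by (simp add: power_mult_distrib power_divide divide_simps mult_ac)
  qed
  have c: "measure \<mu> U / (L * r1) ^ CARD('n) > 0" using mU rL by simp
  have "cball x0 r \<subseteq> I" using r rL(3) by (auto simp: subset_iff)
  show ?thesis by (rule that[OF r(1) c]) (use \<open>cball x0 r \<subseteq> I\<close> main in \<open>auto simp: x0_def I_def ch_def\<close>)
qed

text \<open>Weyl's upper bound: near the identity the characters of low frequency are close to their
  degree, so Bessel's inequality for a normalised indicator of a small ball bounds the degrees.\<close>

lemma weyl_bound:
  obtains C where "C > 0" "\<And>T F. T \<ge> 1 \<Longrightarrow> finite F \<Longrightarrow> F \<subseteq> {\<pi> \<in> Ghat. eig \<pi> < T} \<Longrightarrow>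
    (\<Sum>\<pi>\<in>F. (real (rep_dim \<pi>))\<^sup>2) \<le> C * T powr (real CARD('n) / 2)"
proof -
  define x0 where "x0 = snd c0 0"
  define I where "I = chart_image c0"
  define ch where "ch = chart_inv c0"
  obtain r1 C1 where r1: "r1 > 0" "C1 > 0" "cball x0 r1 \<subseteq> I" "\<And>\<pi> x. \<pi> \<in> Ghat \<Longrightarrow> x \<in> ball x0 r1 \<Longrightarrow>
      real (rep_dim \<pi>) * (1 - C1 * norm (x - x0) * sqrt (eig \<pi>)) \<le> Re (\<Sum>i<rep_dim \<pi>. \<pi> (ch x) $$ (i, i))"
    by (rule character_lower_bound[folded x0_def I_def ch_def]) (rule that; assumption)
  obtain r2 c2 where r2: "r2 > 0" "c2 > 0" "cball x0 r2 \<subseteq> I"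
    "\<And>\<rho>. 0 < \<rho> \<Longrightarrow> \<rho> \<le> r2 \<Longrightarrow> c2 * \<rho> ^ CARD('n) \<le> measure \<mu> (ch ` ball x0 \<rho>)"
    by (rule small_ball_measure[folded x0_def I_def ch_def]) (rule that; assumption)
  \<comment> \<open>The last term makes C1 * \<rho> * sqrt T at most 1/2 for \<rho> = r / sqrt T:
    characters below \<open>T\<close> keep half their degree on the ball.\<close>
  define r where "r = min (min r1 r2) (1 / (2 * C1))"
  have r: "r > 0" "r \<le> r1" "r \<le> r2" "r \<le> 1 / (2 * C1)" using r1 r2 by (auto simp: r_def)
  have main: "(\<Sum>\<pi>\<in>F. (real (rep_dim \<pi>))\<^sup>2) \<le> 4 / (c2 * r ^ CARD('n)) * T powr (real CARD('n) / 2)"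
    if T: "T \<ge> 1" and F: "finite F" "F \<subseteq> {\<pi> \<in> Ghat. eig \<pi> < T}" for T F
  proof -
    define \<rho> where "\<rho> = r / sqrt T"
    have "sqrt T \<ge> 1" using T by simp
    hence \<rho>: "\<rho> > 0" "\<rho> \<le> r" using r(1) by (auto simp: \<rho>_def field_simps)
    define B where "B = ch ` ball x0 \<rho>"
    have oB: "open B" unfolding B_def
      by (rule small_ball_open(1)[folded x0_def I_def ch_def, OF r1(3)]) (use \<rho> r in simp)
    hence [measurable]: "B \<in> sets borel" by simp
    define b where "b = measure \<mu> B"
    have bc: "b \<ge> c2 * \<rho> ^ CARD('n)" unfolding b_def B_def by (rule r2(4)) (use \<rho> r in auto)
    have b: "b > 0" using bc r2(2) \<rho>(1) by (meson less_le_trans mult_pos_pos zero_less_power)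
    define \<phi> where "\<phi> g = complex_of_real (indicator B g)" for g
    define X where "X \<pi> g = (\<Sum>i<rep_dim \<pi>. \<pi> g $$ (i, i))" for \<pi> :: "'g \<Rightarrow> complex mat" and g
    have [measurable]: "\<phi> \<in> borel_measurable \<mu>" unfolding \<phi>_def[abs_def] by measurable
    have phisq: "(cmod (\<phi> g))\<^sup>2 = indicator B g" for g by (simp add: \<phi>_def indicator_def)
    have intB: "integrable \<mu> (\<lambda>g. indicator B g :: real)" by (rule integrable_real_indicator) (simp_all add: less_top[symmetric])
    hence \<phi>L: "\<phi> \<in> L2 \<mu>" by (simp add: L2_def phisq)
    have n\<phi>: "nsq \<phi> = b" by (simp add: nsq_def phisq b_def)
    have sub: "F \<subseteq> Ghat" using F by auto
    have Xc: "continuous_on UNIV (X \<pi>)" if "\<pi> \<in> F" for \<pi>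
      unfolding X_def[abs_def] using that sub by (intro continuous_intros Ghat_cont) auto
    \<comment> \<open>Only pairs of equal diagonal entries survive: d of them, each contributing 1 /
      d.\<close>
    have on: "cip (X \<pi>) (X \<sigma>) = (if \<pi> = \<sigma> then 1 else 0)" if "\<pi> \<in> F" "\<sigma> \<in> F" for \<pi> \<sigma>
    proof -
      have mem: "\<pi> \<in> Ghat" "\<sigma> \<in> Ghat" using that sub by auto
      have cL: "(\<lambda>g. \<alpha> g $$ (i, i)) \<in> L2 \<mu>" if "\<alpha> \<in> Ghat" "i < rep_dim \<alpha>" for \<alpha> i
        using that by (intro continuous_L2 Ghat_cont)
      have X\<sigma>: "X \<sigma> \<in> L2 \<mu>" by (rule continuous_L2[OF Xc[OF that(2)]])
      have "cip (X \<pi>) (X \<sigma>) = (\<Sum>i<rep_dim \<pi>. 1 * cip (\<lambda>g. \<pi> g $$ (i, i)) (X \<sigma>))"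
        unfolding X_def[of \<pi>, abs_def] using cip_sum_left[OF X\<sigma>, of "{..<rep_dim \<pi>}" "\<lambda>i g. \<pi> g $$ (i, i)" "\<lambda>_. 1"] cL[OF mem(1)]
        by simp
      also have "\<dots> = (\<Sum>i<rep_dim \<pi>. \<Sum>j<rep_dim \<sigma>. cip (\<lambda>g. \<pi> g $$ (i, i)) (\<lambda>g. \<sigma> g $$ (j, j)))"
      proof (intro sum.cong refl)
        fix i assume "i \<in> {..<rep_dim \<pi>}"
        thus "1 * cip (\<lambda>g. \<pi> g $$ (i, i)) (X \<sigma>) = (\<Sum>j<rep_dim \<sigma>. cip (\<lambda>g. \<pi> g $$ (i, i)) (\<lambda>g. \<sigma> g $$ (j, j)))"
          unfolding X_def[of \<sigma>, abs_def] using cip_sum_right[OF cL[OF mem(1)], of i "{..<rep_dim \<sigma>}" "\<lambda>j g. \<sigma> g $$ (j, j)" "\<lambda>_. 1"] cL[OF mem(2)]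
          by simp
      qed
      also have "\<dots> = (\<Sum>i<rep_dim \<pi>. \<Sum>j<rep_dim \<sigma>. if \<pi> = \<sigma> \<and> i = j \<and> i = j then 1 / of_nat (rep_dim \<pi>) else 0)"
        by (intro sum.cong refl schur_orthogonality mem) auto
      also have "\<dots> = (if \<pi> = \<sigma> then 1 else 0)" using Ghat_dim[OF mem(1)] by (auto simp: sum.delta)
      finally show ?thesis .
    qed
    have low: "b * real (rep_dim \<pi>) / 2 \<le> cmod (cip \<phi> (X \<pi>))" if \<pi>: "\<pi> \<in> F" for \<pi>
    proof -
      have mem: "\<pi> \<in> Ghat" "eig \<pi> < T" using \<pi> F by auto
      have bound: "real (rep_dim \<pi>) / 2 \<le> Re (X \<pi> g)" if "g \<in> B" for g
      proof -
        obtain x where x: "x \<in> ball x0 \<rho>" "g = ch x" using \<open>g \<in> B\<close> by (auto simp: B_def)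
        have "C1 * norm (x - x0) * sqrt (eig \<pi>) \<le> C1 * \<rho> * sqrt T"
          using x(1) r1(2) mem \<rho> eig_nonneg[OF mem(1)] by (intro mult_mono) (auto simp: dist_norm norm_minus_commute)
        also have "\<dots> = C1 * r" using T by (simp add: \<rho>_def)
        also have "\<dots> \<le> 1 / 2" using r(4) r1(2) by (simp add: field_simps)
        finally have "real (rep_dim \<pi>) * (1 / 2) \<le> real (rep_dim \<pi>) * (1 - C1 * norm (x - x0) * sqrt (eig \<pi>))"
          by (intro mult_left_mono) auto
        also have "\<dots> \<le> Re (X \<pi> g)" unfolding X_def x(2) by (rule r1(4)[OF mem(1)]) (use x(1) \<rho> r in simp)
        finally show ?thesis by simp
      qed
      have int: "integrable \<mu> (\<lambda>g. \<phi> g * cnj (X \<pi> g))"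
        by (rule L2_mult(1)[OF \<phi>L continuous_L2[OF Xc[OF \<pi>]]])
      have "b * real (rep_dim \<pi>) / 2 = (\<integral>g. indicator B g * (real (rep_dim \<pi>) / 2) \<partial>\<mu>)" by (simp add: b_def)
      also have "\<dots> \<le> (\<integral>g. Re (\<phi> g * cnj (X \<pi> g)) \<partial>\<mu>)"
      proof (rule integral_mono)
        show "integrable \<mu> (\<lambda>g. Re (\<phi> g * cnj (X \<pi> g)))" using int by (rule integrable_Re)
        show "indicator B g * (real (rep_dim \<pi>) / 2) \<le> Re (\<phi> g * cnj (X \<pi> g))" for g
          using bound[of g] by (auto simp: \<phi>_def indicator_def)
        show "integrable \<mu> (\<lambda>g. indicator B g * (real (rep_dim \<pi>) / 2))"
          by (rule integrable_mult_left) (rule intB)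
      qed
      also have "\<dots> = Re (cip \<phi> (X \<pi>))" unfolding cip_def using int by (rule integral_Re)
      also have "\<dots> \<le> cmod (cip \<phi> (X \<pi>))" by (rule complex_Re_le_cmod)
      finally show ?thesis .
    qed
    \<comment> \<open>With (b d / 2)^2 below each term and the norm \<open>b\<close> above, Bessel's
      inequality leaves 4 / b, the inverse volume of the ball up to a constant.\<close>
    have "(b / 2)\<^sup>2 * (\<Sum>\<pi>\<in>F. (real (rep_dim \<pi>))\<^sup>2) = (\<Sum>\<pi>\<in>F. (b * real (rep_dim \<pi>) / 2)\<^sup>2)"
      by (simp add: sum_distrib_left power_mult_distrib power_divide)
    also have "\<dots> \<le> (\<Sum>\<pi>\<in>F. (cmod (cip \<phi> (X \<pi>)))\<^sup>2)"
      using low b by (intro sum_mono power_mono) auto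
    also have "\<dots> \<le> b" unfolding n\<phi>[symmetric] by (rule bessel[OF F(1) \<phi>L Xc on])
    finally have "b * (b * (\<Sum>\<pi>\<in>F. (real (rep_dim \<pi>))\<^sup>2)) \<le> b * 4" by (simp add: power2_eq_square mult_ac)
    hence "b * (\<Sum>\<pi>\<in>F. (real (rep_dim \<pi>))\<^sup>2) \<le> 4" using b by (simp only: mult_le_cancel_left_pos)
    hence "(\<Sum>\<pi>\<in>F. (real (rep_dim \<pi>))\<^sup>2) \<le> 4 / b" using b by (simp add: field_simps)
    also have "\<dots> \<le> 4 / (c2 * \<rho> ^ CARD('n))" using bc b r2(2) \<rho>(1) by (intro divide_left_mono) auto
    also have "\<dots> = 4 / (c2 * r ^ CARD('n)) * (sqrt T) ^ CARD('n)"
      using r(1) T by (simp add: \<rho>_def power_divide)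
    also have "(sqrt T) ^ CARD('n) = T powr (real CARD('n) / 2)"
      using T by (simp add: powr_half_sqrt[symmetric] powr_powr flip: powr_realpow)
    finally show ?thesis .
  qed
  show ?thesis by (rule that[OF _ main]) (use r2(2) r(1) in auto)
qed

end

section \<open>Operator norms and Gaussian moments\<close>

lemma mult_cnj_cmod_sq: "z * cnj z = (complex_of_real (cmod z))\<^sup>2"
  using complex_norm_square[of z] by simp

lemma mat_inv_inverse:
  assumes M: "M \<in> carrier_mat d d" and inv: "invertible_mat (M :: complex mat)"
  shows "mat_inv M \<in> carrier_mat d d" "M * mat_inv M = 1\<^sub>m d"
proof -
  obtain B where B: "inverts_mat M B" "inverts_mat B M" using inv by (auto simp: invertible_mat_def)
  have dB: "dim_row B = d" "dim_col B = d"
  proof -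
    have e: "M * B = 1\<^sub>m d" "B * M = 1\<^sub>m (dim_row B)" using B M by (auto simp: inverts_mat_def)
    from arg_cong[OF e(1), of dim_col] show "dim_col B = d" by simp
    from arg_cong[OF e(2), of dim_col] show "dim_row B = d" using M by simp
  qed
  hence "M \<in> Units (ring_mat TYPE(complex) d ())"
    using B M unfolding Units_def inverts_mat_def ring_mat_def
    by (auto intro!: bexI[of _ B])
  with mat_inverse(1)[OF M, of "()"] obtain C where C: "mat_inverse M = Some C" by (cases "mat_inverse M") auto
  from mat_inverse(2)[OF M C] show "mat_inv M \<in> carrier_mat d d" "M * mat_inv M = 1\<^sub>m d"
    by (auto simp: mat_inv_def C)
qed

lemma frobenius_sq_sum:
  assumes "M \<in> carrier_mat d d"
  shows "frobenius_sq M = (\<Sum>i<d. \<Sum>j<d. (cmod (M $$ (i, j)))\<^sup>2)"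
proof -
  note M = assms mat_adjoint_carrier[OF assms]
  have "frobenius_sq M = (\<Sum>i<d. Re ((M * mat_adjoint M) $$ (i, i)))"
    using M by (simp add: frobenius_sq_def mat_trace_def)
  also have "\<dots> = (\<Sum>i<d. \<Sum>j<d. (cmod (M $$ (i, j)))\<^sup>2)"
  proof (intro sum.cong refl)
    fix i assume "i \<in> {..<d}"
    hence i: "i < d" by simp
    have "(M * mat_adjoint M) $$ (i, i) = (\<Sum>j<d. M $$ (i, j) * mat_adjoint M $$ (j, i))" by (rule mat_mult_index[OF M i i])
    also have "\<dots> = (\<Sum>j<d. complex_of_real ((cmod (M $$ (i, j)))\<^sup>2))"
      using M i by (intro sum.cong refl) (simp add: mult_cnj_cmod_sq)
    finally show "Re ((M * mat_adjoint M) $$ (i, i)) = (\<Sum>j<d. (cmod (M $$ (i, j)))\<^sup>2)" by simp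
  qed
  finally show ?thesis .
qed

lemma euclid_norm_sq: "v \<in> carrier_vec d \<Longrightarrow> (euclid_norm v)\<^sup>2 = (\<Sum>i<d. (cmod (vec_index v i))\<^sup>2)"
  "v \<in> carrier_vec d \<Longrightarrow> euclid_norm v = sqrt (\<Sum>i<d. (cmod (vec_index v i))\<^sup>2)"
proof -
  assume v: "v \<in> carrier_vec d"
  have "v \<bullet>c v = (\<Sum>i<d. complex_of_real ((cmod (vec_index v i))\<^sup>2))"
    using v unfolding scalar_prod_def by (auto simp: mult_cnj_cmod_sq lessThan_atLeast0 intro!: sum.cong)
  hence "Re (v \<bullet>c v) = (\<Sum>i<d. (cmod (vec_index v i))\<^sup>2)" by simp
  thus "euclid_norm v = sqrt (\<Sum>i<d. (cmod (vec_index v i))\<^sup>2)" "(euclid_norm v)\<^sup>2 = (\<Sum>i<d. (cmod (vec_index v i))\<^sup>2)"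
    by (simp_all add: euclid_norm_def sum_nonneg)
qed

text \<open>A Frobenius bound shows that the supremum in \<open>op_norm\<close> is over a bounded
  set; normalising \<open>b\<close> then gives the inequality for all vectors.\<close>

lemma op_norm_col:
  assumes H: "H \<in> carrier_mat d d"
  shows "(\<Sum>i<d. (cmod (\<Sum>j<d. H $$ (i, j) * b j))\<^sup>2) \<le> (op_norm H)\<^sup>2 * (\<Sum>j<d. (cmod (b j))\<^sup>2)"
    and "op_norm H \<ge> 0"
proof -
  define S where "S = {euclid_norm (H *\<^sub>v v) |v. v \<in> carrier_vec (dim_col H) \<and> euclid_norm v \<le> 1}"
  define N where "N v = (\<Sum>i<d. (cmod (v i))\<^sup>2)" for v :: "nat \<Rightarrow> complex"
  define A where "A v i = (\<Sum>j<d. H $$ (i, j) * v j)" for v i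
  have idx: "vec_index (H *\<^sub>v v) i = A (vec_index v) i" if "v \<in> carrier_vec d" "i < d" for v i
    unfolding A_def by (rule mat_vec_index[OF H that])
  have en: "euclid_norm (H *\<^sub>v v) = sqrt (N (A (vec_index v)))" if v: "v \<in> carrier_vec d" for v
    unfolding euclid_norm_sq(2)[OF mult_mat_vec_carrier[OF H v]] N_def by (simp add: idx[OF v])
  define F where "F = (\<Sum>i<d. \<Sum>j<d. (cmod (H $$ (i, j)))\<^sup>2)"
  have AF: "N (A v) \<le> F * N v" for v
  proof -
    have "(cmod (A v i))\<^sup>2 \<le> (\<Sum>j<d. (cmod (H $$ (i, j)))\<^sup>2) * N v" for i
    proof -
      have "cmod (A v i) \<le> sqrt (\<Sum>j<d. (cmod (H $$ (i, j)))\<^sup>2) * sqrt (N v)"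
        unfolding A_def N_def by (rule sum_cauchy_schwarz_cmod)
      from power_mono[OF this, of 2] show ?thesis by (simp add: power_mult_distrib N_def sum_nonneg)
    qed
    thus ?thesis unfolding F_def sum_distrib_right N_def[of "A v"] by (intro sum_mono)
  qed
  have bdd: "bdd_above S"
  proof (rule bdd_aboveI)
    fix x assume "x \<in> S"
    then obtain v where v: "v \<in> carrier_vec d" "euclid_norm v \<le> 1" "x = euclid_norm (H *\<^sub>v v)" using H by (auto simp: S_def)
    have "N (vec_index v) \<le> 1" using v(2) unfolding euclid_norm_sq(2)[OF v(1)] N_def by simp
    hence "F * N (vec_index v) \<le> F * 1" by (intro mult_left_mono) (simp_all add: F_def sum_nonneg)
    with AF[of "vec_index v"] show "x \<le> sqrt F" unfolding v(3) en[OF v(1)] by simp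
  qed
  have op: "op_norm H = Sup S" by (simp add: op_norm_def S_def)
  have mem: "sqrt (N (A v)) \<le> op_norm H" if "N v \<le> 1" for v
  proof -
    let ?v = "Matrix.vec d v"
    have e: "N (A (vec_index ?v)) = N (A v)" "N (vec_index ?v) = N v" by (simp_all add: N_def A_def)
    have "euclid_norm ?v \<le> 1" using that e(2) unfolding euclid_norm_sq(2)[OF vec_carrier] N_def by simp
    hence "euclid_norm (H *\<^sub>v ?v) \<in> S" using H by (auto simp: S_def)
    from cSup_upper[OF this bdd] show ?thesis unfolding op en[OF vec_carrier] e .
  qed
  have "N (A (\<lambda>_. 0)) = 0" by (simp add: N_def A_def)
  with mem[of "\<lambda>_. 0"] show op0: "op_norm H \<ge> 0" by (simp add: N_def)
  have "N (A b) \<le> (op_norm H)\<^sup>2 * N b"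
  proof (cases "N b = 0")
    case True
    with AF[of b] show ?thesis by simp
  next
    case False
    hence pos: "N b > 0" using sum_nonneg[of "{..<d}" "\<lambda>i. (cmod (b i))\<^sup>2"] by (simp add: N_def less_le)
    define c where "c = 1 / sqrt (N b)"
    define b' where "b' i = complex_of_real c * b i" for i
    have "N b' = c\<^sup>2 * N b" by (simp add: N_def b'_def norm_mult power_mult_distrib sum_distrib_left)
    also have "\<dots> = 1" using pos by (simp add: c_def power_divide)
    finally have "sqrt (N (A b')) \<le> op_norm H" by (intro mem) simp
    moreover have "A b' i = complex_of_real c * A b i" for i by (simp add: A_def b'_def sum_distrib_left mult_ac)
    hence "N (A b') = c\<^sup>2 * N (A b)" by (simp add: N_def norm_mult power_mult_distrib sum_distrib_left)
    ultimately have "sqrt (c\<^sup>2 * N (A b)) \<le> op_norm H" by (simp only:)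
    hence "c\<^sup>2 * N (A b) \<le> (op_norm H)\<^sup>2" using sqrt_le_D by blast
    thus ?thesis using pos by (simp add: c_def power_divide field_simps)
  qed
  thus "(\<Sum>i<d. (cmod (\<Sum>j<d. H $$ (i, j) * b j))\<^sup>2) \<le> (op_norm H)\<^sup>2 * (\<Sum>j<d. (cmod (b j))\<^sup>2)"
    by (simp add: N_def A_def)
qed

text \<open>The norm also controls the action on row vectors: pairing the image with itself moves
  \<open>H\<close> to the column side, where \<open>op_norm_col\<close> applies.\<close>

lemma op_norm_row:
  assumes H: "H \<in> carrier_mat d d"
  shows "(\<Sum>j<d. (cmod (\<Sum>k<d. a k * H $$ (k, j)))\<^sup>2) \<le> (op_norm H)\<^sup>2 * (\<Sum>k<d. (cmod (a k))\<^sup>2)"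
proof -
  define b where "b j = (\<Sum>k<d. a k * H $$ (k, j))" for j
  define B where "B = (\<Sum>j<d. (cmod (b j))\<^sup>2)"
  define A where "A = (\<Sum>k<d. (cmod (a k))\<^sup>2)"
  have nn: "A \<ge> 0" "B \<ge> 0" by (simp_all add: A_def B_def sum_nonneg)
  have "complex_of_real B = (\<Sum>j<d. b j * cnj (b j))" by (simp add: B_def mult_cnj_cmod_sq)
  also have "\<dots> = (\<Sum>j<d. \<Sum>k<d. a k * (H $$ (k, j) * cnj (b j)))"
    by (subst (1) b_def) (simp add: sum_distrib_right mult.assoc)
  also have "\<dots> = (\<Sum>k<d. a k * (\<Sum>j<d. H $$ (k, j) * cnj (b j)))"
    by (subst sum.swap) (simp add: sum_distrib_left)
  finally have "B \<le> cmod (\<Sum>k<d. a k * (\<Sum>j<d. H $$ (k, j) * cnj (b j)))"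
    by (metis norm_of_real abs_ge_self)
  also have "\<dots> \<le> sqrt A * sqrt (\<Sum>k<d. (cmod (\<Sum>j<d. H $$ (k, j) * cnj (b j)))\<^sup>2)"
    unfolding A_def by (rule sum_cauchy_schwarz_cmod)
  also have "\<dots> \<le> sqrt A * sqrt ((op_norm H)\<^sup>2 * B)"
    using op_norm_col(1)[OF H, of "\<lambda>j. cnj (b j)"] nn by (intro mult_left_mono real_sqrt_le_mono) (simp_all add: B_def)
  finally have "B\<^sup>2 \<le> (sqrt A * sqrt ((op_norm H)\<^sup>2 * B))\<^sup>2" using nn by (intro power_mono)
  also have "\<dots> = (op_norm H)\<^sup>2 * A * B" using nn by (simp add: power_mult_distrib)
  finally have "B * B \<le> ((op_norm H)\<^sup>2 * A) * B" by (simp add: power2_eq_square)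
  hence "B \<le> (op_norm H)\<^sup>2 * A"
    using nn by (cases "B = 0") (auto simp: mult_le_cancel_right)
  thus ?thesis by (simp add: A_def B_def b_def)
qed

lemma op_norm_frobenius:
  assumes H: "H \<in> carrier_mat d d"
  shows "(\<Sum>i<d. \<Sum>j<d. (cmod (H $$ (i, j)))\<^sup>2) \<le> real d * (op_norm H)\<^sup>2"
proof -
  have "(\<Sum>j<d. (cmod (H $$ (i, j)))\<^sup>2) \<le> (op_norm H)\<^sup>2" if "i < d" for i
  proof -
    have 1: "(\<Sum>k<d. (if k = i then 1 else 0) * H $$ (k, j)) = H $$ (i, j)" for j
      using that by (simp add: if_distrib[of "\<lambda>x. x * _"] cong: if_cong)
    have 2: "(\<Sum>k<d. (cmod (if k = i then 1 else 0))\<^sup>2) = 1"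
      using that by (simp add: if_distrib[of "\<lambda>x. (cmod x)\<^sup>2"] cong: if_cong)
    show ?thesis using op_norm_row[OF H, of "\<lambda>k. if k = i then 1 else 0"] unfolding 1 2 by simp
  qed
  thus ?thesis using sum_mono[of "{..<d}" "\<lambda>i. \<Sum>j<d. (cmod (H $$ (i, j)))\<^sup>2" "\<lambda>_. (op_norm H)\<^sup>2"] by simp
qed

lemma centered_gaussian_moments:
  assumes "prob_space P" and g: "centered_gaussian P X"
  shows "integrable P X" "(\<integral>\<omega>. X \<omega> \<partial>P) = 0" "integrable P (\<lambda>\<omega>. (X \<omega>)\<^sup>2)"
proof -
  interpret prob_space P by fact
  have X: "X \<in> borel_measurable P" using g by (simp add: centered_gaussian_def)
  show "integrable P X" "(\<integral>\<omega>. X \<omega> \<partial>P) = 0" "integrable P (\<lambda>\<omega>. (X \<omega>)\<^sup>2)"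
  proof (atomize(full), cases "AE \<omega> in P. X \<omega> = 0")
    case True
    have "integrable P X \<longleftrightarrow> integrable P (\<lambda>_. 0 :: real)"
      by (rule Bochner_Integration.integrable_cong_AE) (use True X in auto)
    moreover have "(\<integral>\<omega>. X \<omega> \<partial>P) = (\<integral>\<omega>. 0 \<partial>P)"
      by (rule Bochner_Integration.integral_cong_AE) (use True X in auto)
    moreover have "integrable P (\<lambda>\<omega>. (X \<omega>)\<^sup>2) \<longleftrightarrow> integrable P (\<lambda>_. 0 :: real)"
      by (rule Bochner_Integration.integrable_cong_AE) (use True X in auto)
    ultimately show "integrable P X \<and> (\<integral>\<omega>. X \<omega> \<partial>P) = 0 \<and> integrable P (\<lambda>\<omega>. (X \<omega>)\<^sup>2)" by simp
  next
    case False
    then obtain \<sigma> where \<sigma>: "\<sigma> > 0" "distributed P lborel X (\<lambda>x. ennreal (normal_density 0 \<sigma> x))"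
      using g by (auto simp: centered_gaussian_def)
    have i: "integrable P (\<lambda>\<omega>. (X \<omega>) ^ k)" for k
      using integrable_normal_moment[OF \<sigma>(1), of 0 k] distributed_integrable[OF \<sigma>(2), of "\<lambda>x. x ^ k"] by simp
    have "(\<integral>\<omega>. X \<omega> \<partial>P) = 0"
      using integral_normal_moment_odd[OF \<sigma>(1), of 0 0] distributed_integral[OF \<sigma>(2), of "\<lambda>x. x"] by simp
    thus "integrable P X \<and> (\<integral>\<omega>. X \<omega> \<partial>P) = 0 \<and> integrable P (\<lambda>\<omega>. (X \<omega>)\<^sup>2)"
      using i[of 1] i[of 2] by simp
  qed
qed

lemma complex_gaussian_moments:
  assumes P: "prob_space P" and g: "circular_complex_gaussian_family P I X" and i: "i \<in> I"
  shows "X i \<in> L2 P" "integrable P (X i)" "(\<integral>\<omega>. X i \<omega> \<partial>P) = 0"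
proof -
  have "centered_gaussian P (\<lambda>\<omega>. Re (\<Sum>k\<in>{i}. c k * X k \<omega>))" for c
    using g i unfolding circular_complex_gaussian_family_def by blast
  \<comment> \<open>These coefficients extract the real and the imaginary part from the real part of
    a complex combination.\<close>
  from this[of "\<lambda>_. 1"] this[of "\<lambda>_. - \<i>"]
  have re: "centered_gaussian P (\<lambda>\<omega>. Re (X i \<omega>))" and im: "centered_gaussian P (\<lambda>\<omega>. Im (X i \<omega>))" by simp_all
  note m = centered_gaussian_moments[OF P re] centered_gaussian_moments[OF P im]
  have [measurable]: "X i \<in> borel_measurable P" using g i by (auto simp: circular_complex_gaussian_family_def)
  have "integrable P (\<lambda>\<omega>. (cmod (X i \<omega>))\<^sup>2)" unfolding cmod_power2 using m by simp
  thus "X i \<in> L2 P" by (simp add: L2_def)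
  have "integrable P (\<lambda>\<omega>. complex_of_real (Re (X i \<omega>)) + \<i> * complex_of_real (Im (X i \<omega>)))"
    using m by (intro Bochner_Integration.integrable_add integrable_mult_right integrable_of_real)
  thus int: "integrable P (X i)" by (simp add: complex_eq[symmetric])
  have "Re (\<integral>\<omega>. X i \<omega> \<partial>P) = 0" "Im (\<integral>\<omega>. X i \<omega> \<partial>P) = 0"
    using m by (simp_all only: integral_Re[OF int, symmetric] integral_Im[OF int, symmetric])
  thus "(\<integral>\<omega>. X i \<omega> \<partial>P) = 0" by (simp add: complex_eq_iff)
qed

section \<open>Second moments of sums\<close>

lemma cmod_sum_sq: "complex_of_real ((cmod (\<Sum>i\<in>I. x i))\<^sup>2) = (\<Sum>i\<in>I. \<Sum>j\<in>I. x i * cnj (x j))"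
  unfolding complex_norm_square cnj_sum sum_product ..

lemma L2_sum_covariance:
  assumes X: "\<And>i. i \<in> I \<Longrightarrow> X i \<in> L2 P"
  shows "complex_of_real (\<integral>\<omega>. (cmod (\<Sum>i\<in>I. X i \<omega>))\<^sup>2 \<partial>P) = (\<Sum>i\<in>I. \<Sum>j\<in>I. \<integral>\<omega>. X i \<omega> * cnj (X j \<omega>) \<partial>P)"
proof -
  have "complex_of_real (\<integral>\<omega>. (cmod (\<Sum>i\<in>I. X i \<omega>))\<^sup>2 \<partial>P) = (\<integral>\<omega>. (\<Sum>i\<in>I. \<Sum>j\<in>I. X i \<omega> * cnj (X j \<omega>)) \<partial>P)"
    unfolding integral_complex_of_real[symmetric] cmod_sum_sq ..
  also have "\<dots> = (\<Sum>i\<in>I. \<integral>\<omega>. (\<Sum>j\<in>I. X i \<omega> * cnj (X j \<omega>)) \<partial>P)"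
    by (intro Bochner_Integration.integral_sum Bochner_Integration.integrable_sum L2_mult(1) X)
  also have "\<dots> = (\<Sum>i\<in>I. \<Sum>j\<in>I. \<integral>\<omega>. X i \<omega> * cnj (X j \<omega>) \<partial>P)"
    by (intro sum.cong refl Bochner_Integration.integral_sum L2_mult(1) X)
  finally show ?thesis .
qed

lemma L2_cmult: "f \<in> L2 P \<Longrightarrow> (\<lambda>\<omega>. c * f \<omega>) \<in> L2 P"
  by (auto simp: L2_def norm_mult power_mult_distrib)

lemma L2_sum: "(\<And>i. i \<in> I \<Longrightarrow> X i \<in> L2 P) \<Longrightarrow> (\<lambda>\<omega>. \<Sum>i\<in>I. X i \<omega>) \<in> L2 P"
proof (induction I rule: infinite_finite_induct)
  case (insert i I)
  hence "(\<lambda>\<omega>. X i \<omega> + (\<Sum>i\<in>I. X i \<omega>)) \<in> L2 P" by (intro L2_add) auto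
  with insert show ?case by simp
qed (simp_all add: L2_def)

lemma (in prob_space) independent_sum_variance:
  fixes X :: "'i \<Rightarrow> 'a \<Rightarrow> complex"
  assumes I: "finite I" and X: "\<And>i. i \<in> I \<Longrightarrow> X i \<in> L2 M" "\<And>i. i \<in> I \<Longrightarrow> (\<integral>\<omega>. X i \<omega> \<partial>M) = 0"
    and int: "\<And>i. i \<in> I \<Longrightarrow> integrable M (X i)"
    and indep: "\<And>i j. i \<in> I \<Longrightarrow> j \<in> I \<Longrightarrow> i \<noteq> j \<Longrightarrow> indep_var borel (X i) borel (X j)"
  shows "(\<integral>\<omega>. (cmod (\<Sum>i\<in>I. X i \<omega>))\<^sup>2 \<partial>M) = (\<Sum>i\<in>I. \<integral>\<omega>. (cmod (X i \<omega>))\<^sup>2 \<partial>M)"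
proof -
  have "(\<integral>\<omega>. X i \<omega> * cnj (X j \<omega>) \<partial>M) = (if i = j then complex_of_real (\<integral>\<omega>. (cmod (X i \<omega>))\<^sup>2 \<partial>M) else 0)"
    if ij: "i \<in> I" "j \<in> I" for i j
  proof (cases "i = j")
    case True
    thus ?thesis unfolding integral_complex_of_real[symmetric] by (simp add: mult_cnj_cmod_sq)
  next
    case False
    have "indep_var borel ((\<lambda>x. x) \<circ> X i) borel (cnj \<circ> X j)"
      by (rule indep_var_compose[OF indep[OF ij False]]) (auto intro: borel_measurable_continuous_onI continuous_intros)
    hence "indep_var borel (X i) borel (\<lambda>\<omega>. cnj (X j \<omega>))" by (simp add: comp_def)
    from indep_var_lebesgue_integral[OF this] int[OF ij(1)] int[OF ij(2)] X(2)[OF ij(1)] False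
    show ?thesis by simp
  qed
  hence "(\<Sum>i\<in>I. \<Sum>j\<in>I. \<integral>\<omega>. X i \<omega> * cnj (X j \<omega>) \<partial>M) =
     (\<Sum>i\<in>I. \<Sum>j\<in>I. if i = j then complex_of_real (\<integral>\<omega>. (cmod (X i \<omega>))\<^sup>2 \<partial>M) else 0)"
    by (intro sum.cong refl)
  with L2_sum_covariance[of I X M, OF X(1)] have "complex_of_real (\<integral>\<omega>. (cmod (\<Sum>i\<in>I. X i \<omega>))\<^sup>2 \<partial>M) =
     (\<Sum>i\<in>I. \<Sum>j\<in>I. if i = j then complex_of_real (\<integral>\<omega>. (cmod (X i \<omega>))\<^sup>2 \<partial>M) else 0)"
    by simp
  also have "\<dots> = complex_of_real (\<Sum>i\<in>I. \<integral>\<omega>. (cmod (X i \<omega>))\<^sup>2 \<partial>M)" using I by simp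
  finally show ?thesis by (simp only: of_real_eq_iff)
qed

section \<open>The shift model\<close>

text \<open>Extracts pairwise independence of derived variables from the joint independence of
  families of events; both the shift terms and the noise terms are handled this way.\<close>

lemma (in prob_space) indep_var_of_indep_sets:
  assumes F: "indep_sets F I" and ab: "a \<in> I" "b \<in> I" "a \<noteq> b"
    and X: "X \<in> borel_measurable M" "\<And>B. B \<in> sets borel \<Longrightarrow> X -` B \<inter> space M \<in> F a"
    and Y: "Y \<in> borel_measurable M" "\<And>B. B \<in> sets borel \<Longrightarrow> Y -` B \<inter> space M \<in> F b"
  shows "indep_var borel X borel Y"
proof -
  let ?A = "{X -` B \<inter> space M |B. B \<in> sets borel}" and ?B = "{Y -` B \<inter> space M |B. B \<in> sets borel}"
  have ev: "?A \<subseteq> events" "?B \<subseteq> events" using X(1) Y(1) by (auto intro: measurable_sets)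
  have "indep_set ?A ?B"
    unfolding indep_sets2_eq
  proof (intro conjI ballI ev)
    fix p q assume pq: "p \<in> ?A" "q \<in> ?B"
    define A where "A i = (if i = a then p else q)" for i
    have "prob (\<Inter>j\<in>{a, b}. A j) = (\<Prod>j\<in>{a, b}. prob (A j))"
      by (rule indep_setsD[OF F]) (use ab pq X Y in \<open>auto simp: A_def\<close>)
    thus "prob (p \<inter> q) = prob p * prob q" using ab by (simp add: A_def Int_commute)
  qed
  moreover have "(\<lambda>i. {case_bool X Y i -` B \<inter> space M |B. B \<in> sets (case_bool borel borel i)}) = case_bool ?A ?B"
    by (rule ext) (simp split: bool.split)
  ultimately show ?thesis
    unfolding indep_var_def indep_vars_def2 indep_set_def using X(1) Y(1) by (auto split: bool.split)
qed

text \<open>Fixes one sample size; it is interpreted anew for every \<open>n\<close>, as the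
  probability measure may change with \<open>n\<close>.\<close>

locale shift_model = dual_group \<mu> Ghat
  for \<mu> :: "'g::{topological_group_add, t2_space, second_countable_topology} measure"
    and Ghat :: "('g \<Rightarrow> complex mat) set" +
  fixes h :: "'g \<Rightarrow> real" and n :: nat and P :: "'w measure" and \<tau> :: "nat \<Rightarrow> 'w \<Rightarrow> 'g"
    and W :: "nat \<Rightarrow> ('g \<Rightarrow> complex) \<Rightarrow> 'w \<Rightarrow> complex" and \<epsilon> :: real
  assumes h_nonneg: "h g \<ge> 0" and h_L2: "(\<lambda>g. complex_of_real (h g)) \<in> L2 \<mu>"
    and model: "shift_noise_model \<mu> h n P \<tau> W" and n_pos: "n > 0"
    and h_inv: "\<pi> \<in> Ghat \<Longrightarrow> invertible_mat (fourier_coeff \<mu> (\<lambda>g. complex_of_real (h g)) \<pi>)"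
begin

sublocale P: prob_space P using model by (simp add: shift_noise_model_def)

abbreviation hc :: "'g \<Rightarrow> complex" where "hc g \<equiv> complex_of_real (h g)"

definition H :: "('g \<Rightarrow> complex mat) \<Rightarrow> complex mat" where
  "H \<pi> = mat_inv (fourier_coeff \<mu> hc \<pi>)"

lemma fourier_coeff_index:
  "fourier_coeff \<mu> f \<pi> \<in> carrier_mat (rep_dim \<pi>) (rep_dim \<pi>)"
  "i < rep_dim \<pi> \<Longrightarrow> j < rep_dim \<pi> \<Longrightarrow> fourier_coeff \<mu> f \<pi> $$ (i, j) = fc f \<pi> i j"
  by (simp_all add: fourier_coeff_def fc_def)

lemma H_carrier: "\<pi> \<in> Ghat \<Longrightarrow> H \<pi> \<in> carrier_mat (rep_dim \<pi>) (rep_dim \<pi>)"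
  unfolding H_def by (rule mat_inv_inverse(1)[OF fourier_coeff_index(1) h_inv])

lemma H_inverse:
  assumes "\<pi> \<in> Ghat" "i < rep_dim \<pi>" "j < rep_dim \<pi>"
  shows "(\<Sum>k<rep_dim \<pi>. fc hc \<pi> i k * H \<pi> $$ (k, j)) = (if i = j then 1 else 0)"
proof -
  have "(fourier_coeff \<mu> hc \<pi> * H \<pi>) $$ (i, j) = 1\<^sub>m (rep_dim \<pi>) $$ (i, j)"
    unfolding H_def by (subst mat_inv_inverse(2)[OF fourier_coeff_index(1) h_inv]) (use assms in auto)
  thus ?thesis using mat_mult_index[OF fourier_coeff_index(1) H_carrier[OF assms(1)] assms(2,3)] assms
    by (simp add: fourier_coeff_index(2))
qed

lemma h_measurable [measurable]: "h \<in> borel_measurable borel"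
proof -
  have "hc \<in> borel_measurable \<mu>" using h_L2 by (simp add: L2_def)
  from measurable_compose[OF this borel_measurable_Re] show ?thesis by simp
qed

lemma \<tau>_measurable: "m \<in> {1..n} \<Longrightarrow> \<tau> m \<in> measurable P borel"
proof -
  assume "m \<in> {1..n}"
  hence "distributed P \<mu> (\<tau> m) (\<lambda>g. ennreal (h g))" using model by (auto simp: shift_noise_model_def)
  from distributed_measurable[OF this] show ?thesis using measurable_cong_sets[OF refl sets_haar] by blast
qed

lemma \<tau>_integral:
  fixes \<psi> :: "'g \<Rightarrow> complex"
  assumes m: "m \<in> {1..n}" and [measurable]: "\<psi> \<in> borel_measurable borel"
  shows "(\<integral>\<omega>. \<psi> (\<tau> m \<omega>) \<partial>P) = (\<integral>g. hc g * \<psi> g \<partial>\<mu>)"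
proof -
  have d: "distributed P \<mu> (\<tau> m) (\<lambda>g. ennreal (h g))" using model m by (auto simp: shift_noise_model_def)
  note [measurable] = \<tau>_measurable[OF m]
  have "(\<integral>\<omega>. \<psi> (\<tau> m \<omega>) \<partial>P) = (\<integral>g. \<psi> g \<partial>distr P \<mu> (\<tau> m))" by (subst integral_distr) auto
  also have "\<dots> = (\<integral>g. \<psi> g \<partial>density \<mu> (\<lambda>g. ennreal (h g)))" by (simp only: distributed_distr_eq_density[OF d])
  also have "\<dots> = (\<integral>g. hc g * \<psi> g \<partial>\<mu>)" by (subst integral_density) (auto simp: h_nonneg scaleR_conv_of_real)
  finally show ?thesis .
qed

lemma Ghat_minus_continuous:
  "\<pi> \<in> Ghat \<Longrightarrow> i < rep_dim \<pi> \<Longrightarrow> j < rep_dim \<pi> \<Longrightarrow> continuous_on UNIV (\<lambda>g. \<pi> (- g) $$ (i, j))"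
  by (rule continuous_on_compose2[OF Ghat_cont]) (auto intro!: continuous_intros)

lemma shifted_coefficient:
  assumes f: "f \<in> L2 \<mu>" and \<pi>: "\<pi> \<in> Ghat" "i < rep_dim \<pi>" "j < rep_dim \<pi>"
  shows "(\<integral>g. \<pi> (- g) $$ (i, j) * f (- t + g) \<partial>\<mu>) = (\<Sum>l<rep_dim \<pi>. fc f \<pi> i l * \<pi> (- t) $$ (l, j))"
proof -
  have [measurable]: "f \<in> borel_measurable borel" using f by (auto simp: L2_def)
  have [measurable]: "(\<lambda>g. \<pi> (- g) $$ (k, l)) \<in> borel_measurable borel" if "k < rep_dim \<pi>" "l < rep_dim \<pi>" for k l
    using continuous_measurable[OF Ghat_minus_continuous[OF \<pi>(1) that]] by simp
  have "continuous_on UNIV (\<lambda>x. \<pi> (- (t + x)) $$ (i, j))"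
    by (rule continuous_on_compose2[OF Ghat_minus_continuous[OF \<pi>]]) (auto intro!: continuous_intros)
  from continuous_measurable[OF this]
  have meas: "(\<lambda>x. \<pi> (- (t + x)) $$ (i, j) * f x) \<in> borel_measurable borel" by simp
  have "(\<integral>g. \<pi> (- g) $$ (i, j) * f (- t + g) \<partial>\<mu>) = (\<integral>g. \<pi> (- (t + (- t + g))) $$ (i, j) * f (- t + g) \<partial>\<mu>)"
    by (simp add: add.assoc[symmetric])
  also have "\<dots> = (\<integral>x. \<pi> (- (t + x)) $$ (i, j) * f x \<partial>\<mu>)" by (rule integral_left[OF meas])
  also have "\<dots> = (\<integral>x. (\<Sum>l<rep_dim \<pi>. f x * \<pi> (- x) $$ (i, l) * \<pi> (- t) $$ (l, j)) \<partial>\<mu>)"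
    by (rule arg_cong[where f="integral\<^sup>L \<mu>"], rule ext)
      (simp only: minus_add Ghat_add[OF \<pi>] sum_distrib_left mult_ac)
  also have "\<dots> = (\<Sum>l<rep_dim \<pi>. \<integral>x. f x * \<pi> (- x) $$ (i, l) * \<pi> (- t) $$ (l, j) \<partial>\<mu>)"
  proof (rule Bochner_Integration.integral_sum)
    fix l assume "l \<in> {..<rep_dim \<pi>}"
    hence l: "l < rep_dim \<pi>" by simp
    have "integrable \<mu> (\<lambda>x. f x * cnj (\<pi> x $$ (l, i)))"
      by (rule L2_mult(1)[OF f continuous_L2[OF Ghat_cont[OF \<pi>(1) l \<pi>(2)]]])
    thus "integrable \<mu> (\<lambda>x. f x * \<pi> (- x) $$ (i, l) * \<pi> (- t) $$ (l, j))"
      by (intro integrable_mult_left) (simp add: Ghat_minus[OF \<pi>(1,2) l])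
  qed
  also have "\<dots> = (\<Sum>l<rep_dim \<pi>. fc f \<pi> i l * \<pi> (- t) $$ (l, j))" by (simp add: fc_def)
  finally show ?thesis .
qed

text \<open>In matrix notation \<open>c\<^sub>\<pi>(Y\<^sub>m) c\<^sub>\<pi>(h)\<^sup>-\<^sup>1 = U(\<tau>\<^sub>m) + \<epsilon> N\<^sub>m\<close> with \<open>U(t) = c\<^sub>\<pi>(f) \<pi>(t\<^sup>-\<^sup>1) c\<^sub>\<pi>(h)\<^sup>-\<^sup>1\<close> and
  \<open>N\<^sub>m = c\<^sub>\<pi>(W\<^sub>m) c\<^sub>\<pi>(h)\<^sup>-\<^sup>1\<close>; below, \<open>Z\<^sub>m = U(\<tau>\<^sub>m) - c\<^sub>\<pi>(f)\<close> is the centered shift term.\<close>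

definition U :: "('g \<Rightarrow> complex) \<Rightarrow> ('g \<Rightarrow> complex mat) \<Rightarrow> nat \<Rightarrow> nat \<Rightarrow> 'g \<Rightarrow> complex" where
  "U f \<pi> i j t = (\<Sum>k<rep_dim \<pi>. (\<Sum>l<rep_dim \<pi>. fc f \<pi> i l * \<pi> (- t) $$ (l, k)) * H \<pi> $$ (k, j))"

lemma U_continuous: "\<pi> \<in> Ghat \<Longrightarrow> continuous_on UNIV (U f \<pi> i j)"
  unfolding U_def[abs_def] by (intro continuous_intros Ghat_minus_continuous) auto

text \<open>Multiplication by the unitary matrix \<open>\<pi> (- t)\<close> preserves the norm of
  each row, so only the operator norm of \<open>H \<pi>\<close> enters, uniformly in
  \<open>t\<close>.\<close>

lemma U_bound:
  assumes \<pi>: "\<pi> \<in> Ghat"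
  shows "(\<Sum>i<rep_dim \<pi>. \<Sum>j<rep_dim \<pi>. (cmod (U f \<pi> i j t))\<^sup>2) \<le>
    (op_norm (H \<pi>))\<^sup>2 * (\<Sum>i<rep_dim \<pi>. \<Sum>j<rep_dim \<pi>. (cmod (fc f \<pi> i j))\<^sup>2)"
  unfolding sum_distrib_left[of _ _ "{..<rep_dim \<pi>}"]
proof (rule sum_mono)
  let ?d = "rep_dim \<pi>"
  fix i assume "i \<in> {..<?d}"
  define a where "a k = (\<Sum>l<?d. fc f \<pi> i l * \<pi> (- t) $$ (l, k))" for k
  have "complex_of_real (\<Sum>k<?d. (cmod (a k))\<^sup>2) =
     (\<Sum>k<?d. \<Sum>l<?d. \<Sum>l'<?d. fc f \<pi> i l * cnj (fc f \<pi> i l') * (\<pi> (- t) $$ (l, k) * cnj (\<pi> (- t) $$ (l', k))))"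
    unfolding of_real_sum a_def cmod_sum_sq by (simp add: mult_ac)
  also have "\<dots> = (\<Sum>l<?d. \<Sum>l'<?d. fc f \<pi> i l * cnj (fc f \<pi> i l') * (\<Sum>k<?d. \<pi> (- t) $$ (l, k) * cnj (\<pi> (- t) $$ (l', k))))"
    unfolding sum_distrib_left by (subst sum.swap) (intro sum.cong refl sum.swap)
  also have "\<dots> = (\<Sum>l<?d. \<Sum>l'<?d. if l = l' then fc f \<pi> i l * cnj (fc f \<pi> i l') else 0)"
    by (intro sum.cong refl) (simp add: Ghat_row_norm[OF \<pi>])
  also have "\<dots> = complex_of_real (\<Sum>l<?d. (cmod (fc f \<pi> i l))\<^sup>2)" by (simp add: mult_cnj_cmod_sq)
  finally have a: "(\<Sum>k<?d. (cmod (a k))\<^sup>2) = (\<Sum>l<?d. (cmod (fc f \<pi> i l))\<^sup>2)" by (simp only: of_real_eq_iff)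
  have "(\<Sum>j<?d. (cmod (U f \<pi> i j t))\<^sup>2) \<le> (op_norm (H \<pi>))\<^sup>2 * (\<Sum>k<?d. (cmod (a k))\<^sup>2)"
    unfolding U_def a_def[symmetric] by (rule op_norm_row[OF H_carrier[OF \<pi>]])
  thus "(\<Sum>j<?d. (cmod (U f \<pi> i j t))\<^sup>2) \<le> (\<Sum>j<?d. (op_norm (H \<pi>))\<^sup>2 * (cmod (fc f \<pi> i j))\<^sup>2)"
    unfolding a sum_distrib_left .
qed

lemma U_mean:
  assumes \<pi>: "\<pi> \<in> Ghat" "i < rep_dim \<pi>" "j < rep_dim \<pi>" and m: "m \<in> {1..n}"
  shows "(\<integral>\<omega>. U f \<pi> i j (\<tau> m \<omega>) \<partial>P) = fc f \<pi> i j"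
proof -
  let ?d = "rep_dim \<pi>"
  have [measurable]: "U f \<pi> i j \<in> borel_measurable borel"
    using continuous_measurable[OF U_continuous[OF \<pi>(1)]] by simp
  have int: "integrable \<mu> (\<lambda>g. hc g * \<pi> (- g) $$ (l, k))" if "l < ?d" "k < ?d" for l k
    using L2_mult(1)[OF h_L2 continuous_L2[OF Ghat_cont[OF \<pi>(1) that(2,1)]]] by (simp add: Ghat_minus[OF \<pi>(1) that])
  have "(\<integral>\<omega>. U f \<pi> i j (\<tau> m \<omega>) \<partial>P) = (\<integral>g. hc g * U f \<pi> i j g \<partial>\<mu>)" by (rule \<tau>_integral[OF m]) simp
  also have "\<dots> = (\<integral>g. (\<Sum>k<?d. \<Sum>l<?d. (fc f \<pi> i l * H \<pi> $$ (k, j)) * (hc g * \<pi> (- g) $$ (l, k))) \<partial>\<mu>)"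
    by (simp add: U_def sum_distrib_left sum_distrib_right mult_ac)
  also have "\<dots> = (\<Sum>k<?d. \<Sum>l<?d. (fc f \<pi> i l * H \<pi> $$ (k, j)) * fc hc \<pi> l k)"
    by (subst Bochner_Integration.integral_sum, (intro Bochner_Integration.integrable_sum integrable_mult_right int; simp),
        intro sum.cong refl, subst Bochner_Integration.integral_sum, (intro integrable_mult_right int; simp),
        simp add: fc_def)
  also have "\<dots> = (\<Sum>l<?d. fc f \<pi> i l * (\<Sum>k<?d. fc hc \<pi> l k * H \<pi> $$ (k, j)))"
    by (subst sum.swap) (simp add: sum_distrib_left mult_ac)
  also have "\<dots> = (\<Sum>l<?d. if l = j then fc f \<pi> i l else 0)"
    by (intro sum.cong refl) (simp add: H_inverse[OF \<pi>(1) _ \<pi>(3)])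
  also have "\<dots> = fc f \<pi> i j" using \<pi>(3) by simp
  finally show ?thesis .
qed

lemma U_L2: 
  assumes \<pi>: "\<pi> \<in> Ghat" and m: "m \<in> {1..n}"
  shows "(\<lambda>\<omega>. U f \<pi> i j (\<tau> m \<omega>)) \<in> L2 P" "integrable P (\<lambda>\<omega>. U f \<pi> i j (\<tau> m \<omega>))"
proof -
  note [measurable] = \<tau>_measurable[OF m]
  have [measurable]: "U f \<pi> i j \<in> borel_measurable borel"
    using continuous_measurable[OF U_continuous[OF \<pi>]] by simp
  obtain B where B: "cmod (U f \<pi> i j t) \<le> B" for t using continuous_bounded[OF U_continuous[OF \<pi>]] by metis
  show "integrable P (\<lambda>\<omega>. U f \<pi> i j (\<tau> m \<omega>))"
    by (rule P.integrable_const_bound[of _ B]) (use B in auto)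
  have "integrable P (\<lambda>\<omega>. (cmod (U f \<pi> i j (\<tau> m \<omega>)))\<^sup>2)"
    by (rule P.integrable_const_bound[of _ "B\<^sup>2"]) (use B in \<open>auto intro!: power_mono\<close>)
  thus "(\<lambda>\<omega>. U f \<pi> i j (\<tau> m \<omega>)) \<in> L2 P" by (simp add: L2_def)
qed

lemma indep: "P.indep_sets (case_sum (\<lambda>m. shift_events P (\<tau> m)) (\<lambda>m. noise_events \<mu> P (W m)))
       (Inl ` {1..n} \<union> Inr ` {1..n})"
  using model by (simp add: shift_noise_model_def)

definition Z where "Z f \<pi> i j m \<omega> = U f \<pi> i j (\<tau> m \<omega>) - fc f \<pi> i j"

lemma Z_L2:
  assumes \<pi>: "\<pi> \<in> Ghat" "i < rep_dim \<pi>" "j < rep_dim \<pi>" and m: "m \<in> {1..n}"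
  shows "Z f \<pi> i j m \<in> L2 P" "integrable P (Z f \<pi> i j m)" "(\<integral>\<omega>. Z f \<pi> i j m \<omega> \<partial>P) = 0"
    "(\<integral>\<omega>. (cmod (Z f \<pi> i j m \<omega>))\<^sup>2 \<partial>P) \<le> (\<integral>\<omega>. (cmod (U f \<pi> i j (\<tau> m \<omega>)))\<^sup>2 \<partial>P)"
proof -
  let ?u = "\<lambda>\<omega>. U f \<pi> i j (\<tau> m \<omega>)" and ?c = "fc f \<pi> i j"
  note u = U_L2[OF \<pi>(1) m, of f i j]
  have "(\<lambda>_. - ?c) \<in> L2 P" by (simp add: L2_def)
  from L2_add[OF u(1) this] show "Z f \<pi> i j m \<in> L2 P" by (simp add: Z_def[abs_def])
  show "integrable P (Z f \<pi> i j m)" unfolding Z_def[abs_def] using u(2) by simp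
  show mean: "(\<integral>\<omega>. Z f \<pi> i j m \<omega> \<partial>P) = 0"
    unfolding Z_def using u(2) by (simp add: U_mean[OF \<pi> m] P.prob_space)
  have e: "(cmod (Z f \<pi> i j m \<omega>))\<^sup>2 = (cmod (?u \<omega>))\<^sup>2 - (cmod ?c)\<^sup>2 - 2 * Re (Z f \<pi> i j m \<omega> * cnj ?c)" for \<omega>
    unfolding Z_def cmod_power2 by (simp add: power2_eq_square algebra_simps)
  have zi: "integrable P (\<lambda>\<omega>. Z f \<pi> i j m \<omega> * cnj ?c)"
    using \<open>integrable P (Z f \<pi> i j m)\<close> by (rule integrable_mult_left)
  have re: "(\<integral>\<omega>. Re (Z f \<pi> i j m \<omega> * cnj ?c) \<partial>P) = 0"
    by (subst integral_Re[OF zi]) (simp add: mean)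
  have "(\<integral>\<omega>. (cmod (Z f \<pi> i j m \<omega>))\<^sup>2 \<partial>P) = (\<integral>\<omega>. (cmod (?u \<omega>))\<^sup>2 \<partial>P) - (cmod ?c)\<^sup>2 - 2 * (\<integral>\<omega>. Re (Z f \<pi> i j m \<omega> * cnj ?c) \<partial>P)"
    proof -
    define R where "R \<omega> = Re (Z f \<pi> i j m \<omega> * cnj ?c)" for \<omega>
    have "integrable P (\<lambda>\<omega>. (cmod (?u \<omega>))\<^sup>2)" "integrable P R"
      using u(1) integrable_Re[OF zi] by (simp_all add: L2_def R_def[abs_def])
    thus ?thesis unfolding e R_def[symmetric] by (simp add: P.prob_space)
  qed
  thus "(\<integral>\<omega>. (cmod (Z f \<pi> i j m \<omega>))\<^sup>2 \<partial>P) \<le> (\<integral>\<omega>. (cmod (?u \<omega>))\<^sup>2 \<partial>P)" unfolding re by simp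
qed

lemma Z_indep:
  assumes \<pi>: "\<pi> \<in> Ghat" "i < rep_dim \<pi>" "j < rep_dim \<pi>" and m: "m \<in> {1..n}" "k \<in> {1..n}" "m \<noteq> k"
  shows "P.indep_var borel (Z f \<pi> i j m) borel (Z f \<pi> i j k)"
proof (rule P.indep_var_of_indep_sets[OF indep, of "Inl m" "Inl k"])
  define \<psi> where "\<psi> t = U f \<pi> i j t - fc f \<pi> i j" for t
  have \<psi>: "\<psi> \<in> borel_measurable borel"
    using continuous_measurable[OF U_continuous[OF \<pi>(1)], of f i j] unfolding \<psi>_def[abs_def] by simp
  have ev: "Z f \<pi> i j q -` B \<inter> space P \<in> shift_events P (\<tau> q)" if "B \<in> sets borel" for q B
  proof -
    have "Z f \<pi> i j q -` B \<inter> space P = \<tau> q -` (\<psi> -` B) \<inter> space P" by (auto simp: Z_def \<psi>_def)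
    moreover have "\<psi> -` B \<in> sets borel" using measurable_sets[OF \<psi> that] by simp
    ultimately show ?thesis unfolding shift_events_def by blast
  qed
  show "Z f \<pi> i j m -` B \<inter> space P \<in> case_sum (\<lambda>m. shift_events P (\<tau> m)) (\<lambda>m. noise_events \<mu> P (W m)) (Inl m)"
    "Z f \<pi> i j k -` B \<inter> space P \<in> case_sum (\<lambda>m. shift_events P (\<tau> m)) (\<lambda>m. noise_events \<mu> P (W m)) (Inl k)"
    if "B \<in> sets borel" for B using ev[OF that] by simp_all
qed (use m Z_L2(2)[OF \<pi>] in auto)

definition N where
  "N \<pi> i j m \<omega> = (\<Sum>k<rep_dim \<pi>. H \<pi> $$ (k, j) * W m (\<lambda>g. \<pi> (- g) $$ (i, k)) \<omega>)"

lemma noise: "m \<in> {1..n} \<Longrightarrow> white_noise \<mu> P (W m)"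
  using model by (simp add: shift_noise_model_def)

text \<open>The functions integrated against the noise along a row are orthogonal with squared norm
  1 / d, by Schur orthogonality; the covariances of the white noise are therefore diagonal.\<close>

lemma N_L2:
  assumes \<pi>: "\<pi> \<in> Ghat" "i < rep_dim \<pi>" "j < rep_dim \<pi>" and m: "m \<in> {1..n}"
  shows "N \<pi> i j m \<in> L2 P" "integrable P (N \<pi> i j m)" "(\<integral>\<omega>. N \<pi> i j m \<omega> \<partial>P) = 0"
    "(\<integral>\<omega>. (cmod (N \<pi> i j m \<omega>))\<^sup>2 \<partial>P) = (\<Sum>k<rep_dim \<pi>. (cmod (H \<pi> $$ (k, j)))\<^sup>2) / real (rep_dim \<pi>)"
proof -
  let ?d = "rep_dim \<pi>"
  define \<phi> where "\<phi> k g = \<pi> (- g) $$ (i, k)" for k g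
  have \<phi>: "\<phi> k \<in> L2 \<mu>" if "k < ?d" for k
    unfolding \<phi>_def[abs_def] by (rule continuous_L2[OF Ghat_minus_continuous[OF \<pi>(1,2) that]])
  have N: "N \<pi> i j m = (\<lambda>\<omega>. \<Sum>k<?d. H \<pi> $$ (k, j) * W m (\<phi> k) \<omega>)" by (simp add: N_def[abs_def] \<phi>_def[abs_def])
  have g: "circular_complex_gaussian_family P (L2 \<mu>) (W m)" using noise[OF m] by (simp add: white_noise_def)
  note mom = complex_gaussian_moments[OF P.prob_space_axioms g \<phi>]
  have L: "(\<lambda>\<omega>. H \<pi> $$ (k, j) * W m (\<phi> k) \<omega>) \<in> L2 P" if "k \<in> {..<?d}" for k
    using mom(1) that by (intro L2_cmult) simp
  show "N \<pi> i j m \<in> L2 P" unfolding N by (rule L2_sum[OF L])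
  show "integrable P (N \<pi> i j m)" unfolding N
    using mom(2) by (intro Bochner_Integration.integrable_sum integrable_mult_right) simp
  show "(\<integral>\<omega>. N \<pi> i j m \<omega> \<partial>P) = 0" unfolding N
    using mom(2,3) by (subst Bochner_Integration.integral_sum) (auto intro!: integrable_mult_right)
  have cov: "(\<integral>\<omega>. W m (\<phi> k) \<omega> * cnj (W m (\<phi> l) \<omega>) \<partial>P) = (if k = l then 1 / of_nat ?d else 0)"
    if kl: "k < ?d" "l < ?d" for k l
  proof -
    have "(\<integral>\<omega>. W m (\<phi> k) \<omega> * cnj (W m (\<phi> l) \<omega>) \<partial>P) = (\<integral>g. \<phi> k g * cnj (\<phi> l g) \<partial>\<mu>)"
      using noise[OF m] \<phi>[OF kl(1)] \<phi>[OF kl(2)] unfolding white_noise_def by blast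
    also have "\<dots> = cip (\<lambda>g. \<pi> g $$ (l, i)) (\<lambda>g. \<pi> g $$ (k, i))"
      unfolding cip_def \<phi>_def Ghat_minus[OF \<pi>(1,2) kl(1)] Ghat_minus[OF \<pi>(1,2) kl(2)] by (simp add: mult.commute)
    also have "\<dots> = (if k = l then 1 / of_nat ?d else 0)"
      using schur_orthogonality[OF \<pi>(1,1) kl(2) \<pi>(2) kl(1) \<pi>(2)] by (simp add: eq_commute)
    finally show ?thesis .
  qed
  have "complex_of_real (\<integral>\<omega>. (cmod (N \<pi> i j m \<omega>))\<^sup>2 \<partial>P) =
     (\<Sum>k<?d. \<Sum>l<?d. \<integral>\<omega>. H \<pi> $$ (k, j) * W m (\<phi> k) \<omega> * cnj (H \<pi> $$ (l, j) * W m (\<phi> l) \<omega>) \<partial>P)"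
    unfolding N by (rule L2_sum_covariance[OF L])
  also have "\<dots> = (\<Sum>k<?d. \<Sum>l<?d. H \<pi> $$ (k, j) * cnj (H \<pi> $$ (l, j)) * (\<integral>\<omega>. W m (\<phi> k) \<omega> * cnj (W m (\<phi> l) \<omega>) \<partial>P))"
    by (intro sum.cong refl) (simp flip: integral_mult_right_zero add: mult_ac)
  also have "\<dots> = (\<Sum>k<?d. \<Sum>l<?d. if k = l then H \<pi> $$ (k, j) * cnj (H \<pi> $$ (k, j)) / of_nat ?d else 0)"
    by (intro sum.cong refl) (simp add: cov)
  also have "\<dots> = complex_of_real ((\<Sum>k<?d. (cmod (H \<pi> $$ (k, j)))\<^sup>2) / real ?d)"
    by (simp add: mult_cnj_cmod_sq sum_divide_distrib)
  finally show "(\<integral>\<omega>. (cmod (N \<pi> i j m \<omega>))\<^sup>2 \<partial>P) = (\<Sum>k<?d. (cmod (H \<pi> $$ (k, j)))\<^sup>2) / real ?d"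
    by (simp only: of_real_eq_iff)
qed

text \<open>Each \<open>N\<close> is a finite combination of noise integrals, hence measurable for
  the sigma-algebra \<open>noise_events\<close>.\<close>

lemma N_indep:
  assumes \<pi>: "\<pi> \<in> Ghat" "i < rep_dim \<pi>" "j < rep_dim \<pi>" and m: "m \<in> {1..n}" "k \<in> {1..n}" "m \<noteq> k"
  shows "P.indep_var borel (N \<pi> i j m) borel (N \<pi> i j k)"
proof (rule P.indep_var_of_indep_sets[OF indep, of "Inr m" "Inr k"])
  have ev: "N \<pi> i j q -` B \<inter> space P \<in> noise_events \<mu> P (W q)" if B: "B \<in> sets borel" for q B
  proof -
    define G where "G = {W q f -` B \<inter> space P |f B. f \<in> L2 \<mu> \<and> B \<in> sets borel}"
    have G: "G \<subseteq> Pow (space P)" by (auto simp: G_def)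
    have [measurable]: "W q (\<lambda>g. \<pi> (- g) $$ (i, l)) \<in> borel_measurable (sigma (space P) G)" if "l < rep_dim \<pi>" for l
    proof (rule measurableI)
      fix B :: "complex set" assume B: "B \<in> sets borel"
      have "(\<lambda>g. \<pi> (- g) $$ (i, l)) \<in> L2 \<mu>"
        by (rule continuous_L2[OF Ghat_minus_continuous[OF \<pi>(1,2) that]])
      hence "W q (\<lambda>g. \<pi> (- g) $$ (i, l)) -` B \<inter> space P \<in> G" using B unfolding G_def by blast
      thus "W q (\<lambda>g. \<pi> (- g) $$ (i, l)) -` B \<inter> space (sigma (space P) G) \<in> sets (sigma (space P) G)"
        using G by (simp add: space_measure_of sets_measure_of)
    qed simp
    have "N \<pi> i j q \<in> borel_measurable (sigma (space P) G)" unfolding N_def[abs_def] by measurable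
    from measurable_sets[OF this B] show ?thesis
      using G by (simp add: noise_events_def space_measure_of sets_measure_of G_def[symmetric])
  qed
  show "N \<pi> i j m -` B \<inter> space P \<in> case_sum (\<lambda>m. shift_events P (\<tau> m)) (\<lambda>m. noise_events \<mu> P (W m)) (Inr m)"
    "N \<pi> i j k -` B \<inter> space P \<in> case_sum (\<lambda>m. shift_events P (\<tau> m)) (\<lambda>m. noise_events \<mu> P (W m)) (Inr k)"
    if "B \<in> sets borel" for B using ev[OF that] by simp_all
qed (use m N_L2(2)[OF \<pi>] in auto)

end

section \<open>From coefficient errors to the risk\<close>

context shift_model
begin

definition est_coeff :: "('g \<Rightarrow> complex) \<Rightarrow> 'w \<Rightarrow> ('g \<Rightarrow> complex mat) \<Rightarrow> nat \<Rightarrow> nat \<Rightarrow> complex" where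
  "est_coeff f \<omega> \<pi> i j = (1 / of_nat n) * (\<Sum>m=1..n. U f \<pi> i j (\<tau> m \<omega>) + complex_of_real \<epsilon> * N \<pi> i j m \<omega>)"

abbreviation obs :: "('g \<Rightarrow> complex) \<Rightarrow> 'w \<Rightarrow> nat \<Rightarrow> ('g \<Rightarrow> complex) \<Rightarrow> complex" where
  "obs f \<omega> m \<equiv> observation \<mu> \<epsilon> f (\<tau> m \<omega>) (\<lambda>\<phi>. W m \<phi> \<omega>)"

text \<open>Puts the estimator into the form of a Fourier synthesis, for which
  \<open>trig_projection\<close> computes the loss exactly.\<close>

lemma estimator_trig:
  assumes f: "f \<in> L2 \<mu>"
  shows "estimator \<mu> Ghat lam h T n (obs f \<omega>) g = trig {\<pi> \<in> Ghat. lam \<pi> < T} (est_coeff f \<omega>) g"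
proof -
  define F where "F = {\<pi> \<in> Ghat. lam \<pi> < T}"
  define K where "K m \<pi> i j = U f \<pi> i j (\<tau> m \<omega>) + complex_of_real \<epsilon> * N \<pi> i j m \<omega>" for m \<pi> i j
  have tr: "mat_trace (\<pi> g * obs_fourier_coeff (obs f \<omega> m) \<pi> * H \<pi>) =
     (\<Sum>i<rep_dim \<pi>. \<Sum>j<rep_dim \<pi>. \<pi> g $$ (i, j) * K m \<pi> j i)" if \<pi>: "\<pi> \<in> Ghat" for m \<pi>
  proof -
    let ?d = "rep_dim \<pi>" and ?Y = "obs_fourier_coeff (obs f \<omega> m) \<pi>"
    note ca = is_rep_entries(1)[OF Ghat_rep[OF \<pi>], of g]
    have Y: "?Y \<in> carrier_mat ?d ?d" by (simp add: obs_fourier_coeff_def)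
    note YH = mult_carrier_mat[OF Y H_carrier[OF \<pi>]]
    have Yi: "?Y $$ (i, k) = (\<Sum>l<?d. fc f \<pi> i l * \<pi> (- \<tau> m \<omega>) $$ (l, k)) + complex_of_real \<epsilon> * W m (\<lambda>g. \<pi> (- g) $$ (i, k)) \<omega>"
      if "i < ?d" "k < ?d" for i k
      using that by (simp add: obs_fourier_coeff_def observation_def shifted_coefficient[OF f \<pi> that])
    have YHi: "(?Y * H \<pi>) $$ (j, i) = K m \<pi> j i" if ji: "j < ?d" "i < ?d" for j i
    proof -
      have "(?Y * H \<pi>) $$ (j, i) = (\<Sum>k<?d. ?Y $$ (j, k) * H \<pi> $$ (k, i))"
        by (rule mat_mult_index[OF Y H_carrier[OF \<pi>] ji])
      also have "\<dots> = (\<Sum>k<?d. (\<Sum>l<?d. fc f \<pi> j l * \<pi> (- \<tau> m \<omega>) $$ (l, k)) * H \<pi> $$ (k, i) +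
          complex_of_real \<epsilon> * (H \<pi> $$ (k, i) * W m (\<lambda>g. \<pi> (- g) $$ (j, k)) \<omega>))"
        by (intro sum.cong refl) (use ji in \<open>simp add: Yi algebra_simps\<close>)
      also have "\<dots> = K m \<pi> j i" by (simp only: K_def U_def N_def sum.distrib sum_distrib_left[of "complex_of_real \<epsilon>"])
      finally show ?thesis .
    qed
    have "mat_trace (\<pi> g * ?Y * H \<pi>) = (\<Sum>i<?d. (\<pi> g * (?Y * H \<pi>)) $$ (i, i))"
      using ca Y H_carrier[OF \<pi>] by (simp add: mat_trace_def assoc_mult_mat[OF ca Y H_carrier[OF \<pi>]] del: index_mult_mat(1))
    also have "\<dots> = (\<Sum>i<?d. \<Sum>j<?d. \<pi> g $$ (i, j) * K m \<pi> j i)"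
    proof (intro sum.cong refl)
      fix i assume "i \<in> {..<?d}"
      hence i: "i < ?d" by simp
      show "(\<pi> g * (?Y * H \<pi>)) $$ (i, i) = (\<Sum>j<?d. \<pi> g $$ (i, j) * K m \<pi> j i)"
        unfolding mat_mult_index[OF ca YH i i] by (intro sum.cong refl) (simp add: YHi i)
    qed
    finally show ?thesis .
  qed
  have "estimator \<mu> Ghat lam h T n (obs f \<omega>) g = (1 / of_nat n) *
     (\<Sum>m=1..n. \<Sum>\<pi>\<in>F. of_nat (rep_dim \<pi>) * (\<Sum>i<rep_dim \<pi>. \<Sum>j<rep_dim \<pi>. \<pi> g $$ (i, j) * K m \<pi> j i))"
    unfolding estimator_def F_def[symmetric] H_def[symmetric]
    by (intro arg_cong[where f="\<lambda>x. (1 / of_nat n) * x"] sum.cong refl) (simp add: F_def tr)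
  also have "\<dots> = (\<Sum>\<pi>\<in>F. of_nat (rep_dim \<pi>) * (\<Sum>i<rep_dim \<pi>. \<Sum>j<rep_dim \<pi>. \<pi> g $$ (i, j) * ((1 / of_nat n) * (\<Sum>m=1..n. K m \<pi> j i))))"
  proof -
    have "(\<Sum>m=1..n. \<Sum>\<pi>\<in>F. of_nat (rep_dim \<pi>) * (\<Sum>i<rep_dim \<pi>. \<Sum>j<rep_dim \<pi>. \<pi> g $$ (i, j) * K m \<pi> j i)) =
      (\<Sum>\<pi>\<in>F. of_nat (rep_dim \<pi>) * (\<Sum>m=1..n. \<Sum>i<rep_dim \<pi>. \<Sum>j<rep_dim \<pi>. \<pi> g $$ (i, j) * K m \<pi> j i))"
      by (subst sum.swap) (simp only: sum_distrib_left)
    also have "\<dots> = (\<Sum>\<pi>\<in>F. of_nat (rep_dim \<pi>) * (\<Sum>i<rep_dim \<pi>. \<Sum>j<rep_dim \<pi>. \<pi> g $$ (i, j) * (\<Sum>m=1..n. K m \<pi> j i)))"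
    proof -
      have inner: "(\<Sum>m=1..n. \<Sum>i<rep_dim \<pi>. \<Sum>j<rep_dim \<pi>. \<pi> g $$ (i, j) * K m \<pi> j i) =
        (\<Sum>i<rep_dim \<pi>. \<Sum>j<rep_dim \<pi>. \<pi> g $$ (i, j) * (\<Sum>m=1..n. K m \<pi> j i))" for \<pi>
      proof -
      have "(\<Sum>m=1..n. \<Sum>i<rep_dim \<pi>. \<Sum>j<rep_dim \<pi>. \<pi> g $$ (i, j) * K m \<pi> j i) =
         (\<Sum>i<rep_dim \<pi>. \<Sum>m=1..n. \<Sum>j<rep_dim \<pi>. \<pi> g $$ (i, j) * K m \<pi> j i)" by (rule sum.swap)
      also have "\<dots> = (\<Sum>i<rep_dim \<pi>. \<Sum>j<rep_dim \<pi>. \<Sum>m=1..n. \<pi> g $$ (i, j) * K m \<pi> j i)"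
        by (intro sum.cong refl sum.swap)
      finally show ?thesis by (simp only: sum_distrib_left)
      qed
      show ?thesis by (simp only: inner)
    qed
    finally show ?thesis by (simp only: sum_distrib_left mult_ac)
  qed
  finally show ?thesis by (simp only: trig_def F_def est_coeff_def K_def)
qed

lemma est_coeff_diff:
  "est_coeff f \<omega> \<pi> i j - fc f \<pi> i j = (1 / of_nat n) * (\<Sum>m\<in>{1..n}. Z f \<pi> i j m \<omega>) +
     (complex_of_real \<epsilon> / of_nat n) * (\<Sum>m\<in>{1..n}. N \<pi> i j m \<omega>)"
  using n_pos by (simp add: est_coeff_def Z_def sum.distrib sum_subtractf sum_distrib_left[symmetric] field_simps)

text \<open>The factor 2 separates the shift error from the noise error. Each is an average of
  independent centered terms, so its second moment carries a factor 1 / n.\<close>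

lemma est_coeff_error:
  assumes \<pi>: "\<pi> \<in> Ghat" "i < rep_dim \<pi>" "j < rep_dim \<pi>"
  shows "(\<lambda>\<omega>. est_coeff f \<omega> \<pi> i j - fc f \<pi> i j) \<in> L2 P"
    and "(\<integral>\<omega>. (cmod (est_coeff f \<omega> \<pi> i j - fc f \<pi> i j))\<^sup>2 \<partial>P) \<le>
      2 / (real n)\<^sup>2 * (\<Sum>m\<in>{1..n}. \<integral>\<omega>. (cmod (U f \<pi> i j (\<tau> m \<omega>)))\<^sup>2 \<partial>P) +
      2 * \<epsilon>\<^sup>2 / real n * ((\<Sum>k<rep_dim \<pi>. (cmod (H \<pi> $$ (k, j)))\<^sup>2) / real (rep_dim \<pi>))"
proof -
  define A B where "A \<omega> = (\<Sum>m\<in>{1..n}. Z f \<pi> i j m \<omega>)" and "B \<omega> = (\<Sum>m\<in>{1..n}. N \<pi> i j m \<omega>)" for \<omega>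
  have AB: "A \<in> L2 P" "B \<in> L2 P"
    unfolding A_def[abs_def] B_def[abs_def] by (intro L2_sum Z_L2 N_L2 \<pi>; assumption)+
  show L: "(\<lambda>\<omega>. est_coeff f \<omega> \<pi> i j - fc f \<pi> i j) \<in> L2 P"
    unfolding est_coeff_diff A_def[symmetric] B_def[symmetric] by (intro L2_add L2_cmult AB)
  have EA: "(\<integral>\<omega>. (cmod (A \<omega>))\<^sup>2 \<partial>P) = (\<Sum>m\<in>{1..n}. \<integral>\<omega>. (cmod (Z f \<pi> i j m \<omega>))\<^sup>2 \<partial>P)"
    unfolding A_def by (rule P.independent_sum_variance) (use Z_L2[OF \<pi>] Z_indep[OF \<pi>] in auto)
  have EB: "(\<integral>\<omega>. (cmod (B \<omega>))\<^sup>2 \<partial>P) = (\<Sum>m\<in>{1..n}. \<integral>\<omega>. (cmod (N \<pi> i j m \<omega>))\<^sup>2 \<partial>P)"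
    unfolding B_def by (rule P.independent_sum_variance) (use N_L2[OF \<pi>] N_indep[OF \<pi>] in auto)
  have pt: "(cmod (est_coeff f \<omega> \<pi> i j - fc f \<pi> i j))\<^sup>2 \<le> 2 / (real n)\<^sup>2 * (cmod (A \<omega>))\<^sup>2 + 2 * \<epsilon>\<^sup>2 / (real n)\<^sup>2 * (cmod (B \<omega>))\<^sup>2" for \<omega>
  proof -
    have "(cmod (est_coeff f \<omega> \<pi> i j - fc f \<pi> i j))\<^sup>2 \<le>
      2 * (cmod (1 / of_nat n * A \<omega>))\<^sup>2 + 2 * (cmod (complex_of_real \<epsilon> / of_nat n * B \<omega>))\<^sup>2"
      unfolding est_coeff_diff A_def[symmetric] B_def[symmetric] by (rule cmod_add_sq_le)
    thus ?thesis by (simp add: norm_mult norm_divide power_mult_distrib power_divide)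
  qed
  have ints: "integrable P (\<lambda>\<omega>. (cmod (A \<omega>))\<^sup>2)" "integrable P (\<lambda>\<omega>. (cmod (B \<omega>))\<^sup>2)"
    using AB by (simp_all add: L2_def)
  have "(\<integral>\<omega>. (cmod (est_coeff f \<omega> \<pi> i j - fc f \<pi> i j))\<^sup>2 \<partial>P) \<le>
      (\<integral>\<omega>. 2 / (real n)\<^sup>2 * (cmod (A \<omega>))\<^sup>2 + 2 * \<epsilon>\<^sup>2 / (real n)\<^sup>2 * (cmod (B \<omega>))\<^sup>2 \<partial>P)"
    using L ints by (intro integral_mono pt Bochner_Integration.integrable_add integrable_mult_right) (simp_all add: L2_def)
  also have "\<dots> = 2 / (real n)\<^sup>2 * (\<integral>\<omega>. (cmod (A \<omega>))\<^sup>2 \<partial>P) + 2 * \<epsilon>\<^sup>2 / (real n)\<^sup>2 * (\<integral>\<omega>. (cmod (B \<omega>))\<^sup>2 \<partial>P)"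
    using ints by simp
  also have "\<dots> \<le> 2 / (real n)\<^sup>2 * (\<Sum>m\<in>{1..n}. \<integral>\<omega>. (cmod (U f \<pi> i j (\<tau> m \<omega>)))\<^sup>2 \<partial>P) +
      2 * \<epsilon>\<^sup>2 / (real n)\<^sup>2 * (\<integral>\<omega>. (cmod (B \<omega>))\<^sup>2 \<partial>P)"
    unfolding EA by (intro add_right_mono mult_left_mono sum_mono Z_L2(4) \<pi>) auto
  also have "(\<integral>\<omega>. (cmod (B \<omega>))\<^sup>2 \<partial>P) = real n * ((\<Sum>k<rep_dim \<pi>. (cmod (H \<pi> $$ (k, j)))\<^sup>2) / real (rep_dim \<pi>))"
    unfolding EB using N_L2(4)[OF \<pi>] by simp
  finally show "(\<integral>\<omega>. (cmod (est_coeff f \<omega> \<pi> i j - fc f \<pi> i j))\<^sup>2 \<partial>P) \<le>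
      2 / (real n)\<^sup>2 * (\<Sum>m\<in>{1..n}. \<integral>\<omega>. (cmod (U f \<pi> i j (\<tau> m \<omega>)))\<^sup>2 \<partial>P) +
      2 * \<epsilon>\<^sup>2 / real n * ((\<Sum>k<rep_dim \<pi>. (cmod (H \<pi> $$ (k, j)))\<^sup>2) / real (rep_dim \<pi>))"
    using n_pos by (simp add: power2_eq_square[of "real n"])
qed

text \<open>Stated for the sum over all entries, because \<open>U_bound\<close> controls the entries
  of \<open>U\<close> only jointly.\<close>

lemma est_coeff_variance:
  assumes \<pi>: "\<pi> \<in> Ghat"
  shows "(\<Sum>i<rep_dim \<pi>. \<Sum>j<rep_dim \<pi>. \<integral>\<omega>. (cmod (est_coeff f \<omega> \<pi> i j - fc f \<pi> i j))\<^sup>2 \<partial>P) \<le>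
    2 * (op_norm (H \<pi>))\<^sup>2 / real n * ((\<Sum>i<rep_dim \<pi>. \<Sum>j<rep_dim \<pi>. (cmod (fc f \<pi> i j))\<^sup>2) + \<epsilon>\<^sup>2 * real (rep_dim \<pi>))"
proof -
  let ?d = "rep_dim \<pi>"
  define S where "S = (op_norm (H \<pi>))\<^sup>2 * (\<Sum>i<?d. \<Sum>j<?d. (cmod (fc f \<pi> i j))\<^sup>2)"
  have u: "(\<Sum>i<?d. \<Sum>j<?d. \<integral>\<omega>. (cmod (U f \<pi> i j (\<tau> m \<omega>)))\<^sup>2 \<partial>P) \<le> S" if m: "m \<in> {1..n}" for m
  proof -
    have int: "integrable P (\<lambda>\<omega>. (cmod (U f \<pi> i j (\<tau> m \<omega>)))\<^sup>2)" for i j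
      using U_L2(1)[OF \<pi> m] by (simp add: L2_def)
    have "(\<Sum>i<?d. \<Sum>j<?d. \<integral>\<omega>. (cmod (U f \<pi> i j (\<tau> m \<omega>)))\<^sup>2 \<partial>P) =
      (\<integral>\<omega>. (\<Sum>i<?d. \<Sum>j<?d. (cmod (U f \<pi> i j (\<tau> m \<omega>)))\<^sup>2) \<partial>P)"
      using int by (simp add: Bochner_Integration.integral_sum)
    also have "\<dots> \<le> (\<integral>\<omega>. S \<partial>P)"
      unfolding S_def by (intro integral_mono U_bound[OF \<pi>] Bochner_Integration.integrable_sum int) simp
    finally show ?thesis by (simp add: P.prob_space)
  qed
  have "(\<Sum>i<?d. \<Sum>j<?d. \<integral>\<omega>. (cmod (est_coeff f \<omega> \<pi> i j - fc f \<pi> i j))\<^sup>2 \<partial>P) \<le>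
    (\<Sum>i<?d. \<Sum>j<?d. 2 / (real n)\<^sup>2 * (\<Sum>m\<in>{1..n}. \<integral>\<omega>. (cmod (U f \<pi> i j (\<tau> m \<omega>)))\<^sup>2 \<partial>P) +
      2 * \<epsilon>\<^sup>2 / real n * ((\<Sum>k<?d. (cmod (H \<pi> $$ (k, j)))\<^sup>2) / real ?d))"
    by (intro sum_mono est_coeff_error(2) \<pi>) auto
  also have "\<dots> = 2 / (real n)\<^sup>2 * (\<Sum>i<?d. \<Sum>j<?d. \<Sum>m\<in>{1..n}. \<integral>\<omega>. (cmod (U f \<pi> i j (\<tau> m \<omega>)))\<^sup>2 \<partial>P) +
      2 * \<epsilon>\<^sup>2 / real n * (\<Sum>i<?d. \<Sum>j<?d. (\<Sum>k<?d. (cmod (H \<pi> $$ (k, j)))\<^sup>2) / real ?d)"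
    by (simp only: sum.distrib sum_distrib_left[symmetric])
  also have "\<dots> \<le> 2 / (real n)\<^sup>2 * (real n * S) + 2 * \<epsilon>\<^sup>2 / real n * (real ?d * (op_norm (H \<pi>))\<^sup>2)"
  proof (intro add_mono mult_left_mono)
    have "(\<Sum>i<?d. \<Sum>j<?d. \<Sum>m\<in>{1..n}. \<integral>\<omega>. (cmod (U f \<pi> i j (\<tau> m \<omega>)))\<^sup>2 \<partial>P) =
      (\<Sum>i<?d. \<Sum>m\<in>{1..n}. \<Sum>j<?d. \<integral>\<omega>. (cmod (U f \<pi> i j (\<tau> m \<omega>)))\<^sup>2 \<partial>P)"
      by (rule sum.cong[OF refl]) (rule sum.swap)
    also have "\<dots> = (\<Sum>m\<in>{1..n}. \<Sum>i<?d. \<Sum>j<?d. \<integral>\<omega>. (cmod (U f \<pi> i j (\<tau> m \<omega>)))\<^sup>2 \<partial>P)"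
      by (rule sum.swap)
    also have "\<dots> \<le> (\<Sum>m\<in>{1..n}. S)" by (rule sum_mono) (rule u)
    finally show "(\<Sum>i<?d. \<Sum>j<?d. \<Sum>m\<in>{1..n}. \<integral>\<omega>. (cmod (U f \<pi> i j (\<tau> m \<omega>)))\<^sup>2 \<partial>P) \<le> real n * S" by simp
    have "(\<Sum>i<?d. \<Sum>j<?d. (\<Sum>k<?d. (cmod (H \<pi> $$ (k, j)))\<^sup>2) / real ?d) = (\<Sum>j<?d. \<Sum>k<?d. (cmod (H \<pi> $$ (k, j)))\<^sup>2)"
      using Ghat_dim[OF \<pi>] by (simp add: sum_divide_distrib[symmetric])
    also have "\<dots> = (\<Sum>k<?d. \<Sum>j<?d. (cmod (H \<pi> $$ (k, j)))\<^sup>2)" by (rule sum.swap)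
    also have "\<dots> \<le> real ?d * (op_norm (H \<pi>))\<^sup>2" by (rule op_norm_frobenius[OF H_carrier[OF \<pi>]])
    finally show "(\<Sum>i<?d. \<Sum>j<?d. (\<Sum>k<?d. (cmod (H \<pi> $$ (k, j)))\<^sup>2) / real ?d) \<le> real ?d * (op_norm (H \<pi>))\<^sup>2" .
  qed auto
  also have "\<dots> = 2 * (op_norm (H \<pi>))\<^sup>2 / real n * ((\<Sum>i<?d. \<Sum>j<?d. (cmod (fc f \<pi> i j))\<^sup>2) + \<epsilon>\<^sup>2 * real ?d)"
    using n_pos unfolding S_def by (simp add: power2_eq_square[of "real n"] distrib_left mult.assoc mult.left_commute)
  finally show ?thesis .
qed

text \<open>The loss is exactly a deterministic bias plus the random coefficient errors, so only the
  latter have to be integrated; weighted by the degree, their bounds add up to Parseval terms and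
  squared degrees.\<close>

lemma risk_bound:
  assumes f: "f \<in> L2 \<mu>" and F: "finite {\<pi> \<in> Ghat. lam \<pi> < T}" (is "finite ?F")
    and M: "\<And>\<pi>. \<pi> \<in> Ghat \<Longrightarrow> lam \<pi> < T \<Longrightarrow> (op_norm (H \<pi>))\<^sup>2 \<le> M"
  shows "risk \<mu> \<epsilon> P \<tau> W (estimator \<mu> Ghat lam h T n) f \<le>
    ennreal (nsq f - (\<Sum>\<pi>\<in>?F. fsq f \<pi>) +
      2 * M / real n * ((\<Sum>\<pi>\<in>?F. fsq f \<pi>) + \<epsilon>\<^sup>2 * (\<Sum>\<pi>\<in>?F. (real (rep_dim \<pi>))\<^sup>2)))"
proof -
  have sub: "?F \<subseteq> Ghat" by auto
  define E where "E \<omega> = (\<Sum>\<pi>\<in>?F. real (rep_dim \<pi>) * (\<Sum>i<rep_dim \<pi>. \<Sum>j<rep_dim \<pi>. (cmod (est_coeff f \<omega> \<pi> i j - fc f \<pi> i j))\<^sup>2))" for \<omega>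
  define b where "b = nsq f - (\<Sum>\<pi>\<in>?F. fsq f \<pi>)"
  have b: "b \<ge> 0" unfolding b_def using fourier_bessel[OF F sub f] by simp
  have E0: "E \<omega> \<ge> 0" for \<omega> unfolding E_def by (intro sum_nonneg mult_nonneg_nonneg) auto
  have loss: "L2_norm_sq \<mu> (\<lambda>g. estimator \<mu> Ghat lam h T n (obs f \<omega>) g - f g) = ennreal (b + E \<omega>)" for \<omega>
  proof -
    let ?t = "trig ?F (est_coeff f \<omega>)"
    have "?t \<in> L2 \<mu>" by (rule continuous_L2[OF continuous_trig[OF sub]])
    from L2_add[OF f L2_cmult[OF this, of "- 1"]] have L: "(\<lambda>g. f g - ?t g) \<in> L2 \<mu>" by simp
    have "L2_norm_sq \<mu> (\<lambda>g. estimator \<mu> Ghat lam h T n (obs f \<omega>) g - f g) = (\<integral>\<^sup>+g. ennreal ((cmod (f g - ?t g))\<^sup>2) \<partial>\<mu>)"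
      unfolding L2_norm_sq_def estimator_trig[OF f] by (simp add: norm_minus_commute)
    also have "\<dots> = ennreal (nsq (\<lambda>g. f g - ?t g))"
      unfolding nsq_def by (rule nn_integral_eq_integral) (use L in \<open>auto simp: L2_def\<close>)
    also have "nsq (\<lambda>g. f g - ?t g) = b + E \<omega>"
      unfolding trig_projection[OF F sub f] b_def E_def ..
    finally show ?thesis .
  qed
  have int1: "integrable P (\<lambda>\<omega>. (cmod (est_coeff f \<omega> \<pi> i j - fc f \<pi> i j))\<^sup>2)"
    if "\<pi> \<in> ?F" "i < rep_dim \<pi>" "j < rep_dim \<pi>" for \<pi> i j
    using est_coeff_error(1)[of \<pi> i j f] that by (simp add: L2_def)
  have intE: "integrable P E" unfolding E_def[abs_def]
    by (intro Bochner_Integration.integrable_sum integrable_mult_right int1) auto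
  have "(\<integral>\<omega>. E \<omega> \<partial>P) = (\<Sum>\<pi>\<in>?F. real (rep_dim \<pi>) *
      (\<Sum>i<rep_dim \<pi>. \<Sum>j<rep_dim \<pi>. \<integral>\<omega>. (cmod (est_coeff f \<omega> \<pi> i j - fc f \<pi> i j))\<^sup>2 \<partial>P))"
  proof -
    have "(\<integral>\<omega>. E \<omega> \<partial>P) = (\<Sum>\<pi>\<in>?F. \<integral>\<omega>. real (rep_dim \<pi>) *
        (\<Sum>i<rep_dim \<pi>. \<Sum>j<rep_dim \<pi>. (cmod (est_coeff f \<omega> \<pi> i j - fc f \<pi> i j))\<^sup>2) \<partial>P)"
      unfolding E_def
      by (rule Bochner_Integration.integral_sum) (intro Bochner_Integration.integrable_sum integrable_mult_right int1; simp)
    also have "\<dots> = (\<Sum>\<pi>\<in>?F. real (rep_dim \<pi>) *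
      (\<Sum>i<rep_dim \<pi>. \<Sum>j<rep_dim \<pi>. \<integral>\<omega>. (cmod (est_coeff f \<omega> \<pi> i j - fc f \<pi> i j))\<^sup>2 \<partial>P))"
    proof (intro sum.cong refl)
      fix \<pi> assume \<pi>: "\<pi> \<in> ?F"
      have "(\<integral>\<omega>. (\<Sum>i<rep_dim \<pi>. \<Sum>j<rep_dim \<pi>. (cmod (est_coeff f \<omega> \<pi> i j - fc f \<pi> i j))\<^sup>2) \<partial>P) =
        (\<Sum>i<rep_dim \<pi>. \<integral>\<omega>. (\<Sum>j<rep_dim \<pi>. (cmod (est_coeff f \<omega> \<pi> i j - fc f \<pi> i j))\<^sup>2) \<partial>P)"
        by (rule Bochner_Integration.integral_sum) (intro Bochner_Integration.integrable_sum int1 \<pi>; simp)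
      also have "\<dots> = (\<Sum>i<rep_dim \<pi>. \<Sum>j<rep_dim \<pi>. \<integral>\<omega>. (cmod (est_coeff f \<omega> \<pi> i j - fc f \<pi> i j))\<^sup>2 \<partial>P)"
        by (intro sum.cong refl Bochner_Integration.integral_sum int1 \<pi>) auto
      finally show "(\<integral>\<omega>. real (rep_dim \<pi>) * (\<Sum>i<rep_dim \<pi>. \<Sum>j<rep_dim \<pi>. (cmod (est_coeff f \<omega> \<pi> i j - fc f \<pi> i j))\<^sup>2) \<partial>P) =
         real (rep_dim \<pi>) * (\<Sum>i<rep_dim \<pi>. \<Sum>j<rep_dim \<pi>. \<integral>\<omega>. (cmod (est_coeff f \<omega> \<pi> i j - fc f \<pi> i j))\<^sup>2 \<partial>P)"
        by (simp only: integral_mult_right_zero)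
    qed
    finally show ?thesis .
  qed
  also have "\<dots> \<le> (\<Sum>\<pi>\<in>?F. real (rep_dim \<pi>) * (2 * M / real n *
      ((\<Sum>i<rep_dim \<pi>. \<Sum>j<rep_dim \<pi>. (cmod (fc f \<pi> i j))\<^sup>2) + \<epsilon>\<^sup>2 * real (rep_dim \<pi>))))"
  proof (intro sum_mono mult_left_mono)
    fix \<pi> assume \<pi>: "\<pi> \<in> ?F"
    hence mem: "\<pi> \<in> Ghat" "lam \<pi> < T" by auto
    have "2 * (op_norm (H \<pi>))\<^sup>2 / real n * ((\<Sum>i<rep_dim \<pi>. \<Sum>j<rep_dim \<pi>. (cmod (fc f \<pi> i j))\<^sup>2) + \<epsilon>\<^sup>2 * real (rep_dim \<pi>)) \<le>
      2 * M / real n * ((\<Sum>i<rep_dim \<pi>. \<Sum>j<rep_dim \<pi>. (cmod (fc f \<pi> i j))\<^sup>2) + \<epsilon>\<^sup>2 * real (rep_dim \<pi>))"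
      using M[OF mem] n_pos by (intro mult_right_mono divide_right_mono add_nonneg_nonneg sum_nonneg) auto
    with est_coeff_variance[OF mem(1), of f] show
      "(\<Sum>i<rep_dim \<pi>. \<Sum>j<rep_dim \<pi>. \<integral>\<omega>. (cmod (est_coeff f \<omega> \<pi> i j - fc f \<pi> i j))\<^sup>2 \<partial>P) \<le>
       2 * M / real n * ((\<Sum>i<rep_dim \<pi>. \<Sum>j<rep_dim \<pi>. (cmod (fc f \<pi> i j))\<^sup>2) + \<epsilon>\<^sup>2 * real (rep_dim \<pi>))"
      by (rule order_trans)
  qed simp
  also have "\<dots> = 2 * M / real n * ((\<Sum>\<pi>\<in>?F. fsq f \<pi>) + \<epsilon>\<^sup>2 * (\<Sum>\<pi>\<in>?F. (real (rep_dim \<pi>))\<^sup>2))"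
  proof -
    have "real (rep_dim \<pi>) * (2 * M / real n *
      ((\<Sum>i<rep_dim \<pi>. \<Sum>j<rep_dim \<pi>. (cmod (fc f \<pi> i j))\<^sup>2) + \<epsilon>\<^sup>2 * real (rep_dim \<pi>))) =
      2 * M / real n * (fsq f \<pi> + \<epsilon>\<^sup>2 * (real (rep_dim \<pi>))\<^sup>2)" for \<pi>
      by (simp add: fsq_def algebra_simps power2_eq_square)
    thus ?thesis by (simp only: sum.distrib sum_distrib_left[symmetric])
  qed
  finally have EE: "(\<integral>\<omega>. E \<omega> \<partial>P) \<le> 2 * M / real n * ((\<Sum>\<pi>\<in>?F. fsq f \<pi>) + \<epsilon>\<^sup>2 * (\<Sum>\<pi>\<in>?F. (real (rep_dim \<pi>))\<^sup>2))" .
  have "risk \<mu> \<epsilon> P \<tau> W (estimator \<mu> Ghat lam h T n) f = (\<integral>\<^sup>+\<omega>. ennreal (b + E \<omega>) \<partial>P)"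
    unfolding risk_def loss ..
  also have "\<dots> = ennreal (\<integral>\<omega>. b + E \<omega> \<partial>P)"
    by (rule nn_integral_eq_integral) (use intE b E0 in auto)
  also have "(\<integral>\<omega>. b + E \<omega> \<partial>P) = b + (\<integral>\<omega>. E \<omega> \<partial>P)" using intE by (simp add: P.prob_space)
  finally show ?thesis using EE unfolding b_def by (simp add: ennreal_leI)
qed

end

section \<open>Sobolev balls and the rate\<close>

context compact_lie_group
begin

lemma smooth_function_continuous:
  assumes f: "smooth_function \<A> f"
  shows "continuous_on UNIV f"
proof -
  have "continuous (at p) f" for p
  proof -
    obtain c where c: "c \<in> \<A>" "p \<in> fst c" using chart_cover[OF atlas] by metis
    note cf = chart_facts'[OF c(1)]
    have "Ck_on 0 (chart_image c) (\<lambda>x. f (chart_inv c x))"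
      using f c(1) unfolding smooth_function_def smooth_on_def by blast
    hence "continuous_on (chart_image c) (\<lambda>x. f (chart_inv c x))" by simp
    hence "continuous_on (fst c) (\<lambda>q. f (chart_inv c (snd c q)))"
      by (rule continuous_on_compose2[OF _ cf(4)]) (use cf(6) in auto)
    hence "continuous_on (fst c) f" by (rule continuous_on_eq) (simp add: cf(5))
    thus ?thesis using cf(1) c(2) continuous_on_eq_continuous_at by blast
  qed
  thus ?thesis by (simp add: continuous_at_imp_continuous_on)
qed

lemma frobenius_fsq: "real (rep_dim \<pi>) * frobenius_sq (fourier_coeff \<mu> f \<pi>) = fsq f \<pi>"
proof -
  have "fourier_coeff \<mu> f \<pi> \<in> carrier_mat (rep_dim \<pi>) (rep_dim \<pi>)" by (simp add: fourier_coeff_def)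
  from frobenius_sq_sum[OF this] show ?thesis by (simp add: fsq_def fc_def fourier_coeff_def)
qed

lemma L2_norm_sq_nsq: "f \<in> L2 \<mu> \<Longrightarrow> L2_norm_sq \<mu> f = ennreal (nsq f)"
  unfolding L2_norm_sq_def nsq_def by (rule nn_integral_eq_integral) (auto simp: L2_def)

text \<open>The last claim holds since the Sobolev norm dominates the L2 norm and smooth functions
  are continuous; it supplies the approximation hypothesis of \<open>parseval\<close>.\<close>

lemma sobolev_ball_bounds:
  assumes f: "f \<in> sobolev_ball \<A> \<mu> Ghat lam s A"
  shows "f \<in> L2 \<mu>" "nsq f \<le> A\<^sup>2"
    "finite F \<Longrightarrow> F \<subseteq> Ghat \<Longrightarrow> (\<Sum>\<pi>\<in>F. lam \<pi> powr s * fsq f \<pi>) \<le> A\<^sup>2"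
    "e > 0 \<Longrightarrow> \<exists>\<phi>. continuous_on UNIV \<phi> \<and> nsq (\<lambda>x. f x - \<phi> x) < e"
proof -
  have sp: "f \<in> sobolev_space \<A> \<mu> Ghat lam s" and le: "sobolev_norm_sq \<mu> Ghat lam s f \<le> ennreal (A\<^sup>2)"
    using f by (auto simp: sobolev_ball_def)
  show L: "f \<in> L2 \<mu>" using sp by (simp add: sobolev_space_def)
  let ?w = "\<lambda>\<pi>. ennreal (lam \<pi> powr s * real (rep_dim \<pi>) * frobenius_sq (fourier_coeff \<mu> f \<pi>))"
  have w: "?w \<pi> = ennreal (lam \<pi> powr s * fsq f \<pi>)" for \<pi> by (simp add: mult.assoc frobenius_fsq)
  have sum: "ennreal (nsq f) + infsum ?w Ghat \<le> ennreal (A\<^sup>2)"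
    using le unfolding sobolev_norm_sq_def L2_norm_sq_nsq[OF L] .
  have "ennreal (nsq f) \<le> ennreal (A\<^sup>2)" using sum by (meson add_increasing2 order_trans zero_le order_refl)
  thus "nsq f \<le> A\<^sup>2" by (simp add: ennreal_le_iff)
  show "(\<Sum>\<pi>\<in>F. lam \<pi> powr s * fsq f \<pi>) \<le> A\<^sup>2" if F: "finite F" "F \<subseteq> Ghat"
  proof -
    have "ennreal (\<Sum>\<pi>\<in>F. lam \<pi> powr s * fsq f \<pi>) = sum ?w F"
      unfolding w by (rule sum_ennreal[symmetric]) (simp add: fsq_nonneg)
    also have "\<dots> = infsum ?w F" using F(1) by simp
    also have "\<dots> \<le> infsum ?w Ghat"
      by (rule infsum_mono_neutral) (use F in \<open>auto intro!: nonneg_summable_on_complete\<close>)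
    also have "\<dots> \<le> ennreal (A\<^sup>2)" using sum by (meson add_increasing order_trans zero_le order_refl)
    finally show ?thesis by (simp add: ennreal_le_iff)
  qed
  show "\<exists>\<phi>. continuous_on UNIV \<phi> \<and> nsq (\<lambda>x. f x - \<phi> x) < e" if e: "e > 0"
  proof -
    obtain \<Phi> where \<Phi>: "\<And>k. smooth_function \<A> (\<Phi> k)"
      "(\<lambda>k. sobolev_norm_sq \<mu> Ghat lam s (\<lambda>g. \<Phi> k g - f g)) \<longlonglongrightarrow> 0"
      using sp unfolding sobolev_space_def by blast
    have "eventually (\<lambda>k. sobolev_norm_sq \<mu> Ghat lam s (\<lambda>g. \<Phi> k g - f g) < ennreal e) sequentially"
      using \<Phi>(2) by (rule order_tendstoD(2)) (use e in simp)
    then obtain k where k: "sobolev_norm_sq \<mu> Ghat lam s (\<lambda>g. \<Phi> k g - f g) < ennreal e"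
      by (auto simp: eventually_sequentially)
    have cont: "continuous_on UNIV (\<Phi> k)" by (rule smooth_function_continuous[OF \<Phi>(1)])
    from L2_add[OF L L2_cmult[OF continuous_L2[OF cont], of "- 1"]]
    have Ld: "(\<lambda>g. f g - \<Phi> k g) \<in> L2 \<mu>" by simp
    have "ennreal (nsq (\<lambda>g. f g - \<Phi> k g)) = L2_norm_sq \<mu> (\<lambda>g. \<Phi> k g - f g)"
      unfolding L2_norm_sq_nsq[OF Ld, symmetric] by (simp add: L2_norm_sq_def norm_minus_commute)
    also have "\<dots> \<le> sobolev_norm_sq \<mu> Ghat lam s (\<lambda>g. \<Phi> k g - f g)"
      unfolding sobolev_norm_sq_def by (rule add_increasing2) auto
    also note k
    finally have "nsq (\<lambda>g. f g - \<Phi> k g) < e" using e by (simp add: ennreal_less_iff nsq_nonneg)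
    thus ?thesis using cont by blast
  qed
qed

text \<open>Up to \<delta>, Parseval reduces the tail to a finite set of classes with eigenvalue at
  least \<open>T\<close>, where the Sobolev weight is at least \<open>T powr s\<close>.\<close>

lemma sobolev_bias:
  assumes f: "f \<in> sobolev_ball \<A> \<mu> Ghat lam s A" and s: "s \<ge> 0" and T: "T > 0"
    and F: "finite {\<pi> \<in> Ghat. lam \<pi> < T}" (is "finite ?F")
  shows "nsq f - (\<Sum>\<pi>\<in>?F. fsq f \<pi>) \<le> T powr (- s) * A\<^sup>2"
proof (rule field_le_epsilon)
  note sb = sobolev_ball_bounds[OF f]
  fix \<delta> :: real assume \<delta>: "\<delta> > 0"
  obtain E where E: "finite E" "E \<subseteq> Ghat" "nsq f - (\<Sum>\<pi>\<in>E. fsq f \<pi>) < \<delta>"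
    using parseval[OF sb(1) sb(4) \<delta>] by blast
  have "(\<Sum>\<pi>\<in>E. fsq f \<pi>) \<le> (\<Sum>\<pi>\<in>?F \<union> (E - ?F). fsq f \<pi>)"
    by (rule sum_mono2) (use E F in \<open>auto simp: fsq_nonneg\<close>)
  also have "\<dots> = (\<Sum>\<pi>\<in>?F. fsq f \<pi>) + (\<Sum>\<pi>\<in>E - ?F. fsq f \<pi>)"
    by (rule sum.union_disjoint) (use E F in auto)
  also have "(\<Sum>\<pi>\<in>E - ?F. fsq f \<pi>) \<le> (\<Sum>\<pi>\<in>E - ?F. T powr (- s) * (lam \<pi> powr s * fsq f \<pi>))"
  proof (rule sum_mono)
    fix \<pi> assume "\<pi> \<in> E - ?F"
    hence "T \<le> lam \<pi>" using E(2) by auto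
    hence "T powr s \<le> lam \<pi> powr s" using T s by (intro powr_mono2) auto
    hence "1 * fsq f \<pi> \<le> (T powr (- s) * lam \<pi> powr s) * fsq f \<pi>"
      using T by (intro mult_right_mono fsq_nonneg) (simp add: powr_minus field_simps)
    thus "fsq f \<pi> \<le> T powr (- s) * (lam \<pi> powr s * fsq f \<pi>)" by (simp add: mult.assoc)
  qed
  also have "\<dots> = T powr (- s) * (\<Sum>\<pi>\<in>E - ?F. lam \<pi> powr s * fsq f \<pi>)" by (rule sum_distrib_left[symmetric])
  also have "\<dots> \<le> T powr (- s) * A\<^sup>2" using E by (intro mult_left_mono sb(3)) auto
  finally show "nsq f - (\<Sum>\<pi>\<in>?F. fsq f \<pi>) \<le> T powr (- s) * A\<^sup>2 + \<delta>" using E(3) by simp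
qed

end

context riemannian_lie_group
begin

text \<open>Every degree is at least 1, so a bound on sums of squared degrees bounds the cardinality
  of all finite subsets.\<close>

lemma finite_low_frequencies:
  assumes C: "\<And>T F. T \<ge> 1 \<Longrightarrow> finite F \<Longrightarrow> F \<subseteq> {\<pi> \<in> Ghat. eig \<pi> < T} \<Longrightarrow>
    (\<Sum>\<pi>\<in>F. (real (rep_dim \<pi>))\<^sup>2) \<le> C * T powr (real CARD('n) / 2)" and T: "T \<ge> 1"
  shows "finite {\<pi> \<in> Ghat. eig \<pi> < T}"
proof -
  define B where "B = nat \<lfloor>C * T powr (real CARD('n) / 2)\<rfloor>"
  have "card F \<le> B" if F: "F \<subseteq> {\<pi> \<in> Ghat. eig \<pi> < T}" "finite F" for F
  proof -
    have "1 \<le> (real (rep_dim \<pi>))\<^sup>2" if "\<pi> \<in> F" for \<pi>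
    proof -
      have "rep_dim \<pi> \<ge> 1" using Ghat_dim[of \<pi>] that F by auto
      thus ?thesis by simp
    qed
    hence "(\<Sum>\<pi>\<in>F. 1) \<le> (\<Sum>\<pi>\<in>F. (real (rep_dim \<pi>))\<^sup>2)" by (rule sum_mono)
    also have "\<dots> \<le> C * T powr (real CARD('n) / 2)" by (rule C[OF T F(2,1)])
    finally have "real (card F) \<le> C * T powr (real CARD('n) / 2)" by simp
    thus ?thesis unfolding B_def by (rule le_nat_floor)
  qed
  from finite_if_finite_subsets_card_bdd[OF this] show ?thesis by (rule conjunct1)
qed

text \<open>The smoothness condition is silent on the eigenvalue 0; the classes concerned are
  finitely many and are absorbed into \<open>M\<close> by adding their norms.\<close>

lemma inverse_growth:
  assumes fin: "finite {\<pi> \<in> Ghat. eig \<pi> < 1}" and \<nu>: "\<nu> \<ge> 0" and h: "smooth_of_order \<mu> Ghat eig \<nu> h"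
  obtains M where "M > 0" "\<And>\<pi> T. T \<ge> 1 \<Longrightarrow> \<pi> \<in> Ghat \<Longrightarrow> eig \<pi> < T \<Longrightarrow>
    (op_norm (mat_inv (fourier_coeff \<mu> h \<pi>)))\<^sup>2 \<le> M * T powr \<nu>"
proof -
  let ?o = "\<lambda>\<pi>. (op_norm (mat_inv (fourier_coeff \<mu> h \<pi>)))\<^sup>2"
  obtain C where C: "C > 0" "\<And>\<pi>. \<pi> \<in> Ghat \<Longrightarrow> eig \<pi> \<noteq> 0 \<Longrightarrow> ?o \<pi> \<le> C * eig \<pi> powr \<nu>"
    using h unfolding smooth_of_order_def by blast
  define M where "M = C + (\<Sum>\<pi>\<in>{\<pi> \<in> Ghat. eig \<pi> < 1}. ?o \<pi>)"
  have s0: "(\<Sum>\<pi>\<in>{\<pi> \<in> Ghat. eig \<pi> < 1}. ?o \<pi>) \<ge> 0" by (rule sum_nonneg) simp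
  have "?o \<pi> \<le> M * T powr \<nu>" if T: "T \<ge> 1" and \<pi>: "\<pi> \<in> Ghat" "eig \<pi> < T" for \<pi> T
  proof (cases "eig \<pi> = 0")
    case True
    have "?o \<pi> \<le> (\<Sum>\<pi>\<in>{\<pi> \<in> Ghat. eig \<pi> < 1}. ?o \<pi>)"
      by (rule member_le_sum) (use fin True \<pi> in auto)
    also have "\<dots> \<le> M * 1" using C(1) by (simp add: M_def)
    also have "\<dots> \<le> M * T powr \<nu>" using T \<nu> C(1) s0 by (intro mult_left_mono ge_one_powr_ge_zero) (auto simp: M_def)
    finally show ?thesis .
  next
    case False
    have "?o \<pi> \<le> C * eig \<pi> powr \<nu>" by (rule C(2)[OF \<pi>(1) False])
    also have "\<dots> \<le> M * T powr \<nu>"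
      using C(1) s0 \<pi> eig_nonneg[OF \<pi>(1)] \<nu> by (intro mult_mono powr_mono2) (auto simp: M_def)
    finally show ?thesis .
  qed
  moreover have "M > 0" using C(1) s0 by (simp add: M_def)
  ultimately show ?thesis using that by blast
qed

end

lemma truncation_rate:
  fixes s \<nu> d :: real
  assumes pos: "s > 0" "\<nu> \<ge> 0" "d > 0" and n: "n \<ge> 1"
  defines "T \<equiv> real_of_int \<lfloor>real n powr (2 / (2 * s + 2 * \<nu> + d))\<rfloor>" and "r \<equiv> 2 * s / (2 * s + 2 * \<nu> + d)"
  shows "T \<ge> 1" "real n powr r * T powr (- s) \<le> 2 powr s" "real n powr r * (T powr (\<nu> + d / 2) / real n) \<le> 1"
proof -
  define D where "D = 2 * s + 2 * \<nu> + d"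
  have D: "D > 0" using pos by (simp add: D_def)
  define x where "x = real n powr (2 / D)"
  have x: "x \<ge> 1" unfolding x_def using n D by (intro ge_one_powr_ge_zero) auto
  have T: "T = real_of_int \<lfloor>x\<rfloor>" by (simp add: T_def x_def D_def)
  show T1: "T \<ge> 1" unfolding T using x by simp
  \<comment> \<open>Rounding down loses at most a factor 2, because x is at least 1.\<close>
  have Tx: "T \<le> x" "x / 2 \<le> T" using T1 unfolding T by linarith+
  have n0: "real n > 0" using n by simp
  have r1: "r = 2 / D * s" by (simp add: r_def D_def)
  \<comment> \<open>As \<open>T\<close> has order n^(2/D), the bias T^(-s) has order n^(-r); by this
    identity the variance T^(\<nu> + d/2) / n has the same order.\<close>
  have "r + 2 / D * (\<nu> + d / 2) = (2 * s + 2 * \<nu> + d) / D" unfolding r1 by (simp add: add_divide_distrib distrib_left)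
  also have "\<dots> = 1" using D by (simp add: D_def)
  finally have r: "r = 2 / D * s" "r + 2 / D * (\<nu> + d / 2) = 1" using r1 by simp_all
  have "real n powr r * T powr (- s) \<le> real n powr r * (x / 2) powr (- s)"
    using pos Tx x by (intro mult_left_mono powr_mono2') auto
  also have "\<dots> = 2 powr s * (real n powr r * x powr (- s))"
    using x by (simp add: powr_divide powr_minus field_simps)
  also have "real n powr r * x powr (- s) = 1"
    using n0 by (simp add: x_def powr_powr powr_add[symmetric] r(1))
  finally show "real n powr r * T powr (- s) \<le> 2 powr s" by simp
  have "T powr (\<nu> + d / 2) \<le> x powr (\<nu> + d / 2)" using pos Tx T1 by (intro powr_mono2) auto
  hence "real n powr r * (T powr (\<nu> + d / 2) / real n) \<le> real n powr r * (x powr (\<nu> + d / 2) / real n)"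
    by (intro mult_left_mono divide_right_mono) auto
  also have "\<dots> = real n powr (r + 2 / D * (\<nu> + d / 2)) / real n"
    by (simp only: x_def powr_powr powr_add[of _ r] times_divide_eq_right)
  also have "\<dots> = 1" unfolding r(2) using n0 by simp
  finally show "real n powr r * (T powr (\<nu> + d / 2) / real n) \<le> 1" .
qed

theorem theorem3p1:
  fixes \<A> :: "('g::{topological_group_add, t2_space, second_countable_topology}, 'n::finite) chart set"
    and gm :: "('g, 'n) metric_field"
    and \<mu> :: "'g measure"
    and Ghat :: "('g \<Rightarrow> complex mat) set"
    and lam :: "('g \<Rightarrow> complex mat) \<Rightarrow> real"
    and h :: "'g \<Rightarrow> real"
    and A \<epsilon> \<nu> s d rate :: real
    and P :: "nat \<Rightarrow> 'w measure"
    and \<tau> :: "nat \<Rightarrow> nat \<Rightarrow> 'w \<Rightarrow> 'g"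
    and W :: "nat \<Rightarrow> nat \<Rightarrow> ('g \<Rightarrow> complex) \<Rightarrow> 'w \<Rightarrow> complex"
    and T :: "nat \<Rightarrow> real"
  assumes "lie_group \<A>"
    and "compact (UNIV :: 'g set)"
    and "connected (UNIV :: 'g set)"
    and "bi_invariant_metric \<A> gm"
    and "normalized_haar \<mu>"
    and "unitary_dual Ghat"
    and "lam = laplace_eigenvalue \<A> gm"
    and "d = real CARD('n)"
    and "A > 0" and "\<epsilon> > 0" and "\<nu> \<ge> 0" and "s > 2 * \<nu> + d"
    and "\<And>g. h g \<ge> 0"
    and "(\<lambda>g. complex_of_real (h g)) \<in> L2 \<mu>"
    and "smooth_of_order \<mu> Ghat lam \<nu> (\<lambda>g. complex_of_real (h g))"
    and "\<And>n. shift_noise_model \<mu> h n (P n) (\<tau> n) (W n)"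
    and "T = (\<lambda>n. real_of_int \<lfloor>real n powr (2 / (2 * s + 2 * \<nu> + d))\<rfloor>)"
    and "rate = 2 * s / (2 * s + 2 * \<nu> + d)"
  shows "\<exists>K1::real. K1 > 0 \<and>
    limsup (\<lambda>n. SUP f \<in> sobolev_ball \<A> \<mu> Ghat lam s A.
      ennreal (real n powr rate) *
      risk \<mu> \<epsilon> (P n) (\<tau> n) (W n) (estimator \<mu> Ghat lam h (T n) n) f) \<le> ennreal K1"
proof -
  interpret riemannian_lie_group \<mu> Ghat \<A> gm
    by unfold_locales (use assms in auto)
  have lam: "lam = eig" unfolding assms(7) by (rule ext) (simp add: eig_def)
  have d: "d > 0" using assms(8) by simp
  have s: "s > 0" using assms(11,12) d by simp
  obtain C where C: "C > 0" "\<And>T F. T \<ge> 1 \<Longrightarrow> finite F \<Longrightarrow> F \<subseteq> {\<pi> \<in> Ghat. eig \<pi> < T} \<Longrightarrow>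
    (\<Sum>\<pi>\<in>F. (real (rep_dim \<pi>))\<^sup>2) \<le> C * T powr (d / 2)"
    using weyl_bound unfolding assms(8) by blast
  have fin: "finite {\<pi> \<in> Ghat. eig \<pi> < t}" if "t \<ge> 1" for t
    by (rule finite_low_frequencies[OF _ that]) (use C(2) assms(8) in auto)
  obtain M where M: "M > 0" "\<And>\<pi> T. T \<ge> 1 \<Longrightarrow> \<pi> \<in> Ghat \<Longrightarrow> eig \<pi> < T \<Longrightarrow>
    (op_norm (mat_inv (fourier_coeff \<mu> (\<lambda>g. complex_of_real (h g)) \<pi>)))\<^sup>2 \<le> M * T powr \<nu>"
    using inverse_growth[OF fin[OF order_refl] assms(11) assms(15)[unfolded lam]] by blast
  \<comment> \<open>The factor \<open>2 powr s\<close> pays for rounding \<open>T\<close> down; the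
    2 in the variance term stems from separating shift and noise errors.\<close>
  define K where "K = 2 powr s * A\<^sup>2 + 2 * M * (A\<^sup>2 + \<epsilon>\<^sup>2 * C)"
  have K: "K > 0" unfolding K_def using M(1) C(1) assms(9,10) by (intro add_pos_pos mult_pos_pos) auto
  have main: "ennreal (real n powr rate) * risk \<mu> \<epsilon> (P n) (\<tau> n) (W n) (estimator \<mu> Ghat lam h (T n) n) f \<le> ennreal K"
    if n: "n \<ge> 1" and f: "f \<in> sobolev_ball \<A> \<mu> Ghat lam s A" for n f
  proof -
    interpret S: shift_model \<mu> Ghat h n "P n" "\<tau> n" "W n" \<epsilon>
      by unfold_locales (use assms n in \<open>auto simp: smooth_of_order_def\<close>)
    let ?t = "T n" and ?F = "{\<pi> \<in> Ghat. eig \<pi> < T n}"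
    have t: "?t = real_of_int \<lfloor>real n powr (2 / (2 * s + 2 * \<nu> + d))\<rfloor>" by (simp add: assms(17))
    note tr = truncation_rate[OF s assms(11) d n, folded assms(18) t]
    have F: "finite ?F" by (rule fin[OF tr(1)])
    note sb = sobolev_ball_bounds[OF f]
    define b where "b = nsq f - (\<Sum>\<pi>\<in>?F. fsq f \<pi>)"
    define v where "v = (\<Sum>\<pi>\<in>?F. fsq f \<pi>) + \<epsilon>\<^sup>2 * (\<Sum>\<pi>\<in>?F. (real (rep_dim \<pi>))\<^sup>2)"
    have b: "b \<le> ?t powr (- s) * A\<^sup>2"
      unfolding b_def using sobolev_bias[OF f] s tr(1) F unfolding lam by simp
    have "v \<le> A\<^sup>2 + \<epsilon>\<^sup>2 * (C * ?t powr (d / 2))"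
      unfolding v_def using fourier_bessel[OF F _ sb(1)] sb(2) C(2)[OF tr(1) F order_refl]
      by (intro add_mono mult_left_mono) auto
    \<comment> \<open>As \<open>T\<close> is at least 1, the shift variance is absorbed into the
      order of the noise variance.\<close>
    also have "\<dots> \<le> A\<^sup>2 * ?t powr (d / 2) + \<epsilon>\<^sup>2 * (C * ?t powr (d / 2))"
    proof -
      have "1 \<le> ?t powr (d / 2)" using tr(1) d by (intro ge_one_powr_ge_zero) auto
      thus ?thesis using mult_left_mono[of 1 "?t powr (d / 2)" "A\<^sup>2"] by simp
    qed
    also have "\<dots> = (A\<^sup>2 + \<epsilon>\<^sup>2 * C) * ?t powr (d / 2)" by (simp add: algebra_simps)
    finally have v: "v \<le> (A\<^sup>2 + \<epsilon>\<^sup>2 * C) * ?t powr (d / 2)" .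
    have "risk \<mu> \<epsilon> (P n) (\<tau> n) (W n) (estimator \<mu> Ghat lam h ?t n) f \<le> ennreal (b + 2 * (M * ?t powr \<nu>) / real n * v)"
      unfolding lam b_def v_def
      by (rule S.risk_bound[OF sb(1) F]) (use M(2)[OF tr(1)] in \<open>simp add: S.H_def\<close>)
    hence "ennreal (real n powr rate) * risk \<mu> \<epsilon> (P n) (\<tau> n) (W n) (estimator \<mu> Ghat lam h ?t n) f \<le>
        ennreal (real n powr rate) * ennreal (b + 2 * (M * ?t powr \<nu>) / real n * v)"
      by (rule mult_left_mono) simp
    also have "\<dots> = ennreal (real n powr rate * (b + 2 * (M * ?t powr \<nu>) / real n * v))"
      by (simp add: ennreal_mult')
    also have "real n powr rate * (b + 2 * (M * ?t powr \<nu>) / real n * v) \<le>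
       real n powr rate * (?t powr (- s) * A\<^sup>2 + 2 * (M * ?t powr \<nu>) / real n * ((A\<^sup>2 + \<epsilon>\<^sup>2 * C) * ?t powr (d / 2)))"
      using b v M(1) n by (intro mult_left_mono add_mono) auto
    also have "\<dots> = (real n powr rate * ?t powr (- s)) * A\<^sup>2 +
       2 * M * (A\<^sup>2 + \<epsilon>\<^sup>2 * C) * (real n powr rate * (?t powr (\<nu> + d / 2) / real n))"
      by (simp add: powr_add algebra_simps)
    also have "\<dots> \<le> 2 powr s * A\<^sup>2 + 2 * M * (A\<^sup>2 + \<epsilon>\<^sup>2 * C) * 1"
      using tr(2,3) M(1) C(1) by (intro add_mono mult_right_mono mult_left_mono) auto
    also have "\<dots> = K" by (simp add: K_def)
    finally show ?thesis by (simp add: ennreal_leI)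
  qed
  have "limsup (\<lambda>n. SUP f \<in> sobolev_ball \<A> \<mu> Ghat lam s A.
      ennreal (real n powr rate) * risk \<mu> \<epsilon> (P n) (\<tau> n) (W n) (estimator \<mu> Ghat lam h (T n) n) f) \<le> ennreal K"
  proof (rule Limsup_bounded)
    show "\<forall>\<^sub>F n in sequentially. (SUP f \<in> sobolev_ball \<A> \<mu> Ghat lam s A.
      ennreal (real n powr rate) * risk \<mu> \<epsilon> (P n) (\<tau> n) (W n) (estimator \<mu> Ghat lam h (T n) n) f) \<le> ennreal K"
      using eventually_ge_at_top[of 1] by eventually_elim (intro SUP_least main)
  qed
  with K show ?thesis by blast
qed

end
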